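(* Let $p>1$, let $\widehat p$ be its Hölder conjugate ($1/p+1/\widehat p=1$), $T>0$, $K>0$. Suppose that $\mathrm{vol}=(\mathrm{vol}_t)_{t\in[0,T]}$ is a non-negative progressively measurable process such that: (A1) either $\mathrm{vol}$ is deterministic and $K^{p-1}\int_0^T \mathrm{vol}_t\,dt<\frac{1}{p-1}$, or $\mathrm{vol}$ is bounded by a constant $\overline{\mathrm{vol}}>0$ such that $K^{p-1}T\,\overline{\mathrm{vol}}<\frac1{p-1}$; (A2) there exist $\varsigma>1$ and $\epsilon>0$ such that $\mathbb E\Big[\int_{T-\epsilon}^T\frac{1}{(\mathrm{vol}_s)^{(\widehat p-1)\varsigma}}\,ds\Big]<+\infty$. Let $\xi$ be an $\mathcal F_T$-measurable random variable with values in $(-\infty,+\infty]$ and $\xi^-\le K$ a.s. Assume that the filtration $\mathbb F$ is left-continuous at time $T$. Then there exists a minimal supersolution $(Y^{\min},M^{\min})$ (minimal among all supersolutions with bounded negative part) of the BSDE $$dY_t=\mathrm{vol}_t|Y_t|^p\,dt+dM_t,\qquad Y_T=\xi,$$ such that $Y^{\min}$ has a left limit at time $T$ (a.s.), and the negative part of $Y^{\min}$ is bounded.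
   Context: $(\Omega,\mathcal F,\mathbb P)$ is a probability space with a complete, right-continuous filtration $\mathbb F=(\mathcal F_t)_{t\ge0}$. $x^-=\max(-x,0)$. Convention $1/0=+\infty$. The left limit at $T$ is taken in $(-\infty,+\infty]$. A pair $(Y,M)$ is a supersolution of the BSDE with terminal condition $\xi$ if: $Y$ is adapted to $\mathbb F$; $M$ is a (right-continuous with left limits) martingale on $[0,T)$; for all $0\le s<t<T$, $Y_s=Y_t-\int_s^t\mathrm{vol}_u|Y_u|^p\,du-(M_t-M_s)$; and $\liminf_{t\to T}Y_t\ge\xi$ a.s. It is minimal (in a class of supersolutions) if for any other supersolution $(Y',M')$ in the class, a.s. $Y'_t\ge Y_t$ for any $t\in[0,T)$. *)

theory Defs
  imports "HOL-Probability.Probability"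
begin

text \<open>Time is real-valued, and only the values of filtrations and processes at the
  indicated times matter: \<open>t \<ge> 0\<close> for filtrations, \<open>0 \<le> t < T\<close> for solutions,
  \<open>0 \<le> t \<le> T\<close> for the coefficient \<open>vol\<close>.\<close>

definition is_filtration :: "'a measure \<Rightarrow> (real \<Rightarrow> 'a measure) \<Rightarrow> bool" where
  "is_filtration M F \<longleftrightarrow>
     (\<forall>t\<ge>0. subalgebra M (F t)) \<and>
     (\<forall>s t. 0 \<le> s \<and> s \<le> t \<longrightarrow> subalgebra (F t) (F s))"

definition complete_filtration :: "'a measure \<Rightarrow> (real \<Rightarrow> 'a measure) \<Rightarrow> bool" where
  "complete_filtration M F \<longleftrightarrow> complete_measure M \<and> null_sets M \<subseteq> sets (F 0)"

definition right_continuous_filtration :: "(real \<Rightarrow> 'a measure) \<Rightarrow> bool" where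
  "right_continuous_filtration F \<longleftrightarrow> (\<forall>t\<ge>0. sets (F t) = (\<Inter>u\<in>{t<..}. sets (F u)))"

definition left_continuous_filtration_at ::
    "'a measure \<Rightarrow> (real \<Rightarrow> 'a measure) \<Rightarrow> real \<Rightarrow> bool" where
  "left_continuous_filtration_at M F T \<longleftrightarrow>
     sets (F T) = sigma_sets (space M) (\<Union>s\<in>{0..<T}. sets (F s))"

definition progressively_measurable ::
    "(real \<Rightarrow> 'a measure) \<Rightarrow> real \<Rightarrow> (real \<Rightarrow> 'a \<Rightarrow> real) \<Rightarrow> bool" where
  "progressively_measurable F T X \<longleftrightarrow>
     (\<forall>t\<in>{0..T}. (\<lambda>(s, \<omega>). X s \<omega>) \<in>
        borel_measurable (restrict_space borel {0..t} \<Otimes>\<^sub>M F t))"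

definition adapted_before ::
    "(real \<Rightarrow> 'a measure) \<Rightarrow> real \<Rightarrow> (real \<Rightarrow> 'a \<Rightarrow> real) \<Rightarrow> bool" where
  "adapted_before F T X \<longleftrightarrow> (\<forall>t\<in>{0..<T}. X t \<in> borel_measurable (F t))"

definition cadlag_before :: "'a measure \<Rightarrow> real \<Rightarrow> (real \<Rightarrow> 'a \<Rightarrow> real) \<Rightarrow> bool" where
  "cadlag_before M T X \<longleftrightarrow>
     (\<forall>\<omega>\<in>space M.
        (\<forall>t\<in>{0..<T}. ((\<lambda>s. X s \<omega>) \<longlongrightarrow> X t \<omega>) (at_right t)) \<and>
        (\<forall>t\<in>{0<..<T}. \<exists>l. ((\<lambda>s. X s \<omega>) \<longlongrightarrow> l) (at_left t)))"

definition martingale_before ::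
    "'a measure \<Rightarrow> (real \<Rightarrow> 'a measure) \<Rightarrow> real \<Rightarrow> (real \<Rightarrow> 'a \<Rightarrow> real) \<Rightarrow> bool" where
  "martingale_before M F T N \<longleftrightarrow>
     adapted_before F T N \<and>
     (\<forall>t\<in>{0..<T}. integrable M (N t)) \<and>
     (\<forall>s t. 0 \<le> s \<and> s \<le> t \<and> t < T \<longrightarrow>
        (AE \<omega> in M. real_cond_exp M (F s) (N t) \<omega> = N s \<omega>))"

text \<open>The dynamics are required almost surely simultaneously for all \<open>s < t\<close>; with an
  exceptional set depending on \<open>s\<close> and \<open>t\<close>, pathwise minimality below would be meaningless.
  Integrability is stated explicitly because the library integral of a non-integrable
  function is 0.\<close>

definition supersolution ::
    "'a measure \<Rightarrow> (real \<Rightarrow> 'a measure) \<Rightarrow> real \<Rightarrow> real \<Rightarrow> (real \<Rightarrow> 'a \<Rightarrow> real) \<Rightarrow> ('a \<Rightarrow> ereal) \<Rightarrow>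
     (real \<Rightarrow> 'a \<Rightarrow> real) \<Rightarrow> (real \<Rightarrow> 'a \<Rightarrow> real) \<Rightarrow> bool" where
  "supersolution M F T p vol \<xi> Y N \<longleftrightarrow>
     adapted_before F T Y \<and>
     martingale_before M F T N \<and> cadlag_before M T N \<and>
     (AE \<omega> in M. \<forall>s t. 0 \<le> s \<and> s < t \<and> t < T \<longrightarrow>
        set_integrable lborel {s..t} (\<lambda>u. vol u \<omega> * \<bar>Y u \<omega>\<bar> powr p) \<and>
        Y s \<omega> = Y t \<omega> - (LINT u:{s..t}|lborel. vol u \<omega> * \<bar>Y u \<omega>\<bar> powr p)
                 - (N t \<omega> - N s \<omega>)) \<and>
     (AE \<omega> in M. \<xi> \<omega> \<le> Liminf (at_left T) (\<lambda>t. ereal (Y t \<omega>)))"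

definition bounded_negative_part ::
    "'a measure \<Rightarrow> real \<Rightarrow> (real \<Rightarrow> 'a \<Rightarrow> real) \<Rightarrow> bool" where
  "bounded_negative_part M T Y \<longleftrightarrow>
     (\<exists>C. AE \<omega> in M. \<forall>t\<in>{0..<T}. max (- Y t \<omega>) 0 \<le> C)"

definition minimal_supersolution_in ::
    "((real \<Rightarrow> 'a \<Rightarrow> real) \<times> (real \<Rightarrow> 'a \<Rightarrow> real)) set \<Rightarrow>
     'a measure \<Rightarrow> (real \<Rightarrow> 'a measure) \<Rightarrow> real \<Rightarrow> real \<Rightarrow> (real \<Rightarrow> 'a \<Rightarrow> real) \<Rightarrow> ('a \<Rightarrow> ereal) \<Rightarrow>
     (real \<Rightarrow> 'a \<Rightarrow> real) \<Rightarrow> (real \<Rightarrow> 'a \<Rightarrow> real) \<Rightarrow> bool" where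
  "minimal_supersolution_in \<C> M F T p vol \<xi> Y N \<longleftrightarrow>
     (Y, N) \<in> \<C> \<and> supersolution M F T p vol \<xi> Y N \<and>
     (\<forall>Y' N'. (Y', N') \<in> \<C> \<and> supersolution M F T p vol \<xi> Y' N' \<longrightarrow>
        (AE \<omega> in M. \<forall>t\<in>{0..<T}. Y t \<omega> \<le> Y' t \<omega>))"

text \<open>The integral is taken in \<open>[0, \<infinity>]\<close>, so the bound includes its finiteness.\<close>

definition assumption_A1 ::
    "'a measure \<Rightarrow> real \<Rightarrow> real \<Rightarrow> real \<Rightarrow> (real \<Rightarrow> 'a \<Rightarrow> real) \<Rightarrow> bool" where
  "assumption_A1 M T K p vol \<longleftrightarrow>
     (\<exists>v :: real \<Rightarrow> real.
        (\<forall>t\<in>{0..T}. \<forall>\<omega>\<in>space M. vol t \<omega> = v t) \<and>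
        ennreal (K powr (p - 1)) * (\<integral>\<^sup>+t\<in>{0..T}. ennreal (v t) \<partial>lborel) < ennreal (1 / (p - 1))) \<or>
     (\<exists>b>0. (AE \<omega> in M. \<forall>t\<in>{0..T}. vol t \<omega> \<le> b) \<and>
        K powr (p - 1) * T * b < 1 / (p - 1))"

text \<open>The quotient is formed in \<open>ennreal\<close>, where \<open>1 / 0 = \<infinity>\<close>. Restricting to
  \<open>\<epsilon> \<le> T\<close> keeps the interval inside the domain \<open>[0, T]\<close> of \<open>vol\<close>.\<close>

definition assumption_A2 ::
    "'a measure \<Rightarrow> real \<Rightarrow> real \<Rightarrow> (real \<Rightarrow> 'a \<Rightarrow> real) \<Rightarrow> bool" where
  "assumption_A2 M T p_hat vol \<longleftrightarrow>
     (\<exists>\<sigma> \<epsilon>. 1 < \<sigma> \<and> 0 < \<epsilon> \<and> \<epsilon> \<le> T \<and>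
        (\<integral>\<^sup>+\<omega>. (\<integral>\<^sup>+s\<in>{T - \<epsilon>..T}. 1 / ennreal (vol s \<omega> powr ((p_hat - 1) * \<sigma>)) \<partial>lborel) \<partial>M) < \<infinity>)"

end

theory Submission
  imports Defs
begin

text \<open>
  The equation with the terminal value truncated to \<open>[- K, n]\<close> has a bounded solution, obtained as
  a fixed point of conditional expectations. The solution of the ordinary differential equation
  \<open>y' = a |y|^p\<close> with terminal value \<open>- K\<close>, where the deterministic function \<open>a\<close> dominates \<open>vol\<close>, is a
  lower barrier for all of them; assumption (A1) keeps it finite. By
  comparison the solutions increase with \<open>n\<close> and stay below every supersolution whose negative part
  is bounded, and (A2) bounds their expectations at each time before \<open>T\<close> uniformly in \<open>n\<close>. Their limit
  is therefore finite before \<open>T\<close>, solves the equation and is minimal.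

  For the left limit at \<open>T\<close>, the process \<open>exp (- Y)\<close> plus a multiple of the primitive of \<open>a\<close> is a
  bounded submartingale because \<open>exp (- y) |y|^p\<close> is bounded on \<open>[- C, \<infinity>)\<close>, so it converges; a limit
  \<open>0\<close> of \<open>exp (- Y)\<close> corresponds to the left limit \<open>\<infinity>\<close> of \<open>Y\<close>.
\<close>


section \<open>Integrals and inequalities on the time axis\<close>

text \<open>Minimality is pathwise, with one null set for all times, whereas conditional
  expectations and monotone limits bring a null set for each time. A solution is therefore first
  found as a progressive process, up to null sets time by time, and then replaced by a
  right-continuous version. Almost sure statements pass from dyadic times to all times by right
  continuity, and into time integrals by Fubini. The right-continuous version itself comes from
  counting upcrossings along dyadic times, and the same count yields the left limits at
  \<open>T\<close>. Left continuity of the filtration at \<open>T\<close> identifies the limit of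
  the martingale part of a bounded solution with its closing variable, which is only measurable for
  \<open>F T\<close>; this is how the truncated terminal value is attained as a limit. Neither drift
  nor martingale part of the minimal solution need stay bounded up to \<open>T\<close>, so its left
  limit cannot be read off the equation. The factor \<open>exp (- Y)\<close> tames the drift near
  large values of \<open>Y\<close>.\<close>

lemma set_integral_combine:
  fixes f :: "real \<Rightarrow> real"
  assumes "set_integrable lborel {s..t} f" "s \<le> u" "u \<le> t"
  shows "(LINT x:{s..t}|lborel. f x) = (LINT x:{s..u}|lborel. f x) + (LINT x:{u..t}|lborel. f x)"
proof -
  have 1: "set_integrable lborel {s..u} f" "set_integrable lborel {u..t} f"
    using assms by (auto intro: set_integrable_subset)
  show ?thesis
    unfolding set_borel_integral_eq_integral(2)[OF 1(1)] set_borel_integral_eq_integral(2)[OF 1(2)]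
      set_borel_integral_eq_integral(2)[OF assms(1)]
    using Henstock_Kurzweil_Integration.integral_combine[OF assms(2,3)
        set_borel_integral_eq_integral(1)[OF assms(1)]] by simp
qed

lemma continuous_on_indefinite_set_integral:
  fixes f :: "real \<Rightarrow> real"
  assumes "set_integrable lborel {s..t} f"
  shows "continuous_on {s..t} (\<lambda>u. LINT x:{s..u}|lborel. f x)"
proof -
  have "continuous_on {s..t} (\<lambda>u. integral {s..u} f)"
    by (rule indefinite_integral_continuous_1, rule set_borel_integral_eq_integral(1)[OF assms])
  moreover have "integral {s..u} f = (LINT x:{s..u}|lborel. f x)" if "u \<in> {s..t}" for u
    using that assms by (intro set_borel_integral_eq_integral(2)[symmetric])
      (auto intro: set_integrable_subset)
  ultimately show ?thesis by (rule continuous_on_eq)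
qed

lemma continuous_on_indefinite_set_integral':
  fixes f :: "real \<Rightarrow> real"
  assumes "set_integrable lborel {s..t} f"
  shows "continuous_on {s..t} (\<lambda>u. LINT x:{u..t}|lborel. f x)"
proof -
  have "continuous_on {s..t} (\<lambda>u. (LINT x:{s..t}|lborel. f x) - (LINT x:{s..u}|lborel. f x))"
    by (intro continuous_intros continuous_on_indefinite_set_integral assms)
  moreover have "(LINT x:{s..t}|lborel. f x) - (LINT x:{s..u}|lborel. f x) = (LINT x:{u..t}|lborel. f x)"
    if "u \<in> {s..t}" for u
    using set_integral_combine[OF assms, of u] that by auto
  ultimately show ?thesis by (rule continuous_on_eq)
qed

lemma set_integral_nonneg_real:
  fixes f :: "'b \<Rightarrow> real"
  assumes "\<And>x. x \<in> A \<Longrightarrow> 0 \<le> f x"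
  shows "0 \<le> (LINT x:A|M. f x)"
  unfolding set_lebesgue_integral_def
  using assms by (intro Bochner_Integration.integral_nonneg) (auto simp: indicator_def)

lemma set_integrable_mult_bounded:
  fixes f g :: "real \<Rightarrow> real"
  assumes "set_integrable lborel A f" "g \<in> borel_measurable borel" "A \<in> sets borel"
    "\<And>x. x \<in> A \<Longrightarrow> \<bar>g x\<bar> \<le> c"
  shows "set_integrable lborel A (\<lambda>x. g x * f x)"
proof -
  have m: "(\<lambda>x. indicator A x *\<^sub>R f x) \<in> borel_measurable lborel"
    using assms(1) unfolding set_integrable_def by (rule borel_measurable_integrable)
  have eq: "(\<lambda>x. indicator A x *\<^sub>R (g x * f x)) = (\<lambda>x. g x * (indicator A x *\<^sub>R f x))"
    by (auto simp: indicator_def)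
  show ?thesis
    unfolding set_integrable_def eq
  proof (rule Bochner_Integration.integrable_bound)
    show "integrable lborel (\<lambda>x. c * (indicator A x *\<^sub>R f x))"
      using assms(1) by (auto simp: set_integrable_def)
    show "(\<lambda>x. g x * (indicator A x *\<^sub>R f x)) \<in> borel_measurable lborel"
      using m assms(2) by (intro borel_measurable_times) auto
    show "AE x in lborel. norm (g x * (indicator A x *\<^sub>R f x)) \<le> norm (c * (indicator A x *\<^sub>R f x))"
    proof (intro AE_I2)
      fix x
      show "norm (g x * (indicator A x *\<^sub>R f x)) \<le> norm (c * (indicator A x *\<^sub>R f x))"
      proof (cases "x \<in> A")
        case True
        then show ?thesis using assms(4)[of x] by (auto simp: abs_mult intro!: mult_right_mono)
      qed auto
    qed
  qed
qed

text \<open>The primitive is merely absolutely continuous, so the fundamental theorem of calculus is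
  unavailable; on short intervals the mean value theorem for \<open>\<phi>\<close> gives the identity up to
  \<open>\<epsilon>\<close> times the integral of \<open>a\<close>, and these errors add up.\<close>

lemma chain_rule_indefinite_integral:
  fixes a :: "real \<Rightarrow> real"
  assumes a: "set_integrable lborel {s..t} a" and a0: "\<And>u. u \<in> {s..t} \<Longrightarrow> 0 \<le> a u" and st: "s \<le> t"
  defines "A \<equiv> \<lambda>u. LINT x:{u..t}|lborel. a x"
  assumes d: "\<And>y. y \<in> {0..A s} \<Longrightarrow> (\<phi> has_real_derivative \<phi>' y) (at y)"
    and c: "continuous_on {0..A s} \<phi>'"
  shows "set_integrable lborel {s..t} (\<lambda>u. \<phi>' (A u) * a u)"
    "(LINT u:{s..t}|lborel. \<phi>' (A u) * a u) = \<phi> (A s) - \<phi> 0"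
proof -
  have comb: "A u = (LINT x:{u..v}|lborel. a x) + A v" if "s \<le> u" "u \<le> v" "v \<le> t" for u v
    unfolding A_def using that a by (intro set_integral_combine) (auto intro: set_integrable_subset)
  have pos: "0 \<le> (LINT x:{u..v}|lborel. a x)" if "s \<le> u" "v \<le> t" for u v
    using that a0 by (intro set_integral_nonneg_real) auto
  have dec: "A v \<le> A u" if "s \<le> u" "u \<le> v" "v \<le> t" for u v
    using comb[OF that] pos[of u v] that by auto
  have A0: "A u \<in> {0..A s}" if "u \<in> {s..t}" for u
    using dec[of s u] that pos[of u t] by (auto simp: A_def)
  have contA: "continuous_on {s..t} A"
    unfolding A_def by (rule continuous_on_indefinite_set_integral'[OF a])
  have contpA: "continuous_on {s..t} (\<lambda>u. \<phi>' (A u))"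
    by (rule continuous_on_compose2[OF c contA]) (use A0 in auto)
  obtain B where B: "\<And>u. u \<in> {s..t} \<Longrightarrow> \<bar>\<phi>' (A u)\<bar> \<le> B"
    using compact_imp_bounded[OF compact_continuous_image[OF contpA]] unfolding bounded_iff by fastforce
  define g where "g \<equiv> \<lambda>u. indicator {s..t} u * \<phi>' (A u)"
  have gm: "g \<in> borel_measurable borel"
    unfolding g_def using borel_measurable_continuous_on_indicator[OF _ contpA] by simp
  have "set_integrable lborel {s..t} (\<lambda>u. g u * a u)"
    by (rule set_integrable_mult_bounded[OF a gm, of B]) (use B in \<open>auto simp: g_def\<close>)
  then show int: "set_integrable lborel {s..t} (\<lambda>u. \<phi>' (A u) * a u)"
    by (rule set_integrable_cong[THEN iffD1, rotated -1]) (auto simp: g_def)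
  \<comment> \<open>\<open>D u v\<close> is the defect of the claimed identity on [u, v]. It is
    additive over adjacent intervals, so it suffices to make it small relative to the integral of
    \<open>a\<close> on short intervals.\<close>
  define D where "D \<equiv> \<lambda>u v. \<phi> (A u) - \<phi> (A v) - (LINT x:{u..v}|lborel. \<phi>' (A x) * a x)"
  have "\<bar>D s t\<bar> \<le> e * A s" if e: "e > 0" for e
  proof -
    define P where "P \<equiv> \<lambda>u v. s \<le> u \<and> v \<le> t \<longrightarrow> \<bar>D u v\<bar> \<le> e * (LINT x:{u..v}|lborel. a x)"
    \<comment> \<open>Bolzano's subdivision principle: \<open>P\<close> passes to unions of adjacent
      intervals and holds on all sufficiently short intervals around each point. The guard inside
      \<open>P\<close> makes intervals that leave [s, t] trivial.\<close>
    have "P s t"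
      using st
    proof (induction rule: Bolzano)
      case (trans u v w)
      show ?case unfolding P_def
      proof (intro impI)
        assume *: "s \<le> u \<and> w \<le> t"
        have "D u w = D u v + D v w"
          unfolding D_def using set_integral_combine[OF set_integrable_subset[OF int], of u w v] trans *
          by auto
        moreover have "(LINT x:{u..w}|lborel. a x) = (LINT x:{u..v}|lborel. a x) + (LINT x:{v..w}|lborel. a x)"
          using trans * by (intro set_integral_combine) (auto intro: set_integrable_subset[OF a])
        ultimately show "\<bar>D u w\<bar> \<le> e * (LINT x:{u..w}|lborel. a x)"
          using trans * by (auto simp: distrib_left P_def)
      qed
    next
      case (local x)
      then have x: "x \<in> {s..t}" by auto
      obtain d1 where d1: "d1 > 0" "\<And>y. y \<in> {0..A s} \<Longrightarrow> \<bar>y - A x\<bar> < d1 \<Longrightarrow> \<bar>\<phi>' y - \<phi>' (A x)\<bar> < e/2"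
        using c A0[OF x] e unfolding continuous_on_iff dist_real_def by (meson half_gt_zero)
      obtain d2 where d2: "d2 > 0" "\<And>y. y \<in> {s..t} \<Longrightarrow> \<bar>y - x\<bar> < d2 \<Longrightarrow> \<bar>A y - A x\<bar> < d1"
        using contA x d1(1) unfolding continuous_on_iff dist_real_def by meson
      show ?case unfolding P_def
      proof (intro exI[of _ d2] conjI allI impI)
        fix u v assume *: "u \<le> x \<and> x \<le> v \<and> v - u < d2" "s \<le> u \<and> v \<le> t"
        have uv: "u \<in> {s..t}" "v \<in> {s..t}" using * x by auto
        have near: "\<bar>\<phi>' y - \<phi>' (A x)\<bar> < e/2" if y: "y \<in> {A v..A u}" for y
        proof (rule d1(2))
          show "y \<in> {0..A s}" using y A0[OF uv(1)] A0[OF uv(2)] by auto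
          show "\<bar>y - A x\<bar> < d1" using d2(2)[OF uv(1)] d2(2)[OF uv(2)] y dec[of u x] dec[of x v] * by auto
        qed
        \<comment> \<open>If \<open>A v = A u\<close>, the mean value theorem has no open interval
          to work in; then any point serves.\<close>
        have ex: "\<exists>c\<in>{A v..A u}. \<phi> (A u) - \<phi> (A v) = \<phi>' c * (A u - A v)"
        proof (cases "A v = A u")
          case True then show ?thesis by auto
        next
          case False
          then have lt: "A v < A u" using dec[of u v] * by auto
          have "\<exists>z. z > A v \<and> z < A u \<and> \<phi> (A u) - \<phi> (A v) = (A u - A v) * \<phi>' z"
          proof (rule MVT2[OF lt])
            fix z assume z: "A v \<le> z" "z \<le> A u"
            then show "DERIV \<phi> z :> \<phi>' z" using A0[OF uv(1)] A0[OF uv(2)] by (intro d) auto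
          qed
          then show ?thesis by (auto intro!: bexI simp: mult.commute)
        qed
        then obtain c where cc: "c \<in> {A v..A u}" "\<phi> (A u) - \<phi> (A v) = \<phi>' c * (A u - A v)" by auto
        have i1: "set_integrable lborel {u..v} a" "set_integrable lborel {u..v} (\<lambda>x. \<phi>' (A x) * a x)"
          using * by (auto intro: set_integrable_subset[OF int] set_integrable_subset[OF a])
        have "D u v = (LINT y:{u..v}|lborel. \<phi>' c * a y) - (LINT x:{u..v}|lborel. \<phi>' (A x) * a x)"
          unfolding D_def cc(2) using comb[of u v] * by auto
        also have "\<dots> = (LINT y:{u..v}|lborel. (\<phi>' c - \<phi>' (A y)) * a y)"
          using i1 by (subst set_integral_diff(2)[symmetric]) (auto simp: left_diff_distrib)
        finally have D: "D u v = (LINT y:{u..v}|lborel. (\<phi>' c - \<phi>' (A y)) * a y)" .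
        have i2: "set_integrable lborel {u..v} (\<lambda>y. (\<phi>' c - \<phi>' (A y)) * a y)"
          using i1 set_integral_diff(1)[of lborel "{u..v}" "\<lambda>y. \<phi>' c * a y" "\<lambda>x. \<phi>' (A x) * a x"]
          by (auto simp: left_diff_distrib)
        have bd: "\<bar>(\<phi>' c - \<phi>' (A y)) * a y\<bar> \<le> e * a y" if y: "y \<in> {u..v}" for y
        proof -
          have "A y \<in> {A v..A u}" using dec[of u y] dec[of y v] y * by auto
          then have "\<bar>\<phi>' c - \<phi>' (A y)\<bar> \<le> e" using near[of c] near[of "A y"] cc(1) by linarith
          then show ?thesis using a0[of y] y * by (auto simp: abs_mult intro!: mult_right_mono)
        qed
        have ie: "set_integrable lborel {u..v} (\<lambda>y. e * a y)" using i1(1) by simp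
        have "D u v \<le> (LINT y:{u..v}|lborel. e * a y)"
          unfolding D by (rule set_integral_mono[OF i2 ie]) (use bd in \<open>auto simp: abs_le_iff\<close>)
        moreover have "set_integrable lborel {u..v} (\<lambda>y. - ((\<phi>' c - \<phi>' (A y)) * a y))"
          using i2 unfolding set_integrable_def by simp
        then have "- D u v \<le> (LINT y:{u..v}|lborel. e * a y)"
          unfolding D set_integral_uminus[OF i2, symmetric]
          using bd unfolding abs_le_iff by (intro set_integral_mono[OF _ ie]) blast+
        ultimately have "\<bar>D u v\<bar> \<le> (LINT y:{u..v}|lborel. e * a y)" by linarith
        then show "\<bar>D u v\<bar> \<le> e * (LINT x:{u..v}|lborel. a x)" by auto
      qed (use d2 in auto)
    qed
    then show ?thesis by (simp add: A_def P_def)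
  qed
  note De = this
  have "\<bar>D s t\<bar> \<le> 0"
  proof (rule field_le_epsilon)
    fix e :: real assume e: "e > 0"
    have As: "0 \<le> A s" using A0[of s] st by auto
    \<comment> \<open>The \<open>+ 1\<close> avoids a division by 0 when
      \<open>A s = 0\<close>.\<close>
    have "\<bar>D s t\<bar> \<le> e / (A s + 1) * A s" using e As by (intro De divide_pos_pos) auto
    also have "\<dots> \<le> e" using e As by (simp add: field_simps)
    finally show "\<bar>D s t\<bar> \<le> 0 + e" by simp
  qed
  moreover have "A t = 0"
    using set_borel_integral_eq_integral(2)[OF set_integrable_subset[OF a, of "{t..t}"]] st
    unfolding A_def by simp
  ultimately show "(LINT u:{s..t}|lborel. \<phi>' (A u) * a u) = \<phi> (A s) - \<phi> 0" by (simp add: D_def)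
qed

text \<open>The weight \<open>w\<close> has backward derivative \<open>2 * L * a * w\<close>, so
  integrating \<open>L * a * w\<close> over [s, t] gives less than half of \<open>w s\<close>. This
  halving is the origin of the factor 2 in the exponent; it drives both the Gronwall estimate and
  the Picard contraction.\<close>

lemma exp_weight_integral:
  fixes a :: "real \<Rightarrow> real"
  assumes "set_integrable lborel {s..t} a" "\<And>u. u \<in> {s..t} \<Longrightarrow> 0 \<le> a u" "s \<le> t"
  shows "set_integrable lborel {s..t} (\<lambda>u. a u * exp (2 * L * (LINT x:{u..t}|lborel. a x)))"
    "L * (LINT u:{s..t}|lborel. a u * exp (2 * L * (LINT x:{u..t}|lborel. a x)))
      = (exp (2 * L * (LINT x:{s..t}|lborel. a x)) - 1) / 2"
proof -
  have d: "((\<lambda>y. exp (2 * L * y) / 2) has_real_derivative L * exp (2 * L * y)) (at y)" for y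
    by (auto intro!: derivative_eq_intros)
  note c = chain_rule_indefinite_integral(2)[OF assms d]
  \<comment> \<open>The natural primitive \<open>exp (2 * L * y) / (2 * L)\<close> breaks down at
    \<open>L = 0\<close>, where it is replaced by \<open>y\<close>.\<close>
  have d': "((\<lambda>y. if L = 0 then y else exp (2 * L * y) / (2 * L)) has_real_derivative exp (2 * L * y)) (at y)" for y
    by (cases "L = 0") (auto intro!: derivative_eq_intros)
  have "set_integrable lborel {s..t} (\<lambda>u. exp (2 * L * (LINT x:{u..t}|lborel. a x)) * a u)"
    by (rule chain_rule_indefinite_integral(1)[OF assms d']) (auto intro!: continuous_intros)
  then show "set_integrable lborel {s..t} (\<lambda>u. a u * exp (2 * L * (LINT x:{u..t}|lborel. a x)))"
    by (simp add: mult.commute)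
  show "L * (LINT u:{s..t}|lborel. a u * exp (2 * L * (LINT x:{u..t}|lborel. a x)))
      = (exp (2 * L * (LINT x:{s..t}|lborel. a x)) - 1) / 2"
    using c by (simp add: diff_divide_distrib continuous_intros mult_ac flip: set_integral_mult_right)
qed

text \<open>With the weight \<open>w\<close> of \<open>exp_weight_integral\<close>, the supremum
  \<open>\<kappa>\<close> of \<open>\<delta> / w\<close> satisfies
  \<open>\<kappa> \<le> e + \<kappa> / 2\<close>. Boundedness of \<open>\<delta>\<close> makes
  \<open>\<kappa>\<close> finite, so it can be absorbed; the factor 2 in the conclusion is the
  price.\<close>

lemma gronwall_backward:
  fixes a \<delta> :: "real \<Rightarrow> real"
  assumes a: "set_integrable lborel {s..t} a" "\<And>u. u \<in> {s..t} \<Longrightarrow> 0 \<le> a u" "s \<le> t" and L: "0 \<le> L" and e: "0 \<le> e"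
    and m: "\<delta> \<in> borel_measurable borel" and b: "\<And>u. u \<in> {s..t} \<Longrightarrow> \<delta> u \<in> {0..c}"
    and le: "\<And>u. u \<in> {s..t} \<Longrightarrow> \<delta> u \<le> e + L * (LINT x:{u..t}|lborel. a x * \<delta> x)"
  shows "\<delta> s \<le> 2 * e * exp (2 * L * (LINT x:{s..t}|lborel. a x))"
proof -
  define w where "w \<equiv> \<lambda>u. exp (2 * L * (LINT x:{u..t}|lborel. a x))"
  have w1: "1 \<le> w u" if "u \<in> {s..t}" for u
    unfolding w_def using L a(2) that by (auto intro!: mult_nonneg_nonneg set_integral_nonneg_real)
  have w0: "0 < w u" for u by (simp add: w_def)
  define \<kappa> where "\<kappa> = (SUP u\<in>{s..t}. \<delta> u / w u)"
  have quot: "\<delta> u / w u \<le> c" if "u \<in> {s..t}" for u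
  proof -
    have "\<delta> u / w u \<le> \<delta> u / 1" using w1[OF that] b[OF that] by (intro divide_left_mono) auto
    then show ?thesis using b[OF that] by auto
  qed
  have bdd: "bdd_above ((\<lambda>u. \<delta> u / w u) ` {s..t})" using quot by (intro bdd_aboveI2[where M=c]) auto
  have k: "\<delta> u \<le> \<kappa> * w u" if "u \<in> {s..t}" for u
  proof -
    have "\<delta> u / w u \<le> \<kappa>" unfolding \<kappa>_def using that bdd by (intro cSUP_upper)
    then show ?thesis using w0[of u] by (simp add: field_simps)
  qed
  have k0: "0 \<le> \<kappa>" using k[of s] b[of s] w0[of s] a(3) by (smt (verit) atLeastAtMost_iff mult_neg_pos)
  have "\<delta> u / w u \<le> e + \<kappa> / 2" if u: "u \<in> {s..t}" for u
  proof -
    have au: "set_integrable lborel {u..t} a" using u by (intro set_integrable_subset[OF a(1)]) auto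
    have i1: "set_integrable lborel {u..t} (\<lambda>x. a x * w x)"
      unfolding w_def using u by (intro exp_weight_integral(1) au a) auto
    have i2: "set_integrable lborel {u..t} (\<lambda>x. \<delta> x * a x)"
      using b u by (intro set_integrable_mult_bounded[OF au m, where c=c]) (fastforce simp: abs_le_iff)+
    have "(LINT x:{u..t}|lborel. a x * \<delta> x) \<le> (LINT x:{u..t}|lborel. \<kappa> * (a x * w x))"
      using set_integrable_mult_right[OF i1, of \<kappa>] i2 k a(2) u
      by (intro set_integral_mono) (auto simp: mult.commute[of _ "a _"] mult.left_commute[of \<kappa>] intro!: mult_left_mono)
    then have "L * (LINT x:{u..t}|lborel. a x * \<delta> x) \<le> \<kappa> * (L * (LINT x:{u..t}|lborel. a x * w x))"
      using mult_left_mono[OF _ L] by (fastforce simp: mult_ac)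
    also have "L * (LINT x:{u..t}|lborel. a x * w x) = (w u - 1) / 2"
      unfolding w_def using u by (intro exp_weight_integral(2) au a) auto
    finally have "\<delta> u \<le> e + \<kappa> * ((w u - 1) / 2)" using le[OF u] by linarith
    \<comment> \<open>As \<open>w u \<ge> 1\<close>, the constant \<open>e\<close> may be multiplied
      by the weight, and the negative term \<open>- \<kappa> / 2\<close> is dropped.\<close>
    also have "\<dots> \<le> e * w u + \<kappa> / 2 * w u"
      using k0 e w1[OF u] mult_left_mono[OF w1[OF u] e] by (auto simp: field_simps)
    finally show ?thesis using w0[of u] by (simp add: field_simps)
  qed
  then have "\<kappa> \<le> e + \<kappa> / 2" unfolding \<kappa>_def using a(3) by (intro cSUP_least) auto
  then have "\<kappa> \<le> 2 * e" by simp
  then have "\<kappa> * w s \<le> 2 * e * w s" using w0[of s] by (intro mult_right_mono) auto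
  moreover have "\<delta> s \<le> \<kappa> * w s" using a(3) by (intro k) auto
  ultimately show ?thesis unfolding w_def by linarith
qed

lemma abs_powr_lipschitz:
  fixes x y :: real
  assumes "1 < p" "\<bar>x\<bar> \<le> m" "\<bar>y\<bar> \<le> m"
  shows "\<bar>\<bar>x\<bar> powr p - \<bar>y\<bar> powr p\<bar> \<le> p * m powr (p - 1) * \<bar>x - y\<bar>"
proof -
  have *: "v powr p - u powr p \<le> p * m powr (p - 1) * (v - u)" if "0 \<le> u" "u < v" "v \<le> m" for u v :: real
  proof -
    \<comment> \<open>The form of the mean value theorem with differentiability only in the open
      interval is essential, because \<open>u\<close> may be 0.\<close>
    have "\<exists>l z. u < z \<and> z < v \<and> DERIV (\<lambda>x. x powr p) z :> l \<and> v powr p - u powr p = (v - u) * l"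
    proof (rule MVT)
      show "continuous_on {u..v} (\<lambda>x. x powr p)" using that assms by (intro continuous_on_powr') (auto intro!: continuous_intros)
      show "(\<lambda>x. x powr p) differentiable (at x)" if "u < x" for x
        using has_real_derivative_powr[of x p] that \<open>0 \<le> u\<close> by (auto simp: real_differentiable_def)
    qed fact
    then obtain l z where z: "u < z" "z < v" "DERIV (\<lambda>x. x powr p) z :> l" "v powr p - u powr p = (v - u) * l"
      by auto
    have "l = p * z powr (p - 1)"
      using DERIV_unique[OF z(3) has_real_derivative_powr] z that by auto
    moreover have "z powr (p - 1) \<le> m powr (p - 1)" using z that assms by (intro powr_mono2) auto
    ultimately have "l \<le> p * m powr (p - 1)" using assms by (auto intro!: mult_left_mono)
    then show ?thesis using z(4) that by (simp add: mult.commute mult_right_mono)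
  qed
  have "\<bar>\<bar>x\<bar> powr p - \<bar>y\<bar> powr p\<bar> \<le> p * m powr (p - 1) * \<bar>\<bar>x\<bar> - \<bar>y\<bar>\<bar>"
  proof (cases "\<bar>x\<bar>" "\<bar>y\<bar>" rule: linorder_cases)
    case less
    then have "\<bar>x\<bar> powr p \<le> \<bar>y\<bar> powr p" using assms by (intro powr_mono2) auto
    then show ?thesis using *[of "\<bar>x\<bar>" "\<bar>y\<bar>"] less assms by auto
  next
    case greater
    then have "\<bar>y\<bar> powr p \<le> \<bar>x\<bar> powr p" using assms by (intro powr_mono2) auto
    then show ?thesis using *[of "\<bar>y\<bar>" "\<bar>x\<bar>"] greater assms by auto
  qed auto
  also have "\<dots> \<le> p * m powr (p - 1) * \<bar>x - y\<bar>"
    using assms by (intro mult_left_mono) auto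
  finally show ?thesis .
qed

text \<open>At a point where the left limit differs from the value, some rational \<open>r\<close>
  separates the value from all values on a left neighbourhood of rational length \<open>d\<close>.
  For fixed \<open>r\<close> and \<open>d\<close> any two such points are at least \<open>d\<close>
  apart, so the exceptional set is countable.\<close>

lemma AE_left_continuous:
  fixes x :: "real \<Rightarrow> real"
  assumes "\<And>u. u \<in> {0<..<T} \<Longrightarrow> \<exists>l. (x \<longlongrightarrow> l) (at_left u)"
  shows "AE u in lborel. u \<in> {0<..<T} \<longrightarrow> (x \<longlongrightarrow> x u) (at_left u)"
proof -
  define J1 where "J1 \<equiv> \<lambda>r d :: real. {u. r < x u \<and> (\<forall>v\<in>{u-d<..<u}. x v < r)}"
  define J2 where "J2 \<equiv> \<lambda>r d :: real. {u. r > x u \<and> (\<forall>v\<in>{u-d<..<u}. x v > r)}"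
  \<comment> \<open>Points that are \<open>d\<close> apart have distinct integer parts after
    division by \<open>d\<close>.\<close>
  have gap: "countable J" if d: "d > 0" and J: "\<And>u v. u \<in> J \<Longrightarrow> v \<in> J \<Longrightarrow> u < v \<Longrightarrow> u \<le> v - d" for J and d :: real
  proof -
    have "inj_on (\<lambda>u. \<lfloor>u / d\<rfloor>) J"
    proof (rule linorder_inj_onI)
      fix u v assume "u < v" "u \<in> J" "v \<in> J"
      then have "u \<le> v - d" by (intro J)
      then have "(u + d) / d \<le> v / d" using d by (intro divide_right_mono) auto
      then have "u / d + 1 \<le> v / d" using d by (simp add: add_divide_distrib)
      then show "\<lfloor>u / d\<rfloor> \<noteq> \<lfloor>v / d\<rfloor>" by linarith
    qed auto
    then show ?thesis by (rule countable_image_inj_on[rotated]) auto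
  qed
  have c1: "countable (J1 r d)" if "d > 0" for r d
    by (rule gap[OF that]) (force simp: J1_def not_less)
  have c2: "countable (J2 r d)" if "d > 0" for r d
    by (rule gap[OF that]) (force simp: J2_def not_less)
  define N where "N = (\<Union>r\<in>\<rat>. \<Union>d\<in>\<rat> \<inter> {0<..}. J1 r d \<union> J2 r d)"
  have "countable N" unfolding N_def using c1 c2 countable_rat
    by (intro countable_UN countable_Int1 countable_Un) auto
  have "(x \<longlongrightarrow> x u) (at_left u)" if u: "u \<in> {0<..<T}" "u \<notin> N" for u
  proof -
    obtain l where l: "(x \<longlongrightarrow> l) (at_left u)" using assms u by auto
    have ev: "\<exists>d\<in>\<rat> \<inter> {0<..}. \<forall>v\<in>{u-d<..<u}. P (x v)" if evP: "eventually (\<lambda>v. P (x v)) (at_left u)" for P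
    proof -
      obtain b where b: "b < u" "\<forall>y>b. y < u \<longrightarrow> P (x y)" using evP eventually_at_left[of "u-1" u "\<lambda>v. P (x v)"] by auto
      obtain d where d: "d \<in> \<rat>" "0 < d" "d < u - b" using Rats_dense_in_real[of 0 "u-b"] b by auto
      then show ?thesis using b by (intro bexI[of _ d]) auto
    qed
    have "l = x u"
    proof (rule ccontr)
      assume "l \<noteq> x u"
      then consider "l < x u" | "l > x u" by linarith
      then show False
      proof cases
        case 1
        then obtain r where r: "r \<in> \<rat>" "l < r" "r < x u" using Rats_dense_in_real by blast
        show ?thesis using ev[OF order_tendstoD(2)[OF l r(2)]] r u unfolding N_def J1_def by blast
      next
        case 2
        then obtain r where r: "r \<in> \<rat>" "x u < r" "r < l" using Rats_dense_in_real by blast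
        show ?thesis using ev[OF order_tendstoD(1)[OF l r(3)]] r u unfolding N_def J2_def by blast
      qed
    qed
    then show ?thesis using l by simp
  qed
  moreover have "AE u in lborel. u \<notin> N"
    by (rule AE_not_in[OF countable_imp_null_set_lborel[OF \<open>countable N\<close>]])
  ultimately show ?thesis by (auto elim!: eventually_mono)
qed

section \<open>Upcrossings\<close>

text \<open>Vitali convergence. The tail hypothesis is what the martingale property yields for
  values closed by a variable with modulus \<open>Z\<close>: it bounds first the measure of the sets
  of large values by Markov's inequality, then the tails themselves uniformly in \<open>k\<close>.
  Truncation at a level \<open>c\<close> leaves a bounded sequence, treated by dominated
  convergence, and remainders that are uniformly small in mean.\<close>

lemma (in finite_measure) uniformly_integrable_limit:
  fixes X :: "nat \<Rightarrow> 'a \<Rightarrow> real" and Y Z :: "'a \<Rightarrow> real"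
  assumes X: "\<And>k. integrable M (X k)" and Z: "integrable M Z" "\<And>\<omega>. 0 \<le> Z \<omega>"
    and tail: "\<And>k c. c > 0 \<Longrightarrow> (\<integral>\<omega>. indicator {\<omega>. c < \<bar>X k \<omega>\<bar>} \<omega> * \<bar>X k \<omega>\<bar> \<partial>M)
        \<le> (\<integral>\<omega>. indicator {\<omega>. c < \<bar>X k \<omega>\<bar>} \<omega> * Z \<omega> \<partial>M)"
    and lim: "AE \<omega> in M. (\<lambda>k. X k \<omega>) \<longlonglongrightarrow> Y \<omega>" and Y[measurable]: "Y \<in> borel_measurable M"
  shows "integrable M Y"
    "\<And>B. B \<in> sets M \<Longrightarrow> (\<lambda>k. \<integral>\<omega>. indicator B \<omega> * X k \<omega> \<partial>M) \<longlonglongrightarrow> (\<integral>\<omega>. indicator B \<omega> * Y \<omega> \<partial>M)"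
proof -
  have [measurable]: "X k \<in> borel_measurable M" "Z \<in> borel_measurable M" for k using X Z by auto
  define clip where "clip \<equiv> \<lambda>c x :: real. max (- c) (min c x)"
  have clip_le: "\<bar>clip c x\<bar> \<le> c" if "0 \<le> c" for c x using that by (auto simp: clip_def)
  have clip_m[measurable]: "clip c \<in> borel_measurable borel" for c unfolding clip_def by measurable
  have clip_lim: "(\<lambda>k. clip c (x k)) \<longlonglongrightarrow> clip c y" if "x \<longlonglongrightarrow> y" for c x y
    unfolding clip_def by (intro tendsto_intros that)
  have iX: "integrable M (\<lambda>\<omega>. indicator {\<omega>. c < \<bar>X k \<omega>\<bar>} \<omega> * V \<omega>)" if "integrable M V" for V :: "'a \<Rightarrow> real" and c k
    using that by (intro Bochner_Integration.integrable_bound[OF that]) (auto simp: indicator_def)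
  have cheb: "(\<integral>\<omega>. indicator {\<omega>. c < \<bar>X k \<omega>\<bar>} \<omega> \<partial>M) \<le> (\<integral>\<omega>. Z \<omega> \<partial>M) / c" if c: "0 < c" for c k
  proof -
    have "c * (\<integral>\<omega>. indicator {\<omega>. c < \<bar>X k \<omega>\<bar>} \<omega> \<partial>M) = (\<integral>\<omega>. indicator {\<omega>. c < \<bar>X k \<omega>\<bar>} \<omega> * c \<partial>M)"
      by (subst Bochner_Integration.integral_mult_left_zero) (simp add: mult.commute)
    also have "\<dots> \<le> (\<integral>\<omega>. indicator {\<omega>. c < \<bar>X k \<omega>\<bar>} \<omega> * \<bar>X k \<omega>\<bar> \<partial>M)"
      using X by (intro integral_mono iX) (auto simp: indicator_def)
    also have "\<dots> \<le> (\<integral>\<omega>. indicator {\<omega>. c < \<bar>X k \<omega>\<bar>} \<omega> * Z \<omega> \<partial>M)" by (rule tail[OF c])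
    also have "\<dots> \<le> (\<integral>\<omega>. Z \<omega> \<partial>M)" using Z by (intro integral_mono iX) (auto simp: indicator_def)
    finally show ?thesis using c by (simp add: field_simps)
  qed
  have small: "\<exists>c>0. \<forall>k. (\<integral>\<omega>. \<bar>X k \<omega> - clip c (X k \<omega>)\<bar> \<partial>M) \<le> e" if e: "0 < e" for e
  proof -
    have "(\<lambda>n. \<integral>\<omega>. indicator {\<omega>. real n < Z \<omega>} \<omega> * Z \<omega> \<partial>M) \<longlonglongrightarrow> (\<integral>\<omega>. 0 \<partial>M)"
    proof (rule integral_dominated_convergence[OF _ _ Z(1)])
      show "AE \<omega> in M. (\<lambda>n. indicator {\<omega>. real n < Z \<omega>} \<omega> * Z \<omega>) \<longlonglongrightarrow> 0"
      proof (intro AE_I2)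
        fix \<omega>
        have "eventually (\<lambda>n. indicator {\<omega>. real n < Z \<omega>} \<omega> * Z \<omega> = 0) sequentially"
          using eventually_ge_at_top[of "nat \<lceil>Z \<omega>\<rceil>"] by eventually_elim (auto simp: indicator_def nat_le_iff ceiling_le_iff)
        then show "(\<lambda>n. indicator {\<omega>. real n < Z \<omega>} \<omega> * Z \<omega>) \<longlonglongrightarrow> 0" by (rule tendsto_eventually)
      qed
    qed (use Z in \<open>auto simp: indicator_def\<close>)
    then have "eventually (\<lambda>n. (\<integral>\<omega>. indicator {\<omega>. real n < Z \<omega>} \<omega> * Z \<omega> \<partial>M) < e / 2) sequentially"
      using e by (intro order_tendstoD) auto
    then obtain n where n: "(\<integral>\<omega>. indicator {\<omega>. real n < Z \<omega>} \<omega> * Z \<omega> \<partial>M) < e / 2"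
      by (auto simp: eventually_sequentially)
    \<comment> \<open>By the choice of \<open>n\<close> the part of \<open>Z\<close> above
      \<open>n\<close> has mean below \<open>e / 2\<close>. The level \<open>c\<close> makes
      \<open>n\<close> times the Markov bound at most \<open>e / 2\<close>; the added ones keep the
      factors positive when \<open>n\<close> or the mean of \<open>Z\<close> is 0.\<close>
    define c where "c = 2 * (real n + 1) * ((\<integral>\<omega>. Z \<omega> \<partial>M) + 1) / e"
    have EZ: "0 \<le> (\<integral>\<omega>. Z \<omega> \<partial>M)" using Z by simp
    then have c: "c > 0" unfolding c_def using e by (auto intro!: divide_pos_pos mult_pos_pos)
    have "(\<integral>\<omega>. \<bar>X k \<omega> - clip c (X k \<omega>)\<bar> \<partial>M) \<le> e" for k
    proof -
      have iZ: "integrable M (\<lambda>\<omega>. indicator {\<omega>. real n < Z \<omega>} \<omega> * Z \<omega>)"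
        using Z by (intro Bochner_Integration.integrable_bound[OF Z(1)]) (auto simp: indicator_def)
      have ii: "integrable M (\<lambda>\<omega>. indicator {\<omega>. c < \<bar>X k \<omega>\<bar>} \<omega> :: real)"
        by (rule integrable_const_bound[where B=1]) (auto simp: indicator_def)
      have "(\<integral>\<omega>. \<bar>X k \<omega> - clip c (X k \<omega>)\<bar> \<partial>M) \<le> (\<integral>\<omega>. indicator {\<omega>. c < \<bar>X k \<omega>\<bar>} \<omega> * \<bar>X k \<omega>\<bar> \<partial>M)"
      proof (rule integral_mono)
        show "integrable M (\<lambda>\<omega>. \<bar>X k \<omega> - clip c (X k \<omega>)\<bar>)"
          by (rule Bochner_Integration.integrable_bound[OF X[of k]]) (use c in \<open>auto simp: clip_def\<close>)
        show "\<bar>X k \<omega> - clip c (X k \<omega>)\<bar> \<le> indicator {\<omega>. c < \<bar>X k \<omega>\<bar>} \<omega> * \<bar>X k \<omega>\<bar>" for \<omega>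
          using c by (auto simp: clip_def indicator_def)
      qed (use X in \<open>auto intro!: iX\<close>)
      also have "\<dots> \<le> (\<integral>\<omega>. indicator {\<omega>. c < \<bar>X k \<omega>\<bar>} \<omega> * Z \<omega> \<partial>M)" by (rule tail[OF c])
      also have "\<dots> \<le> (\<integral>\<omega>. indicator {\<omega>. real n < Z \<omega>} \<omega> * Z \<omega> + real n * indicator {\<omega>. c < \<bar>X k \<omega>\<bar>} \<omega> \<partial>M)"
        using Z iZ ii by (intro integral_mono iX Bochner_Integration.integrable_add) (auto simp: indicator_def)
      also have "\<dots> = (\<integral>\<omega>. indicator {\<omega>. real n < Z \<omega>} \<omega> * Z \<omega> \<partial>M) + real n * (\<integral>\<omega>. indicator {\<omega>. c < \<bar>X k \<omega>\<bar>} \<omega> \<partial>M)"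
        using iZ ii by (subst Bochner_Integration.integral_add) auto
      also have "\<dots> \<le> e / 2 + real n * ((\<integral>\<omega>. Z \<omega> \<partial>M) / c)"
        using n cheb[OF c] by (intro add_mono mult_left_mono) auto
      also have "real n * ((\<integral>\<omega>. Z \<omega> \<partial>M) / c) \<le> (real n + 1) * (((\<integral>\<omega>. Z \<omega> \<partial>M) + 1) / c)"
        using c EZ by (intro mult_mono divide_right_mono) auto
      also have "\<dots> = e / 2"
      proof -
        have "a * (b / (2 * a * b / e)) = e / 2" if "0 < a" "0 < b" for a b :: real
          using that e by (simp add: field_simps)
        from this[of "real n + 1" "(\<integral>\<omega>. Z \<omega> \<partial>M) + 1"] show ?thesis unfolding c_def using EZ by simp
      qed
      finally show ?thesis by simp
    qed
    then show ?thesis using c by blast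
  qed
  \<comment> \<open>Fatou's lemma in the form used twice below: with \<open>h\<close> the identity,
    for integrability of \<open>Y\<close>, and with \<open>h\<close> the truncation remainder, so
    that the remainder of the limit is small as well.\<close>
  have fatou: "(\<integral>\<^sup>+\<omega>. ennreal \<bar>h (Y \<omega>)\<bar> \<partial>M) \<le> ennreal C"
    if h: "\<And>x y. x \<longlonglongrightarrow> y \<Longrightarrow> (\<lambda>k. h (x k)) \<longlonglongrightarrow> h y" and [measurable]: "h \<in> borel_measurable borel"
      and hi: "\<And>k. integrable M (\<lambda>\<omega>. h (X k \<omega>))" and C: "\<And>k. (\<integral>\<omega>. \<bar>h (X k \<omega>)\<bar> \<partial>M) \<le> C"
    for h :: "real \<Rightarrow> real" and C
  proof -
    have "(\<integral>\<^sup>+\<omega>. ennreal \<bar>h (Y \<omega>)\<bar> \<partial>M) = (\<integral>\<^sup>+\<omega>. liminf (\<lambda>k. ennreal \<bar>h (X k \<omega>)\<bar>) \<partial>M)"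
    proof (rule nn_integral_cong_AE)
      show "AE \<omega> in M. ennreal \<bar>h (Y \<omega>)\<bar> = liminf (\<lambda>k. ennreal \<bar>h (X k \<omega>)\<bar>)"
        using lim
      proof eventually_elim
        case (elim \<omega>)
        have "(\<lambda>k. ennreal \<bar>h (X k \<omega>)\<bar>) \<longlonglongrightarrow> ennreal \<bar>h (Y \<omega>)\<bar>" by (intro tendsto_intros h elim)
        then show ?case by (rule lim_imp_Liminf[OF sequentially_bot, symmetric])
      qed
    qed
    also have "\<dots> \<le> liminf (\<lambda>k. \<integral>\<^sup>+\<omega>. ennreal \<bar>h (X k \<omega>)\<bar> \<partial>M)" by (rule nn_integral_liminf) simp
    also have "\<dots> \<le> ennreal C"
    proof (rule Liminf_le)
      show "\<forall>\<^sub>F k in sequentially. (\<integral>\<^sup>+\<omega>. ennreal \<bar>h (X k \<omega>)\<bar> \<partial>M) \<le> ennreal C"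
        using C hi by (intro always_eventually allI) (auto simp: nn_integral_eq_integral intro!: ennreal_leI)
    qed simp
    finally show ?thesis .
  qed
  show iY: "integrable M Y"
  proof -
    obtain c where c: "c > 0" "\<And>k. (\<integral>\<omega>. \<bar>X k \<omega> - clip c (X k \<omega>)\<bar> \<partial>M) \<le> 1" using small[of 1] by auto
    have "(\<integral>\<omega>. \<bar>X k \<omega>\<bar> \<partial>M) \<le> 1 + c * measure M (space M)" for k
    proof -
      have i: "integrable M (\<lambda>\<omega>. \<bar>X k \<omega> - clip c (X k \<omega>)\<bar>)"
        by (rule Bochner_Integration.integrable_bound[OF X[of k]]) (use c in \<open>auto simp: clip_def\<close>)
      have "(\<integral>\<omega>. \<bar>X k \<omega>\<bar> \<partial>M) \<le> (\<integral>\<omega>. \<bar>X k \<omega> - clip c (X k \<omega>)\<bar> + c \<partial>M)"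
        using i X c(1) by (intro integral_mono) (auto simp: clip_def)
      also have "\<dots> \<le> 1 + c * measure M (space M)" using i c(2)[of k] by simp
      finally show ?thesis .
    qed
    then have "(\<integral>\<^sup>+\<omega>. ennreal \<bar>Y \<omega>\<bar> \<partial>M) \<le> ennreal (1 + c * measure M (space M))"
      using fatou[of "\<lambda>x. x" "1 + c * measure M (space M)"] X by auto
    then have "(\<integral>\<^sup>+\<omega>. ennreal \<bar>Y \<omega>\<bar> \<partial>M) < \<infinity>" by (rule le_less_trans) (simp add: ennreal_less_top)
    then show ?thesis by (auto simp: integrable_iff_bounded)
  qed
  fix B assume B[measurable]: "B \<in> sets M"
  show "(\<lambda>k. \<integral>\<omega>. indicator B \<omega> * X k \<omega> \<partial>M) \<longlonglongrightarrow> (\<integral>\<omega>. indicator B \<omega> * Y \<omega> \<partial>M)"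
  proof (rule LIMSEQ_I)
    fix e :: real assume e: "0 < e"
    obtain c where c: "c > 0" "\<And>k. (\<integral>\<omega>. \<bar>X k \<omega> - clip c (X k \<omega>)\<bar> \<partial>M) \<le> e / 4" using small[of "e/4"] e by auto
    have iXc: "integrable M (\<lambda>\<omega>. X k \<omega> - clip c (X k \<omega>))" for k
      by (rule Bochner_Integration.integrable_bound[OF X[of k]]) (use c in \<open>auto simp: clip_def\<close>)
    have iYc: "integrable M (\<lambda>\<omega>. Y \<omega> - clip c (Y \<omega>))"
      by (rule Bochner_Integration.integrable_bound[OF iY]) (use c in \<open>auto simp: clip_def\<close>)
    have cl: "(\<lambda>k. x k - clip c (x k)) \<longlonglongrightarrow> y - clip c y" if "x \<longlonglongrightarrow> y" for x y
      by (intro tendsto_diff that clip_lim)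
    have "(\<integral>\<^sup>+\<omega>. ennreal \<bar>Y \<omega> - clip c (Y \<omega>)\<bar> \<partial>M) \<le> ennreal (e / 4)"
      using fatou[of "\<lambda>x. x - clip c x" "e/4", OF cl _ iXc c(2)] by measurable
    then have Yc: "(\<integral>\<omega>. \<bar>Y \<omega> - clip c (Y \<omega>)\<bar> \<partial>M) \<le> e / 4"
      using iYc e by (subst (asm) nn_integral_eq_integral) auto
    have "(\<lambda>k. \<integral>\<omega>. indicator B \<omega> * clip c (X k \<omega>) \<partial>M) \<longlonglongrightarrow> (\<integral>\<omega>. indicator B \<omega> * clip c (Y \<omega>) \<partial>M)"
    proof (rule integral_dominated_convergence[where w="\<lambda>_. c"])
      show "AE \<omega> in M. (\<lambda>k. indicator B \<omega> * clip c (X k \<omega>)) \<longlonglongrightarrow> indicator B \<omega> * clip c (Y \<omega>)"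
        using lim by eventually_elim (intro tendsto_intros clip_lim)
      show "AE \<omega> in M. norm (indicator B \<omega> * clip c (X k \<omega>)) \<le> c" for k
        using clip_le[of c] c(1) by (auto simp: indicator_def)
    qed auto
    from LIMSEQ_D[OF this, of "e / 4"] e
    obtain k0 where k0: "\<And>k. k \<ge> k0 \<Longrightarrow>
        norm ((\<integral>\<omega>. indicator B \<omega> * clip c (X k \<omega>) \<partial>M) - (\<integral>\<omega>. indicator B \<omega> * clip c (Y \<omega>) \<partial>M)) < e / 4"
      by auto
    have split: "\<bar>(\<integral>\<omega>. indicator B \<omega> * V \<omega> \<partial>M) - (\<integral>\<omega>. indicator B \<omega> * clip c (V \<omega>) \<partial>M)\<bar> \<le> e / 4"
      if V: "integrable M V" "integrable M (\<lambda>\<omega>. V \<omega> - clip c (V \<omega>))" and le: "(\<integral>\<omega>. \<bar>V \<omega> - clip c (V \<omega>)\<bar> \<partial>M) \<le> e / 4" for V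
    proof -
      have [measurable]: "V \<in> borel_measurable M" using V by auto
      have i: "integrable M (\<lambda>\<omega>. indicator B \<omega> * V \<omega>)"
        by (rule Bochner_Integration.integrable_bound[OF V(1)]) (auto simp: indicator_def)
      have i': "integrable M (\<lambda>\<omega>. indicator B \<omega> * clip c (V \<omega>))"
        by (rule integrable_const_bound[where B=c]) (use clip_le[of c] c(1) in \<open>auto simp: indicator_def\<close>)
      have "\<bar>(\<integral>\<omega>. indicator B \<omega> * V \<omega> \<partial>M) - (\<integral>\<omega>. indicator B \<omega> * clip c (V \<omega>) \<partial>M)\<bar>
          = norm (\<integral>\<omega>. indicator B \<omega> * V \<omega> - indicator B \<omega> * clip c (V \<omega>) \<partial>M)"
        using i i' by simp
      also have "\<dots> \<le> (\<integral>\<omega>. norm (indicator B \<omega> * V \<omega> - indicator B \<omega> * clip c (V \<omega>)) \<partial>M)"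
        by (rule integral_norm_bound)
      also have "\<dots> \<le> (\<integral>\<omega>. \<bar>V \<omega> - clip c (V \<omega>)\<bar> \<partial>M)"
        using i i' V(2) by (intro integral_mono integrable_norm Bochner_Integration.integrable_diff) (auto simp: indicator_def)
      finally show ?thesis using le by simp
    qed
    show "\<exists>k0. \<forall>k\<ge>k0. norm ((\<integral>\<omega>. indicator B \<omega> * X k \<omega> \<partial>M) - (\<integral>\<omega>. indicator B \<omega> * Y \<omega> \<partial>M)) < e"
    proof (intro exI allI impI)
      fix k assume "k \<ge> k0"
      from k0[OF this] split[OF X[of k] iXc[of k] c(2)[of k]] split[OF iY iYc Yc]
      show "norm ((\<integral>\<omega>. indicator B \<omega> * X k \<omega> \<partial>M) - (\<integral>\<omega>. indicator B \<omega> * Y \<omega> \<partial>M)) < e"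
        unfolding real_norm_def by linarith
    qed
  qed
qed

text \<open>The state of a trading position just after index \<open>i\<close>: opened at a value at
  most \<open>\<alpha>\<close>, held until a value reaches \<open>\<beta>\<close>. The counter
  \<open>upcount\<close> records the completed sales.\<close>

primrec upst :: "(nat \<Rightarrow> real) \<Rightarrow> real \<Rightarrow> real \<Rightarrow> nat \<Rightarrow> bool" where
  "upst x \<alpha> \<beta> 0 \<longleftrightarrow> x 0 \<le> \<alpha>"
| "upst x \<alpha> \<beta> (Suc i) \<longleftrightarrow> (if upst x \<alpha> \<beta> i then x (Suc i) < \<beta> else x (Suc i) \<le> \<alpha>)"

primrec upcount :: "(nat \<Rightarrow> real) \<Rightarrow> real \<Rightarrow> real \<Rightarrow> nat \<Rightarrow> nat" where
  "upcount x \<alpha> \<beta> 0 = 0"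
| "upcount x \<alpha> \<beta> (Suc i) = upcount x \<alpha> \<beta> i + (if upst x \<alpha> \<beta> i \<and> \<beta> \<le> x (Suc i) then 1 else 0)"

text \<open>Buying at level \<open>\<alpha>\<close> and selling at level \<open>\<beta>\<close>, with the position valued at \<open>max 0 (x - \<alpha>)\<close>:
  each completed upcrossing gains at least \<open>\<beta> - \<alpha>\<close>, and an open position has not lost anything.\<close>

lemma upcount_gain:
  assumes "\<alpha> < \<beta>"
  shows "(\<beta> - \<alpha>) * upcount x \<alpha> \<beta> m + (if upst x \<alpha> \<beta> m then max 0 (x m - \<alpha>) else 0)
    \<le> (\<Sum>i<m. if upst x \<alpha> \<beta> i then max 0 (x (Suc i) - \<alpha>) - max 0 (x i - \<alpha>) else 0)"
proof (induction m)
  case (Suc m)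
  then show ?case using assms by (cases "upst x \<alpha> \<beta> m") (auto simp: distrib_left)
qed auto

text \<open>Counting for a time set without successors, such as the dyadic numbers: \<open>k\<close>
  disjoint upcrossings strictly before \<open>u\<close>, described by peeling off the latest
  one.\<close>

primrec up_chain :: "(real \<Rightarrow> real) \<Rightarrow> real \<Rightarrow> real \<Rightarrow> real set \<Rightarrow> nat \<Rightarrow> real \<Rightarrow> bool" where
  "up_chain x \<alpha> \<beta> S 0 u \<longleftrightarrow> True"
| "up_chain x \<alpha> \<beta> S (Suc k) u \<longleftrightarrow>
    (\<exists>q r. q \<in> S \<and> r \<in> S \<and> q < r \<and> r < u \<and> x q \<le> \<alpha> \<and> \<beta> \<le> x r \<and> up_chain x \<alpha> \<beta> S k q)"

lemma up_chain_mono: "up_chain x \<alpha> \<beta> S k u \<Longrightarrow> u \<le> v \<Longrightarrow> up_chain x \<alpha> \<beta> S k v"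
  by (cases k) (auto, meson order_less_le_trans)

text \<open>The greedy counter misses none of the crossings in a chain: a position is open at the
  low point of a crossing and has been sold by its high point, so each crossing contains at least
  one counted sale.\<close>

lemma up_chain_le_upcount:
  assumes "\<alpha> < \<beta>" "strict_mono \<tau>" "up_chain x \<alpha> \<beta> (range \<tau>) k u" "\<And>i. \<tau> i < u \<Longrightarrow> i \<le> j"
  shows "k \<le> upcount (\<lambda>i. x (\<tau> i)) \<alpha> \<beta> j"
  using assms(3,4)
proof (induction k arbitrary: u j)
  case (Suc k)
  let ?U = "upcount (\<lambda>i. x (\<tau> i)) \<alpha> \<beta>" and ?S = "upst (\<lambda>i. x (\<tau> i)) \<alpha> \<beta>"
  have mono: "?U i \<le> ?U j" if "i \<le> j" for i j
    using that by (rule lift_Suc_mono_le[rotated]) auto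
  from Suc.prems obtain i j' where ij: "\<tau> i < \<tau> j'" "\<tau> j' < u" "x (\<tau> i) \<le> \<alpha>" "\<beta> \<le> x (\<tau> j')"
    "up_chain x \<alpha> \<beta> (range \<tau>) k (\<tau> i)" by auto
  have lt: "i < j'" using ij(1) assms(2) by (simp add: strict_mono_less)
  have k: "k \<le> ?U i" by (rule Suc.IH[OF ij(5)]) (use assms(2) in \<open>auto simp: strict_mono_less\<close>)
  \<comment> \<open>After a value at most \<open>\<alpha>\<close> a position is always open: it is
    either bought there or, since \<open>\<alpha> < \<beta>\<close>, not sold there.\<close>
  have "?S i" using ij(3) assms(1) by (cases i) auto
  have "?S j' \<or> Suc (?U i) \<le> ?U j'" if "i \<le> j'" for j'
    using that
  proof (induction rule: dec_induct)
    case base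
    then show ?case using \<open>?S i\<close> by simp
  next
    case (step n)
    then show ?case using mono[of i n] by auto
  qed
  moreover obtain n where n: "j' = Suc n" "i \<le> n" using lt by (cases j') auto
  ultimately have "Suc (?U i) \<le> ?U j'" using ij(4) mono[of i n] by fastforce
  also have "\<dots> \<le> ?U j" using Suc.prems(2)[OF ij(2)] by (rule mono)
  finally show ?case using k by simp
qed auto

text \<open>A chain involves finitely many points, which all lie in one member of the increasing
  family and hence in every later one.\<close>

lemma up_chain_UN:
  assumes "\<And>m. D m \<subseteq> D (Suc m)" "up_chain x \<alpha> \<beta> (\<Union>m. D m) k u"
  shows "\<exists>m0. \<forall>m\<ge>m0. up_chain x \<alpha> \<beta> (D m) k u"
  using assms(2)
proof (induction k arbitrary: u)
  case (Suc k)
  then obtain q r m1 m2 where *: "q \<in> D m1" "r \<in> D m2" "q < r" "r < u" "x q \<le> \<alpha>" "\<beta> \<le> x r"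
    "up_chain x \<alpha> \<beta> (\<Union>m. D m) k q" by auto
  obtain m0 where m0: "\<And>m. m \<ge> m0 \<Longrightarrow> up_chain x \<alpha> \<beta> (D m) k q" using Suc.IH[OF *(7)] by auto
  have sub: "D m \<subseteq> D n" if "m \<le> n" for m n using assms(1) that by (rule lift_Suc_mono_le)
  show ?case
  proof (intro exI[of _ "max m0 (max m1 m2)"] allI impI)
    fix m assume "max m0 (max m1 m2) \<le> m"
    then show "up_chain x \<alpha> \<beta> (D m) (Suc k) u"
      using * m0[of m] sub[of m1 m] sub[of m2 m] by auto
  qed
qed auto

text \<open>The limit is the supremum \<open>s\<close> of the eventual lower bounds. Above
  \<open>s\<close>, two rationals \<open>\<alpha> < \<beta> < y\<close> are inserted:
  \<open>\<alpha>\<close> is no eventual lower bound, so by hypothesis \<open>\<beta>\<close> is an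
  eventual strict upper bound.\<close>

lemma tendsto_of_no_oscillation:
  fixes x :: "real \<Rightarrow> real"
  assumes G: "G \<noteq> bot" and b: "eventually (\<lambda>q. \<bar>x q\<bar> \<le> b) G"
    and no: "\<And>\<alpha> \<beta>. \<alpha> \<in> \<rat> \<Longrightarrow> \<beta> \<in> \<rat> \<Longrightarrow> \<alpha> < \<beta> \<Longrightarrow>
      eventually (\<lambda>q. \<alpha> < x q) G \<or> eventually (\<lambda>q. x q < \<beta>) G"
  shows "\<exists>l. (x \<longlongrightarrow> l) G"
proof -
  define s where "s = Sup {\<alpha>. eventually (\<lambda>q. \<alpha> < x q) G}"
  have bdd: "bdd_above {\<alpha>. eventually (\<lambda>q. \<alpha> < x q) G}"
  proof (rule bdd_aboveI)
    fix \<alpha> assume "\<alpha> \<in> {\<alpha>. eventually (\<lambda>q. \<alpha> < x q) G}"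
    then have "eventually (\<lambda>q. \<alpha> < b) G" using b by (auto elim: eventually_elim2)
    then show "\<alpha> \<le> b" using G by (auto simp: eventually_const_iff)
  qed
  have ne: "{\<alpha>. eventually (\<lambda>q. \<alpha> < x q) G} \<noteq> {}"
    using b by (auto intro!: exI[of _ "- b - 1"] elim: eventually_mono)
  have "(x \<longlongrightarrow> s) G"
  proof (rule order_tendstoI)
    fix y assume "y < s"
    then obtain \<alpha> where "y < \<alpha>" "eventually (\<lambda>q. \<alpha> < x q) G"
      unfolding s_def using less_cSup_iff[OF ne bdd] by auto
    then show "eventually (\<lambda>q. y < x q) G" by (auto elim: eventually_mono)
  next
    fix y assume y: "s < y"
    obtain \<alpha> where \<alpha>: "\<alpha> \<in> \<rat>" "s < \<alpha>" "\<alpha> < y" using Rats_dense_in_real[OF y] by auto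
    obtain \<beta> where \<beta>: "\<beta> \<in> \<rat>" "\<alpha> < \<beta>" "\<beta> < y" using Rats_dense_in_real[OF \<alpha>(3)] by auto
    have "\<not> eventually (\<lambda>q. \<alpha> < x q) G"
      using cSup_upper[OF _ bdd, of \<alpha>] \<alpha>(2) unfolding s_def by auto
    then have "eventually (\<lambda>q. x q < \<beta>) G" using no[OF \<alpha>(1) \<beta>(1,2)] by auto
    then show "eventually (\<lambda>q. x q < y) G" using \<beta>(3) by (auto elim: eventually_mono)
  qed
  then show ?thesis by blast
qed

text \<open>Oscillation on the right of \<open>t\<close> supplies a high point close to
  \<open>t\<close> and then a low point still closer. This extends a chain at its earlier end, which
  is exactly how \<open>up_chain\<close> recurses.\<close>

lemma right_limit_of_no_up_chain:
  fixes x :: "real \<Rightarrow> real"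
  assumes ne: "at t within (S \<inter> {t<..}) \<noteq> bot" and t: "t < c"
    and b: "\<And>q. q \<in> S \<Longrightarrow> q < c \<Longrightarrow> \<bar>x q\<bar> \<le> b"
    and no: "\<And>\<alpha> \<beta>. \<alpha> \<in> \<rat> \<Longrightarrow> \<beta> \<in> \<rat> \<Longrightarrow> \<alpha> < \<beta> \<Longrightarrow> \<exists>k. \<not> up_chain x \<alpha> \<beta> S k c"
  shows "\<exists>l. (x \<longlongrightarrow> l) (at t within (S \<inter> {t<..}))"
proof (rule tendsto_of_no_oscillation[OF ne])
  show "\<forall>\<^sub>F q in at t within S \<inter> {t<..}. \<bar>x q\<bar> \<le> b"
    unfolding eventually_at using t b by (intro exI[of _ "c - t"]) (auto simp: dist_real_def)
  fix \<alpha> \<beta> :: real assume ab: "\<alpha> \<in> \<rat>" "\<beta> \<in> \<rat>" "\<alpha> < \<beta>"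
  show "(\<forall>\<^sub>F q in at t within S \<inter> {t<..}. \<alpha> < x q) \<or> (\<forall>\<^sub>F q in at t within S \<inter> {t<..}. x q < \<beta>)"
  proof (rule ccontr)
    assume "\<not> ?thesis"
    then have n: "\<not> (\<forall>\<^sub>F q in at t within S \<inter> {t<..}. \<alpha> < x q)" "\<not> (\<forall>\<^sub>F q in at t within S \<inter> {t<..}. x q < \<beta>)" by auto
    have lo: "\<exists>q\<in>S. t < q \<and> q < u \<and> x q \<le> \<alpha>" if "t < u" for u
      using n(1) that unfolding eventually_at by (fastforce simp: dist_real_def dest!: spec[of _ "u - t"])
    have hi: "\<exists>q\<in>S. t < q \<and> q < u \<and> \<beta> \<le> x q" if "t < u" for u
      using n(2) that unfolding eventually_at by (fastforce simp: dist_real_def dest!: spec[of _ "u - t"])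
    have "up_chain x \<alpha> \<beta> S k u" if "t < u" for k u
      using that
    proof (induction k arbitrary: u)
      case (Suc k)
      obtain r where r: "r \<in> S" "t < r" "r < u" "\<beta> \<le> x r" using hi Suc.prems by blast
      obtain q where q: "q \<in> S" "t < q" "q < r" "x q \<le> \<alpha>" using lo r by blast
      show ?case using r q Suc.IH[of q] by auto
    qed auto
    then show False using no[OF ab] t by auto
  qed
qed

text \<open>On the left of \<open>t\<close> the new crossing is found after the existing chain, so
  the induction carries along an endpoint \<open>u < t\<close>.\<close>

lemma left_limit_of_no_up_chain:
  fixes x :: "real \<Rightarrow> real"
  assumes ne: "at t within (S \<inter> {..<t}) \<noteq> bot" and t: "t \<le> c"
    and b: "\<And>q. q \<in> S \<Longrightarrow> q < c \<Longrightarrow> \<bar>x q\<bar> \<le> b"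
    and no: "\<And>\<alpha> \<beta>. \<alpha> \<in> \<rat> \<Longrightarrow> \<beta> \<in> \<rat> \<Longrightarrow> \<alpha> < \<beta> \<Longrightarrow> \<exists>k. \<not> up_chain x \<alpha> \<beta> S k c"
  shows "\<exists>l. (x \<longlongrightarrow> l) (at t within (S \<inter> {..<t}))"
proof (rule tendsto_of_no_oscillation[OF ne])
  show "\<forall>\<^sub>F q in at t within S \<inter> {..<t}. \<bar>x q\<bar> \<le> b"
    unfolding eventually_at using t b by (intro exI[of _ 1]) (auto simp: dist_real_def)
  fix \<alpha> \<beta> :: real assume ab: "\<alpha> \<in> \<rat>" "\<beta> \<in> \<rat>" "\<alpha> < \<beta>"
  show "(\<forall>\<^sub>F q in at t within S \<inter> {..<t}. \<alpha> < x q) \<or> (\<forall>\<^sub>F q in at t within S \<inter> {..<t}. x q < \<beta>)"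
  proof (rule ccontr)
    assume "\<not> ?thesis"
    then have n: "\<not> (\<forall>\<^sub>F q in at t within S \<inter> {..<t}. \<alpha> < x q)" "\<not> (\<forall>\<^sub>F q in at t within S \<inter> {..<t}. x q < \<beta>)" by auto
    have lo: "\<exists>q\<in>S. u < q \<and> q < t \<and> x q \<le> \<alpha>" if "u < t" for u
      using n(1) that unfolding eventually_at by (fastforce simp: dist_real_def dest!: spec[of _ "t - u"])
    have hi: "\<exists>q\<in>S. u < q \<and> q < t \<and> \<beta> \<le> x q" if "u < t" for u
      using n(2) that unfolding eventually_at by (fastforce simp: dist_real_def dest!: spec[of _ "t - u"])
    have "\<exists>u<t. up_chain x \<alpha> \<beta> S k u" for k
    proof (induction k)
      case 0
      show ?case by (auto intro!: exI[of _ "t - 1"])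
    next
      case (Suc k)
      then obtain u where u: "u < t" "up_chain x \<alpha> \<beta> S k u" by auto
      obtain q where q: "q \<in> S" "u < q" "q < t" "x q \<le> \<alpha>" using lo u by blast
      obtain r where r: "r \<in> S" "q < r" "r < t" "\<beta> \<le> x r" using hi q by blast
      obtain u' where "r < u'" "u' < t" using dense r by blast
      then show ?case using q r up_chain_mono[OF u(2), of q] by auto
    qed
    then show False using no[OF ab] t up_chain_mono by (metis less_le_trans less_imp_le)
  qed
qed

lemma within_bound_extends:
  fixes z R :: "real \<Rightarrow> real"
  assumes "at s within (S \<inter> {s<..}) \<noteq> bot" "(z \<longlongrightarrow> R s) (at s within (S \<inter> {s<..}))"
    "\<And>q. q \<in> S \<Longrightarrow> s < q \<Longrightarrow> q < v \<Longrightarrow> \<bar>z q - l\<bar> \<le> e" "s < v"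
  shows "\<bar>R s - l\<bar> \<le> e"
proof (rule tendsto_upperbound[OF _ _ assms(1)])
  show "((\<lambda>q. \<bar>z q - l\<bar>) \<longlongrightarrow> \<bar>R s - l\<bar>) (at s within S \<inter> {s<..})" by (intro tendsto_intros assms)
  show "\<forall>\<^sub>F q in at s within S \<inter> {s<..}. \<bar>z q - l\<bar> \<le> e"
    unfolding eventually_at using assms(3,4) by (intro exI[of _ "v - s"]) (auto simp: dist_real_def)
qed

text \<open>\<open>R\<close> consists of right limits of \<open>z\<close> along \<open>S\<close>. If
  \<open>z\<close> is close to \<open>l\<close> just after \<open>t\<close>, so is \<open>R\<close>,
  because \<open>R s\<close> is approached by values of \<open>z\<close> at times slightly later
  than \<open>s\<close>. The left version below uses the same remark.\<close>

lemma right_tendsto_of_dense_right_limits: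
  fixes z R :: "real \<Rightarrow> real"
  assumes ne: "\<And>s. t < s \<Longrightarrow> s < c \<Longrightarrow> at s within (S \<inter> {s<..}) \<noteq> bot"
    and R: "\<And>s. t < s \<Longrightarrow> s < c \<Longrightarrow> (z \<longlongrightarrow> R s) (at s within (S \<inter> {s<..}))"
    and l: "(z \<longlongrightarrow> l) (at t within (S \<inter> {t<..}))" and t: "t < c"
  shows "(R \<longlongrightarrow> l) (at_right t)"
proof (rule tendstoI)
  fix e :: real assume "e > 0"
  then obtain d where d: "d > 0" "\<And>q. q \<in> S \<Longrightarrow> t < q \<Longrightarrow> q < t + d \<Longrightarrow> \<bar>z q - l\<bar> < e / 2"
    using tendstoD[OF l, of "e/2"] unfolding eventually_at by (auto simp: dist_real_def)
  show "eventually (\<lambda>s. dist (R s) l < e) (at_right t)"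
    unfolding eventually_at
  proof (intro exI[of _ "min d (c - t)"] conjI ballI impI)
    fix s assume s: "s \<in> {t<..}" "s \<noteq> t \<and> dist s t < min d (c - t)"
    then have "\<bar>R s - l\<bar> \<le> e / 2"
      using d(2) by (intro within_bound_extends[OF ne R, where v="t + d"]) (auto simp: dist_real_def intro: less_imp_le)
    then show "dist (R s) l < e" using \<open>e > 0\<close> by (simp add: dist_real_def)
  qed (use d t in auto)
qed

lemma left_tendsto_of_dense_right_limits:
  fixes z R :: "real \<Rightarrow> real"
  assumes ne: "\<And>s. c < s \<Longrightarrow> s < t \<Longrightarrow> at s within (S \<inter> {s<..}) \<noteq> bot"
    and R: "\<And>s. c < s \<Longrightarrow> s < t \<Longrightarrow> (z \<longlongrightarrow> R s) (at s within (S \<inter> {s<..}))"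
    and l: "(z \<longlongrightarrow> l) (at t within (S \<inter> {..<t}))" and t: "c < t"
  shows "(R \<longlongrightarrow> l) (at_left t)"
proof (rule tendstoI)
  fix e :: real assume "e > 0"
  then obtain d where d: "d > 0" "\<And>q. q \<in> S \<Longrightarrow> q < t \<Longrightarrow> t - d < q \<Longrightarrow> \<bar>z q - l\<bar> < e / 2"
    using tendstoD[OF l, of "e/2"] unfolding eventually_at by (auto simp: dist_real_def)
  show "eventually (\<lambda>s. dist (R s) l < e) (at_left t)"
    unfolding eventually_at
  proof (intro exI[of _ "min d (t - c)"] conjI ballI impI)
    fix s assume s: "s \<in> {..<t}" "s \<noteq> t \<and> dist s t < min d (t - c)"
    then have "\<bar>R s - l\<bar> \<le> e / 2"
      using d(2) by (intro within_bound_extends[OF ne R, where v=t]) (auto simp: dist_real_def intro: less_imp_le)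
    then show "dist (R s) l < e" using \<open>e > 0\<close> by (simp add: dist_real_def)
  qed (use d t in auto)
qed

section \<open>Regularity of martingales\<close>

locale filtered_prob_space = prob_space M for M :: "'a measure" +
  fixes F :: "real \<Rightarrow> 'a measure" and T :: real
  assumes filtration: "is_filtration M F" and complete: "complete_filtration M F"
    and right_continuous: "right_continuous_filtration F" and T_pos: "0 < T"
begin

section \<open>Filtration and negligible events\<close>

lemma subalgebra_F: "0 \<le> t \<Longrightarrow> subalgebra M (F t)"
  using filtration by (auto simp: is_filtration_def)

lemma space_F[simp]: "0 \<le> t \<Longrightarrow> space (F t) = space M"
  using subalgebra_F by (auto simp: subalgebra_def)

lemma sets_F_mono: "0 \<le> s \<Longrightarrow> s \<le> t \<Longrightarrow> sets (F s) \<subseteq> sets (F t)"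
  using filtration by (auto simp: is_filtration_def subalgebra_def)

lemma sets_F_M: "0 \<le> t \<Longrightarrow> sets (F t) \<subseteq> sets M"
  using subalgebra_F by (auto simp: subalgebra_def)

lemma measurable_F_mono: "f \<in> borel_measurable (F s) \<Longrightarrow> 0 \<le> s \<Longrightarrow> s \<le> t \<Longrightarrow> f \<in> borel_measurable (F t)"
  using measurable_from_subalg[of "F t" "F s" f borel] filtration by (auto simp: is_filtration_def)

lemma measurable_F_M: "f \<in> borel_measurable (F s) \<Longrightarrow> 0 \<le> s \<Longrightarrow> f \<in> borel_measurable M"
  using measurable_from_subalg[OF subalgebra_F] by auto

lemma null_sets_F: "N \<in> null_sets M \<Longrightarrow> 0 \<le> t \<Longrightarrow> N \<in> sets (F t)"
  using complete sets_F_mono[of 0 t] by (auto simp: complete_filtration_def)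

text \<open>Completeness places null sets in \<open>F 0\<close>. A process can therefore be changed
  off the good set \<open>G\<close> without losing adaptedness, which turns almost sure path
  properties into properties of every path.\<close>

lemma AE_good_set:
  assumes "AE \<omega> in M. P \<omega>"
  obtains G where "\<And>t. 0 \<le> t \<Longrightarrow> G \<in> sets (F t)" "AE \<omega> in M. \<omega> \<in> G" "\<And>\<omega>. \<omega> \<in> G \<Longrightarrow> P \<omega>" "G \<subseteq> space M"
proof -
  obtain N where N: "{\<omega> \<in> space M. \<not> P \<omega>} \<subseteq> N" "N \<in> null_sets M" using AE_E[OF assms] by (metis null_setsI)
  show ?thesis
  proof
    show "space M - N \<in> sets (F t)" if "0 \<le> t" for t
      using null_sets_F[OF N(2) that] sets.compl_sets[of N "F t"] that by simp
    show "AE \<omega> in M. \<omega> \<in> space M - N" using AE_not_in[OF N(2)] by auto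
  qed (use N in auto)
qed

lemma measurable_F_right:
  fixes f :: "'a \<Rightarrow> real"
  assumes "0 \<le> t" "\<And>u. t < u \<Longrightarrow> f \<in> borel_measurable (F u)"
  shows "f \<in> borel_measurable (F t)"
proof (rule measurableI)
  fix A :: "real set" assume A: "A \<in> sets borel"
  have "f -` A \<inter> space M \<in> sets (F u)" if "t < u" for u
    using measurable_sets[OF assms(2)[OF that] A] assms(1) that by simp
  then have "f -` A \<inter> space M \<in> (\<Inter>u\<in>{t<..}. sets (F u))" by auto
  then show "f -` A \<inter> space (F t) \<in> sets (F t)"
    using right_continuous assms(1) by (auto simp: right_continuous_filtration_def)
qed auto

lemma cond_subalgebra: "0 \<le> t \<Longrightarrow> sigma_finite_subalgebra M (F t)"
  by (intro finite_measure_subalgebra_is_sigma_finite finite_measure_subalgebra.intro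
      finite_measure_axioms finite_measure_subalgebra_axioms.intro subalgebra_F)

abbreviation "mart \<equiv> martingale_before M F T"

text \<open>The conditional inequality is tested on events of the past. In this form it integrates
  and telescopes directly, and no exceptional sets appear.\<close>

definition "submart X \<longleftrightarrow> adapted_before F T X \<and> (\<forall>t\<in>{0..<T}. integrable M (X t)) \<and>
  (\<forall>s t B. 0 \<le> s \<and> s \<le> t \<and> t < T \<and> B \<in> sets (F s) \<longrightarrow>
     (\<integral>\<omega>. indicator B \<omega> * X s \<omega> \<partial>M) \<le> (\<integral>\<omega>. indicator B \<omega> * X t \<omega> \<partial>M))"

lemma integrable_indicator_mult:
  fixes f :: "'a \<Rightarrow> real"
  assumes "integrable M f" "B \<in> sets M"
  shows "integrable M (\<lambda>\<omega>. indicator B \<omega> * f \<omega>)"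
  using integrable_mult_indicator[OF assms(2,1)] by simp

lemma mart_indicator_integral:
  assumes X: "mart X" and st: "0 \<le> s" "s \<le> t" "t < T" and B: "B \<in> sets (F s)"
  shows "(\<integral>\<omega>. indicator B \<omega> * X s \<omega> \<partial>M) = (\<integral>\<omega>. indicator B \<omega> * X t \<omega> \<partial>M)"
proof -
  interpret sigma_finite_subalgebra M "F s" using st by (intro cond_subalgebra)
  have i: "integrable M (X t)" "integrable M (X s)" and ae: "AE \<omega> in M. real_cond_exp M (F s) (X t) \<omega> = X s \<omega>"
    using X st by (auto simp: martingale_before_def)
  have BM: "B \<in> sets M" using B sets_F_M st by auto
  have "(\<integral>\<omega>. indicator B \<omega> * X t \<omega> \<partial>M) = (\<integral>\<omega>. indicator B \<omega> * real_cond_exp M (F s) (X t) \<omega> \<partial>M)"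
    using real_cond_exp_intA[OF i(1) B] by (simp add: set_lebesgue_integral_def)
  also have "\<dots> = (\<integral>\<omega>. indicator B \<omega> * X s \<omega> \<partial>M)"
    using ae BM i by (intro integral_cong_AE) (auto elim: eventually_mono)
  finally show ?thesis by simp
qed

lemma mart_expectation:
  assumes "mart N" "0 \<le> s" "s \<le> t" "t < T"
  shows "(\<integral>\<omega>. N s \<omega> \<partial>M) = (\<integral>\<omega>. N t \<omega> \<partial>M)"
proof -
  have "space M \<in> sets (F s)" using sets.top[of "F s"] assms by simp
  from mart_indicator_integral[OF assms this] show ?thesis by (simp cong: Bochner_Integration.integral_cong)
qed

lemma martI:
  assumes ad: "adapted_before F T X" and i: "\<And>t. 0 \<le> t \<Longrightarrow> t < T \<Longrightarrow> integrable M (X t)"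
    and eq: "\<And>s t B. 0 \<le> s \<Longrightarrow> s \<le> t \<Longrightarrow> t < T \<Longrightarrow> B \<in> sets (F s) \<Longrightarrow>
      (\<integral>\<omega>. indicator B \<omega> * X s \<omega> \<partial>M) = (\<integral>\<omega>. indicator B \<omega> * X t \<omega> \<partial>M)"
  shows "mart X"
  unfolding martingale_before_def
proof (intro conjI allI impI ballI)
  fix s t assume st: "0 \<le> s \<and> s \<le> t \<and> t < T"
  interpret sigma_finite_subalgebra M "F s" using st by (intro cond_subalgebra) auto
  show "AE \<omega> in M. real_cond_exp M (F s) (X t) \<omega> = X s \<omega>"
  proof (rule real_cond_exp_charact)
    show "X s \<in> borel_measurable (F s)" using ad st by (auto simp: adapted_before_def)
  qed (use st i eq in \<open>auto simp: set_lebesgue_integral_def\<close>)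
qed (use ad i in auto)

lemma mart_imp_submart: "mart X \<Longrightarrow> submart X"
  using mart_indicator_integral by (auto simp: submart_def martingale_before_def)

lemma adapted_uminus: "adapted_before F T X \<Longrightarrow> adapted_before F T (\<lambda>t \<omega>. - X t \<omega>)"
  by (auto simp: adapted_before_def)

lemma mart_uminus: assumes "mart X" shows "mart (\<lambda>t \<omega>. - X t \<omega>)"
proof (rule martI)
  show "adapted_before F T (\<lambda>t \<omega>. - X t \<omega>)" using assms by (auto simp: martingale_before_def intro: adapted_uminus)
  show "integrable M (\<lambda>\<omega>. - X t \<omega>)" if "0 \<le> t" "t < T" for t using assms that by (auto simp: martingale_before_def)
qed (use mart_indicator_integral[OF assms] in auto)

lemma mart_diff:
  assumes "mart X" "mart Y" shows "mart (\<lambda>t \<omega>. X t \<omega> - Y t \<omega>)"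
proof (rule martI)
  show "adapted_before F T (\<lambda>t \<omega>. X t \<omega> - Y t \<omega>)"
    using assms by (auto simp: martingale_before_def adapted_before_def intro!: borel_measurable_diff)
  show i: "integrable M (\<lambda>\<omega>. X t \<omega> - Y t \<omega>)" if "0 \<le> t" "t < T" for t
    using assms that by (auto simp: martingale_before_def)
  fix s t B assume *: "0 \<le> s" "s \<le> t" "t < T" "B \<in> sets (F s)"
  have BM: "B \<in> sets M" using * sets_F_M by auto
  have ii: "integrable M (\<lambda>\<omega>. indicator B \<omega> * V u \<omega>)" if "V \<in> {X, Y}" "u \<in> {s,t}" for V u
    using assms * BM that by (intro integrable_indicator_mult) (auto simp: martingale_before_def)
  show "(\<integral>\<omega>. indicator B \<omega> * (X s \<omega> - Y s \<omega>) \<partial>M) = (\<integral>\<omega>. indicator B \<omega> * (X t \<omega> - Y t \<omega>) \<partial>M)"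
    using ii mart_indicator_integral[OF assms(1) *] mart_indicator_integral[OF assms(2) *]
    by (simp add: right_diff_distrib)
qed

lemma adaptedD: "adapted_before F T X \<Longrightarrow> 0 \<le> t \<Longrightarrow> t < T \<Longrightarrow> X t \<in> borel_measurable (F t)"
  by (auto simp: adapted_before_def)

text \<open>The event \<open>C\<close> on which \<open>X s\<close> exceeds \<open>\<alpha>\<close>
  is known at time \<open>s\<close>. On it the submartingale inequality applies to
  \<open>X - \<alpha>\<close>, which lies below its positive part at time \<open>t\<close>;
  elsewhere the positive part at \<open>s\<close> vanishes.\<close>

lemma submart_pos_part:
  assumes X: "submart X" shows "submart (\<lambda>t \<omega>. max 0 (X t \<omega> - \<alpha>))"
  unfolding submart_def
proof (intro conjI allI impI ballI)
  have Xm: "X t \<in> borel_measurable (F t)" if "0 \<le> t" "t < T" for t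
    using X that by (auto simp: submart_def intro: adaptedD)
  show "adapted_before F T (\<lambda>t \<omega>. max 0 (X t \<omega> - \<alpha>))"
    using X by (auto simp: submart_def adapted_before_def)
  have i: "integrable M (\<lambda>\<omega>. max 0 (X t \<omega> - \<alpha>))" "integrable M (X t)" if "0 \<le> t" "t < T" for t
    using X that by (auto simp: submart_def intro!: Bochner_Integration.integrable_max)
  then show "integrable M (\<lambda>\<omega>. max 0 (X t \<omega> - \<alpha>))" if "t \<in> {0..<T}" for t using that by auto
  fix s t B assume *: "0 \<le> s \<and> s \<le> t \<and> t < T \<and> B \<in> sets (F s)"
  define C where "C = B \<inter> {\<omega> \<in> space M. \<alpha> < X s \<omega>}"
  have [measurable]: "X s \<in> borel_measurable (F s)" using Xm * by auto
  have "{\<omega> \<in> space (F s). \<alpha> < X s \<omega>} \<in> sets (F s)" by measurable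
  then have C: "C \<in> sets (F s)" unfolding C_def using * by auto
  have CM: "C \<in> sets M" "B \<in> sets M" using C * sets_F_M by auto
  have B: "\<omega> \<in> B \<Longrightarrow> \<omega> \<in> space M" for \<omega> using sets.sets_into_space CM by auto
  have ic: "integrable M (\<lambda>\<omega>. indicator C \<omega> * X u \<omega>)" "integrable M (\<lambda>\<omega>. indicator C \<omega> * \<alpha>)" if "u \<in> {s,t}" for u
    using i(2)[of s] i(2)[of t] * that by (intro integrable_indicator_mult CM(1); auto)+
  have "(\<integral>\<omega>. indicator B \<omega> * max 0 (X s \<omega> - \<alpha>) \<partial>M) = (\<integral>\<omega>. indicator C \<omega> * X s \<omega> - indicator C \<omega> * \<alpha> \<partial>M)"
    using B by (intro Bochner_Integration.integral_cong) (auto simp: C_def indicator_def)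
  also have "\<dots> \<le> (\<integral>\<omega>. indicator C \<omega> * X t \<omega> - indicator C \<omega> * \<alpha> \<partial>M)"
    unfolding Bochner_Integration.integral_diff[OF ic(1)[of s] ic(2)[of s], OF insertI1 insertI1] Bochner_Integration.integral_diff[OF ic(1)[of t] ic(2)[of s], OF insertI2[OF insertI1] insertI1]
    using X C * by (simp add: submart_def)
  also have "\<dots> \<le> (\<integral>\<omega>. indicator B \<omega> * max 0 (X t \<omega> - \<alpha>) \<partial>M)"
    using ic i * CM by (intro integral_mono integrable_indicator_mult Bochner_Integration.integrable_diff)
      (auto simp: C_def indicator_def)
  finally show "(\<integral>\<omega>. indicator B \<omega> * max 0 (X s \<omega> - \<alpha>) \<partial>M) \<le> (\<integral>\<omega>. indicator B \<omega> * max 0 (X t \<omega> - \<alpha>) \<partial>M)" .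
qed

lemma submart_mono_integral:
  assumes "submart X" "0 \<le> s" "s \<le> t" "t < T"
  shows "(\<integral>\<omega>. X s \<omega> \<partial>M) \<le> (\<integral>\<omega>. X t \<omega> \<partial>M)"
proof -
  have "space M \<in> sets (F s)" using sets.top[of "F s"] assms by simp
  then have "(\<integral>\<omega>. indicator (space M) \<omega> * X s \<omega> \<partial>M) \<le> (\<integral>\<omega>. indicator (space M) \<omega> * X t \<omega> \<partial>M)"
    using assms unfolding submart_def by blast
  then show ?thesis by (simp cong: Bochner_Integration.integral_cong)
qed

lemma upst_measurable:
  assumes X: "submart X" and \<tau>: "mono \<tau>" "\<And>i. 0 \<le> \<tau> i" and m: "\<tau> m < T"
  shows "{\<omega> \<in> space M. upst (\<lambda>i. X (\<tau> i) \<omega>) \<alpha> \<beta> m} \<in> sets (F (\<tau> m))"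
  using m
proof (induction m)
  case 0
  have [measurable]: "X (\<tau> 0) \<in> borel_measurable (F (\<tau> 0))"
    using X \<tau> 0 by (auto simp: submart_def intro: adaptedD)
  have "{\<omega> \<in> space (F (\<tau> 0)). X (\<tau> 0) \<omega> \<le> \<alpha>} \<in> sets (F (\<tau> 0))" by measurable
  then show ?case using \<tau> by simp
next
  case (Suc m)
  let ?G = "F (\<tau> (Suc m))"
  have le: "\<tau> m \<le> \<tau> (Suc m)" using \<tau>(1) by (auto simp: mono_def)
  have [measurable]: "X (\<tau> (Suc m)) \<in> borel_measurable ?G"
    using X \<tau> Suc by (auto simp: submart_def intro: adaptedD)
  have S: "{\<omega> \<in> space ?G. upst (\<lambda>i. X (\<tau> i) \<omega>) \<alpha> \<beta> m} \<in> sets ?G"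
    using Suc le sets_F_mono[OF \<tau>(2) le] \<tau>(2) by auto
  have [measurable]: "Measurable.pred ?G (\<lambda>\<omega>. upst (\<lambda>i. X (\<tau> i) \<omega>) \<alpha> \<beta> m)"
    using S by (simp add: pred_def)
  have "{\<omega> \<in> space ?G. upst (\<lambda>i. X (\<tau> i) \<omega>) \<alpha> \<beta> (Suc m)} \<in> sets ?G"
    unfolding upst.simps by measurable
  then show ?case using \<tau>(2) by simp
qed

lemma upcount_measurable:
  assumes X: "submart X" and \<tau>: "mono \<tau>" "\<And>i. 0 \<le> \<tau> i" and m: "\<tau> m < T"
  shows "(\<lambda>\<omega>. real (upcount (\<lambda>i. X (\<tau> i) \<omega>) \<alpha> \<beta> m)) \<in> borel_measurable M"
  using m
proof (induction m)
  case (Suc m)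
  have le: "\<tau> m \<le> \<tau> (Suc m)" using \<tau>(1) by (auto simp: mono_def)
  have [measurable]: "X (\<tau> (Suc m)) \<in> borel_measurable M"
    using X \<tau> Suc by (auto simp: submart_def)
  have "{\<omega> \<in> space M. upst (\<lambda>i. X (\<tau> i) \<omega>) \<alpha> \<beta> m} \<in> sets M"
    using upst_measurable[OF X \<tau>, of m] Suc le sets_F_M[OF \<tau>(2)] by auto
  then have [measurable]: "Measurable.pred M (\<lambda>\<omega>. upst (\<lambda>i. X (\<tau> i) \<omega>) \<alpha> \<beta> m)"
    by (simp add: pred_def)
  have [measurable]: "(\<lambda>\<omega>. real (upcount (\<lambda>i. X (\<tau> i) \<omega>) \<alpha> \<beta> m)) \<in> borel_measurable M"
    using Suc le by auto
  have "(\<lambda>\<omega>. real (upcount (\<lambda>i. X (\<tau> i) \<omega>) \<alpha> \<beta> m) +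
      (if upst (\<lambda>i. X (\<tau> i) \<omega>) \<alpha> \<beta> m \<and> \<beta> \<le> X (\<tau> (Suc m)) \<omega> then 1 else 0)) \<in> borel_measurable M"
    by measurable
  then show ?case by (rule measurable_cong[THEN iffD1, rotated]) auto
qed auto

text \<open>Doob's inequality: the pathwise gain \<open>upcount_gain\<close> of the trading strategy
  is integrated, and its mean is at most the total rise in mean of
  \<open>max 0 (X - \<alpha>)\<close>, since abstaining from trade forgoes a nonnegative expected
  gain.\<close>

lemma upcrossing_inequality:
  assumes X: "submart X" and \<tau>: "mono \<tau>" "\<And>i. 0 \<le> \<tau> i" and m: "\<tau> m < T" and ab: "\<alpha> < \<beta>"
  shows "integrable M (\<lambda>\<omega>. real (upcount (\<lambda>i. X (\<tau> i) \<omega>) \<alpha> \<beta> m))"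
    "(\<beta> - \<alpha>) * (\<integral>\<omega>. real (upcount (\<lambda>i. X (\<tau> i) \<omega>) \<alpha> \<beta> m) \<partial>M) \<le> (\<integral>\<omega>. max 0 (X (\<tau> m) \<omega> - \<alpha>) \<partial>M)"
proof -
  let ?U = "\<lambda>\<omega>. real (upcount (\<lambda>i. X (\<tau> i) \<omega>) \<alpha> \<beta> m)"
  let ?S = "\<lambda>i. {\<omega> \<in> space M. upst (\<lambda>j. X (\<tau> j) \<omega>) \<alpha> \<beta> i}"
  define Y where "Y \<equiv> \<lambda>i \<omega>. max 0 (X (\<tau> i) \<omega> - \<alpha>)"
  have lt: "\<tau> i < T" if "i \<le> m" for i using monoD[OF \<tau>(1) that] m by simp
  have sub: "submart (\<lambda>t \<omega>. max 0 (X t \<omega> - \<alpha>))" by (rule submart_pos_part[OF X])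
  have iY: "integrable M (Y i)" if "i \<le> m" for i
    using sub lt[OF that] \<tau>(2) unfolding submart_def Y_def by auto
  have ub: "upcount x \<alpha> \<beta> n \<le> n" for x n by (induction n) auto
  show iU: "integrable M ?U"
    using ub by (intro integrable_const_bound[where B="real m"] upcount_measurable X \<tau> m) auto
  have SM: "?S i \<in> sets M" "?S i \<in> sets (F (\<tau> i))" if "i \<le> m" for i
    using upst_measurable[OF X \<tau> lt[OF that]] sets_F_M[OF \<tau>(2)] by auto
  let ?G = "\<lambda>i \<omega>. indicator (?S i) \<omega> * Y (Suc i) \<omega> - indicator (?S i) \<omega> * Y i \<omega>"
  have iG: "integrable M (\<lambda>\<omega>. indicator (?S i) \<omega> * Y j \<omega>)" if "i < m" "j \<le> m" for i j
    using iY that SM by (intro integrable_indicator_mult) auto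
  have iG': "integrable M (?G i)" if "i < m" for i
    by (intro Bochner_Integration.integrable_diff iG) (use that in auto)
  have "(\<beta> - \<alpha>) * (\<integral>\<omega>. ?U \<omega> \<partial>M) = (\<integral>\<omega>. (\<beta> - \<alpha>) * ?U \<omega> \<partial>M)" by simp
  also have "\<dots> \<le> (\<integral>\<omega>. (\<Sum>i<m. ?G i \<omega>) \<partial>M)"
  proof (rule integral_mono)
    fix \<omega> assume "\<omega> \<in> space M"
    then have "(\<Sum>i<m. ?G i \<omega>) = (\<Sum>i<m. if upst (\<lambda>j. X (\<tau> j) \<omega>) \<alpha> \<beta> i then Y (Suc i) \<omega> - Y i \<omega> else 0)"
      by (intro sum.cong) (auto simp: indicator_def)
    moreover have "0 \<le> (if upst (\<lambda>j. X (\<tau> j) \<omega>) \<alpha> \<beta> m then Y m \<omega> else 0)" by (simp add: Y_def)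
    moreover have "(\<beta> - \<alpha>) * ?U \<omega> + (if upst (\<lambda>j. X (\<tau> j) \<omega>) \<alpha> \<beta> m then Y m \<omega> else 0)
        \<le> (\<Sum>i<m. if upst (\<lambda>j. X (\<tau> j) \<omega>) \<alpha> \<beta> i then Y (Suc i) \<omega> - Y i \<omega> else 0)"
      unfolding Y_def by (rule upcount_gain[OF ab])
    ultimately show "(\<beta> - \<alpha>) * ?U \<omega> \<le> (\<Sum>i<m. ?G i \<omega>)" by linarith
  qed (use iU iG' in auto)
  also have "\<dots> = (\<Sum>i<m. (\<integral>\<omega>. ?G i \<omega> \<partial>M))" by (rule Bochner_Integration.integral_sum) (use iG' in auto)
  also have "\<dots> \<le> (\<Sum>i<m. (\<integral>\<omega>. Y (Suc i) \<omega> \<partial>M) - (\<integral>\<omega>. Y i \<omega> \<partial>M))"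
  proof (rule sum_mono)
    fix i assume "i \<in> {..<m}"
    then have i: "i < m" by simp
    \<comment> \<open>The event without an open position is also known at time
      \<open>\<tau> i\<close>, so the positive part of \<open>X - \<alpha>\<close> has a nonnegative
      mean increment there.\<close>
    let ?C = "space M - ?S i"
    have C: "?C \<in> sets (F (\<tau> i))" using sets.compl_sets[OF SM(2)[of i]] i \<tau>(2) by auto
    have CM: "?C \<in> sets M" using SM i by auto
    have le: "\<tau> i \<le> \<tau> (Suc i)" using \<tau>(1) by (auto simp: mono_def)
    have "(\<integral>\<omega>. indicator ?C \<omega> * Y i \<omega> \<partial>M) \<le> (\<integral>\<omega>. indicator ?C \<omega> * Y (Suc i) \<omega> \<partial>M)"
      using sub C le lt[of "Suc i"] i \<tau>(2) unfolding submart_def Y_def by auto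
    moreover have *: "(\<integral>\<omega>. Y j \<omega> \<partial>M) = (\<integral>\<omega>. indicator ?C \<omega> * Y j \<omega> \<partial>M) + (\<integral>\<omega>. indicator (?S i) \<omega> * Y j \<omega> \<partial>M)"
      if "j \<le> m" for j
    proof -
      have "(\<integral>\<omega>. Y j \<omega> \<partial>M) = (\<integral>\<omega>. indicator ?C \<omega> * Y j \<omega> + indicator (?S i) \<omega> * Y j \<omega> \<partial>M)"
        by (intro Bochner_Integration.integral_cong) (auto simp: indicator_def)
      also have "\<dots> = (\<integral>\<omega>. indicator ?C \<omega> * Y j \<omega> \<partial>M) + (\<integral>\<omega>. indicator (?S i) \<omega> * Y j \<omega> \<partial>M)"
        using iY[OF that] i CM SM by (intro Bochner_Integration.integral_add integrable_indicator_mult) auto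
      finally show ?thesis .
    qed
    moreover have "(\<integral>\<omega>. ?G i \<omega> \<partial>M) = (\<integral>\<omega>. indicator (?S i) \<omega> * Y (Suc i) \<omega> \<partial>M) - (\<integral>\<omega>. indicator (?S i) \<omega> * Y i \<omega> \<partial>M)"
      using i by (intro Bochner_Integration.integral_diff iG) auto
    ultimately show "(\<integral>\<omega>. ?G i \<omega> \<partial>M) \<le> (\<integral>\<omega>. Y (Suc i) \<omega> \<partial>M) - (\<integral>\<omega>. Y i \<omega> \<partial>M)"
      using *[of i] *[of "Suc i"] i by linarith
  qed
  also have "\<dots> = (\<integral>\<omega>. Y m \<omega> \<partial>M) - (\<integral>\<omega>. Y 0 \<omega> \<partial>M)" by (rule sum_lessThan_telescope[of "\<lambda>i. \<integral>\<omega>. Y i \<omega> \<partial>M"])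
  also have "\<dots> \<le> (\<integral>\<omega>. Y m \<omega> \<partial>M)" by (simp add: Y_def)
  finally show "(\<beta> - \<alpha>) * (\<integral>\<omega>. ?U \<omega> \<partial>M) \<le> (\<integral>\<omega>. max 0 (X (\<tau> m) \<omega> - \<alpha>) \<partial>M)" by (simp add: Y_def)
qed

section \<open>Dyadic times\<close>

definition grid :: "nat \<Rightarrow> nat \<Rightarrow> real" where "grid m i = T * real i / 2 ^ m"

definition dyadics :: "real set" where "dyadics = (\<Union>m. range (grid m))"

lemma strict_mono_grid: "strict_mono (grid m)"
  using T_pos by (auto simp: strict_mono_def grid_def divide_strict_right_mono)

lemma grid_refine: "range (grid m) \<subseteq> range (grid (Suc m))"
proof -
  have "grid m i = grid (Suc m) (2 * i)" for i by (simp add: grid_def)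
  then show ?thesis by auto
qed

lemma grid_nonneg: "0 \<le> grid m i" using T_pos by (simp add: grid_def)

lemma dyadics_nonneg: "q \<in> dyadics \<Longrightarrow> 0 \<le> q"
  by (auto simp: dyadics_def grid_nonneg)

lemma dyadics_dense:
  assumes "0 \<le> u" "u < v" obtains q where "q \<in> dyadics" "u < q" "q < v"
proof -
  obtain m :: nat where m: "T / (v - u) < 2 ^ m" using real_arch_pow[of 2 "T / (v - u)"] by auto
  define i where "i = nat \<lfloor>u * 2 ^ m / T\<rfloor> + 1"
  have nn: "0 \<le> u * 2 ^ m / T" using assms T_pos by auto
  have i: "u * 2 ^ m / T < real i" "real i \<le> u * 2 ^ m / T + 1"
    unfolding i_def using nn by (auto simp: of_nat_nat) linarith+
  have "u < grid m i" using i(1) T_pos by (simp add: grid_def field_simps)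
  moreover have "grid m i < v"
  proof -
    have "T * real i \<le> T * (u * 2 ^ m / T + 1)" using i(2) T_pos by (intro mult_left_mono) auto
    also have "\<dots> = u * 2 ^ m + T" using T_pos by (simp add: field_simps)
    also have "\<dots> < v * 2 ^ m" using m assms by (simp add: field_simps)
    finally show ?thesis by (simp add: grid_def field_simps)
  qed
  ultimately show ?thesis using that[of "grid m i"] by (auto simp: dyadics_def)
qed

lemma dyadics_right_ne:
  assumes "0 \<le> t"
  shows "at t within (dyadics \<inter> {t<..}) \<noteq> bot"
proof -
  have "t islimpt (dyadics \<inter> {t<..})"
    unfolding islimpt_approachable
  proof (intro allI impI)
    fix e :: real assume "0 < e"
    then obtain q where "q \<in> dyadics" "t < q" "q < t + e"
      using dyadics_dense[of "t" "t + e"] assms by auto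
    then show "\<exists>x'\<in>dyadics \<inter> {t<..}. x' \<noteq> t \<and> dist x' t < e"
      by (intro bexI[of _ q]) (auto simp: dist_real_def)
  qed
  then show ?thesis by (simp add: trivial_limit_within)
qed

lemma dyadics_left_ne:
  assumes "0 < t"
  shows "at t within (dyadics \<inter> {..<t}) \<noteq> bot"
proof -
  have "t islimpt (dyadics \<inter> {..<t})"
    unfolding islimpt_approachable
  proof (intro allI impI)
    fix e :: real assume "0 < e"
    then obtain q where "q \<in> dyadics" "max 0 (t - e) < q" "q < t"
      using dyadics_dense[of "max 0 (t - e)" "t"] assms by auto
    then show "\<exists>x'\<in>dyadics \<inter> {..<t}. x' \<noteq> t \<and> dist x' t < e"
      by (intro bexI[of _ q]) (auto simp: dist_real_def)
  qed
  then show ?thesis by (simp add: trivial_limit_within)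
qed

text \<open>By Fatou's lemma, the expected number of upcrossings along all dyadic times before \<open>c\<close>
  obeys the bound valid along each grid.\<close>

lemma upcrossing_counter:
  assumes X: "submart X" and c: "0 < c" "c \<le> T" and ab: "\<alpha> < \<beta>"
    and B: "\<And>t. 0 \<le> t \<Longrightarrow> t < c \<Longrightarrow> (\<integral>\<omega>. max 0 (X t \<omega> - \<alpha>) \<partial>M) \<le> B"
  shows "\<exists>V :: 'a \<Rightarrow> ennreal. V \<in> borel_measurable M \<and> (\<integral>\<^sup>+\<omega>. V \<omega> \<partial>M) \<le> ennreal (B / (\<beta> - \<alpha>)) \<and>
    (\<forall>k \<omega>. up_chain (\<lambda>t. X t \<omega>) \<alpha> \<beta> dyadics k c \<longrightarrow> of_nat k \<le> V \<omega>)"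
proof -
  \<comment> \<open>The last grid index strictly before \<open>c\<close>. Grid points continue past
    \<open>T\<close>, so it is a true maximum; ceiling minus one is used because \<open>c\<close>
    itself, which may be a grid point, is excluded.\<close>
  define l where "l \<equiv> \<lambda>m. nat (\<lceil>c * 2 ^ m / T\<rceil> - 1)"
  have less_iff: "grid m i < c \<longleftrightarrow> i \<le> l m" for m i
  proof -
    have "0 < c * 2 ^ m / T" using c T_pos by auto
    then have "0 < \<lceil>c * 2 ^ m / T\<rceil>" by linarith
    moreover have "grid m i < c \<longleftrightarrow> real i < c * 2 ^ m / T" using T_pos by (simp add: grid_def field_simps)
    moreover have "real i < c * 2 ^ m / T \<longleftrightarrow> int i < \<lceil>c * 2 ^ m / T\<rceil>" by (simp add: less_ceiling_iff)
    ultimately show ?thesis unfolding l_def by linarith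
  qed
  have lc: "grid m (l m) < c" for m using less_iff by auto
  have mg: "mono (grid m)" for m using strict_mono_grid by (simp add: strict_mono_mono)
  let ?U = "\<lambda>m \<omega>. upcount (\<lambda>i. X (grid m i) \<omega>) \<alpha> \<beta> (l m)"
  note up = upcrossing_inequality[OF X mg grid_nonneg less_le_trans[OF lc c(2)] ab]
  have [measurable]: "(\<lambda>\<omega>. real (?U m \<omega>)) \<in> borel_measurable M" for m using up(1)[of m] by auto
  show ?thesis
  proof (intro exI[of _ "\<lambda>\<omega>. liminf (\<lambda>m. ennreal (real (?U m \<omega>)))"] conjI allI impI)
    show "(\<lambda>\<omega>. liminf (\<lambda>m. ennreal (real (?U m \<omega>)))) \<in> borel_measurable M" by measurable
    have "(\<integral>\<^sup>+\<omega>. liminf (\<lambda>m. ennreal (real (?U m \<omega>))) \<partial>M) \<le> liminf (\<lambda>m. \<integral>\<^sup>+\<omega>. ennreal (real (?U m \<omega>)) \<partial>M)"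
      by (rule nn_integral_liminf) measurable
    also have "\<dots> \<le> ennreal (B / (\<beta> - \<alpha>))"
    proof (rule Liminf_le)
      show "\<forall>\<^sub>F m in sequentially. (\<integral>\<^sup>+\<omega>. ennreal (real (?U m \<omega>)) \<partial>M) \<le> ennreal (B / (\<beta> - \<alpha>))"
      proof (intro always_eventually allI)
      fix m
      have "(\<beta> - \<alpha>) * (\<integral>\<omega>. real (?U m \<omega>) \<partial>M) \<le> B"
        using up(2)[of m] B[OF grid_nonneg lc, of m] by linarith
      then have "(\<integral>\<omega>. real (?U m \<omega>) \<partial>M) \<le> B / (\<beta> - \<alpha>)" using ab by (simp add: field_simps)
      then show "(\<integral>\<^sup>+\<omega>. ennreal (real (?U m \<omega>)) \<partial>M) \<le> ennreal (B / (\<beta> - \<alpha>))"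
        using up(1)[of m] by (subst nn_integral_eq_integral) (auto intro: ennreal_leI)
      qed
    qed simp
    finally show "(\<integral>\<^sup>+\<omega>. liminf (\<lambda>m. ennreal (real (?U m \<omega>))) \<partial>M) \<le> ennreal (B / (\<beta> - \<alpha>))" .
    fix k \<omega> assume "up_chain (\<lambda>t. X t \<omega>) \<alpha> \<beta> dyadics k c"
    then obtain m0 where m0: "\<And>m. m \<ge> m0 \<Longrightarrow> up_chain (\<lambda>t. X t \<omega>) \<alpha> \<beta> (range (grid m)) k c"
      using up_chain_UN[of "\<lambda>m. range (grid m)", OF grid_refine] unfolding dyadics_def by blast
    have "k \<le> ?U m \<omega>" if "m \<ge> m0" for m
      by (rule up_chain_le_upcount[OF ab strict_mono_grid m0[OF that]]) (simp add: less_iff)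
    then have "eventually (\<lambda>m. of_nat k \<le> ennreal (real (?U m \<omega>))) sequentially"
      by (auto simp: eventually_sequentially ennreal_of_nat_eq_real_of_nat intro!: exI[of _ m0] ennreal_leI)
    then show "of_nat k \<le> liminf (\<lambda>m. ennreal (real (?U m \<omega>)))" by (intro Liminf_bounded)
  qed
qed

lemma AE_no_up_chain:
  assumes X: "submart X" and c: "0 < c" "c \<le> T"
    and B: "\<And>t \<alpha>. 0 \<le> t \<Longrightarrow> t < c \<Longrightarrow> (\<integral>\<omega>. max 0 (X t \<omega> - \<alpha>) \<partial>M) \<le> B \<alpha>"
  shows "AE \<omega> in M. \<forall>\<alpha>\<in>\<rat>. \<forall>\<beta>\<in>\<rat>. \<alpha> < \<beta> \<longrightarrow> (\<exists>k. \<not> up_chain (\<lambda>t. X t \<omega>) \<alpha> \<beta> dyadics k c)"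
proof -
  have "AE \<omega> in M. \<exists>k. \<not> up_chain (\<lambda>t. X t \<omega>) \<alpha> \<beta> dyadics k c" if ab: "\<alpha> < \<beta>" for \<alpha> \<beta>
  proof -
    obtain V :: "'a \<Rightarrow> ennreal" where V: "V \<in> borel_measurable M" "(\<integral>\<^sup>+\<omega>. V \<omega> \<partial>M) \<le> ennreal (B \<alpha> / (\<beta> - \<alpha>))"
      "\<And>k \<omega>. up_chain (\<lambda>t. X t \<omega>) \<alpha> \<beta> dyadics k c \<Longrightarrow> of_nat k \<le> V \<omega>"
      using upcrossing_counter[OF X c ab, of "B \<alpha>"] B by blast
    have "AE \<omega> in M. V \<omega> \<noteq> \<infinity>"
      using V(2) by (intro nn_integral_PInf_AE V(1)) (auto simp: top_unique)
    then show ?thesis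
    proof eventually_elim
      case (elim \<omega>)
      then obtain k :: nat where "V \<omega> < of_nat k" using ennreal_Ex_less_of_nat[of "V \<omega>"] by (auto simp: less_top)
      then show ?case using V(3) by (auto simp: not_le[symmetric])
    qed
  qed
  then show ?thesis
    by (intro AE_ball_countable[THEN iffD2] countable_rat ballI) (auto simp: AE_conj_iff)
qed

text \<open>An unbounded path starting below \<open>a\<close> upcrosses [a, a + j + 1] for every
  \<open>j\<close>, while the expected number of these upcrossings is at most
  \<open>B / (j + 1)\<close>, which tends to 0. The paths are sorted by a natural number
  \<open>a\<close> above their initial value.\<close>

lemma AE_bounded_above_dyadics:
  assumes X: "submart X" and c: "0 < c" "c < T"
  shows "AE \<omega> in M. \<exists>b. \<forall>q\<in>dyadics. q < c \<longrightarrow> X q \<omega> \<le> b"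
proof -
  have "AE \<omega> in M. X 0 \<omega> \<le> real a \<longrightarrow> (\<exists>b. \<forall>q\<in>dyadics. q < c \<longrightarrow> X q \<omega> \<le> b)" for a :: nat
  proof -
    define B where "B = (\<integral>\<omega>. max 0 (X c \<omega> - a) \<partial>M)"
    have B: "(\<integral>\<omega>. max 0 (X t \<omega> - a) \<partial>M) \<le> B" if "0 \<le> t" "t < c" for t
      unfolding B_def using submart_mono_integral[OF submart_pos_part[OF X], of t c] that c by auto
    have "\<forall>j. \<exists>V. V \<in> borel_measurable M \<and> (\<integral>\<^sup>+\<omega>. V \<omega> \<partial>M) \<le> ennreal (B / real (Suc j)) \<and>
      (\<forall>k \<omega>. up_chain (\<lambda>t. X t \<omega>) a (a + real (Suc j)) dyadics k c \<longrightarrow> of_nat k \<le> V \<omega>)"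
      (is "\<forall>j. \<exists>V. ?P j V")
    proof
      fix j
      show "\<exists>V. ?P j V"
      using upcrossing_counter[OF X c(1) less_imp_le[OF c(2)], of "real a" "real a + real (Suc j)" B] B by simp
    qed
    from choice[OF this] obtain V :: "nat \<Rightarrow> 'a \<Rightarrow> ennreal" where "\<forall>j. ?P j (V j)" ..
    then have V: "\<And>j. V j \<in> borel_measurable M"
      "\<And>j. (\<integral>\<^sup>+\<omega>. V j \<omega> \<partial>M) \<le> ennreal (B / real (Suc j))"
      "\<And>j k \<omega>. up_chain (\<lambda>t. X t \<omega>) a (a + real (Suc j)) dyadics k c \<Longrightarrow> of_nat k \<le> V j \<omega>"
      by blast+
    note V(1)[measurable]
    have "(\<integral>\<^sup>+\<omega>. liminf (\<lambda>j. V j \<omega>) \<partial>M) \<le> liminf (\<lambda>j. \<integral>\<^sup>+\<omega>. V j \<omega> \<partial>M)"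
      by (rule nn_integral_liminf) measurable
    also have "\<dots> \<le> liminf (\<lambda>j. ennreal (B / real (Suc j)))"
      by (intro Liminf_mono always_eventually allI V)
    also have "\<dots> = ennreal 0"
    proof (rule lim_imp_Liminf[OF sequentially_bot, OF tendsto_ennrealI])
      show "(\<lambda>j. B / real (Suc j)) \<longlonglongrightarrow> 0" by (rule LIMSEQ_Suc) (rule lim_const_over_n)
    qed
    finally have "(\<integral>\<^sup>+\<omega>. liminf (\<lambda>j. V j \<omega>) \<partial>M) = 0" by simp
    then have "AE \<omega> in M. liminf (\<lambda>j. V j \<omega>) = 0"
      by (subst (asm) nn_integral_0_iff_AE) measurable
    then show ?thesis
    proof eventually_elim
      case (elim \<omega>)
      show ?case
      proof (intro impI, rule ccontr)
        assume 0: "X 0 \<omega> \<le> real a" and n: "\<nexists>b. \<forall>q\<in>dyadics. q < c \<longrightarrow> X q \<omega> \<le> b"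
        \<comment> \<open>Time 0 is the low point of the upcrossing constructed next.\<close>
        have z: "0 \<in> dyadics" unfolding dyadics_def by (auto intro!: exI[of _ 0] image_eqI[of _ _ 0] simp: grid_def)
        have "of_nat 1 \<le> V j \<omega>" for j
        proof (rule V(3))
          obtain q where q: "q \<in> dyadics" "q < c" "real a + real (Suc j) < X q \<omega>"
            using n not_le by blast
          then have "0 < q" using dyadics_nonneg[OF q(1)] 0 by (cases "q = 0") auto
          then show "up_chain (\<lambda>t. X t \<omega>) a (a + real (Suc j)) dyadics 1 c"
            unfolding One_nat_def up_chain.simps using q 0 z by (intro exI[of _ 0] exI[of _ q] conjI) auto
        qed
        then have "of_nat 1 \<le> liminf (\<lambda>j. V j \<omega>)" by (intro Liminf_bounded always_eventually) auto
        then show False using elim by simp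
      qed
    qed
  qed
  then have "AE \<omega> in M. \<forall>a :: nat. X 0 \<omega> \<le> real a \<longrightarrow> (\<exists>b. \<forall>q\<in>dyadics. q < c \<longrightarrow> X q \<omega> \<le> b)"
    unfolding AE_all_countable ..
  then show ?thesis by eventually_elim (meson real_arch_simple)
qed

text \<open>The sign of \<open>X s\<close> is known at time \<open>s\<close>, so the martingale
  identity can be applied separately on the two parts of \<open>B\<close>.\<close>

lemma mart_abs_indicator_integral:
  assumes X: "mart X" and st: "0 \<le> s" "s \<le> t" "t < T" and B: "B \<in> sets (F s)"
  shows "(\<integral>\<omega>. indicator B \<omega> * \<bar>X s \<omega>\<bar> \<partial>M) \<le> (\<integral>\<omega>. indicator B \<omega> * \<bar>X t \<omega>\<bar> \<partial>M)"
proof -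
  have [measurable]: "X s \<in> borel_measurable (F s)"
    using X st by (auto simp: martingale_before_def intro: adaptedD)
  define C where "C = B \<inter> {\<omega> \<in> space (F s). 0 \<le> X s \<omega>}"
  define D where "D = B \<inter> {\<omega> \<in> space (F s). X s \<omega> < 0}"
  have sets: "C \<in> sets (F s)" "D \<in> sets (F s)" unfolding C_def D_def by (auto intro!: sets.Int B)
  then have M: "B \<in> sets M" "C \<in> sets M" "D \<in> sets M" using B sets_F_M st by auto
  have i: "integrable M (X u)" if "u \<in> {s, t}" for u using X st that by (auto simp: martingale_before_def)
  have BC: "\<omega> \<in> B \<Longrightarrow> \<omega> \<in> space M" for \<omega> using M sets.sets_into_space by auto
  have "(\<integral>\<omega>. indicator B \<omega> * \<bar>X s \<omega>\<bar> \<partial>M) = (\<integral>\<omega>. indicator C \<omega> * X s \<omega> - indicator D \<omega> * X s \<omega> \<partial>M)"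
    using BC st by (intro Bochner_Integration.integral_cong) (auto simp: C_def D_def indicator_def)
  also have "\<dots> = (\<integral>\<omega>. indicator C \<omega> * X s \<omega> \<partial>M) - (\<integral>\<omega>. indicator D \<omega> * X s \<omega> \<partial>M)"
    using i M by (intro Bochner_Integration.integral_diff integrable_indicator_mult) auto
  also have "\<dots> = (\<integral>\<omega>. indicator C \<omega> * X t \<omega> \<partial>M) - (\<integral>\<omega>. indicator D \<omega> * X t \<omega> \<partial>M)"
    using mart_indicator_integral[OF X st] sets by simp
  also have "\<dots> = (\<integral>\<omega>. indicator C \<omega> * X t \<omega> - indicator D \<omega> * X t \<omega> \<partial>M)"
    using i M by (intro Bochner_Integration.integral_diff[symmetric] integrable_indicator_mult) auto
  also have "\<dots> \<le> (\<integral>\<omega>. indicator B \<omega> * \<bar>X t \<omega>\<bar> \<partial>M)"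
    using i M by (intro integral_mono Bochner_Integration.integrable_diff integrable_indicator_mult integrable_abs)
      (auto simp: C_def D_def indicator_def)
  finally show ?thesis .
qed

lemma AE_eq_of_indicator_integrals:
  fixes f g :: "'a \<Rightarrow> real"
  assumes t: "0 \<le> t" and m: "f \<in> borel_measurable (F t)" "g \<in> borel_measurable (F t)"
    and i: "integrable M f" "integrable M g"
    and eq: "\<And>B. B \<in> sets (F t) \<Longrightarrow> (\<integral>\<omega>. indicator B \<omega> * f \<omega> \<partial>M) = (\<integral>\<omega>. indicator B \<omega> * g \<omega> \<partial>M)"
  shows "AE \<omega> in M. f \<omega> = g \<omega>"
proof -
  interpret sigma_finite_subalgebra M "F t" using t by (intro cond_subalgebra)
  have "AE \<omega> in M. real_cond_exp M (F t) f \<omega> = g \<omega>"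
    by (rule real_cond_exp_charact) (use i m eq in \<open>auto simp: set_lebesgue_integral_def\<close>)
  moreover have "AE \<omega> in M. real_cond_exp M (F t) f \<omega> = f \<omega>" using i m by (intro real_cond_exp_F_meas)
  ultimately show ?thesis by eventually_elim auto
qed

lemma mart_cond_exp:
  assumes W: "integrable M W"
  shows "mart (\<lambda>t. real_cond_exp M (F t) W)"
    "\<And>t B. 0 \<le> t \<Longrightarrow> B \<in> sets (F t) \<Longrightarrow>
      (\<integral>\<omega>. indicator B \<omega> * real_cond_exp M (F t) W \<omega> \<partial>M) = (\<integral>\<omega>. indicator B \<omega> * W \<omega> \<partial>M)"
proof -
  show eq: "(\<integral>\<omega>. indicator B \<omega> * real_cond_exp M (F t) W \<omega> \<partial>M) = (\<integral>\<omega>. indicator B \<omega> * W \<omega> \<partial>M)"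
    if "0 \<le> t" "B \<in> sets (F t)" for t B
  proof -
    interpret sigma_finite_subalgebra M "F t" using that by (intro cond_subalgebra)
    show ?thesis using real_cond_exp_intA[OF W that(2)] by (simp add: set_lebesgue_integral_def)
  qed
  show "mart (\<lambda>t. real_cond_exp M (F t) W)"
  proof (rule martI)
    fix t assume "0 \<le> t" "t < T"
    interpret sigma_finite_subalgebra M "F t" using \<open>0 \<le> t\<close> by (intro cond_subalgebra)
    show "integrable M (real_cond_exp M (F t) W)" using W by (rule real_cond_exp_int)
  next
    fix s t B assume *: "0 \<le> s" "s \<le> t" "t < T" "B \<in> sets (F s)"
    then have "B \<in> sets (F t)" using sets_F_mono by auto
    then show "(\<integral>\<omega>. indicator B \<omega> * real_cond_exp M (F s) W \<omega> \<partial>M) = (\<integral>\<omega>. indicator B \<omega> * real_cond_exp M (F t) W \<omega> \<partial>M)"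
      using * eq by simp
  qed (auto simp: adapted_before_def)
qed

lemma dyadic_sequence:
  assumes "0 \<le> t" "t < c"
  obtains q where "\<And>j. q j \<in> dyadics" "\<And>j. t < q j" "\<And>j. q j < c" "q \<longlonglongrightarrow> t"
proof -
  have "\<exists>q. q \<in> dyadics \<and> t < q \<and> q < t + (c - t) / real (Suc j)" for j
    using dyadics_dense[of t "t + (c - t) / real (Suc j)"] assms by auto
  then obtain q where q: "\<And>j. q j \<in> dyadics" "\<And>j. t < q j" "\<And>j. q j < t + (c - t) / real (Suc j)" by metis
  show ?thesis
  proof
    show "q j < c" for j
    proof -
      have "(c - t) / real (Suc j) \<le> (c - t) / 1" using assms by (intro divide_left_mono) auto
      then show ?thesis using q(3)[of j] by simp
    qed
    show "q \<longlonglongrightarrow> t"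
    proof (rule tendsto_sandwich[where f="\<lambda>_. t" and h="\<lambda>j. t + (c - t) / real (Suc j)"])
      have "(\<lambda>j. (c - t) / real (Suc j)) \<longlonglongrightarrow> 0" by (rule LIMSEQ_Suc) (rule lim_const_over_n)
      then show "(\<lambda>j. t + (c - t) / real (Suc j)) \<longlonglongrightarrow> t" using tendsto_add[OF tendsto_const] by force
      show "eventually (\<lambda>j. t \<le> q j) sequentially" using q(2) by (intro always_eventually allI less_imp_le)
      show "eventually (\<lambda>j. q j \<le> t + (c - t) / real (Suc j)) sequentially"
        using q(3) by (intro always_eventually allI less_imp_le)
    qed simp
  qed (use q in auto)
qed

text \<open>\<open>X t\<close> is the right limit of \<open>Z\<close> along the dyadic times. It
  exists off a null set by boundedness and the absence of infinite chains of upcrossings. That it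
  agrees with \<open>Z t\<close> follows by testing on events of \<open>F t\<close>, where the
  integrals of \<open>Z\<close> at later times are constant and uniform integrability allows passage
  to the limit.\<close>

theorem mart_cadlag_modification:
  assumes Z: "mart Z"
  shows "\<exists>X. mart X \<and> cadlag_before M T X \<and> (\<forall>t. 0 \<le> t \<and> t < T \<longrightarrow> (AE \<omega> in M. X t \<omega> = Z t \<omega>))"
proof -
  \<comment> \<open>The martingale lives on [0, T) and the upcrossing bounds need a closing time
    inside, so they are obtained on [0, c j) with \<open>c j\<close> increasing to
    \<open>T\<close>.\<close>
  define c where "c \<equiv> \<lambda>j :: nat. T * (1 - 1 / (real j + 2))"
  have c: "0 < c j" "c j < T" for j
  proof -
    have "0 < 1 - 1 / (real j + 2)" "1 - 1 / (real j + 2) < 1" by (auto simp: field_simps)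
    then show "0 < c j" "c j < T" using T_pos mult_strict_left_mono[of "1 - 1 / (real j + 2)" 1 T] by (auto simp: c_def)
  qed
  have c_ex: "\<exists>j. t < c j" if "t < T" for t
  proof -
    have "(\<lambda>j. T * (1 - 1 / (real j + 2))) \<longlonglongrightarrow> T * (1 - 0)"
      using LIMSEQ_ignore_initial_segment[OF lim_const_over_n[of 1], of 2]
      by (intro tendsto_intros) (simp add: add.commute)
    then have "eventually (\<lambda>j. t < T * (1 - 1 / (real j + 2))) sequentially"
      using that by (intro order_tendstoD(1)) auto
    then show ?thesis unfolding c_def by (auto simp: eventually_sequentially)
  qed
  have Zi: "integrable M (Z t)" if "0 \<le> t" "t < T" for t using Z that by (auto simp: martingale_before_def)
  define P where "P \<equiv> \<lambda>\<omega>. \<forall>j. (\<exists>b. \<forall>q\<in>dyadics. q < c j \<longrightarrow> \<bar>Z q \<omega>\<bar> \<le> b) \<and>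
      (\<forall>\<alpha>\<in>\<rat>. \<forall>\<beta>\<in>\<rat>. \<alpha> < \<beta> \<longrightarrow> (\<exists>k. \<not> up_chain (\<lambda>t. Z t \<omega>) \<alpha> \<beta> dyadics k (c j)))"
  have "AE \<omega> in M. P \<omega>"
    unfolding P_def AE_all_countable
  proof
    fix j
    have s: "submart Z" "submart (\<lambda>t \<omega>. - Z t \<omega>)" using Z mart_uminus mart_imp_submart by auto
    have B: "(\<integral>\<omega>. max 0 (Z t \<omega> - \<alpha>) \<partial>M) \<le> (\<integral>\<omega>. max 0 (Z (c j) \<omega> - \<alpha>) \<partial>M)" if "0 \<le> t" "t < c j" for t \<alpha>
      using submart_mono_integral[OF submart_pos_part[OF s(1)], of t "c j"] that c by auto
    have nc: "AE \<omega> in M. \<forall>\<alpha>\<in>\<rat>. \<forall>\<beta>\<in>\<rat>. \<alpha> < \<beta> \<longrightarrow> (\<exists>k. \<not> up_chain (\<lambda>t. Z t \<omega>) \<alpha> \<beta> dyadics k (c j))"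
      by (rule AE_no_up_chain[OF s(1) c(1) less_imp_le[OF c(2)] B])
    from nc
      AE_bounded_above_dyadics[OF s(1) c[of j]] AE_bounded_above_dyadics[OF s(2) c[of j]]
    show "AE \<omega> in M. (\<exists>b. \<forall>q\<in>dyadics. q < c j \<longrightarrow> \<bar>Z q \<omega>\<bar> \<le> b) \<and>
      (\<forall>\<alpha>\<in>\<rat>. \<forall>\<beta>\<in>\<rat>. \<alpha> < \<beta> \<longrightarrow> (\<exists>k. \<not> up_chain (\<lambda>t. Z t \<omega>) \<alpha> \<beta> dyadics k (c j)))"
    proof eventually_elim
      case (elim \<omega>)
      from elim(2) obtain b1 where b1: "\<forall>q\<in>dyadics. q < c j \<longrightarrow> Z q \<omega> \<le> b1" ..
      from elim(3) obtain b2 where b2: "\<forall>q\<in>dyadics. q < c j \<longrightarrow> - Z q \<omega> \<le> b2" ..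
      have "\<forall>q\<in>dyadics. q < c j \<longrightarrow> \<bar>Z q \<omega>\<bar> \<le> max b1 b2"
      proof (intro ballI impI)
        fix q assume "q \<in> dyadics" "q < c j"
        with b1 b2 have "Z q \<omega> \<le> b1" "- Z q \<omega> \<le> b2" by auto
        then show "\<bar>Z q \<omega>\<bar> \<le> max b1 b2" by linarith
      qed
      then show ?case using elim(1) by blast
    qed
  qed
  from AE_good_set[OF this] obtain G where G: "\<And>t. 0 \<le> t \<Longrightarrow> G \<in> sets (F t)" "AE \<omega> in M. \<omega> \<in> G" "\<And>\<omega>. \<omega> \<in> G \<Longrightarrow> P \<omega>" "G \<subseteq> space M"
    by blast
  have PG: "\<exists>b. \<forall>q\<in>dyadics. q < c j \<longrightarrow> \<bar>Z q \<omega>\<bar> \<le> b" if "\<omega> \<in> G" for \<omega> j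
    using G(3)[OF that] unfolding P_def by blast
  have PG': "\<exists>k. \<not> up_chain (\<lambda>t. Z t \<omega>) \<alpha> \<beta> dyadics k (c j)"
    if "\<omega> \<in> G" "\<alpha> \<in> \<rat>" "\<beta> \<in> \<rat>" "\<alpha> < \<beta>" for \<omega> j \<alpha> \<beta>
    using G(3)[OF that(1)] that(2-) unfolding P_def by blast
  \<comment> \<open>Paths off \<open>G\<close> are identically 0, so that regularity holds on every
    path.\<close>
  define X where "X \<equiv> \<lambda>t \<omega>. if \<omega> \<in> G \<and> 0 \<le> t \<and> t < T then Lim (at t within (dyadics \<inter> {t<..})) (\<lambda>q. Z q \<omega>) else 0"
  have R: "((\<lambda>q. Z q \<omega>) \<longlongrightarrow> X t \<omega>) (at t within (dyadics \<inter> {t<..}))" if w: "\<omega> \<in> G" and t: "0 \<le> t" "t < T" for t \<omega>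
  proof -
    obtain j where j: "t < c j" using c_ex t by auto
    obtain b where b: "\<forall>q\<in>dyadics. q < c j \<longrightarrow> \<bar>Z q \<omega>\<bar> \<le> b" using PG[OF w] by blast
    have "\<exists>l. ((\<lambda>q. Z q \<omega>) \<longlongrightarrow> l) (at t within (dyadics \<inter> {t<..}))"
      by (rule right_limit_of_no_up_chain[OF dyadics_right_ne[OF t(1)] j]) (use b PG'[OF w] in auto)
    then show ?thesis using tendsto_Lim[OF dyadics_right_ne[OF t(1)]] w t by (auto simp: X_def)
  qed
  have Lf: "\<exists>l. ((\<lambda>q. Z q \<omega>) \<longlongrightarrow> l) (at t within (dyadics \<inter> {..<t}))" if w: "\<omega> \<in> G" and t: "0 < t" "t < T" for t \<omega>
  proof -
    obtain j where j: "t < c j" using c_ex t by auto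
    obtain b where b: "\<forall>q\<in>dyadics. q < c j \<longrightarrow> \<bar>Z q \<omega>\<bar> \<le> b" using PG[OF w] by blast
    show ?thesis
      by (rule left_limit_of_no_up_chain[OF dyadics_left_ne[OF t(1)] less_imp_le[OF j]]) (use b PG'[OF w] in auto)
  qed
  have cad: "cadlag_before M T X"
    unfolding cadlag_before_def
  proof (intro ballI conjI)
    fix \<omega> t assume "\<omega> \<in> space M" and t: "t \<in> {0..<T}"
    show "((\<lambda>s. X s \<omega>) \<longlongrightarrow> X t \<omega>) (at_right t)"
    proof (cases "\<omega> \<in> G")
      case True
      show ?thesis
        by (rule right_tendsto_of_dense_right_limits[where c=T and S=dyadics, OF dyadics_right_ne R[OF True] R[OF True]])
          (use t in auto)
    qed (simp add: X_def)
  next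
    fix \<omega> t assume "\<omega> \<in> space M" and t: "t \<in> {0<..<T}"
    show "\<exists>l. ((\<lambda>s. X s \<omega>) \<longlongrightarrow> l) (at_left t)"
    proof (cases "\<omega> \<in> G")
      case True
      obtain l where l: "((\<lambda>q. Z q \<omega>) \<longlongrightarrow> l) (at t within (dyadics \<inter> {..<t}))" using Lf[OF True] t by auto
      have "((\<lambda>s. X s \<omega>) \<longlongrightarrow> l) (at_left t)"
        by (rule left_tendsto_of_dense_right_limits[where c=0 and S=dyadics, OF dyadics_right_ne R[OF True] l])
          (use t in auto)
      then show ?thesis ..
    qed (auto simp: X_def)
  qed
  have main: "X t \<in> borel_measurable (F t) \<and> integrable M (X t) \<and> (AE \<omega> in M. X t \<omega> = Z t \<omega>)" if t: "0 \<le> t" "t < T" for t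
  proof -
    \<comment> \<open>A time strictly between \<open>t\<close> and \<open>T\<close>. All sample
      times \<open>q j\<close> lie before it, so \<open>Z e\<close> closes the sequence and controls
      its tails.\<close>
    define e where "e = (t + T) / 2"
    have e: "t < e" "e < T" using t by (auto simp: e_def)
    obtain q where q: "\<And>j. q j \<in> dyadics" "\<And>j. t < q j" "\<And>j. q j < e" "q \<longlonglongrightarrow> t" using dyadic_sequence[OF t(1) e(1)] by blast
    have "filterlim q (at t within (dyadics \<inter> {t<..})) sequentially"
      unfolding filterlim_at using q(1,2,4) by (simp add: order.strict_implies_not_eq[OF q(2), symmetric])
    then have lim: "(\<lambda>j. Z (q j) \<omega>) \<longlonglongrightarrow> X t \<omega>" if "\<omega> \<in> G" for \<omega>
      using filterlim_compose[OF R[OF that t]] by blast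
    have qT: "q j < T" "0 \<le> q j" for j using q(2,3)[of j] e t by auto
    have Zq: "Z (q j) \<in> borel_measurable (F (q j))" for j
      using Z qT by (auto simp: martingale_before_def intro: adaptedD)
    \<comment> \<open>The limit depends only on times after \<open>t\<close>. For each
      \<open>u > t\<close> the sequence eventually stays before \<open>u\<close>, and right
      continuity of the filtration then gives measurability at \<open>t\<close> itself.\<close>
    have meas: "X t \<in> borel_measurable (F t)"
    proof (rule measurable_F_right[OF t(1)])
      fix u assume u: "t < u"
      then have "eventually (\<lambda>j. q j < u) sequentially" using q(4) by (intro order_tendstoD)
      then obtain j0 where j0: "\<And>j. j \<ge> j0 \<Longrightarrow> q j < u" by (auto simp: eventually_sequentially)
      show "X t \<in> borel_measurable (F u)"
      proof (rule borel_measurable_LIMSEQ_real)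
        show "(\<lambda>\<omega>. indicator G \<omega> * Z (q (j + j0)) \<omega>) \<in> borel_measurable (F u)" for j
          using measurable_F_mono[OF Zq qT(2), of "j + j0" u] j0[of "j + j0"] G(1)[of u] u t
          by (intro borel_measurable_times borel_measurable_indicator) auto
        show "(\<lambda>j. indicator G \<omega> * Z (q (j + j0)) \<omega>) \<longlonglongrightarrow> X t \<omega>" for \<omega>
        proof (cases "\<omega> \<in> G")
          case True
          then show ?thesis using LIMSEQ_ignore_initial_segment[OF lim[OF True], of j0] by simp
        qed (simp add: X_def)
      qed
    qed
    have limAE: "AE \<omega> in M. (\<lambda>j. Z (q j) \<omega>) \<longlonglongrightarrow> X t \<omega>" using G(2) by eventually_elim (rule lim)
    have tail: "(\<integral>\<omega>. indicator {\<omega>. d < \<bar>Z (q k) \<omega>\<bar>} \<omega> * \<bar>Z (q k) \<omega>\<bar> \<partial>M)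
        \<le> (\<integral>\<omega>. indicator {\<omega>. d < \<bar>Z (q k) \<omega>\<bar>} \<omega> * \<bar>Z e \<omega>\<bar> \<partial>M)" for k d
    proof -
      note Zq[measurable]
      have S: "{\<omega> \<in> space (F (q k)). d < \<bar>Z (q k) \<omega>\<bar>} \<in> sets (F (q k))" by measurable
      have *: "(\<integral>\<omega>. indicator {\<omega>. d < \<bar>Z (q k) \<omega>\<bar>} \<omega> * V \<omega> \<partial>M) = (\<integral>\<omega>. indicator {\<omega> \<in> space (F (q k)). d < \<bar>Z (q k) \<omega>\<bar>} \<omega> * V \<omega> \<partial>M)" for V :: "'a \<Rightarrow> real"
        using qT by (intro Bochner_Integration.integral_cong) (auto simp: indicator_def)
      show ?thesis unfolding * by (rule mart_abs_indicator_integral[OF Z qT(2) less_imp_le[OF q(3)] e(2) S])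
    qed
    have XM: "X t \<in> borel_measurable M" by (rule measurable_F_M[OF meas t(1)])
    note ui = uniformly_integrable_limit[where X="\<lambda>k. Z (q k)" and Z="\<lambda>\<omega>. \<bar>Z e \<omega>\<bar>" and Y="X t", OF Zi[OF qT(2,1)] integrable_abs[OF Zi] abs_ge_zero tail limAE XM]
    have e0: "0 \<le> e" using e t by auto
    have iX: "integrable M (X t)" by (rule ui(1)) (use e e0 in auto)
    have "AE \<omega> in M. X t \<omega> = Z t \<omega>"
    proof (rule AE_eq_of_indicator_integrals[OF t(1) meas _ iX Zi[OF t]])
      show "Z t \<in> borel_measurable (F t)" using Z t by (auto simp: martingale_before_def intro: adaptedD)
      fix B assume B: "B \<in> sets (F t)"
      have "(\<lambda>k. \<integral>\<omega>. indicator B \<omega> * Z (q k) \<omega> \<partial>M) \<longlonglongrightarrow> (\<integral>\<omega>. indicator B \<omega> * X t \<omega> \<partial>M)"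
        by (rule ui(2)) (use e e0 B sets_F_M[OF t(1)] in auto)
      moreover have "(\<integral>\<omega>. indicator B \<omega> * Z (q k) \<omega> \<partial>M) = (\<integral>\<omega>. indicator B \<omega> * Z t \<omega> \<partial>M)" for k
        using mart_indicator_integral[OF Z t(1) less_imp_le[OF q(2)] qT(1) B] by simp
      ultimately show "(\<integral>\<omega>. indicator B \<omega> * X t \<omega> \<partial>M) = (\<integral>\<omega>. indicator B \<omega> * Z t \<omega> \<partial>M)"
        by (simp add: LIMSEQ_const_iff)
    qed
    then show ?thesis using meas iX by blast
  qed
  have "mart X"
  proof (rule martI)
    show "adapted_before F T X" using main by (auto simp: adapted_before_def)
    fix s t B assume *: "0 \<le> s" "s \<le> t" "t < T" "B \<in> sets (F s)"
    have BM: "B \<in> sets M" using * sets_F_M by auto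
    have "(\<integral>\<omega>. indicator B \<omega> * X u \<omega> \<partial>M) = (\<integral>\<omega>. indicator B \<omega> * Z u \<omega> \<partial>M)" if "u \<in> {s,t}" for u
    proof (rule integral_cong_AE)
      have u: "0 \<le> u" "u < T" using that * by auto
      show "(\<lambda>\<omega>. indicator B \<omega> * X u \<omega>) \<in> borel_measurable M" "(\<lambda>\<omega>. indicator B \<omega> * Z u \<omega>) \<in> borel_measurable M"
        using main[OF u] Zi[OF u] BM by auto
      show "AE \<omega> in M. indicator B \<omega> * X u \<omega> = indicator B \<omega> * Z u \<omega>"
        using main[OF u] by (auto elim: eventually_mono)
    qed
    then show "(\<integral>\<omega>. indicator B \<omega> * X s \<omega> \<partial>M) = (\<integral>\<omega>. indicator B \<omega> * X t \<omega> \<partial>M)"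
      using mart_indicator_integral[OF Z *] by simp
  qed (use main in auto)
  then show ?thesis using cad main by blast
qed

text \<open>Boundedness keeps the upcrossing bound finite up to \<open>T\<close>, so the count may
  be taken over all of [0, T) and excludes oscillation at \<open>T\<close>.\<close>

lemma submart_left_limit:
  assumes S: "submart S" and rc: "AE \<omega> in M. \<forall>t\<in>{0..<T}. ((\<lambda>s. S s \<omega>) \<longlongrightarrow> S t \<omega>) (at_right t)"
    and b: "AE \<omega> in M. \<forall>t\<in>{0..<T}. \<bar>S t \<omega>\<bar> \<le> b"
  shows "AE \<omega> in M. \<exists>l. ((\<lambda>t. S t \<omega>) \<longlongrightarrow> l) (at_left T)"
proof -
  have B: "(\<integral>\<omega>. max 0 (S t \<omega> - \<alpha>) \<partial>M) \<le> \<bar>b\<bar> + \<bar>\<alpha>\<bar>" if t: "0 \<le> t" "t < T" for t \<alpha>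
  proof -
    have "(\<integral>\<omega>. max 0 (S t \<omega> - \<alpha>) \<partial>M) \<le> (\<integral>\<omega>. \<bar>b\<bar> + \<bar>\<alpha>\<bar> \<partial>M)"
    proof (rule integral_mono_AE)
      show "integrable M (\<lambda>\<omega>. max 0 (S t \<omega> - \<alpha>))" using submart_pos_part[OF S] t by (auto simp: submart_def)
      show "AE \<omega> in M. max 0 (S t \<omega> - \<alpha>) \<le> \<bar>b\<bar> + \<bar>\<alpha>\<bar>" using b
      proof eventually_elim
        case (elim \<omega>)
        then have "\<bar>S t \<omega>\<bar> \<le> b" using t by auto
        then show ?case by linarith
      qed
    qed auto
    then show ?thesis by (simp add: prob_space)
  qed
  have nc: "AE \<omega> in M. \<forall>\<alpha>\<in>\<rat>. \<forall>\<beta>\<in>\<rat>. \<alpha> < \<beta> \<longrightarrow> (\<exists>k. \<not> up_chain (\<lambda>t. S t \<omega>) \<alpha> \<beta> dyadics k T)"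
    by (rule AE_no_up_chain[OF S T_pos order_refl B])
  from nc rc b
  show ?thesis
  proof eventually_elim
    case (elim \<omega>)
    have "\<exists>l. ((\<lambda>q. S q \<omega>) \<longlongrightarrow> l) (at T within (dyadics \<inter> {..<T}))"
      by (rule left_limit_of_no_up_chain[OF dyadics_left_ne[OF T_pos] order_refl, where b=b])
        (use elim dyadics_nonneg in auto)
    then obtain l where l: "((\<lambda>q. S q \<omega>) \<longlongrightarrow> l) (at T within (dyadics \<inter> {..<T}))" ..
    have "((\<lambda>t. S t \<omega>) \<longlongrightarrow> l) (at_left T)"
    proof (rule left_tendsto_of_dense_right_limits[where c=0 and S=dyadics, OF dyadics_right_ne _ l T_pos])
      fix s assume s: "0 < s" "s < T"
      show "((\<lambda>q. S q \<omega>) \<longlongrightarrow> S s \<omega>) (at s within dyadics \<inter> {s<..})"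
        by (rule tendsto_within_subset) (use elim(2) s in auto)
    qed auto
    then show ?case ..
  qed
qed

text \<open>The limit \<open>L\<close> and the closing variable \<open>W\<close> have equal
  integrals over every event of \<open>F s\<close> with \<open>s < T\<close>. These events form an
  intersection-stable generator of \<open>F T\<close> by left continuity, so Dynkin's argument
  extends the equality to \<open>F T\<close>, for which both variables are measurable.\<close>

lemma closed_mart_left_limit:
  assumes N: "mart N" and rc: "AE \<omega> in M. \<forall>t\<in>{0..<T}. ((\<lambda>s. N s \<omega>) \<longlongrightarrow> N t \<omega>) (at_right t)"
    and b: "AE \<omega> in M. \<forall>t\<in>{0..<T}. \<bar>N t \<omega>\<bar> \<le> b" and lc: "left_continuous_filtration_at M F T"
    and W: "W \<in> borel_measurable (F T)" "integrable M W"
    and eq: "\<And>t B. 0 \<le> t \<Longrightarrow> t < T \<Longrightarrow> B \<in> sets (F t) \<Longrightarrow>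
      (\<integral>\<omega>. indicator B \<omega> * N t \<omega> \<partial>M) = (\<integral>\<omega>. indicator B \<omega> * W \<omega> \<partial>M)"
  shows "AE \<omega> in M. ((\<lambda>t. N t \<omega>) \<longlongrightarrow> W \<omega>) (at_left T)"
proof -
  define t where "t \<equiv> \<lambda>k :: nat. T - T / real (Suc k)"
  have t: "0 \<le> t k" "t k < T" for k using T_pos by (auto simp: t_def field_simps)
  have tT: "t \<longlonglongrightarrow> T - 0" unfolding t_def by (intro tendsto_diff tendsto_const) (rule LIMSEQ_Suc, rule lim_const_over_n)
  then have tl: "filterlim t (at_left T) sequentially" unfolding filterlim_at using t less_imp_neq[OF t(2)] by auto
  \<comment> \<open>The limit is taken along a sequence, which makes its measurability
    immediate.\<close>
  define L where "L \<equiv> \<lambda>\<omega>. lim (\<lambda>k. N (t k) \<omega>)"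
  have Nm: "N (t k) \<in> borel_measurable (F T)" for k
    using N t[of k] by (intro measurable_F_mono[OF adaptedD]) (auto simp: martingale_before_def)
  have Lm: "L \<in> borel_measurable (F T)" unfolding L_def using Nm by (rule borel_measurable_lim_metric)
  have T0: "0 \<le> T" using T_pos by simp
  have LM: "L \<in> borel_measurable M" by (rule measurable_F_M[OF Lm T0])
  have ex: "AE \<omega> in M. ((\<lambda>t. N t \<omega>) \<longlongrightarrow> L \<omega>) (at_left T)"
    using submart_left_limit[OF mart_imp_submart[OF N] rc b]
  proof eventually_elim
    case (elim \<omega>)
    then obtain l where l: "((\<lambda>t. N t \<omega>) \<longlongrightarrow> l) (at_left T)" ..
    then have "(\<lambda>k. N (t k) \<omega>) \<longlonglongrightarrow> l" using tl by (rule filterlim_compose)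
    then have "L \<omega> = l" unfolding L_def by (rule limI)
    then show ?case using l by simp
  qed
  have seq: "AE \<omega> in M. (\<lambda>k. N (t k) \<omega>) \<longlonglongrightarrow> L \<omega>"
    using ex by eventually_elim (rule filterlim_compose[OF _ tl])
  have Lb: "AE \<omega> in M. \<bar>L \<omega>\<bar> \<le> b" using seq b
  proof eventually_elim
    case (elim \<omega>)
    have "(\<lambda>k. \<bar>N (t k) \<omega>\<bar>) \<longlonglongrightarrow> \<bar>L \<omega>\<bar>" by (intro tendsto_intros elim)
    then show ?case by (rule LIMSEQ_le_const2) (use elim t in auto)
  qed
  have Li: "integrable M L" by (rule integrable_const_bound[OF _ LM]) (use Lb in auto)
  have eqF: "(\<integral>\<omega>. indicator B \<omega> * L \<omega> \<partial>M) = (\<integral>\<omega>. indicator B \<omega> * W \<omega> \<partial>M)" if s: "0 \<le> s" "s < T" and B: "B \<in> sets (F s)" for s B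
  proof -
    have BM: "B \<in> sets M" using B sets_F_M[OF s(1)] by auto
    have "(\<lambda>k. \<integral>\<omega>. indicator B \<omega> * N (t k) \<omega> \<partial>M) \<longlonglongrightarrow> (\<integral>\<omega>. indicator B \<omega> * L \<omega> \<partial>M)"
    proof (rule integral_dominated_convergence[where w="\<lambda>_. b"])
      show "(\<lambda>\<omega>. indicator B \<omega> * L \<omega>) \<in> borel_measurable M" "(\<lambda>\<omega>. indicator B \<omega> * N (t k) \<omega>) \<in> borel_measurable M" for k
        using LM measurable_F_M[OF Nm T0] BM by auto
      show "AE \<omega> in M. (\<lambda>k. indicator B \<omega> * N (t k) \<omega>) \<longlonglongrightarrow> indicator B \<omega> * L \<omega>"
        using seq by eventually_elim (intro tendsto_intros)
      show "AE \<omega> in M. norm (indicator B \<omega> * N (t k) \<omega>) \<le> b" for k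
        using b by eventually_elim (use t[of k] in \<open>force simp: indicator_def\<close>)
    qed auto
    moreover have "eventually (\<lambda>k. (\<integral>\<omega>. indicator B \<omega> * N (t k) \<omega> \<partial>M) = (\<integral>\<omega>. indicator B \<omega> * W \<omega> \<partial>M)) sequentially"
    proof -
      have "eventually (\<lambda>k. s < t k) sequentially" using tT s by (intro order_tendstoD(1)[of _ "T - 0"]) auto
      then show ?thesis
      proof eventually_elim
        case (elim k)
        then have "B \<in> sets (F (t k))" using B sets_F_mono[of s "t k"] s by auto
        then show ?case using eq t by blast
      qed
    qed
    ultimately show ?thesis by (rule LIMSEQ_unique[OF _ tendsto_eventually])
  qed
  let ?G = "\<Union>s\<in>{0..<T}. sets (F s)"
  have GM: "?G \<subseteq> Pow (space M)" using sets_F_M sets.sets_into_space[of _ M] by force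
  have st: "Int_stable ?G"
  proof (rule Int_stableI)
    fix A B assume "A \<in> ?G" "B \<in> ?G"
    then obtain s u where su: "s \<in> {0..<T}" "u \<in> {0..<T}" "A \<in> sets (F s)" "B \<in> sets (F u)" by auto
    then have "A \<inter> B \<in> sets (F (max s u))" using sets_F_mono[of s "max s u"] sets_F_mono[of u "max s u"] by (intro sets.Int) auto
    then show "A \<inter> B \<in> ?G" using su by (intro UN_I[of "max s u"]) auto
  qed
  have split: "(\<integral>\<omega>. indicator (space M - A) \<omega> * V \<omega> \<partial>M) = (\<integral>\<omega>. V \<omega> \<partial>M) - (\<integral>\<omega>. indicator A \<omega> * V \<omega> \<partial>M)"
    if "integrable M V" "A \<in> sets M" for V :: "'a \<Rightarrow> real" and A
  proof -
    have "(\<integral>\<omega>. indicator (space M - A) \<omega> * V \<omega> \<partial>M) = (\<integral>\<omega>. V \<omega> - indicator A \<omega> * V \<omega> \<partial>M)"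
      by (intro Bochner_Integration.integral_cong) (auto simp: indicator_def)
    then show ?thesis using integrable_indicator_mult[OF that] that by simp
  qed
  have sub: "sigma_sets (space M) ?G \<subseteq> sets M"
    using lc sets_F_M[OF T0] by (simp add: left_continuous_filtration_at_def)
  have "(\<integral>\<omega>. indicator B \<omega> * L \<omega> \<partial>M) = (\<integral>\<omega>. indicator B \<omega> * W \<omega> \<partial>M)" if "B \<in> sigma_sets (space M) ?G" for B
    using st GM that
  proof (induction rule: sigma_sets_induct_disjoint)
    case (basic A)
    then show ?case using eqF by auto
  next
    case (compl A)
    have "(\<integral>\<omega>. L \<omega> \<partial>M) = (\<integral>\<omega>. W \<omega> \<partial>M)"
    proof -
      have "space M \<in> sets (F 0)" using sets.top[of "F 0"] by simp
      from eqF[OF _ T_pos this] show ?thesis by (simp cong: Bochner_Integration.integral_cong)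
    qed
    then show ?case using compl sub Li W(2) by (subst (1 2) split) auto
  next
    case (union A)
    have A: "A i \<in> sets M" for i using union sub by auto
    have *: "(\<integral>\<omega>. indicator (\<Union>i. A i) \<omega> * V \<omega> \<partial>M) = (\<Sum>i. \<integral>\<omega>. indicator (A i) \<omega> * V \<omega> \<partial>M)"
      if V: "integrable M V" for V :: "'a \<Rightarrow> real"
    proof -
      have "set_integrable M (\<Union>i. A i) V"
        using integrable_indicator_mult[OF V, of "\<Union>i. A i"] A by (auto simp: set_integrable_def)
      then have "(LINT \<omega>:(\<Union>i. A i)|M. V \<omega>) = (\<Sum>i. LINT \<omega>:A i|M. V \<omega>)"
        using A union(1) by (intro lebesgue_integral_countable_add) (auto simp: disjoint_family_on_def)
      then show ?thesis by (simp add: set_lebesgue_integral_def)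
    qed
    show ?case unfolding *[OF Li] *[OF W(2)] using union(3) by simp
  qed auto
  then have "AE \<omega> in M. L \<omega> = W \<omega>"
    using lc by (intro AE_eq_of_indicator_integrals[OF T0 Lm W(1) Li W(2)]) (simp add: left_continuous_filtration_at_def)
  then show ?thesis using ex by eventually_elim simp
qed

end

section \<open>Progressive processes and optional sampling\<close>

lemma measurable_pair_subalgebra:
  assumes f: "f \<in> measurable (A \<Otimes>\<^sub>M B) N" and sub: "subalgebra A' A"
  shows "f \<in> measurable (A' \<Otimes>\<^sub>M B) N"
proof -
  have id: "(\<lambda>x. x) \<in> measurable A' A" by (rule measurable_from_subalg[OF sub]) simp
  have "(\<lambda>x. (fst x, snd x)) \<in> measurable (A' \<Otimes>\<^sub>M B) (A \<Otimes>\<^sub>M B)"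
    by (intro measurable_Pair measurable_compose[OF measurable_fst id] measurable_snd)
  from measurable_compose[OF this f] show ?thesis by simp
qed

lemma borel_measurable_pair_lborel_iff:
  "f \<in> borel_measurable (A \<Otimes>\<^sub>M lborel) \<longleftrightarrow> f \<in> borel_measurable (A \<Otimes>\<^sub>M borel)"
  by (intro arg_cong[where f="\<lambda>S. f \<in> S"] measurable_cong_sets sets_pair_measure_cong) auto

lemma right_continuous_sequentially:
  fixes x :: "real \<Rightarrow> real"
  assumes "(x \<longlongrightarrow> x t) (at_right t)" "q \<longlonglongrightarrow> t" "\<And>j. t \<le> q j"
  shows "(\<lambda>j. x (q j)) \<longlonglongrightarrow> x t"
proof -
  have "continuous (at t within {t..}) x"
    using assms(1) by (simp add: continuous_within at_within_Ici_at_right)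
  from continuous_within_tendsto_compose'[OF this _ assms(2)] show ?thesis using assms(3) by simp
qed

context filtered_prob_space
begin

text \<open>The restriction to [0, t] is expressed by an indicator, so that the plain product with
  \<open>borel\<close> can be used. The order of the arguments in the pair suits Fubini on
  \<open>M\<close> and \<open>lborel\<close>.\<close>

definition prog :: "(real \<Rightarrow> 'a \<Rightarrow> real) \<Rightarrow> bool" where
  "prog X \<longleftrightarrow> (\<forall>t. 0 \<le> t \<and> t < T \<longrightarrow>
    (\<lambda>x. indicator {0..t} (snd x) * X (snd x) (fst x)) \<in> borel_measurable (F t \<Otimes>\<^sub>M borel))"

lemma progD: "prog X \<Longrightarrow> 0 \<le> t \<Longrightarrow> t < T \<Longrightarrow>
    (\<lambda>x. indicator {0..t} (snd x) * X (snd x) (fst x)) \<in> borel_measurable (F t \<Otimes>\<^sub>M borel)"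
  by (auto simp: prog_def)

lemma times_below_T:
  obtains c :: "nat \<Rightarrow> real" where "\<And>k. 0 < c k" "\<And>k. c k < T" "c \<longlonglongrightarrow> T"
proof
  show "0 < T - T / real (Suc (Suc k))" "T - T / real (Suc (Suc k)) < T" for k
    using T_pos by (auto simp: field_simps add_pos_nonneg)
  have "(\<lambda>k. T - T / real (Suc (Suc k))) \<longlonglongrightarrow> T - 0"
    by (intro tendsto_diff tendsto_const) (rule LIMSEQ_Suc, rule LIMSEQ_Suc, rule lim_const_over_n)
  then show "(\<lambda>k. T - T / real (Suc (Suc k))) \<longlonglongrightarrow> T" by simp
qed

lemma prog_measurable_T:
  assumes X: "prog X"
  shows "(\<lambda>x. indicator {0..<T} (snd x) * X (snd x) (fst x)) \<in> borel_measurable (F T \<Otimes>\<^sub>M borel)"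
proof -
  obtain c :: "nat \<Rightarrow> real" where c: "\<And>k. 0 < c k" "\<And>k. c k < T" "c \<longlonglongrightarrow> T" using times_below_T by blast
  show ?thesis
  proof (rule borel_measurable_LIMSEQ_real)
    show "(\<lambda>x. indicator {0..c k} (snd x) * X (snd x) (fst x)) \<in> borel_measurable (F T \<Otimes>\<^sub>M borel)" for k
    proof (rule measurable_pair_subalgebra)
      show "(\<lambda>x. indicator {0..c k} (snd x) * X (snd x) (fst x)) \<in> borel_measurable (F (c k) \<Otimes>\<^sub>M borel)"
        using c(1,2)[of k] by (intro progD X) auto
      show "subalgebra (F T) (F (c k))" using filtration c(1,2)[of k] by (auto simp: is_filtration_def)
    qed
    show "(\<lambda>k. indicator {0..c k} (snd x) * X (snd x) (fst x)) \<longlonglongrightarrow> indicator {0..<T} (snd x) * X (snd x) (fst x)" for x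
    proof (intro tendsto_mult tendsto_const)
      show "(\<lambda>k. indicator {0..c k} (snd x) :: real) \<longlonglongrightarrow> indicator {0..<T} (snd x)"
      proof (cases "snd x < T")
        case True
        then have "eventually (\<lambda>k. snd x < c k) sequentially" using c(3) by (intro order_tendstoD)
        then show ?thesis using True by (intro tendsto_eventually) (auto elim!: eventually_mono simp: indicator_def)
      next
        case False
        then have "snd x \<notin> {0..c k}" for k using c(2)[of k] by auto
        then show ?thesis using False by simp
      qed
    qed
  qed
qed

lemma prog_measurable_M:
  assumes X: "prog X"
  shows "(\<lambda>x. indicator {0..<T} (snd x) * X (snd x) (fst x)) \<in> borel_measurable (M \<Otimes>\<^sub>M borel)"
  using T_pos by (intro measurable_pair_subalgebra[OF prog_measurable_T[OF X] subalgebra_F]) auto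

lemma prog_path_measurable:
  assumes X: "prog X" and w: "\<omega> \<in> space M"
  shows "(\<lambda>u. indicator {0..<T} u * X u \<omega>) \<in> borel_measurable borel"
  using measurable_compose[OF measurable_Pair1'[OF w] prog_measurable_M[OF X]] by simp

lemma prog_comp:
  assumes X: "prog X" and G: "G \<in> borel_measurable borel" shows "prog (\<lambda>u \<omega>. G (X u \<omega>))"
  unfolding prog_def
proof (intro allI impI)
  fix t assume t: "0 \<le> t \<and> t < T"
  have [measurable]: "(\<lambda>x. indicator {0..t} (snd x) * X (snd x) (fst x)) \<in> borel_measurable (F t \<Otimes>\<^sub>M borel)"
    using t by (intro progD X) auto
  note G[measurable]
  have "(\<lambda>x. indicator {0..t} (snd x) * G (indicator {0..t} (snd x) * X (snd x) (fst x))) \<in> borel_measurable (F t \<Otimes>\<^sub>M borel)"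
    by measurable
  moreover have "(\<lambda>x. indicator {0..t} (snd x) * G (indicator {0..t} (snd x) * X (snd x) (fst x))) = (\<lambda>x. indicator {0..t} (snd x) * G (X (snd x) (fst x)))"
    by (auto simp: indicator_def)
  ultimately show "(\<lambda>x. indicator {0..t} (snd x) * G (X (snd x) (fst x))) \<in> borel_measurable (F t \<Otimes>\<^sub>M borel)" by simp
qed

lemma prog_mult:
  assumes X: "prog X" and Y: "prog Y" shows "prog (\<lambda>u \<omega>. X u \<omega> * Y u \<omega>)"
  unfolding prog_def
proof (intro allI impI)
  fix t assume t: "0 \<le> t \<and> t < T"
  have [measurable]: "(\<lambda>x. indicator {0..t} (snd x) * X (snd x) (fst x)) \<in> borel_measurable (F t \<Otimes>\<^sub>M borel)"
    "(\<lambda>x. indicator {0..t} (snd x) * Y (snd x) (fst x)) \<in> borel_measurable (F t \<Otimes>\<^sub>M borel)"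
    using t X Y by (auto intro: progD)
  have "(\<lambda>x. (indicator {0..t} (snd x) * X (snd x) (fst x)) * (indicator {0..t} (snd x) * Y (snd x) (fst x))) \<in> borel_measurable (F t \<Otimes>\<^sub>M borel)"
    by measurable
  moreover have "(\<lambda>x. (indicator {0..t} (snd x) * X (snd x) (fst x)) * (indicator {0..t} (snd x) * Y (snd x) (fst x))) =
      (\<lambda>x. indicator {0..t} (snd x) * (X (snd x) (fst x) * Y (snd x) (fst x)))"
    by (auto simp: indicator_def)
  ultimately show "(\<lambda>x. indicator {0..t} (snd x) * (X (snd x) (fst x) * Y (snd x) (fst x))) \<in> borel_measurable (F t \<Otimes>\<^sub>M borel)" by simp
qed

lemma prog_lim:
  fixes X :: "nat \<Rightarrow> real \<Rightarrow> 'a \<Rightarrow> real"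
  assumes X: "\<And>n. prog (X n)" shows "prog (\<lambda>t \<omega>. lim (\<lambda>n. X n t \<omega>))"
  unfolding prog_def
proof (intro allI impI)
  fix t assume t: "0 \<le> t \<and> t < T"
  have "(\<lambda>x. indicator {0..t} (snd x) * X n (snd x) (fst x)) \<in> borel_measurable (F t \<Otimes>\<^sub>M borel)" for n
    using t X by (auto intro: progD)
  then have [measurable]: "(\<lambda>x. lim (\<lambda>n. indicator {0..t} (snd x) * X n (snd x) (fst x))) \<in> borel_measurable (F t \<Otimes>\<^sub>M borel)"
    by (rule borel_measurable_lim_metric)
  have "(\<lambda>x. indicator {0..t} (snd x) * lim (\<lambda>n. indicator {0..t} (snd x) * X n (snd x) (fst x))) \<in> borel_measurable (F t \<Otimes>\<^sub>M borel)"
    by measurable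
  moreover have "indicator {0..t} u * lim (\<lambda>n. indicator {0..t} u * X n u \<omega>) = indicator {0..t} u * lim (\<lambda>n. X n u \<omega>)" for u \<omega>
    by (cases "u \<in> {0..t}") auto
  ultimately show "(\<lambda>x. indicator {0..t} (snd x) * lim (\<lambda>n. X n (snd x) (fst x))) \<in> borel_measurable (F t \<Otimes>\<^sub>M borel)" by simp
qed

lemma prog_set_integral_measurable:
  assumes X: "prog X" and t: "0 \<le> t" "t < T"
  shows "(\<lambda>\<omega>. LINT u:{0..t}|lborel. X u \<omega>) \<in> borel_measurable (F t)"
proof -
  have "(\<lambda>x. indicator {0..t} (snd x) * X (snd x) (fst x)) \<in> borel_measurable (F t \<Otimes>\<^sub>M lborel)"
    unfolding borel_measurable_pair_lborel_iff by (rule progD[OF X t])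
  then have "(\<lambda>(\<omega>, u). indicator {0..t} u * X u \<omega>) \<in> borel_measurable (F t \<Otimes>\<^sub>M lborel)"
    by (simp add: split_beta')
  from lborel.borel_measurable_lebesgue_integral[OF this] show ?thesis
    by (simp add: set_lebesgue_integral_def)
qed

text \<open>Each time is approximated from the right by dyadic points, where adaptedness gives
  measurability; right continuity is precisely what makes these values converge.\<close>

lemma prog_right_continuous:
  assumes ad: "adapted_before F T X"
    and rc: "\<And>\<omega> t. \<omega> \<in> space M \<Longrightarrow> t \<in> {0..<T} \<Longrightarrow> ((\<lambda>s. X s \<omega>) \<longlongrightarrow> X t \<omega>) (at_right t)"
  shows "prog X"
  unfolding prog_def
proof (intro allI impI)
  fix t assume t: "0 \<le> t \<and> t < T"
  \<comment> \<open>The right end of a dyadic cell, capped at \<open>t\<close>. The cap keeps the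
    value measurable for \<open>F t\<close>.\<close>
  define h where "h \<equiv> \<lambda>(k::nat) (i::int). max 0 (min t ((real_of_int i + 1) / 2 ^ k))"
  show "(\<lambda>x. indicator {0..t} (snd x) * X (snd x) (fst x)) \<in> borel_measurable (F t \<Otimes>\<^sub>M borel)"
  proof (rule borel_measurable_LIMSEQ_real)
    fix k
    have [measurable]: "X (h k i) \<in> borel_measurable (F t)" for i
    proof -
      have "0 \<le> h k i" "h k i \<le> t" using t by (auto simp: h_def)
      then show ?thesis using t ad by (intro measurable_F_mono[OF adaptedD]) auto
    qed
    have [measurable]: "(\<lambda>x. X (h k \<lfloor>(2::real) ^ k * snd x\<rfloor>) (fst x)) \<in> borel_measurable (F t \<Otimes>\<^sub>M borel)"
      by (rule measurable_compose_countable[where f="\<lambda>i x. X (h k i) (fst x)" and g="\<lambda>x. \<lfloor>(2::real) ^ k * snd x\<rfloor>"]) measurable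
    show "(\<lambda>x. indicator {0..t} (snd x) * X (h k \<lfloor>(2::real) ^ k * snd x\<rfloor>) (fst x)) \<in> borel_measurable (F t \<Otimes>\<^sub>M borel)"
      by measurable
  next
    fix x :: "'a \<times> real" assume x: "x \<in> space (F t \<Otimes>\<^sub>M borel)"
    then have w: "fst x \<in> space M" using t by (auto simp: space_pair_measure)
    define u where "u = snd x"
    show "(\<lambda>k. indicator {0..t} (snd x) * X (h k \<lfloor>(2::real) ^ k * snd x\<rfloor>) (fst x)) \<longlonglongrightarrow> indicator {0..t} (snd x) * X (snd x) (fst x)"
    proof (cases "u \<in> {0..t}")
      case True
      have lo: "u \<le> h k \<lfloor>2 ^ k * u\<rfloor>" and hi: "h k \<lfloor>2 ^ k * u\<rfloor> \<le> u + (1 / 2) ^ k" for k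
      proof -
        have "2 ^ k * u \<le> real_of_int \<lfloor>2 ^ k * u\<rfloor> + 1" "real_of_int \<lfloor>2 ^ k * u\<rfloor> \<le> 2 ^ k * u" by linarith+
        then have "u \<le> (real_of_int \<lfloor>2 ^ k * u\<rfloor> + 1) / 2 ^ k" "(real_of_int \<lfloor>2 ^ k * u\<rfloor> + 1) / 2 ^ k \<le> u + (1 / 2) ^ k"
          by (auto simp: field_simps power_divide)
        then show "u \<le> h k \<lfloor>2 ^ k * u\<rfloor>" "h k \<lfloor>2 ^ k * u\<rfloor> \<le> u + (1 / 2) ^ k"
          using True by (auto simp: h_def)
      qed
      have "(\<lambda>k. h k \<lfloor>2 ^ k * u\<rfloor>) \<longlonglongrightarrow> u"
      proof (rule tendsto_sandwich[where f="\<lambda>_. u" and h="\<lambda>k. u + (1 / 2) ^ k"])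
        have "(\<lambda>k. u + (1 / 2) ^ k) \<longlonglongrightarrow> u + 0"
          by (intro tendsto_add tendsto_const LIMSEQ_power_zero) auto
        then show "(\<lambda>k. u + (1 / 2) ^ k) \<longlonglongrightarrow> u" by simp
      qed (use lo hi in auto)
      then have "(\<lambda>k. X (h k \<lfloor>2 ^ k * u\<rfloor>) (fst x)) \<longlonglongrightarrow> X u (fst x)"
        using True t by (intro right_continuous_sequentially[where x="\<lambda>s. X s (fst x)"] rc w lo) auto
      then show ?thesis by (auto simp: u_def intro: tendsto_mult)
    qed (simp add: u_def)
  qed
qed

text \<open>The value at the random grid time is a finite sum, and each summand can be moved to the
  terminal time \<open>t\<close> by the martingale property.\<close>

lemma optional_sampling:
  fixes g :: "nat \<Rightarrow> real"
  assumes R: "mart R" and s: "0 \<le> s" and t: "t < T" and g: "\<And>i. i \<le> n \<Longrightarrow> s \<le> g i \<and> g i \<le> t"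
    and I: "\<And>\<omega>. \<omega> \<in> space M \<Longrightarrow> I \<omega> \<le> n" "\<And>i. i \<le> n \<Longrightarrow> {\<omega> \<in> space M. I \<omega> = i} \<in> sets (F (g i))"
  shows "integrable M (\<lambda>\<omega>. R (g (I \<omega>)) \<omega>)"
    "\<And>B. B \<in> sets (F s) \<Longrightarrow> (\<integral>\<omega>. indicator B \<omega> * R (g (I \<omega>)) \<omega> \<partial>M) = (\<integral>\<omega>. indicator B \<omega> * R s \<omega> \<partial>M)"
    "\<And>d. (\<integral>\<omega>. indicator {\<omega>. d < \<bar>R (g (I \<omega>)) \<omega>\<bar>} \<omega> * \<bar>R (g (I \<omega>)) \<omega>\<bar> \<partial>M)
      \<le> (\<integral>\<omega>. indicator {\<omega>. d < \<bar>R (g (I \<omega>)) \<omega>\<bar>} \<omega> * \<bar>R t \<omega>\<bar> \<partial>M)"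
proof -
  have st: "s \<le> t" using g[of 0] by auto
  let ?E = "\<lambda>i. {\<omega> \<in> space M. I \<omega> = i}"
  have g0: "0 \<le> g i" "g i < T" if "i \<le> n" for i using g[OF that] s t by auto
  have EM: "?E i \<in> sets M" if "i \<le> n" for i using I(2)[OF that] sets_F_M[OF g0(1)[OF that]] by auto
  have iR: "integrable M (R u)" if "0 \<le> u" "u < T" for u using R that by (auto simp: martingale_before_def)
  have Rm: "R u \<in> borel_measurable (F u)" if "0 \<le> u" "u < T" for u using R that by (auto simp: martingale_before_def intro: adaptedD)
  have dec: "V (I \<omega>) \<omega> = (\<Sum>i\<le>n. indicator (?E i) \<omega> * V i \<omega>)" if "\<omega> \<in> space M" for V :: "nat \<Rightarrow> 'a \<Rightarrow> real" and \<omega>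
    using I(1)[OF that] that by (simp add: indicator_def if_distrib[of "\<lambda>x. x * _"] sum.delta cong: if_cong)
  have int_dec: "(\<integral>\<omega>. V (I \<omega>) \<omega> \<partial>M) = (\<Sum>i\<le>n. \<integral>\<omega>. indicator (?E i) \<omega> * V i \<omega> \<partial>M)"
      "integrable M (\<lambda>\<omega>. V (I \<omega>) \<omega>)"
    if V: "\<And>i. i \<le> n \<Longrightarrow> integrable M (V i)" for V :: "nat \<Rightarrow> 'a \<Rightarrow> real"
  proof -
    have i: "integrable M (\<lambda>\<omega>. indicator (?E i) \<omega> * V i \<omega>)" if "i \<le> n" for i
      using V EM that by (intro integrable_indicator_mult) auto
    have "(\<integral>\<omega>. V (I \<omega>) \<omega> \<partial>M) = (\<integral>\<omega>. (\<Sum>i\<le>n. indicator (?E i) \<omega> * V i \<omega>) \<partial>M)"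
      by (rule Bochner_Integration.integral_cong) (auto simp: dec)
    also have "\<dots> = (\<Sum>i\<le>n. \<integral>\<omega>. indicator (?E i) \<omega> * V i \<omega> \<partial>M)"
      by (rule Bochner_Integration.integral_sum) (use i in auto)
    finally show "(\<integral>\<omega>. V (I \<omega>) \<omega> \<partial>M) = (\<Sum>i\<le>n. \<integral>\<omega>. indicator (?E i) \<omega> * V i \<omega> \<partial>M)" .
    have "integrable M (\<lambda>\<omega>. (\<Sum>i\<le>n. indicator (?E i) \<omega> * V i \<omega>))"
      by (rule Bochner_Integration.integrable_sum) (use i in auto)
    then show "integrable M (\<lambda>\<omega>. V (I \<omega>) \<omega>)"
      by (rule Bochner_Integration.integrable_cong[THEN iffD1, rotated -1]) (auto simp: dec)
  qed
  show "integrable M (\<lambda>\<omega>. R (g (I \<omega>)) \<omega>)"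
    using int_dec(2)[of "\<lambda>i. R (g i)"] iR g0 by auto
  show "(\<integral>\<omega>. indicator B \<omega> * R (g (I \<omega>)) \<omega> \<partial>M) = (\<integral>\<omega>. indicator B \<omega> * R s \<omega> \<partial>M)" if B: "B \<in> sets (F s)" for B
  proof -
    have BM: "B \<in> sets M" using B sets_F_M[OF s] by auto
    have "(\<integral>\<omega>. indicator B \<omega> * R (g (I \<omega>)) \<omega> \<partial>M) = (\<Sum>i\<le>n. \<integral>\<omega>. indicator (?E i) \<omega> * (indicator B \<omega> * R (g i) \<omega>) \<partial>M)"
      using int_dec(1)[of "\<lambda>i \<omega>. indicator B \<omega> * R (g i) \<omega>"] iR g0 BM integrable_indicator_mult by auto
    also have "\<dots> = (\<Sum>i\<le>n. \<integral>\<omega>. indicator (?E i) \<omega> * (indicator B \<omega> * R t \<omega>) \<partial>M)"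
    proof (rule sum.cong[OF refl])
      fix i assume "i \<in> {..n}"
      then have i: "i \<le> n" by simp
      have "?E i \<inter> B \<in> sets (F (g i))" using I(2)[OF i] B sets_F_mono[OF s, of "g i"] g[OF i] by auto
      from mart_indicator_integral[OF R g0(1)[OF i] _ t this] g[OF i]
      show "(\<integral>\<omega>. indicator (?E i) \<omega> * (indicator B \<omega> * R (g i) \<omega>) \<partial>M) = (\<integral>\<omega>. indicator (?E i) \<omega> * (indicator B \<omega> * R t \<omega>) \<partial>M)"
        by (simp add: indicator_inter_arith mult.assoc)
    qed
    also have "\<dots> = (\<integral>\<omega>. indicator B \<omega> * R t \<omega> \<partial>M)"
      using int_dec(1)[of "\<lambda>i \<omega>. indicator B \<omega> * R t \<omega>"] iR[of t] s st t BM integrable_indicator_mult by auto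
    also have "\<dots> = (\<integral>\<omega>. indicator B \<omega> * R s \<omega> \<partial>M)"
      using mart_indicator_integral[OF R s st t B] by simp
    finally show ?thesis .
  qed
  fix d :: real
  have t0: "0 \<le> t" using s st by simp
  let ?V = "\<lambda>U i \<omega>. indicator {\<omega> \<in> space M. d < \<bar>R (g i) \<omega>\<bar>} \<omega> * U i \<omega>"
  have S: "{\<omega> \<in> space M. d < \<bar>R (g i) \<omega>\<bar>} \<in> sets (F (g i))" if "i \<le> n" for i
  proof -
    note Rm[OF g0[OF that], measurable]
    have "{\<omega> \<in> space (F (g i)). d < \<bar>R (g i) \<omega>\<bar>} \<in> sets (F (g i))" by measurable
    then show ?thesis using g0[OF that] by simp
  qed
  have SM: "{\<omega> \<in> space M. d < \<bar>R (g i) \<omega>\<bar>} \<in> sets M" if "i \<le> n" for i using S[OF that] sets_F_M[OF g0(1)[OF that]] by auto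
  have *: "(\<integral>\<omega>. indicator {\<omega>. d < \<bar>R (g (I \<omega>)) \<omega>\<bar>} \<omega> * U (I \<omega>) \<omega> \<partial>M) = (\<Sum>i\<le>n. \<integral>\<omega>. indicator (?E i) \<omega> * ?V U i \<omega> \<partial>M)"
    if "\<And>i. i \<le> n \<Longrightarrow> integrable M (U i)" for U :: "nat \<Rightarrow> 'a \<Rightarrow> real"
  proof -
    have "(\<integral>\<omega>. indicator {\<omega>. d < \<bar>R (g (I \<omega>)) \<omega>\<bar>} \<omega> * U (I \<omega>) \<omega> \<partial>M) = (\<integral>\<omega>. ?V U (I \<omega>) \<omega> \<partial>M)"
      by (rule Bochner_Integration.integral_cong) (auto simp: indicator_def)
    also have "\<dots> = (\<Sum>i\<le>n. \<integral>\<omega>. indicator (?E i) \<omega> * ?V U i \<omega> \<partial>M)"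
      by (rule int_dec(1)) (use that SM in \<open>auto intro!: integrable_indicator_mult\<close>)
    finally show ?thesis .
  qed
  have "(\<integral>\<omega>. indicator {\<omega>. d < \<bar>R (g (I \<omega>)) \<omega>\<bar>} \<omega> * \<bar>R (g (I \<omega>)) \<omega>\<bar> \<partial>M) = (\<Sum>i\<le>n. \<integral>\<omega>. indicator (?E i) \<omega> * ?V (\<lambda>i \<omega>. \<bar>R (g i) \<omega>\<bar>) i \<omega> \<partial>M)"
    by (rule *) (use iR g0 in auto)
  also have "\<dots> \<le> (\<Sum>i\<le>n. \<integral>\<omega>. indicator (?E i) \<omega> * ?V (\<lambda>i \<omega>. \<bar>R t \<omega>\<bar>) i \<omega> \<partial>M)"
  proof (rule sum_mono)
    fix i assume "i \<in> {..n}"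
    then have i: "i \<le> n" by simp
    have "?E i \<inter> {\<omega> \<in> space M. d < \<bar>R (g i) \<omega>\<bar>} \<in> sets (F (g i))" using I(2)[OF i] S[OF i] by auto
    from mart_abs_indicator_integral[OF R g0(1)[OF i] _ t this] g[OF i]
    show "(\<integral>\<omega>. indicator (?E i) \<omega> * ?V (\<lambda>i \<omega>. \<bar>R (g i) \<omega>\<bar>) i \<omega> \<partial>M) \<le> (\<integral>\<omega>. indicator (?E i) \<omega> * ?V (\<lambda>i \<omega>. \<bar>R t \<omega>\<bar>) i \<omega> \<partial>M)"
      by (simp add: indicator_inter_arith mult.assoc)
  qed
  also have "\<dots> = (\<integral>\<omega>. indicator {\<omega>. d < \<bar>R (g (I \<omega>)) \<omega>\<bar>} \<omega> * \<bar>R t \<omega>\<bar> \<partial>M)"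
    by (rule *[symmetric]) (use iR[OF t0 t] in auto)
  finally show "(\<integral>\<omega>. indicator {\<omega>. d < \<bar>R (g (I \<omega>)) \<omega>\<bar>} \<omega> * \<bar>R (g (I \<omega>)) \<omega>\<bar> \<partial>M)
      \<le> (\<integral>\<omega>. indicator {\<omega>. d < \<bar>R (g (I \<omega>)) \<omega>\<bar>} \<omega> * \<bar>R t \<omega>\<bar> \<partial>M)" .
qed

end

section \<open>Processes with a drift\<close>

lemma right_continuous_of_increments:
  fixes x r f :: "real \<Rightarrow> real"
  assumes t: "t < T" and r: "(r \<longlongrightarrow> r t) (at_right t)"
    and dyn: "\<And>s. t \<le> s \<Longrightarrow> s < T \<Longrightarrow>
      set_integrable lborel {t..s} f \<and> x s = x t + (LINT u:{t..s}|lborel. f u) + (r s - r t)"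
  shows "(x \<longlongrightarrow> x t) (at_right t)"
proof -
  define e where "e = (t + T) / 2"
  have e: "t < e" "e < T" using t by (auto simp: e_def)
  have "continuous_on {t..e} (\<lambda>s. LINT u:{t..s}|lborel. f u)"
    using dyn[of e] e by (intro continuous_on_indefinite_set_integral) auto
  then have "((\<lambda>s. LINT u:{t..s}|lborel. f u) \<longlongrightarrow> (LINT u:{t..t}|lborel. f u)) (at_right t)"
    using e by (auto simp: continuous_on_def at_within_Icc_at_right dest!: bspec[of _ _ t])
  moreover have "(LINT u:{t..t}|lborel. f u) = 0" using dyn[of t] t by simp
  ultimately have "((\<lambda>s. x t + (LINT u:{t..s}|lborel. f u) + (r s - r t)) \<longlongrightarrow> x t + 0 + (r t - r t)) (at_right t)"
    using r by (intro tendsto_intros) auto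
  then have "((\<lambda>s. x t + (LINT u:{t..s}|lborel. f u) + (r s - r t)) \<longlongrightarrow> x t) (at_right t)" by simp
  then show ?thesis
  proof (rule Lim_transform_eventually)
    show "\<forall>\<^sub>F s in at_right t. x t + (LINT u:{t..s}|lborel. f u) + (r s - r t) = x s"
      unfolding eventually_at_right[OF e(1)]
    proof (intro exI[of _ e] conjI allI impI)
      fix s assume s: "t < s" "s < e"
      have "x s = x t + (LINT u:{t..s}|lborel. f u) + (r s - r t)" by (rule dyn[THEN conjunct2]) (use s e in auto)
      then show "x t + (LINT u:{t..s}|lborel. f u) + (r s - r t) = x s" by simp
    qed (rule e)
  qed
qed

text \<open>The right endpoint is excluded because sign information about a path is only available
  strictly before the stopping time, and step functions on a grid agree only on half-open
  cells.\<close>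

lemma set_integral_mono_except_point:
  fixes f g :: "real \<Rightarrow> real"
  assumes "set_integrable lborel {s..t} f" "set_integrable lborel {s..t} g"
    "\<And>u. u \<in> {s..<t} \<Longrightarrow> f u \<le> g u"
  shows "(LINT u:{s..t}|lborel. f u) \<le> (LINT u:{s..t}|lborel. g u)"
  unfolding set_lebesgue_integral_def
proof (rule integral_mono_AE)
  show "AE u in lborel. indicator {s..t} u *\<^sub>R f u \<le> indicator {s..t} u *\<^sub>R g u"
    using AE_lborel_singleton[of t] by eventually_elim (use assms(3) in \<open>auto simp: indicator_def\<close>)
qed (use assms in \<open>auto simp: set_integrable_def\<close>)

context filtered_prob_space
begin

sublocale pair: pair_sigma_finite M lborel ..

lemma integrable_pair_bounded:
  fixes h :: "'a \<times> real \<Rightarrow> real"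
  assumes h: "h \<in> borel_measurable (M \<Otimes>\<^sub>M borel)" and b: "integrable lborel b"
    and le: "\<And>\<omega> u. \<omega> \<in> space M \<Longrightarrow> \<bar>h (\<omega>, u)\<bar> \<le> b u"
  shows "integrable (M \<Otimes>\<^sub>M lborel) h"
proof (rule pair.Fubini_integrable)
  show m: "h \<in> borel_measurable (M \<Otimes>\<^sub>M lborel)" using h by (simp add: borel_measurable_pair_lborel_iff)
  have i: "integrable lborel (\<lambda>u. h (\<omega>, u))" if "\<omega> \<in> space M" for \<omega>
    using le[OF that] measurable_compose[OF measurable_Pair1'[OF that] m]
    by (intro Bochner_Integration.integrable_bound[OF b] AE_I2) (auto intro: order_trans[OF _ abs_ge_self])
  then show "AE \<omega> in M. integrable lborel (\<lambda>u. h (\<omega>, u))" by auto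
  show "integrable M (\<lambda>\<omega>. \<integral>u. norm (h (\<omega>, u)) \<partial>lborel)"
  proof (rule integrable_const_bound)
    have "(\<lambda>(\<omega>, u). norm (h (\<omega>, u))) \<in> borel_measurable (M \<Otimes>\<^sub>M lborel)"
      using m by (simp add: split_beta')
    then show "(\<lambda>\<omega>. \<integral>u. norm (h (\<omega>, u)) \<partial>lborel) \<in> borel_measurable M"
      by (rule lborel.borel_measurable_lebesgue_integral)
    show "AE \<omega> in M. norm (\<integral>u. norm (h (\<omega>, u)) \<partial>lborel) \<le> (\<integral>u. b u \<partial>lborel)"
    proof (intro AE_I2)
      fix \<omega> assume w: "\<omega> \<in> space M"
      have "(\<integral>u. norm (h (\<omega>, u)) \<partial>lborel) \<le> (\<integral>u. b u \<partial>lborel)"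
        using i[OF w] le[OF w] b by (intro integral_mono integrable_norm) auto
      then show "norm (\<integral>u. norm (h (\<omega>, u)) \<partial>lborel) \<le> (\<integral>u. b u \<partial>lborel)" by simp
    qed
  qed
qed

text \<open>Along each path the process stays nonnegative up to the first time \<open>\<tau>\<close> at which it is
  nonpositive, so only there the drift bound is needed. The time \<open>\<tau>\<close> is the limit of first
  entrance times along refining grids, and uniform integrability of the stopped martingales
  replaces integrability of the drift.\<close>

theorem drift_nonpositive:
  fixes D R f :: "real \<Rightarrow> 'a \<Rightarrow> real" and a :: "real \<Rightarrow> real"
  assumes D: "adapted_before F T D" and R: "mart R" "cadlag_before M T R"
    and a: "set_integrable lborel {0..T} a" "a \<in> borel_measurable borel" "\<And>u. 0 \<le> a u" and L: "0 \<le> L"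
    and dyn: "AE \<omega> in M. \<forall>s t. 0 \<le> s \<and> s \<le> t \<and> t < T \<longrightarrow> set_integrable lborel {s..t} (\<lambda>u. f u \<omega>) \<and>
        D t \<omega> = D s \<omega> + (LINT u:{s..t}|lborel. f u \<omega>) + (R t \<omega> - R s \<omega>)"
    and drift: "AE \<omega> in M. \<forall>u\<in>{0..<T}. 0 \<le> D u \<omega> \<longrightarrow> - (L * a u * D u \<omega>) \<le> f u \<omega>"
    and ub: "AE \<omega> in M. \<forall>u\<in>{0..<T}. D u \<omega> \<le> c"
    and lim: "AE \<omega> in M. ((\<lambda>t. max 0 (D t \<omega>)) \<longlongrightarrow> 0) (at_left T)"
  shows "AE \<omega> in M. \<forall>t\<in>{0..<T}. D t \<omega> \<le> 0"
proof -
  define Q where "Q \<equiv> \<lambda>\<omega>. (\<forall>s t. 0 \<le> s \<and> s \<le> t \<and> t < T \<longrightarrow> set_integrable lborel {s..t} (\<lambda>u. f u \<omega>) \<and>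
        D t \<omega> = D s \<omega> + (LINT u:{s..t}|lborel. f u \<omega>) + (R t \<omega> - R s \<omega>)) \<and>
      (\<forall>u\<in>{0..<T}. 0 \<le> D u \<omega> \<longrightarrow> - (L * a u * D u \<omega>) \<le> f u \<omega>) \<and> (\<forall>u\<in>{0..<T}. D u \<omega> \<le> c) \<and>
      ((\<lambda>t. max 0 (D t \<omega>)) \<longlongrightarrow> 0) (at_left T)"
  have "AE \<omega> in M. Q \<omega>" using dyn drift ub lim unfolding Q_def by eventually_elim blast
  from AE_good_set[OF this] obtain G where G: "\<And>t. 0 \<le> t \<Longrightarrow> G \<in> sets (F t)" "AE \<omega> in M. \<omega> \<in> G"
    "\<And>\<omega>. \<omega> \<in> G \<Longrightarrow> Q \<omega>" "G \<subseteq> space M" by blast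
  have Gdyn: "set_integrable lborel {s..t} (\<lambda>u. f u \<omega>)" "D t \<omega> = D s \<omega> + (LINT u:{s..t}|lborel. f u \<omega>) + (R t \<omega> - R s \<omega>)"
    if "\<omega> \<in> G" "0 \<le> s" "s \<le> t" "t < T" for s t \<omega> using G(3)[OF that(1)] that unfolding Q_def by blast+
  have Gdrift: "- (L * a u * D u \<omega>) \<le> f u \<omega>" if "\<omega> \<in> G" "0 \<le> u" "u < T" "0 \<le> D u \<omega>" for u \<omega>
    using G(3)[OF that(1)] that unfolding Q_def by auto
  have Gub: "D u \<omega> \<le> c" if "\<omega> \<in> G" "0 \<le> u" "u < T" for u \<omega>
    using G(3)[OF that(1)] that unfolding Q_def by auto
  have Rrc: "((\<lambda>s. R s \<omega>) \<longlongrightarrow> R t \<omega>) (at_right t)" if "\<omega> \<in> space M" "0 \<le> t" "t < T" for t \<omega>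
    using R(2) that by (auto simp: cadlag_before_def)
  \<comment> \<open>Setting \<open>D\<close> to 0 on the exceptional null set makes right continuity
    and the upper bound valid on every path.\<close>
  define D' where "D' \<equiv> \<lambda>t \<omega>. if \<omega> \<in> G then D t \<omega> else 0"
  define c' where "c' = max c 0"
  define P where "P \<equiv> \<lambda>t \<omega>. max 0 (D' t \<omega>)"
  have P01: "0 \<le> P t \<omega>" for t \<omega> by (simp add: P_def)
  have Pc: "P t \<omega> \<le> c'" if "0 \<le> t" "t < T" for t \<omega> using Gub[of \<omega> t] that by (auto simp: P_def D'_def c'_def)
  have D'm: "D' t \<in> borel_measurable (F t)" if "0 \<le> t" "t < T" for t
  proof -
    have "D' t = (\<lambda>\<omega>. indicator G \<omega> * D t \<omega>)" by (auto simp: D'_def indicator_def)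
    then show ?thesis using adaptedD[OF D that] G(1)[OF that(1)] by auto
  qed
  have D'rc: "((\<lambda>s. D' s \<omega>) \<longlongrightarrow> D' t \<omega>) (at_right t)" if w: "\<omega> \<in> space M" and t: "t \<in> {0..<T}" for t \<omega>
  proof (cases "\<omega> \<in> G")
    case True
    have "((\<lambda>s. D s \<omega>) \<longlongrightarrow> D t \<omega>) (at_right t)"
    proof (rule right_continuous_of_increments[where T=T and r="\<lambda>s. R s \<omega>" and f="\<lambda>u. f u \<omega>"])
      show "((\<lambda>s. R s \<omega>) \<longlongrightarrow> R t \<omega>) (at_right t)" using t by (intro Rrc[OF w]) auto
      show "set_integrable lborel {t..s} (\<lambda>u. f u \<omega>) \<and> D s \<omega> = D t \<omega> + (LINT u:{t..s}|lborel. f u \<omega>) + (R s \<omega> - R t \<omega>)"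
        if "t \<le> s" "s < T" for s using t that by (intro conjI Gdyn[OF True]) auto
    qed (use t in auto)
    then show ?thesis using True by (simp add: D'_def)
  qed (simp add: D'_def)
  have adD': "adapted_before F T D'" using D'm by (auto simp: adapted_before_def)
  have progP: "prog P"
    unfolding P_def by (rule prog_comp[OF prog_right_continuous[OF adD' D'rc]]) auto
  \<comment> \<open>The mean of the positive part; the goal is to show that it vanishes. The
    indicator makes it a measurable function on the whole line.\<close>
  define \<delta> where "\<delta> \<equiv> \<lambda>u. \<integral>\<omega>. indicator {0..<T} u * P u \<omega> \<partial>M"
  have \<delta>m: "\<delta> \<in> borel_measurable borel"
  proof -
    have "(\<lambda>(u, \<omega>). indicator {0..<T} u * P u \<omega>) \<in> borel_measurable (borel \<Otimes>\<^sub>M M)"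
      using measurable_compose[OF measurable_pair_swap' prog_measurable_M[OF progP]] by (simp add: split_beta')
    then show ?thesis unfolding \<delta>_def by (rule borel_measurable_lebesgue_integral)
  qed
  have Pm: "P t \<in> borel_measurable M" if "0 \<le> t" "t < T" for t
    unfolding P_def using measurable_F_M[OF D'm[OF that] that(1)] by simp
  have Pi: "integrable M (P t)" if "0 \<le> t" "t < T" for t
    using Pm[OF that] Pc[OF that] P01 by (intro integrable_const_bound[where B=c']) auto
  have \<delta>E: "\<delta> t = (\<integral>\<omega>. P t \<omega> \<partial>M)" if "0 \<le> t" "t < T" for t using that by (simp add: \<delta>_def)
  have c'0: "0 \<le> c'" by (simp add: c'_def)
  have \<delta>b: "\<delta> t \<in> {0..c'}" if "0 \<le> t" "t < T" for t
  proof -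
    have "(\<integral>\<omega>. P t \<omega> \<partial>M) \<le> (\<integral>\<omega>. c' \<partial>M)" using Pi[OF that] Pc[OF that] by (intro integral_mono) auto
    then show ?thesis using P01 \<delta>E[OF that] by (simp add: prob_space)
  qed
  have ai: "set_integrable lborel {s..t} a" if "0 \<le> s" "t < T" for s t
    using that by (intro set_integrable_subset[OF a(1)]) auto
  \<comment> \<open>A backward integral inequality for the mean of the positive part, ready for
    Gronwall. It is obtained by stopping at the first time in [s, t] at which \<open>D'\<close> is
    nonpositive.\<close>
  have key: "\<delta> s \<le> \<delta> t + L * (LINT u:{s..t}|lborel. a u * \<delta> u)" if s: "0 \<le> s" and st: "s \<le> t" and t: "t < T" for s t
  proof -
    define g where "g \<equiv> \<lambda>k i. s + (t - s) * real i / 2 ^ k"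
    \<comment> \<open>The index of the first grid time with \<open>D'\<close> nonpositive; the last
      index \<open>2 ^ k\<close>, that is time \<open>t\<close>, is the default when there is
      none.\<close>
    define I where "I \<equiv> \<lambda>k \<omega>. LEAST i. i = 2 ^ k \<or> D' (g k i) \<omega> \<le> 0"
    have I_le: "I k \<omega> \<le> 2 ^ k" for k \<omega> unfolding I_def by (rule Least_le) simp
    have I_least: "I k \<omega> \<le> i" if "i = 2 ^ k \<or> D' (g k i) \<omega> \<le> 0" for k \<omega> i
      unfolding I_def using that by (rule Least_le)
    have I_prop: "I k \<omega> = 2 ^ k \<or> D' (g k (I k \<omega>)) \<omega> \<le> 0" for k \<omega>
      unfolding I_def by (rule LeastI[of "\<lambda>i. i = 2 ^ k \<or> D' (g k i) \<omega> \<le> 0" "2 ^ k"]) simp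
    have g_st: "s \<le> g k i \<and> g k i \<le> t" if "i \<le> 2 ^ k" for k i
    proof -
      have "real i \<le> real (2 ^ k)" using that by (rule of_nat_mono)
      then have "real i / 2 ^ k \<le> 1" by simp
      then have "(t - s) * (real i / 2 ^ k) \<le> (t - s) * 1" using st by (intro mult_left_mono) auto
      then show ?thesis using st by (simp add: g_def)
    qed
    have g_mono: "g k i \<le> g k j" if "i \<le> j" for k i j
      using st that by (simp add: g_def divide_right_mono mult_left_mono)
    have Iset: "{\<omega> \<in> space M. I k \<omega> = i} \<in> sets (F (g k i))" if i: "i \<le> 2 ^ k" for k i
    proof -
      have gi: "0 \<le> g k i" "g k i < T" using g_st[OF i] s t by auto
      have [measurable]: "D' (g k (min j i)) \<in> borel_measurable (F (g k i))" for j
      proof -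
        have "min j i \<le> 2 ^ k" using i by auto
        then show ?thesis
          using g_st[of "min j i" k] s t g_mono[of "min j i" i k] by (intro measurable_F_mono[OF D'm]) auto
      qed
      have [measurable]: "D' (g k i) \<in> borel_measurable (F (g k i))" by (rule D'm[OF gi])
      \<comment> \<open>Writing \<open>min j i\<close> keeps every clause, also for
        \<open>j \<ge> i\<close>, measurable for \<open>F (g k i)\<close>; under
        \<open>j < i\<close> it is just \<open>j\<close>.\<close>
      have "I k \<omega> = i \<longleftrightarrow> (i = 2 ^ k \<or> D' (g k i) \<omega> \<le> 0) \<and> (\<forall>j. j < i \<longrightarrow> \<not> (j = 2 ^ k \<or> D' (g k (min j i)) \<omega> \<le> 0))" for \<omega>
      proof
        assume i: "I k \<omega> = i"
        show "(i = 2 ^ k \<or> D' (g k i) \<omega> \<le> 0) \<and> (\<forall>j. j < i \<longrightarrow> \<not> (j = 2 ^ k \<or> D' (g k (min j i)) \<omega> \<le> 0))"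
        proof (intro conjI allI impI notI)
          show "i = 2 ^ k \<or> D' (g k i) \<omega> \<le> 0" using I_prop[of k \<omega>] i by simp
          fix j assume "j < i" "j = 2 ^ k \<or> D' (g k (min j i)) \<omega> \<le> 0"
          then have "I k \<omega> \<le> j" by (intro I_least) (auto simp: min_def)
          then show False using \<open>j < i\<close> i by simp
        qed
      next
        assume *: "(i = 2 ^ k \<or> D' (g k i) \<omega> \<le> 0) \<and> (\<forall>j. j < i \<longrightarrow> \<not> (j = 2 ^ k \<or> D' (g k (min j i)) \<omega> \<le> 0))"
        show "I k \<omega> = i" unfolding I_def
        proof (rule Least_equality)
          fix j assume "j = 2 ^ k \<or> D' (g k j) \<omega> \<le> 0"
          then show "i \<le> j" using * by (cases "j < i") (auto simp: min_def)
        qed (use * in auto)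
      qed
      then have "{\<omega> \<in> space M. I k \<omega> = i} = {\<omega> \<in> space (F (g k i)). (i = 2 ^ k \<or> D' (g k i) \<omega> \<le> 0) \<and> (\<forall>j. j < i \<longrightarrow> \<not> (j = 2 ^ k \<or> D' (g k (min j i)) \<omega> \<le> 0))}"
        using gi by auto
      also have "\<dots> \<in> sets (F (g k i))" by measurable
      finally show ?thesis .
    qed
    define \<tau> where "\<tau> \<equiv> \<lambda>k \<omega>. g k (I k \<omega>)"
    have \<tau>_st: "s \<le> \<tau> k \<omega> \<and> \<tau> k \<omega> \<le> t" for k \<omega> unfolding \<tau>_def by (rule g_st[OF I_le])
    have dec: "decseq (\<lambda>k. \<tau> k \<omega>)" for \<omega>
    proof (rule decseq_SucI)
      fix k
      \<comment> \<open>Index \<open>2 * i\<close> of the finer grid is the same time as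
        \<open>i\<close>, so refinement can only make the entrance earlier.\<close>
      have r: "g (Suc k) (2 * i) = g k i" for i by (simp add: g_def)
      have "I (Suc k) \<omega> \<le> 2 * I k \<omega>"
        by (rule I_least) (use I_prop[of k \<omega>] in \<open>auto simp: r\<close>)
      then have "g (Suc k) (I (Suc k) \<omega>) \<le> g (Suc k) (2 * I k \<omega>)" by (rule g_mono)
      then show "\<tau> (Suc k) \<omega> \<le> \<tau> k \<omega>" by (simp add: \<tau>_def r)
    qed
    define \<theta> where "\<theta> \<equiv> \<lambda>\<omega>. lim (\<lambda>k. \<tau> k \<omega>)"
    have \<theta>: "(\<lambda>k. \<tau> k \<omega>) \<longlonglongrightarrow> \<theta> \<omega>" "\<theta> \<omega> \<le> \<tau> k \<omega>" for k \<omega>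
    proof -
      obtain l where l: "(\<lambda>k. \<tau> k \<omega>) \<longlonglongrightarrow> l" "\<And>k. l \<le> \<tau> k \<omega>"
        using decseq_convergent[OF dec[of \<omega>], of s] \<tau>_st by blast
      moreover have "\<theta> \<omega> = l" unfolding \<theta>_def by (rule limI[OF l(1)])
      ultimately show "(\<lambda>k. \<tau> k \<omega>) \<longlonglongrightarrow> \<theta> \<omega>" "\<theta> \<omega> \<le> \<tau> k \<omega>" by simp_all
    qed
    have \<theta>_st: "s \<le> \<theta> \<omega>" "\<theta> \<omega> \<le> t" for \<omega>
    proof -
      show "s \<le> \<theta> \<omega>" by (rule LIMSEQ_le_const[OF \<theta>(1)]) (use \<tau>_st in auto)
      show "\<theta> \<omega> \<le> t" by (rule order_trans[OF \<theta>(2)]) (use \<tau>_st in auto)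
    qed
    \<comment> \<open>\<open>S\<close> is the value of \<open>R\<close> at the limit time
      \<open>\<theta>\<close>, but as a limit of the sampled values its measurability needs no
      argument about \<open>\<theta>\<close>.\<close>
    define S where "S \<equiv> \<lambda>\<omega>. lim (\<lambda>k. R (\<tau> k \<omega>) \<omega>)"
    have Rlim: "(\<lambda>k. R (\<tau> k \<omega>) \<omega>) \<longlonglongrightarrow> R (\<theta> \<omega>) \<omega>" if w: "\<omega> \<in> space M" for \<omega>
      by (rule right_continuous_sequentially[where x="\<lambda>u. R u \<omega>", OF Rrc[OF w] \<theta>])
        (use \<theta>_st[of \<omega>] s t in auto)
    have S_eq: "S \<omega> = R (\<theta> \<omega>) \<omega>" if w: "\<omega> \<in> space M" for \<omega> unfolding S_def by (rule limI[OF Rlim[OF w]])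
    note sampling = optional_sampling[OF R(1) s t, where n="2 ^ k" and g="g k" and I="I k" for k, OF g_st I_le Iset]
    have os: "integrable M (\<lambda>\<omega>. R (\<tau> k \<omega>) \<omega>)"
      "\<And>B. B \<in> sets (F s) \<Longrightarrow> (\<integral>\<omega>. indicator B \<omega> * R (\<tau> k \<omega>) \<omega> \<partial>M) = (\<integral>\<omega>. indicator B \<omega> * R s \<omega> \<partial>M)"
      "\<And>d. (\<integral>\<omega>. indicator {\<omega>. d < \<bar>R (\<tau> k \<omega>) \<omega>\<bar>} \<omega> * \<bar>R (\<tau> k \<omega>) \<omega>\<bar> \<partial>M)
      \<le> (\<integral>\<omega>. indicator {\<omega>. d < \<bar>R (\<tau> k \<omega>) \<omega>\<bar>} \<omega> * \<bar>R t \<omega>\<bar> \<partial>M)" for k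
      unfolding \<tau>_def by (rule sampling; assumption?)+
    have Sm: "S \<in> borel_measurable M" unfolding S_def
      by (rule borel_measurable_lim_metric) (use os(1) in auto)
    have t0: "0 \<le> t" using s st by simp
    have Ri: "integrable M (R u)" if "0 \<le> u" "u < T" for u using R(1) that by (auto simp: martingale_before_def)
    have Slim: "AE \<omega> in M. (\<lambda>k. R (\<tau> k \<omega>) \<omega>) \<longlonglongrightarrow> S \<omega>" using Rlim S_eq by (intro AE_I2) auto
    note ui = uniformly_integrable_limit[where X="\<lambda>k \<omega>. R (\<tau> k \<omega>) \<omega>" and Z="\<lambda>\<omega>. \<bar>R t \<omega>\<bar>" and Y=S,
        OF os(1) integrable_abs[OF Ri[OF t0 t]] abs_ge_zero os(3) Slim Sm]
    \<comment> \<open>This event is known at time \<open>s\<close>, so optional sampling applies on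
      it; off it the positive part at \<open>s\<close> is 0.\<close>
    define B where "B = {\<omega> \<in> space (F s). 0 < D' s \<omega>}"
    have sT: "s < T" using st t by simp
    have B: "B \<in> sets (F s)" unfolding B_def using D'm[OF s sT] by measurable
    have BM: "B \<in> sets M" using B sets_F_M[OF s] by auto
    have BG: "\<omega> \<in> G \<and> \<omega> \<in> space M" if "\<omega> \<in> B" for \<omega>
      using that s by (auto simp: B_def D'_def split: if_splits)
    have ES: "(\<integral>\<omega>. indicator B \<omega> * S \<omega> \<partial>M) = (\<integral>\<omega>. indicator B \<omega> * R s \<omega> \<partial>M)"
    proof (rule LIMSEQ_unique[OF ui(2)[OF BM]])
      show "(\<lambda>k. \<integral>\<omega>. indicator B \<omega> * R (\<tau> k \<omega>) \<omega> \<partial>M) \<longlonglongrightarrow> (\<integral>\<omega>. indicator B \<omega> * R s \<omega> \<partial>M)"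
        unfolding os(2)[OF B] by simp
    qed
    define J where "J \<equiv> \<lambda>\<omega>. LINT u:{s..t}|lborel. a u * P u \<omega>"
    have aP: "set_integrable lborel {s..v} (\<lambda>u. a u * P u \<omega>)" if w: "\<omega> \<in> space M" and v: "v \<le> t" for \<omega> v
    proof -
      have "set_integrable lborel {s..v} (\<lambda>u. (indicator {0..<T} u * P u \<omega>) * a u)"
        using v t s Pc[of _ \<omega>] P01[of _ \<omega>]
        by (intro set_integrable_mult_bounded[OF ai prog_path_measurable[OF progP w], where c=c']) (auto simp: indicator_def)
      then show ?thesis
        by (rule set_integrable_cong[THEN iffD1, rotated -1]) (use v t s in \<open>auto simp: indicator_def\<close>)
    qed
    have path: "D' s \<omega> \<le> P t \<omega> + L * J \<omega> - (S \<omega> - R s \<omega>)" if "\<omega> \<in> B" for \<omega>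
    proof -
      have w: "\<omega> \<in> G" "\<omega> \<in> space M" using BG[OF that] by auto
      have D'D: "D' u \<omega> = D u \<omega>" for u using w by (simp add: D'_def)
      have 1: "D s \<omega> \<le> P t \<omega> - (LINT u:{s..\<tau> k \<omega>}|lborel. f u \<omega>) - (R (\<tau> k \<omega>) \<omega> - R s \<omega>)" for k
      proof -
        have "g k (2 ^ k) = t" by (simp add: g_def)
        \<comment> \<open>Either a nonpositive value was met, or the sampled time is
          \<open>t\<close>.\<close>
        then have "D (\<tau> k \<omega>) \<omega> \<le> P t \<omega>" using I_prop[of k \<omega>] by (auto simp: \<tau>_def P_def D'D)
        moreover have "s \<le> \<tau> k \<omega>" "\<tau> k \<omega> < T" using \<tau>_st[of k \<omega>] t by auto
        note Gdyn(2)[OF w(1) s this]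
        ultimately show ?thesis by linarith
      qed
      have cont: "continuous_on {s..t} (\<lambda>v. LINT u:{s..v}|lborel. f u \<omega>)"
        by (rule continuous_on_indefinite_set_integral[OF Gdyn(1)[OF w(1) s st t]])
      have "(\<lambda>k. LINT u:{s..\<tau> k \<omega>}|lborel. f u \<omega>) \<longlonglongrightarrow> (LINT u:{s..\<theta> \<omega>}|lborel. f u \<omega>)"
        by (rule continuous_on_tendsto_compose[OF cont \<theta>(1)]) (use \<theta>_st \<tau>_st in auto)
      then have "(\<lambda>k. P t \<omega> - (LINT u:{s..\<tau> k \<omega>}|lborel. f u \<omega>) - (R (\<tau> k \<omega>) \<omega> - R s \<omega>)) \<longlonglongrightarrow>
          P t \<omega> - (LINT u:{s..\<theta> \<omega>}|lborel. f u \<omega>) - (R (\<theta> \<omega>) \<omega> - R s \<omega>)"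
        by (intro tendsto_intros Rlim[OF w(2)])
      then have 2: "D s \<omega> \<le> P t \<omega> - (LINT u:{s..\<theta> \<omega>}|lborel. f u \<omega>) - (R (\<theta> \<omega>) \<omega> - R s \<omega>)"
        by (rule LIMSEQ_le_const) (use 1 in auto)
      \<comment> \<open>A negative value before \<open>\<theta>\<close> persists on an interval to
        the right, which contains a point of some grid before \<open>\<theta>\<close>. The entrance
        time of that grid would then precede \<open>\<theta>\<close>, the infimum of all of
        them.\<close>
      have pos: "0 \<le> D u \<omega>" if u: "s \<le> u" "u < \<theta> \<omega>" for u
      proof (rule ccontr)
        assume "\<not> 0 \<le> D u \<omega>"
        then have neg: "D' u \<omega> < 0" by (simp add: D'D)
        have "u \<in> {0..<T}" using u s \<theta>_st[of \<omega>] t by auto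
        from order_tendstoD(2)[OF D'rc[OF w(2) this] neg]
        obtain b where b: "u < b" "\<And>y. u < y \<Longrightarrow> y < b \<Longrightarrow> D' y \<omega> < 0"
          unfolding eventually_at_right[OF u(2)] by auto
        have lt: "s < t" using u \<theta>_st[of \<omega>] by linarith
        define v where "v = min b (\<theta> \<omega>)"
        have uv: "u < v" using b u by (auto simp: v_def)
        \<comment> \<open>Density is known for dyadic fractions of [0, T], so the interval is
          rescaled from [s, t] to [0, T].\<close>
        have "(u - s) * T / (t - s) < (v - s) * T / (t - s)"
          using uv lt T_pos by (intro divide_strict_right_mono mult_strict_right_mono) auto
        then obtain q where q: "q \<in> dyadics" "(u - s) * T / (t - s) < q" "q < (v - s) * T / (t - s)"
          using dyadics_dense[of "(u - s) * T / (t - s)" "(v - s) * T / (t - s)"] u lt T_pos by auto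
        then obtain k i where ki: "q = T * real i / 2 ^ k" by (auto simp: dyadics_def grid_def)
        have g1: "g k i = s + (t - s) * (q / T)" using T_pos by (simp add: g_def ki)
        have "u < g k i" "g k i < v" unfolding g1 using q(2,3) lt T_pos by (auto simp: field_simps)
        then have gi: "D' (g k i) \<omega> \<le> 0" "g k i < \<theta> \<omega>" using b(2)[of "g k i"] by (auto simp: v_def)
        have "I k \<omega> \<le> i" by (rule I_least) (use gi in auto)
        then have "\<tau> k \<omega> \<le> g k i" unfolding \<tau>_def by (rule g_mono)
        then show False using \<theta>(2)[of \<omega> k] gi by auto
      qed
      have "(LINT u:{s..\<theta> \<omega>}|lborel. - (L * (a u * P u \<omega>))) \<le> (LINT u:{s..\<theta> \<omega>}|lborel. f u \<omega>)"
      proof (rule set_integral_mono_except_point)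
        show "set_integrable lborel {s..\<theta> \<omega>} (\<lambda>u. - (L * (a u * P u \<omega>)))"
          using aP[OF w(2) \<theta>_st(2)[of \<omega>]] set_integrable_mult_right[of "- L" lborel "{s..\<theta> \<omega>}" "\<lambda>u. a u * P u \<omega>"] by simp
        show "set_integrable lborel {s..\<theta> \<omega>} (\<lambda>u. f u \<omega>)" using Gdyn(1)[OF w(1) s \<theta>_st(1)[of \<omega>]] \<theta>_st(2)[of \<omega>] t by auto
        show "- (L * (a u * P u \<omega>)) \<le> f u \<omega>" if u: "u \<in> {s..<\<theta> \<omega>}" for u
          using Gdrift[OF w(1), of u] pos[of u] u s t \<theta>_st(2)[of \<omega>] by (auto simp: P_def D'D mult.assoc max_def)
      qed
      also have "(LINT u:{s..\<theta> \<omega>}|lborel. - (L * (a u * P u \<omega>))) = - (L * (LINT u:{s..\<theta> \<omega>}|lborel. a u * P u \<omega>))"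
        using set_integral_mult_right[of lborel "{s..\<theta> \<omega>}" "- L" "\<lambda>u. a u * P u \<omega>"] by simp
      finally have 3: "- (LINT u:{s..\<theta> \<omega>}|lborel. f u \<omega>) \<le> L * (LINT u:{s..\<theta> \<omega>}|lborel. a u * P u \<omega>)" by simp
      have "(LINT u:{s..\<theta> \<omega>}|lborel. a u * P u \<omega>) \<le> J \<omega>"
      proof -
        have "0 \<le> (LINT u:{\<theta> \<omega>..t}|lborel. a u * P u \<omega>)"
          by (rule set_integral_nonneg_real) (use a(3) P01 in auto)
        then show ?thesis
          using set_integral_combine[OF aP[OF w(2) order_refl] \<theta>_st, of \<omega>] by (simp add: J_def)
      qed
      then have "L * (LINT u:{s..\<theta> \<omega>}|lborel. a u * P u \<omega>) \<le> L * J \<omega>" using L by (rule mult_left_mono)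
      then show ?thesis using 2 3 S_eq[OF w(2)] by (simp add: D'D)
    qed
    let ?h = "\<lambda>\<omega> u. indicator {s..t} u * (a u * P u \<omega>)"
    have hi: "integrable (M \<Otimes>\<^sub>M lborel) (\<lambda>(\<omega>, u). ?h \<omega> u)"
    proof (rule integrable_pair_bounded[where b="\<lambda>u. c' * (indicator {s..t} u * a u)"])
      have [measurable]: "(\<lambda>x. indicator {0..<T} (snd x) * P (snd x) (fst x)) \<in> borel_measurable (M \<Otimes>\<^sub>M borel)"
        by (rule prog_measurable_M[OF progP])
      note a(2)[measurable]
      have "(\<lambda>x. indicator {s..t} (snd x) * (a (snd x) * (indicator {0..<T} (snd x) * P (snd x) (fst x)))) \<in> borel_measurable (M \<Otimes>\<^sub>M borel)"
        by measurable
      moreover have "(\<lambda>x. indicator {s..t} (snd x) * (a (snd x) * (indicator {0..<T} (snd x) * P (snd x) (fst x)))) = (\<lambda>(\<omega>, u). ?h \<omega> u)"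
        using s t by (auto simp: indicator_def)
      ultimately show "(\<lambda>(\<omega>, u). ?h \<omega> u) \<in> borel_measurable (M \<Otimes>\<^sub>M borel)" by simp
      show "integrable lborel (\<lambda>u. c' * (indicator {s..t} u * a u))" using ai[OF s t] by (simp add: set_integrable_def)
      show "\<bar>(\<lambda>(\<omega>, u). ?h \<omega> u) (\<omega>, u)\<bar> \<le> c' * (indicator {s..t} u * a u)" for \<omega> u
        using Pc[of u \<omega>] P01[of u \<omega>] a(3)[of u] s t mult_left_mono[of "P u \<omega>" c' "a u"]
        by (auto simp: indicator_def mult.commute[of c'])
    qed
    have Ji: "integrable M J" and EJ: "(\<integral>\<omega>. J \<omega> \<partial>M) = (LINT u:{s..t}|lborel. a u * \<delta> u)"
    proof -
      show "integrable M J" using pair.integrable_fst[OF hi] by (simp add: J_def set_lebesgue_integral_def)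
      have "(\<integral>\<omega>. J \<omega> \<partial>M) = (\<integral>u. (\<integral>\<omega>. ?h \<omega> u \<partial>M) \<partial>lborel)"
        using pair.Fubini_integral[OF hi] by (simp add: J_def set_lebesgue_integral_def)
      also have "\<dots> = (LINT u:{s..t}|lborel. a u * \<delta> u)"
        unfolding set_lebesgue_integral_def using s t
        by (intro Bochner_Integration.integral_cong) (auto simp: \<delta>E indicator_def)
      finally show "(\<integral>\<omega>. J \<omega> \<partial>M) = (LINT u:{s..t}|lborel. a u * \<delta> u)" .
    qed
    have J0: "0 \<le> J \<omega>" for \<omega> unfolding J_def using a(3) P01 by (intro set_integral_nonneg_real) auto
    have iB: "integrable M (\<lambda>\<omega>. indicator B \<omega> * S \<omega>)" "integrable M (\<lambda>\<omega>. indicator B \<omega> * R s \<omega>)"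
      using ui(1) Ri[OF s sT] BM by (auto intro: integrable_indicator_mult)
    have "\<delta> s \<le> (\<integral>\<omega>. (P t \<omega> + L * J \<omega>) - (indicator B \<omega> * S \<omega> - indicator B \<omega> * R s \<omega>) \<partial>M)"
      unfolding \<delta>E[OF s sT]
    proof (rule integral_mono)
      show "P s \<omega> \<le> (P t \<omega> + L * J \<omega>) - (indicator B \<omega> * S \<omega> - indicator B \<omega> * R s \<omega>)" if "\<omega> \<in> space M" for \<omega>
      proof (cases "\<omega> \<in> B")
        case True
        then show ?thesis using path[OF True] s by (auto simp: P_def B_def)
      next
        case False
        then have "P s \<omega> = 0" using that s by (auto simp: P_def B_def)
        then show ?thesis using False P01[of t \<omega>] J0[of \<omega>] L by simp
      qed
    qed (use Pi[OF s sT] Pi[OF t0 t] Ji iB in auto)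
    also have "\<dots> = \<delta> t + L * (LINT u:{s..t}|lborel. a u * \<delta> u)"
      using Pi[OF t0 t] Ji iB ES EJ \<delta>E[OF t0 t] by simp
    finally show ?thesis .
  qed
  \<comment> \<open>The constant is independent of both times, so the decay of
    \<open>\<delta>\<close> along times tending to \<open>T\<close> forces
    \<open>\<delta> s = 0\<close> for every \<open>s\<close>.\<close>
  define C where "C = 2 * exp (2 * L * (LINT u:{0..T}|lborel. a u))"
  have gr: "\<delta> s \<le> C * \<delta> t" if s: "0 \<le> s" and st: "s \<le> t" and t: "t < T" for s t
  proof -
    have "\<delta> s \<le> 2 * \<delta> t * exp (2 * L * (LINT x:{s..t}|lborel. a x))"
      by (rule gronwall_backward[OF ai[OF s t] a(3) st L _ \<delta>m, where c=c']) (use \<delta>b key s st t in auto)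
    also have "(LINT x:{s..t}|lborel. a x) \<le> (LINT x:{0..T}|lborel. a x)"
      unfolding set_lebesgue_integral_def using a(1) ai[OF s t] s t a(3)
      by (intro integral_mono) (auto simp: set_integrable_def indicator_def)
    then have "2 * \<delta> t * exp (2 * L * (LINT x:{s..t}|lborel. a x)) \<le> C * \<delta> t"
      using L \<delta>b[of t] s st t unfolding C_def by (auto intro!: mult_left_mono simp: mult_ac)
    finally show ?thesis .
  qed
  obtain tt :: "nat \<Rightarrow> real" where tt: "\<And>k. 0 < tt k" "\<And>k. tt k < T" "tt \<longlonglongrightarrow> T" using times_below_T by blast
  have ttl: "filterlim tt (at_left T) sequentially"
    unfolding filterlim_at using tt(2,3) order.strict_implies_not_eq[OF tt(2)] by auto
  have "(\<lambda>k. \<integral>\<omega>. P (tt k) \<omega> \<partial>M) \<longlonglongrightarrow> (\<integral>\<omega>. 0 \<partial>M)"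
  proof (rule integral_dominated_convergence[where w="\<lambda>_. c'"])
    show "AE \<omega> in M. (\<lambda>k. P (tt k) \<omega>) \<longlonglongrightarrow> 0"
      using G(2)
    proof eventually_elim
      case (elim \<omega>)
      then have "((\<lambda>t. max 0 (D t \<omega>)) \<longlongrightarrow> 0) (at_left T)" using G(3) by (auto simp: Q_def)
      from filterlim_compose[OF this ttl] show ?case using elim by (simp add: P_def D'_def)
    qed
  qed (use Pm Pc P01 tt in \<open>auto simp: less_imp_le\<close>)
  then have \<delta>0: "(\<lambda>k. \<delta> (tt k)) \<longlonglongrightarrow> 0" using \<delta>E tt by (simp add: less_imp_le)
  have D'0: "AE \<omega> in M. D' s \<omega> \<le> 0" if s: "0 \<le> s" "s < T" for s
  proof -
    have "eventually (\<lambda>k. \<delta> s \<le> C * \<delta> (tt k)) sequentially"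
      using order_tendstoD(1)[OF tt(3) s(2)] by eventually_elim (use gr s tt in auto)
    then have "\<delta> s \<le> C * 0"
      by (intro tendsto_lowerbound[OF tendsto_mult[OF tendsto_const \<delta>0]]) auto
    then have "(\<integral>\<omega>. P s \<omega> \<partial>M) = 0" using \<delta>b[of s] \<delta>E[OF s] s by auto
    then have "AE \<omega> in M. P s \<omega> = 0" using Pi[OF s] P01 by (subst (asm) integral_nonneg_eq_0_iff_AE) auto
    then show ?thesis by eventually_elim (auto simp: P_def max_def split: if_splits)
  qed
  have "countable dyadics" unfolding dyadics_def by auto
  then have "AE \<omega> in M. \<forall>q\<in>dyadics. q < T \<longrightarrow> D' q \<omega> \<le> 0"
    using D'0 dyadics_nonneg by (intro AE_ball_countable[THEN iffD2]) (auto simp: AE_conj_iff)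
  then show ?thesis using G(2) AE_space
  proof eventually_elim
    case (elim \<omega>)
    show ?case
    proof
      fix t assume t: "t \<in> {0..<T}"
      obtain q where q: "\<And>j. q j \<in> dyadics" "\<And>j. t < q j" "\<And>j. q j < T" "q \<longlonglongrightarrow> t" using dyadic_sequence[of t T] t by auto
      have "(\<lambda>j. D' (q j) \<omega>) \<longlonglongrightarrow> D' t \<omega>"
        by (rule right_continuous_sequentially[where x="\<lambda>u. D' u \<omega>", OF D'rc]) (use elim t q(4) less_imp_le[OF q(2)] in auto)
      then have "D' t \<omega> \<le> 0" by (rule LIMSEQ_le_const2) (use elim(1) q in auto)
      then show "D t \<omega> \<le> 0" using elim by (simp add: D'_def)
    qed
  qed
qed

end

section \<open>Bounded Lipschitz drivers\<close>

lemma set_integral_cong_AE_borel: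
  fixes f g :: "real \<Rightarrow> real"
  assumes f: "f \<in> borel_measurable borel" and g: "g \<in> borel_measurable borel"
    and ae: "AE u in lborel. f u = g u" and A: "A \<in> sets borel"
  shows "set_integrable lborel A f \<longleftrightarrow> set_integrable lborel A g"
    "(LINT u:A|lborel. f u) = (LINT u:A|lborel. g u)"
proof -
  have m: "(\<lambda>u. indicator A u *\<^sub>R f u) \<in> borel_measurable lborel" "(\<lambda>u. indicator A u *\<^sub>R g u) \<in> borel_measurable lborel"
    using f g A by auto
  have e: "AE u in lborel. indicator A u *\<^sub>R f u = indicator A u *\<^sub>R g u" using ae by eventually_elim simp
  show "set_integrable lborel A f \<longleftrightarrow> set_integrable lborel A g"
    unfolding set_integrable_def by (rule integrable_cong_AE[OF m e])
  show "(LINT u:A|lborel. f u) = (LINT u:A|lborel. g u)"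
    unfolding set_lebesgue_integral_def by (rule integral_cong_AE[OF m e])
qed

context filtered_prob_space
begin

section \<open>From single times to all times and to almost every time\<close>

lemma AE_all_times_of_right_continuous:
  assumes P: "\<And>t. 0 \<le> t \<Longrightarrow> t < T \<Longrightarrow> AE \<omega> in M. X t \<omega> \<le> (c :: real)"
    and rc: "AE \<omega> in M. \<forall>t\<in>{0..<T}. ((\<lambda>s. X s \<omega>) \<longlongrightarrow> X t \<omega>) (at_right t)"
  shows "AE \<omega> in M. \<forall>t\<in>{0..<T}. X t \<omega> \<le> c"
proof -
  have "countable dyadics" unfolding dyadics_def by auto
  then have "AE \<omega> in M. \<forall>q\<in>dyadics. q < T \<longrightarrow> X q \<omega> \<le> c"
    using P dyadics_nonneg by (intro AE_ball_countable[THEN iffD2]) (auto simp: AE_conj_iff)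
  then show ?thesis using rc
  proof eventually_elim
    case (elim \<omega>)
    show ?case
    proof
      fix t assume t: "t \<in> {0..<T}"
      obtain q where q: "\<And>j. q j \<in> dyadics" "\<And>j. t < q j" "\<And>j. q j < T" "q \<longlonglongrightarrow> t" using dyadic_sequence[of t T] t by auto
      have "(\<lambda>j. X (q j) \<omega>) \<longlonglongrightarrow> X t \<omega>"
        by (rule right_continuous_sequentially[where x="\<lambda>u. X u \<omega>"]) (use elim t q(4) less_imp_le[OF q(2)] in auto)
      then show "X t \<omega> \<le> c" by (rule LIMSEQ_le_const2) (use elim(1) q in auto)
    qed
  qed
qed

lemma cond_exp_characterization:
  fixes f w :: "'a \<Rightarrow> real"
  assumes t: "0 \<le> t" and f: "f \<in> borel_measurable (F t)" "integrable M f" and w: "integrable M w"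
    and eq: "\<And>B. B \<in> sets (F t) \<Longrightarrow> (\<integral>\<omega>. indicator B \<omega> * f \<omega> \<partial>M) = (\<integral>\<omega>. indicator B \<omega> * w \<omega> \<partial>M)"
  shows "AE \<omega> in M. f \<omega> = real_cond_exp M (F t) w \<omega>"
proof -
  interpret sigma_finite_subalgebra M "F t" using t by (intro cond_subalgebra)
  have "AE \<omega> in M. real_cond_exp M (F t) w \<omega> = f \<omega>"
    by (rule real_cond_exp_charact) (use eq f w in \<open>auto simp: set_lebesgue_integral_def\<close>)
  then show ?thesis by eventually_elim simp
qed

lemma cond_le_const:
  fixes f w :: "'a \<Rightarrow> real"
  assumes t: "0 \<le> t" and f: "f \<in> borel_measurable (F t)" "integrable M f" and w: "integrable M w"
    and eq: "\<And>B. B \<in> sets (F t) \<Longrightarrow> (\<integral>\<omega>. indicator B \<omega> * f \<omega> \<partial>M) = (\<integral>\<omega>. indicator B \<omega> * w \<omega> \<partial>M)"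
    and le: "AE \<omega> in M. w \<omega> \<le> c"
  shows "AE \<omega> in M. f \<omega> \<le> c"
proof -
  interpret sigma_finite_subalgebra M "F t" using t by (intro cond_subalgebra)
  have "AE \<omega> in M. real_cond_exp M (F t) w \<omega> \<le> real_cond_exp M (F t) (\<lambda>_. c) \<omega>"
    by (rule real_cond_exp_mono[OF le w]) auto
  moreover have "AE \<omega> in M. real_cond_exp M (F t) (\<lambda>_. c) \<omega> = c" by (rule real_cond_exp_F_meas) auto
  moreover have "AE \<omega> in M. f \<omega> = real_cond_exp M (F t) w \<omega>" by (rule cond_exp_characterization[OF t f w eq])
  ultimately show ?thesis by eventually_elim auto
qed

text \<open>Conditional expectation does not increase the mean absolute value: the sign of
  \<open>f\<close> is known at time \<open>t\<close>, so each sign region is an admissible test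
  event.\<close>

lemma cond_abs_integral_le:
  fixes f w :: "'a \<Rightarrow> real"
  assumes t: "0 \<le> t" and f: "f \<in> borel_measurable (F t)" "integrable M f" and w: "integrable M w"
    and eq: "\<And>B. B \<in> sets (F t) \<Longrightarrow> (\<integral>\<omega>. indicator B \<omega> * f \<omega> \<partial>M) = (\<integral>\<omega>. indicator B \<omega> * w \<omega> \<partial>M)"
  shows "(\<integral>\<omega>. \<bar>f \<omega>\<bar> \<partial>M) \<le> (\<integral>\<omega>. \<bar>w \<omega>\<bar> \<partial>M)"
proof -
  define B where "B = {\<omega> \<in> space (F t). 0 \<le> f \<omega>}"
  define C where "C = {\<omega> \<in> space (F t). f \<omega> < 0}"
  note f(1)[measurable]
  have B: "B \<in> sets (F t)" "C \<in> sets (F t)" unfolding B_def C_def by measurable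
  then have BM: "B \<in> sets M" "C \<in> sets M" using sets_F_M[OF t] by auto
  have "(\<integral>\<omega>. \<bar>f \<omega>\<bar> \<partial>M) = (\<integral>\<omega>. indicator B \<omega> * f \<omega> - indicator C \<omega> * f \<omega> \<partial>M)"
    using t by (intro Bochner_Integration.integral_cong) (auto simp: B_def C_def indicator_def)
  also have "\<dots> = (\<integral>\<omega>. indicator B \<omega> * w \<omega> \<partial>M) - (\<integral>\<omega>. indicator C \<omega> * w \<omega> \<partial>M)"
    using f BM B by (subst Bochner_Integration.integral_diff) (auto intro: integrable_indicator_mult simp: eq)
  also have "\<dots> = (\<integral>\<omega>. indicator B \<omega> * w \<omega> - indicator C \<omega> * w \<omega> \<partial>M)"
    using w BM by (subst Bochner_Integration.integral_diff) (auto intro: integrable_indicator_mult)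
  also have "\<dots> \<le> (\<integral>\<omega>. \<bar>w \<omega>\<bar> \<partial>M)"
    using w BM by (intro integral_mono Bochner_Integration.integrable_diff integrable_indicator_mult integrable_abs)
      (auto simp: B_def C_def indicator_def)
  finally show ?thesis .
qed

lemma integral_indicator_cong_AE:
  fixes f g :: "'a \<Rightarrow> real"
  assumes "AE \<omega> in M. f \<omega> = g \<omega>" "f \<in> borel_measurable M" "g \<in> borel_measurable M" "B \<in> sets M"
  shows "(\<integral>\<omega>. indicator B \<omega> * f \<omega> \<partial>M) = (\<integral>\<omega>. indicator B \<omega> * g \<omega> \<partial>M)"
  using assms by (intro integral_cong_AE) (auto elim: eventually_mono)

text \<open>Progressive measurability makes the exceptional set jointly measurable, so the order of
  the two almost-everywhere quantifiers can be exchanged.\<close>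

lemma AE_AE_lborel_of_AE:
  assumes X: "prog X" and Y: "prog Y" and eq: "\<And>t. 0 \<le> t \<Longrightarrow> t < T \<Longrightarrow> AE \<omega> in M. X t \<omega> = Y t \<omega>"
  shows "AE \<omega> in M. AE u in lborel. u \<in> {0..<T} \<longrightarrow> X u \<omega> = Y u \<omega>"
proof (subst pair.AE_commute)
  have [measurable]: "(\<lambda>x. indicator {0..<T} (snd x) * X (snd x) (fst x)) \<in> borel_measurable (M \<Otimes>\<^sub>M lborel)"
    "(\<lambda>x. indicator {0..<T} (snd x) * Y (snd x) (fst x)) \<in> borel_measurable (M \<Otimes>\<^sub>M lborel)"
    using prog_measurable_M X Y by (auto simp: borel_measurable_pair_lborel_iff)
  have "{x \<in> space (M \<Otimes>\<^sub>M lborel). indicator {0..<T} (snd x) * X (snd x) (fst x) = indicator {0..<T} (snd x) * Y (snd x) (fst x)} \<in> sets (M \<Otimes>\<^sub>M lborel)"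
    by measurable
  moreover have "indicator {0..<T} u * X u \<omega> = indicator {0..<T} u * Y u \<omega> \<longleftrightarrow> (u \<in> {0..<T} \<longrightarrow> X u \<omega> = Y u \<omega>)" for u \<omega>
    by (auto simp: indicator_def)
  ultimately show "{x \<in> space (M \<Otimes>\<^sub>M lborel). snd x \<in> {0..<T} \<longrightarrow> X (snd x) (fst x) = Y (snd x) (fst x)} \<in> sets (M \<Otimes>\<^sub>M lborel)"
    by simp
  show "AE u in lborel. AE \<omega> in M. u \<in> {0..<T} \<longrightarrow> X u \<omega> = Y u \<omega>"
  proof (rule AE_I2)
    fix u :: real
    show "AE \<omega> in M. u \<in> {0..<T} \<longrightarrow> X u \<omega> = Y u \<omega>"
      using eq[of u] by (cases "u \<in> {0..<T}") auto
  qed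
qed

lemma AE_AE_lborel_of_AE_LIMSEQ:
  fixes X :: "nat \<Rightarrow> real \<Rightarrow> 'a \<Rightarrow> real"
  assumes X: "\<And>n. prog (X n)" and Y: "prog Y"
    and lim: "\<And>t. 0 \<le> t \<Longrightarrow> t < T \<Longrightarrow> AE \<omega> in M. (\<lambda>n. X n t \<omega>) \<longlonglongrightarrow> Y t \<omega>"
  shows "AE \<omega> in M. AE u in lborel. u \<in> {0..<T} \<longrightarrow> (\<lambda>n. X n u \<omega>) \<longlonglongrightarrow> Y u \<omega>"
proof (subst pair.AE_commute)
  have [measurable]: "(\<lambda>x. indicator {0..<T} (snd x) * X n (snd x) (fst x)) \<in> borel_measurable (M \<Otimes>\<^sub>M lborel)"
    "(\<lambda>x. indicator {0..<T} (snd x) * Y (snd x) (fst x)) \<in> borel_measurable (M \<Otimes>\<^sub>M lborel)" for n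
    using prog_measurable_M X Y by (auto simp: borel_measurable_pair_lborel_iff)
  have "{x \<in> space (M \<Otimes>\<^sub>M lborel). (\<lambda>n. indicator {0..<T} (snd x) * X n (snd x) (fst x)) \<longlonglongrightarrow> indicator {0..<T} (snd x) * Y (snd x) (fst x)} \<in> sets (M \<Otimes>\<^sub>M lborel)"
    by measurable
  moreover have "(\<lambda>n. indicator {0..<T} u * X n u \<omega>) \<longlonglongrightarrow> indicator {0..<T} u * Y u \<omega> \<longleftrightarrow> (u \<in> {0..<T} \<longrightarrow> (\<lambda>n. X n u \<omega>) \<longlonglongrightarrow> Y u \<omega>)" for u \<omega>
    by (cases "u \<in> {0..<T}") auto
  ultimately show "{x \<in> space (M \<Otimes>\<^sub>M lborel). snd x \<in> {0..<T} \<longrightarrow> (\<lambda>n. X n (snd x) (fst x)) \<longlonglongrightarrow> Y (snd x) (fst x)} \<in> sets (M \<Otimes>\<^sub>M lborel)"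
    by simp
  show "AE u in lborel. AE \<omega> in M. u \<in> {0..<T} \<longrightarrow> (\<lambda>n. X n u \<omega>) \<longlonglongrightarrow> Y u \<omega>"
  proof (rule AE_I2)
    fix u :: real
    show "AE \<omega> in M. u \<in> {0..<T} \<longrightarrow> (\<lambda>n. X n u \<omega>) \<longlonglongrightarrow> Y u \<omega>"
      using lim[of u] by (cases "u \<in> {0..<T}") auto
  qed
qed

end

text \<open>\<open>v\<close> stands for \<open>vol\<close> cut off at a deterministic integrable
  majorant \<open>a\<close> and outside [0, T). The inequalities hold at every point rather than
  almost surely, and \<open>a\<close> serves both alternatives of (A1) at once.\<close>

locale bsde_coefficient = filtered_prob_space +
  fixes v :: "real \<Rightarrow> 'a \<Rightarrow> real" and a :: "real \<Rightarrow> real"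
  assumes v_prog: "prog v" and v_nonneg: "0 \<le> v u \<omega>" and v_le: "v u \<omega> \<le> a u"
    and a_zero: "u \<notin> {0..<T} \<Longrightarrow> a u = 0"
    and a_measurable: "a \<in> borel_measurable borel" and a_integrable: "integrable lborel a"
begin

section \<open>Measurability of the driver and regular versions\<close>

lemma a_nonneg: "0 \<le> a u" using v_nonneg v_le by (meson order_trans)

lemma v_zero: "u \<notin> {0..<T} \<Longrightarrow> v u \<omega> = 0"
  using v_nonneg[of u \<omega>] v_le[of u \<omega>] a_zero[of u] by simp

lemma a_set_integrable: "A \<in> sets borel \<Longrightarrow> set_integrable lborel A a"
  using integrable_mult_indicator[OF _ a_integrable, of A] by (simp add: set_integrable_def)

lemma driver_joint_measurable:
  assumes X: "prog X" and G: "G \<in> borel_measurable borel"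
  shows "(\<lambda>x. v (snd x) (fst x) * G (X (snd x) (fst x))) \<in> borel_measurable (M \<Otimes>\<^sub>M borel)"
proof -
  have "(\<lambda>x. indicator {0..<T} (snd x) * (v (snd x) (fst x) * G (X (snd x) (fst x)))) \<in> borel_measurable (M \<Otimes>\<^sub>M borel)"
    by (rule prog_measurable_M[OF prog_mult[OF v_prog prog_comp[OF X G]]])
  moreover have "indicator {0..<T} u * (v u \<omega> * G (X u \<omega>)) = v u \<omega> * G (X u \<omega>)" for u \<omega>
    using v_zero[of u \<omega>] by (cases "u \<in> {0..<T}") auto
  ultimately show ?thesis by simp
qed

lemma driver_path_measurable:
  assumes "prog X" "G \<in> borel_measurable borel" "\<omega> \<in> space M"
  shows "(\<lambda>u. v u \<omega> * G (X u \<omega>)) \<in> borel_measurable borel"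
  using measurable_compose[OF measurable_Pair1'[OF assms(3)] driver_joint_measurable[OF assms(1,2)]] by simp

lemma driver_integral_measurable:
  assumes "prog X" "G \<in> borel_measurable borel" "0 \<le> t" "t < T"
  shows "(\<lambda>\<omega>. LINT u:{0..t}|lborel. v u \<omega> * G (X u \<omega>)) \<in> borel_measurable (F t)"
  by (rule prog_set_integral_measurable[OF prog_mult[OF v_prog prog_comp[OF assms(1,2)]] assms(3,4)])

text \<open>Passing to the right-continuous version of \<open>X\<close> changes it only on a null set at each time,
  hence leaves the integral of the driver unchanged by Fubini.\<close>

theorem regularization:
  assumes X: "prog X" and G: "G \<in> borel_measurable borel"
    and fi: "\<And>t. 0 \<le> t \<Longrightarrow> t < T \<Longrightarrow>
      integrable (M \<Otimes>\<^sub>M lborel) (\<lambda>x. indicator {0..t} (snd x) * (v (snd x) (fst x) * G (X (snd x) (fst x))))"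
    and mart: "mart (\<lambda>t \<omega>. X t \<omega> - (LINT u:{0..t}|lborel. v u \<omega> * G (X u \<omega>)))"
  shows "\<exists>Y N. adapted_before F T Y \<and> mart N \<and> cadlag_before M T N \<and>
    (\<forall>\<omega>\<in>space M. \<forall>t\<in>{0..<T}. ((\<lambda>s. Y s \<omega>) \<longlongrightarrow> Y t \<omega>) (at_right t)) \<and>
    (\<forall>t. 0 \<le> t \<and> t < T \<longrightarrow> (AE \<omega> in M. Y t \<omega> = X t \<omega>)) \<and>
    (AE \<omega> in M. \<forall>t\<in>{0..<T}. set_integrable lborel {0..t} (\<lambda>u. v u \<omega> * G (Y u \<omega>)) \<and>
      Y t \<omega> = N t \<omega> + (LINT u:{0..t}|lborel. v u \<omega> * G (Y u \<omega>)))"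
proof -
  let ?f = "\<lambda>X \<omega> u. v u \<omega> * G (X u \<omega>)"
  from mart_cadlag_modification[OF mart] obtain N where N: "mart N" "cadlag_before M T N"
    "\<And>t. 0 \<le> t \<Longrightarrow> t < T \<Longrightarrow> AE \<omega> in M. N t \<omega> = X t \<omega> - (LINT u:{0..t}|lborel. ?f X \<omega> u)" by blast
  obtain c :: "nat \<Rightarrow> real" where c: "\<And>k. 0 < c k" "\<And>k. c k < T" "c \<longlonglongrightarrow> T" using times_below_T by blast
  have "AE \<omega> in M. \<forall>k. integrable lborel (\<lambda>u. indicator {0..c k} u * ?f X \<omega> u)"
    unfolding AE_all_countable
    using pair.AE_integrable_fst'[OF fi[OF less_imp_le[OF c(1)] c(2)]] by auto
  then have "AE \<omega> in M. \<forall>t\<in>{0..<T}. set_integrable lborel {0..t} (?f X \<omega>)"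
  proof eventually_elim
    case (elim \<omega>)
    show ?case
    proof
      fix t assume "t \<in> {0..<T}"
      then have "eventually (\<lambda>k. t < c k) sequentially" using c(3) by (intro order_tendstoD) auto
      then obtain k where "t < c k" by (auto simp: eventually_sequentially)
      moreover have "set_integrable lborel {0..c k} (?f X \<omega>)" using elim by (simp add: set_integrable_def)
      ultimately show "set_integrable lborel {0..t} (?f X \<omega>)" by (auto intro: set_integrable_subset)
    qed
  qed
  from AE_good_set[OF this] obtain A where A: "\<And>t. 0 \<le> t \<Longrightarrow> A \<in> sets (F t)" "AE \<omega> in M. \<omega> \<in> A"
    "\<And>\<omega>. \<omega> \<in> A \<Longrightarrow> \<forall>t\<in>{0..<T}. set_integrable lborel {0..t} (?f X \<omega>)" "A \<subseteq> space M" by blast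
  \<comment> \<open>Off \<open>A\<close> the drift integral may be meaningless and is dropped; there
    \<open>Y\<close> is just \<open>N\<close>, which is right-continuous on every path.\<close>
  define Y where "Y \<equiv> \<lambda>t \<omega>. N t \<omega> + indicator A \<omega> * (LINT u:{0..t}|lborel. ?f X \<omega> u)"
  have adY: "adapted_before F T Y"
    unfolding adapted_before_def Y_def
  proof
    fix t assume t: "t \<in> {0..<T}"
    have "N t \<in> borel_measurable (F t)" using N(1) t by (auto simp: martingale_before_def intro: adaptedD)
    moreover have "(\<lambda>\<omega>. LINT u:{0..t}|lborel. ?f X \<omega> u) \<in> borel_measurable (F t)"
      using t by (intro driver_integral_measurable X G) auto
    ultimately show "(\<lambda>\<omega>. N t \<omega> + indicator A \<omega> * (LINT u:{0..t}|lborel. ?f X \<omega> u)) \<in> borel_measurable (F t)"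
      using A(1)[of t] t by (intro borel_measurable_add borel_measurable_times borel_measurable_indicator) auto
  qed
  have rcY: "((\<lambda>s. Y s \<omega>) \<longlongrightarrow> Y t \<omega>) (at_right t)" if w: "\<omega> \<in> space M" and t: "t \<in> {0..<T}" for t \<omega>
  proof -
    have Nrc: "((\<lambda>s. N s \<omega>) \<longlongrightarrow> N t \<omega>) (at_right t)" using N(2) w t by (auto simp: cadlag_before_def)
    show ?thesis
    proof (cases "\<omega> \<in> A")
      case True
      show ?thesis
      proof (rule right_continuous_of_increments[where T=T, OF _ Nrc])
        fix s assume s: "t \<le> s" "s < T"
        have i: "set_integrable lborel {0..s} (?f X \<omega>)" using A(3)[OF True] s t by auto
        then have "set_integrable lborel {t..s} (?f X \<omega>)" using s t by (auto intro: set_integrable_subset)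
        moreover have "Y s \<omega> = Y t \<omega> + (LINT u:{t..s}|lborel. ?f X \<omega> u) + (N s \<omega> - N t \<omega>)"
          using set_integral_combine[OF i, of t] s t True by (simp add: Y_def)
        ultimately show "set_integrable lborel {t..s} (?f X \<omega>) \<and> Y s \<omega> = Y t \<omega> + (LINT u:{t..s}|lborel. ?f X \<omega> u) + (N s \<omega> - N t \<omega>)" ..
      qed (use t in auto)
    next
      case False
      then show ?thesis using Nrc by (simp add: Y_def)
    qed
  qed
  have YX: "AE \<omega> in M. Y t \<omega> = X t \<omega>" if "0 \<le> t" "t < T" for t
    using N(3)[OF that] A(2) by eventually_elim (simp add: Y_def)
  have progY: "prog Y" by (rule prog_right_continuous[OF adY rcY])
  have YX_AE: "AE \<omega> in M. AE u in lborel. u \<in> {0..<T} \<longrightarrow> Y u \<omega> = X u \<omega>"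
    by (rule AE_AE_lborel_of_AE[OF progY X YX])
  have "AE \<omega> in M. \<forall>t\<in>{0..<T}. set_integrable lborel {0..t} (?f Y \<omega>) \<and> Y t \<omega> = N t \<omega> + (LINT u:{0..t}|lborel. ?f Y \<omega> u)"
    using YX_AE A(2) AE_space
  proof eventually_elim
    case (elim \<omega>)
    from elim(1) have ae: "AE u in lborel. ?f Y \<omega> u = ?f X \<omega> u"
    proof eventually_elim
      case (elim u)
      then show ?case using v_zero[of u \<omega>] by (cases "u \<in> {0..<T}") auto
    qed
    note cong = set_integral_cong_AE_borel[OF driver_path_measurable[OF progY G elim(3)] driver_path_measurable[OF X G elim(3)] ae]
    show ?case
    proof
      fix t assume t: "t \<in> {0..<T}"
      show "set_integrable lborel {0..t} (?f Y \<omega>) \<and> Y t \<omega> = N t \<omega> + (LINT u:{0..t}|lborel. ?f Y \<omega> u)"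
        using A(3)[OF elim(2)] t elim(2) cong(1)[of "{0..t}"] cong(2)[of "{0..t}"] by (simp add: Y_def)
    qed
  qed
  then show ?thesis using adY N(1,2) rcY YX by blast
qed

text \<open>Taking conditional expectations given \<open>F t\<close> turns the tail value into the equation for
  bounded solutions.\<close>

definition tail_value :: "(real \<Rightarrow> real) \<Rightarrow> ('a \<Rightarrow> real) \<Rightarrow> (real \<Rightarrow> 'a \<Rightarrow> real) \<Rightarrow> real \<Rightarrow> 'a \<Rightarrow> real" where
  "tail_value g \<zeta> X t \<omega> = \<zeta> \<omega> - (LINT u:{t..T}|lborel. v u \<omega> * g (X u \<omega>))"

text \<open>The Picard map, written as a relation because its output at each time is determined only
  up to a null set: \<open>Y t\<close> is the conditional expectation of the tail value of
  \<open>X\<close> given \<open>F t\<close>.\<close>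

definition conditional_value :: "(real \<Rightarrow> real) \<Rightarrow> ('a \<Rightarrow> real) \<Rightarrow> (real \<Rightarrow> 'a \<Rightarrow> real) \<Rightarrow> (real \<Rightarrow> 'a \<Rightarrow> real) \<Rightarrow> bool" where
  "conditional_value g \<zeta> X Y \<longleftrightarrow> (\<forall>t. 0 \<le> t \<and> t < T \<longrightarrow> Y t \<in> borel_measurable (F t) \<and> integrable M (Y t) \<and>
     (\<forall>B\<in>sets (F t). (\<integral>\<omega>. indicator B \<omega> * Y t \<omega> \<partial>M) = (\<integral>\<omega>. indicator B \<omega> * tail_value g \<zeta> X t \<omega> \<partial>M)))"

lemma driver_set_integrable:
  assumes X: "prog X" and g: "g \<in> borel_measurable borel" "\<And>y. \<bar>g y\<bar> \<le> b" and w: "\<omega> \<in> space M" and A: "A \<in> sets borel"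
  shows "set_integrable lborel A (\<lambda>u. v u \<omega> * g (X u \<omega>))"
  unfolding set_integrable_def
proof (rule Bochner_Integration.integrable_bound)
  show "integrable lborel (\<lambda>u. b * a u)" using a_integrable by simp
  show "(\<lambda>u. indicator A u *\<^sub>R (v u \<omega> * g (X u \<omega>))) \<in> borel_measurable lborel"
    using driver_path_measurable[OF X g(1) w] A by auto
  show "AE u in lborel. norm (indicator A u *\<^sub>R (v u \<omega> * g (X u \<omega>))) \<le> norm (b * a u)"
  proof (rule AE_I2)
    fix u
    have "\<bar>v u \<omega> * g (X u \<omega>)\<bar> \<le> a u * b" unfolding abs_mult
      using v_nonneg[of u \<omega>] v_le[of u \<omega>] g(2) a_nonneg by (intro mult_mono) auto
    then show "norm (indicator A u *\<^sub>R (v u \<omega> * g (X u \<omega>))) \<le> norm (b * a u)"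
      by (auto simp: indicator_def mult.commute)
  qed
qed

lemma driver_integral_bound:
  assumes X: "prog X" and g: "g \<in> borel_measurable borel" "\<And>y. \<bar>g y\<bar> \<le> b" and w: "\<omega> \<in> space M" and A: "A \<in> sets borel"
  shows "\<bar>LINT u:A|lborel. v u \<omega> * g (X u \<omega>)\<bar> \<le> b * (\<integral>u. a u \<partial>lborel)"
proof -
  have "\<bar>LINT u:A|lborel. v u \<omega> * g (X u \<omega>)\<bar> \<le> (\<integral>u. \<bar>indicator A u *\<^sub>R (v u \<omega> * g (X u \<omega>))\<bar> \<partial>lborel)"
    unfolding set_lebesgue_integral_def by (rule integral_abs_bound)
  also have "\<dots> \<le> (\<integral>u. b * a u \<partial>lborel)"
  proof (rule integral_mono)
    show "integrable lborel (\<lambda>u. \<bar>indicator A u *\<^sub>R (v u \<omega> * g (X u \<omega>))\<bar>)"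
      using driver_set_integrable[OF X g w A] by (simp add: set_integrable_def)
    show "integrable lborel (\<lambda>u. b * a u)" using a_integrable by simp
    fix u
    have "\<bar>v u \<omega> * g (X u \<omega>)\<bar> \<le> a u * b" unfolding abs_mult
      using v_nonneg[of u \<omega>] v_le[of u \<omega>] g(2) a_nonneg by (intro mult_mono) auto
    moreover have "0 \<le> b" using g(2)[of 0] by linarith
    ultimately show "\<bar>indicator A u *\<^sub>R (v u \<omega> * g (X u \<omega>))\<bar> \<le> b * a u"
      using a_nonneg[of u] by (auto simp: indicator_def mult.commute)
  qed
  finally show ?thesis by simp
qed

lemma driver_integral_measurable_T:
  assumes X: "prog X" and g: "g \<in> borel_measurable borel" and A: "A \<in> sets borel"
  shows "(\<lambda>\<omega>. LINT u:A|lborel. v u \<omega> * g (X u \<omega>)) \<in> borel_measurable (F T)"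
proof -
  have "(\<lambda>x. indicator {0..<T} (snd x) * (v (snd x) (fst x) * g (X (snd x) (fst x)))) \<in> borel_measurable (F T \<Otimes>\<^sub>M borel)"
    by (rule prog_measurable_T[OF prog_mult[OF v_prog prog_comp[OF X g]]])
  moreover have "indicator {0..<T} u * (v u \<omega> * g (X u \<omega>)) = v u \<omega> * g (X u \<omega>)" for u \<omega>
    using v_zero[of u \<omega>] by (cases "u \<in> {0..<T}") auto
  ultimately have [measurable]: "(\<lambda>x. v (snd x) (fst x) * g (X (snd x) (fst x))) \<in> borel_measurable (F T \<Otimes>\<^sub>M borel)" by simp
  note A[measurable]
  have "(\<lambda>x. indicator A (snd x) * (v (snd x) (fst x) * g (X (snd x) (fst x)))) \<in> borel_measurable (F T \<Otimes>\<^sub>M borel)"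
    by measurable
  then have "(\<lambda>(\<omega>, u). indicator A u * (v u \<omega> * g (X u \<omega>))) \<in> borel_measurable (F T \<Otimes>\<^sub>M lborel)"
    by (simp add: borel_measurable_pair_lborel_iff split_beta')
  from lborel.borel_measurable_lebesgue_integral[OF this] show ?thesis by (simp add: set_lebesgue_integral_def)
qed

lemma driver_integral_measurable_M:
  assumes X: "prog X" and g: "g \<in> borel_measurable borel" and A: "A \<in> sets borel"
  shows "(\<lambda>\<omega>. LINT u:A|lborel. v u \<omega> * g (X u \<omega>)) \<in> borel_measurable M"
  using T_pos by (intro measurable_F_M[OF driver_integral_measurable_T[OF assms]]) simp

end

locale bounded_bsde = bsde_coefficient M F T v a for M :: "'a measure" and F T v a +
  fixes g :: "real \<Rightarrow> real" and b L z :: real and \<zeta> :: "'a \<Rightarrow> real"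
  assumes g_measurable: "g \<in> borel_measurable borel" and g_bound: "\<And>y. \<bar>g y\<bar> \<le> b"
    and g_lipschitz: "\<And>x y. \<bar>g x - g y\<bar> \<le> L * \<bar>x - y\<bar>"
    and \<zeta>_measurable: "\<zeta> \<in> borel_measurable (F T)" and \<zeta>_bound: "\<And>\<omega>. \<bar>\<zeta> \<omega>\<bar> \<le> z"
begin

section \<open>Picard iteration for a bounded Lipschitz driver\<close>

definition "sol_bound = z + b * (\<integral>u. a u \<partial>lborel)"

lemma b_nonneg: "0 \<le> b" using g_bound[of 0] by linarith
lemma L_nonneg: "0 \<le> L" using g_lipschitz[of 1 0] by simp
lemma sol_bound_nonneg: "0 \<le> sol_bound"
  unfolding sol_bound_def using \<zeta>_bound b_nonneg a_nonneg
  by (meson Bochner_Integration.integral_nonneg abs_ge_zero add_nonneg_nonneg mult_nonneg_nonneg order_trans)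

lemma tail_value_measurable_T: "prog X \<Longrightarrow> tail_value g \<zeta> X t \<in> borel_measurable (F T)"
  unfolding tail_value_def by (intro borel_measurable_diff \<zeta>_measurable driver_integral_measurable_T g_measurable) auto

lemma tail_value_measurable: "prog X \<Longrightarrow> tail_value g \<zeta> X t \<in> borel_measurable M"
  using T_pos by (intro measurable_F_M[OF tail_value_measurable_T]) auto

lemma tail_value_bound: "prog X \<Longrightarrow> \<omega> \<in> space M \<Longrightarrow> \<bar>tail_value g \<zeta> X t \<omega>\<bar> \<le> sol_bound"
  unfolding tail_value_def sol_bound_def
  using driver_integral_bound[OF _ g_measurable g_bound, of X \<omega> "{t..T}"] \<zeta>_bound[of \<omega>] by auto

lemma tail_value_integrable: "prog X \<Longrightarrow> integrable M (tail_value g \<zeta> X t)"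
  by (rule integrable_const_bound[OF _ tail_value_measurable]) (auto intro: tail_value_bound)

lemma tail_value_split:
  assumes X: "prog X" and w: "\<omega> \<in> space M" and t: "0 \<le> t" "t < T"
  shows "tail_value g \<zeta> X t \<omega> = tail_value g \<zeta> X 0 \<omega> + (LINT u:{0..t}|lborel. v u \<omega> * g (X u \<omega>))"
  unfolding tail_value_def
  using set_integral_combine[OF driver_set_integrable[OF X g_measurable g_bound w], of 0 T t] t by auto

lemma driver_integral_integrable:
  assumes X: "prog X"
  shows "integrable M (\<lambda>\<omega>. LINT u:{s..t}|lborel. v u \<omega> * g (X u \<omega>))"
  by (rule integrable_const_bound[where B="b * (\<integral>u. a u \<partial>lborel)", OF _ driver_integral_measurable_M[OF X g_measurable]])
    (use driver_integral_bound[OF X g_measurable g_bound] in \<open>auto intro!: AE_I2\<close>)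

text \<open>The tail value at \<open>t\<close> is the tail value \<open>?W\<close> at 0 plus the
  driver integral over [0, t], which is known at time \<open>t\<close>. A right-continuous version
  of the martingale closed by \<open>?W\<close> plus that integral is therefore an output of the
  Picard map.\<close>

lemma picard_step:
  assumes X: "prog X"
  shows "\<exists>Y. prog Y \<and> (\<forall>t \<omega>. \<bar>Y t \<omega>\<bar> \<le> sol_bound) \<and> conditional_value g \<zeta> X Y"
proof -
  let ?W = "tail_value g \<zeta> X 0"
  let ?I = "\<lambda>t \<omega>. LINT u:{0..t}|lborel. v u \<omega> * g (X u \<omega>)"
  obtain N where N: "mart N" "cadlag_before M T N"
    "\<And>t. 0 \<le> t \<Longrightarrow> t < T \<Longrightarrow> AE \<omega> in M. N t \<omega> = real_cond_exp M (F t) ?W \<omega>"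
    using mart_cadlag_modification[OF mart_cond_exp(1)[OF tail_value_integrable[OF X, of 0]]] by blast
  define Y where "Y \<equiv> \<lambda>t \<omega>. N t \<omega> + ?I t \<omega>"
  have Ym: "Y t \<in> borel_measurable (F t)" if "0 \<le> t" "t < T" for t
    unfolding Y_def using N(1) that
    by (intro borel_measurable_add driver_integral_measurable X g_measurable) (auto simp: martingale_before_def intro: adaptedD)
  have Yi: "integrable M (Y t)" if "0 \<le> t" "t < T" for t
    unfolding Y_def using N(1) that driver_integral_integrable[OF X] by (auto simp: martingale_before_def)
  have rc: "((\<lambda>s. Y s \<omega>) \<longlongrightarrow> Y t \<omega>) (at_right t)" if w: "\<omega> \<in> space M" and t: "t \<in> {0..<T}" for t \<omega>
  proof (rule right_continuous_of_increments[where T=T])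
    show "((\<lambda>s. N s \<omega>) \<longlongrightarrow> N t \<omega>) (at_right t)" using N(2) w t by (auto simp: cadlag_before_def)
    fix s assume s: "t \<le> s" "s < T"
    show "set_integrable lborel {t..s} (\<lambda>u. v u \<omega> * g (X u \<omega>)) \<and>
        Y s \<omega> = Y t \<omega> + (LINT u:{t..s}|lborel. v u \<omega> * g (X u \<omega>)) + (N s \<omega> - N t \<omega>)"
      using driver_set_integrable[OF X g_measurable g_bound w] s t
        set_integral_combine[OF driver_set_integrable[OF X g_measurable g_bound w], of 0 s t]
      by (simp add: Y_def)
  qed (use t in auto)
  have progY: "prog Y" by (rule prog_right_continuous[OF _ rc]) (use Ym in \<open>auto simp: adapted_before_def\<close>)
  have eq: "(\<integral>\<omega>. indicator B \<omega> * Y t \<omega> \<partial>M) = (\<integral>\<omega>. indicator B \<omega> * tail_value g \<zeta> X t \<omega> \<partial>M)"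
    if t: "0 \<le> t" "t < T" and B: "B \<in> sets (F t)" for t B
  proof -
    have BM: "B \<in> sets M" using B sets_F_M t by auto
    have Ni: "integrable M (N t)" using N(1) t by (auto simp: martingale_before_def)
    have i: "integrable M (\<lambda>\<omega>. indicator B \<omega> * N t \<omega>)" "integrable M (\<lambda>\<omega>. indicator B \<omega> * ?I t \<omega>)"
      "integrable M (\<lambda>\<omega>. indicator B \<omega> * ?W \<omega>)"
      using Ni BM driver_integral_integrable[OF X] tail_value_integrable[OF X] by (auto intro!: integrable_indicator_mult)
    have "(\<integral>\<omega>. indicator B \<omega> * N t \<omega> \<partial>M) = (\<integral>\<omega>. indicator B \<omega> * real_cond_exp M (F t) ?W \<omega> \<partial>M)"
      using N(3)[OF t] Ni BM by (intro integral_indicator_cong_AE) auto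
    also have "\<dots> = (\<integral>\<omega>. indicator B \<omega> * ?W \<omega> \<partial>M)" by (rule mart_cond_exp(2)[OF tail_value_integrable[OF X] t(1) B])
    finally have "(\<integral>\<omega>. indicator B \<omega> * Y t \<omega> \<partial>M) = (\<integral>\<omega>. indicator B \<omega> * ?W \<omega> + indicator B \<omega> * ?I t \<omega> \<partial>M)"
      using i by (simp add: Y_def distrib_left)
    also have "\<dots> = (\<integral>\<omega>. indicator B \<omega> * tail_value g \<zeta> X t \<omega> \<partial>M)"
      by (rule Bochner_Integration.integral_cong) (auto simp: tail_value_split[OF X _ t] distrib_left)
    finally show ?thesis .
  qed
  \<comment> \<open>Clipping changes nothing almost surely at any fixed time, but gives the bound on
    every path, as needed for the next iteration.\<close>
  define Y' where "Y' \<equiv> \<lambda>t \<omega>. max (- sol_bound) (min sol_bound (Y t \<omega>))"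
  have Y'Y: "AE \<omega> in M. Y' t \<omega> = Y t \<omega>" if t: "0 \<le> t" "t < T" for t
  proof -
    have "AE \<omega> in M. Y t \<omega> \<le> sol_bound"
      by (rule cond_le_const[OF t(1) Ym[OF t] Yi[OF t] tail_value_integrable[OF X] eq[OF t]])
        (use tail_value_bound[OF X] in \<open>auto simp: abs_le_iff intro!: AE_I2\<close>)
    moreover have "AE \<omega> in M. - Y t \<omega> \<le> sol_bound"
      by (rule cond_le_const[OF t(1), where w="\<lambda>\<omega>. - tail_value g \<zeta> X t \<omega>"])
        (use tail_value_bound[OF X] tail_value_integrable[OF X] eq[OF t] Ym[OF t] Yi[OF t] in \<open>auto simp: abs_le_iff intro!: AE_I2\<close>)
    ultimately show ?thesis by eventually_elim (auto simp: Y'_def)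
  qed
  have Y'm: "Y' t \<in> borel_measurable (F t)" if "0 \<le> t" "t < T" for t
    unfolding Y'_def using Ym[OF that] by simp
  have "conditional_value g \<zeta> X Y'"
    unfolding conditional_value_def
  proof (intro allI impI conjI ballI)
    fix t assume "0 \<le> t \<and> t < T"
    then have t: "0 \<le> t" "t < T" by auto
    show "Y' t \<in> borel_measurable (F t)" by (rule Y'm[OF t])
    have m: "Y' t \<in> borel_measurable M" by (rule measurable_F_M[OF Y'm[OF t] t(1)])
    show "integrable M (Y' t)"
      by (rule integrable_const_bound[where B=sol_bound, OF _ m]) (use sol_bound_nonneg in \<open>auto simp: Y'_def\<close>)
    fix B assume B: "B \<in> sets (F t)"
    then show "(\<integral>\<omega>. indicator B \<omega> * Y' t \<omega> \<partial>M) = (\<integral>\<omega>. indicator B \<omega> * tail_value g \<zeta> X t \<omega> \<partial>M)"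
      using integral_indicator_cong_AE[OF Y'Y[OF t] m, of B] Yi[OF t] eq[OF t B] sets_F_M[OF t(1)] by auto
  qed
  moreover have "prog Y'" unfolding Y'_def by (rule prog_comp[OF progY]) measurable
  moreover have "\<bar>Y' t \<omega>\<bar> \<le> sol_bound" for t \<omega> using sol_bound_nonneg by (auto simp: Y'_def)
  ultimately show ?thesis by blast
qed

lemma tail_value_difference:
  assumes X: "prog X" and Y: "prog Y" and w: "\<omega> \<in> space M"
    and i: "set_integrable lborel {t..T} (\<lambda>u. a u * \<bar>X u \<omega> - Y u \<omega>\<bar>)"
  shows "\<bar>tail_value g \<zeta> X t \<omega> - tail_value g \<zeta> Y t \<omega>\<bar> \<le> L * (LINT u:{t..T}|lborel. a u * \<bar>X u \<omega> - Y u \<omega>\<bar>)"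
proof -
  have iX: "set_integrable lborel {t..T} (\<lambda>u. v u \<omega> * g (X u \<omega>))" "set_integrable lborel {t..T} (\<lambda>u. v u \<omega> * g (Y u \<omega>))"
    using driver_set_integrable[OF _ g_measurable g_bound w] X Y by auto
  note d = set_integral_diff[OF iX]
  have "\<bar>tail_value g \<zeta> X t \<omega> - tail_value g \<zeta> Y t \<omega>\<bar> = \<bar>LINT u:{t..T}|lborel. v u \<omega> * g (X u \<omega>) - v u \<omega> * g (Y u \<omega>)\<bar>"
    unfolding d(2) tail_value_def by simp
  also have "\<dots> \<le> (LINT u:{t..T}|lborel. L * (a u * \<bar>X u \<omega> - Y u \<omega>\<bar>))"
  proof -
    have iL: "set_integrable lborel {t..T} (\<lambda>u. L * (a u * \<bar>X u \<omega> - Y u \<omega>\<bar>))" using i by simp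
    have le: "\<bar>v u \<omega> * g (X u \<omega>) - v u \<omega> * g (Y u \<omega>)\<bar> \<le> L * (a u * \<bar>X u \<omega> - Y u \<omega>\<bar>)" for u
    proof -
      have "\<bar>v u \<omega> * g (X u \<omega>) - v u \<omega> * g (Y u \<omega>)\<bar> = v u \<omega> * \<bar>g (X u \<omega>) - g (Y u \<omega>)\<bar>"
        using v_nonneg[of u \<omega>] by (simp add: abs_mult flip: right_diff_distrib)
      also have "\<dots> \<le> a u * (L * \<bar>X u \<omega> - Y u \<omega>\<bar>)"
        using v_nonneg[of u \<omega>] v_le[of u \<omega>] a_nonneg[of u] by (intro mult_mono g_lipschitz) auto
      finally show ?thesis by (simp add: mult_ac)
    qed
    have "(LINT u:{t..T}|lborel. v u \<omega> * g (X u \<omega>) - v u \<omega> * g (Y u \<omega>)) \<le> (LINT u:{t..T}|lborel. L * (a u * \<bar>X u \<omega> - Y u \<omega>\<bar>))"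
      using le by (intro set_integral_mono d(1) iL) (auto simp: abs_le_iff)
    moreover have "- (LINT u:{t..T}|lborel. v u \<omega> * g (X u \<omega>) - v u \<omega> * g (Y u \<omega>)) \<le> (LINT u:{t..T}|lborel. L * (a u * \<bar>X u \<omega> - Y u \<omega>\<bar>))"
    proof -
      have "- (LINT u:{t..T}|lborel. v u \<omega> * g (X u \<omega>) - v u \<omega> * g (Y u \<omega>)) = (LINT u:{t..T}|lborel. v u \<omega> * g (Y u \<omega>) - v u \<omega> * g (X u \<omega>))"
        unfolding d(2) set_integral_diff(2)[OF iX(2,1)] by simp
      also have "\<dots> \<le> (LINT u:{t..T}|lborel. L * (a u * \<bar>X u \<omega> - Y u \<omega>\<bar>))"
        using le by (intro set_integral_mono set_integral_diff(1)[OF iX(2,1)] iL) (auto simp: abs_le_iff)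
      finally show ?thesis .
    qed
    ultimately show ?thesis by linarith
  qed
  finally show ?thesis by simp
qed

text \<open>Means of differences are measured relative to the exponential weight. By
  \<open>exp_weight_integral\<close> the backward integral of \<open>L * a\<close> against this
  weight is less than half of it, which produces the contraction factor 1/2 without any restriction
  on \<open>L\<close> or \<open>T\<close>.\<close>

lemma picard_contraction:
  assumes X: "prog X" "\<And>t \<omega>. \<bar>X t \<omega>\<bar> \<le> c" and Y: "prog Y" "\<And>t \<omega>. \<bar>Y t \<omega>\<bar> \<le> c"
    and X': "conditional_value g \<zeta> X X'" and Y': "conditional_value g \<zeta> Y Y'"
    and bound: "\<And>u. 0 \<le> u \<Longrightarrow> u < T \<Longrightarrow> (\<integral>\<omega>. \<bar>X u \<omega> - Y u \<omega>\<bar> \<partial>M) \<le> k * exp (2 * L * (LINT x:{u..T}|lborel. a x))"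
    and t: "0 \<le> t" "t < T" and k: "0 \<le> k"
  shows "(\<integral>\<omega>. \<bar>X' t \<omega> - Y' t \<omega>\<bar> \<partial>M) \<le> k / 2 * exp (2 * L * (LINT x:{t..T}|lborel. a x))"
proof -
  define w where "w \<equiv> \<lambda>u. exp (2 * L * (LINT x:{u..T}|lborel. a x))"
  let ?h = "\<lambda>\<omega> u. indicator {t..T} u * (a u * (indicator {0..<T} u * \<bar>X u \<omega> - Y u \<omega>\<bar>))"
  define \<delta> where "\<delta> \<equiv> \<lambda>u. \<integral>\<omega>. indicator {0..<T} u * \<bar>X u \<omega> - Y u \<omega>\<bar> \<partial>M"
  have c0: "0 \<le> c" using X(2)[of 0] abs_ge_zero order_trans by blast
  have dm: "(\<lambda>x. indicator {0..<T} (snd x) * \<bar>X (snd x) (fst x) - Y (snd x) (fst x)\<bar>) \<in> borel_measurable (M \<Otimes>\<^sub>M borel)"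
  proof -
    note prog_measurable_M[OF X(1), measurable] prog_measurable_M[OF Y(1), measurable]
    have "(\<lambda>x. \<bar>indicator {0..<T} (snd x) * X (snd x) (fst x) - indicator {0..<T} (snd x) * Y (snd x) (fst x)\<bar>) \<in> borel_measurable (M \<Otimes>\<^sub>M borel)"
      by measurable
    moreover have "\<bar>indicator {0..<T} u * x - indicator {0..<T} u * y\<bar> = indicator {0..<T} u * \<bar>x - y\<bar>" for u x y :: real
      by (auto simp: indicator_def)
    ultimately show ?thesis by simp
  qed
  have dc: "\<bar>X u \<omega> - Y u \<omega>\<bar> \<le> 2 * c" for u \<omega> using X(2)[of u \<omega>] Y(2)[of u \<omega>] by linarith
  have hi: "integrable (M \<Otimes>\<^sub>M lborel) (\<lambda>(\<omega>, u). ?h \<omega> u)"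
  proof (rule integrable_pair_bounded[where b="\<lambda>u. 2 * c * a u"])
    note dm[measurable] a_measurable[measurable]
    have "(\<lambda>x. indicator {t..T} (snd x) * (a (snd x) * (indicator {0..<T} (snd x) * \<bar>X (snd x) (fst x) - Y (snd x) (fst x)\<bar>))) \<in> borel_measurable (M \<Otimes>\<^sub>M borel)"
      by measurable
    then show "(\<lambda>(\<omega>, u). ?h \<omega> u) \<in> borel_measurable (M \<Otimes>\<^sub>M borel)" by (simp add: split_beta')
    show "integrable lborel (\<lambda>u. 2 * c * a u)" using a_integrable by simp
    show "\<bar>(\<lambda>(\<omega>, u). ?h \<omega> u) (\<omega>, u)\<bar> \<le> 2 * c * a u" for \<omega> u
      using mult_left_mono[OF dc[of u \<omega>] a_nonneg[of u]] a_nonneg[of u] c0 by (auto simp: indicator_def mult_ac)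
  qed
  have h_eq: "?h \<omega> u = indicator {t..T} u * (a u * \<bar>X u \<omega> - Y u \<omega>\<bar>)" for \<omega> u
    using a_zero[of u] by (cases "u \<in> {0..<T}") auto
  define J where "J \<equiv> \<lambda>\<omega>. LINT u:{t..T}|lborel. a u * \<bar>X u \<omega> - Y u \<omega>\<bar>"
  have J_eq: "(\<integral>u. ?h \<omega> u \<partial>lborel) = J \<omega>" for \<omega>
    unfolding h_eq J_def set_lebesgue_integral_def by simp
  have J_int: "set_integrable lborel {t..T} (\<lambda>u. a u * \<bar>X u \<omega> - Y u \<omega>\<bar>)" if w: "\<omega> \<in> space M" for \<omega>
  proof -
    have m1: "(\<lambda>u. indicator {0..<T} u * \<bar>X u \<omega> - Y u \<omega>\<bar>) \<in> borel_measurable borel"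
      using measurable_compose[OF measurable_Pair1'[OF w] dm] by simp
    have "set_integrable lborel {t..T} (\<lambda>u. (indicator {0..<T} u * \<bar>X u \<omega> - Y u \<omega>\<bar>) * a u)"
      using dc[of _ \<omega>] c0 by (intro set_integrable_mult_bounded[OF a_set_integrable m1, where c="2 * c"]) (auto simp: indicator_def)
    moreover have "(indicator {0..<T} u * \<bar>X u \<omega> - Y u \<omega>\<bar>) * a u = a u * \<bar>X u \<omega> - Y u \<omega>\<bar>" for u
      using a_zero[of u] by (cases "u \<in> {0..<T}") auto
    ultimately show ?thesis by simp
  qed
  have Ji: "integrable M J" using pair.integrable_fst[OF hi] by (simp add: J_eq)
  have EJ: "(\<integral>\<omega>. J \<omega> \<partial>M) = (LINT u:{t..T}|lborel. a u * \<delta> u)"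
  proof -
    have "(\<integral>\<omega>. J \<omega> \<partial>M) = (\<integral>u. (\<integral>\<omega>. ?h \<omega> u \<partial>M) \<partial>lborel)"
      using pair.Fubini_integral[OF hi] by (simp add: J_eq)
    then show ?thesis by (simp add: \<delta>_def set_lebesgue_integral_def)
  qed
  have \<delta>m: "\<delta> \<in> borel_measurable borel"
  proof -
    have "(\<lambda>(u, \<omega>). indicator {0..<T} u * \<bar>X u \<omega> - Y u \<omega>\<bar>) \<in> borel_measurable (borel \<Otimes>\<^sub>M M)"
      using measurable_compose[OF measurable_pair_swap' dm] by (simp add: split_beta')
    then show ?thesis unfolding \<delta>_def by (rule borel_measurable_lebesgue_integral)
  qed
  have \<delta>k: "\<delta> u \<le> k * w u" and \<delta>0: "0 \<le> \<delta> u" for u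
  proof -
    show "\<delta> u \<le> k * w u"
      using bound[of u] k by (cases "u \<in> {0..<T}") (auto simp: \<delta>_def w_def)
    show "0 \<le> \<delta> u" unfolding \<delta>_def by (intro Bochner_Integration.integral_nonneg) (auto simp: indicator_def)
  qed
  have \<delta>c: "\<delta> u \<le> 2 * c" for u
  proof -
    have "\<delta> u \<le> (\<integral>\<omega>. 2 * c \<partial>M)"
      unfolding \<delta>_def
    proof (rule integral_mono')
      show "indicator {0..<T} u * \<bar>X u \<omega> - Y u \<omega>\<bar> \<le> 2 * c" for \<omega> using dc[of u \<omega>] c0 by (auto simp: indicator_def)
    qed (use c0 in auto)
    then show ?thesis by (simp add: prob_space)
  qed
  have iw: "set_integrable lborel {t..T} (\<lambda>u. a u * w u)"
    unfolding w_def using t a_nonneg by (intro exp_weight_integral(1) a_set_integrable) auto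
  have i\<delta>: "set_integrable lborel {t..T} (\<lambda>u. a u * \<delta> u)"
    using set_integrable_mult_bounded[OF a_set_integrable \<delta>m, of "{t..T}" "2 * c"] \<delta>c \<delta>0 by (simp add: mult.commute)
  have X'm: "X' t \<in> borel_measurable (F t)" "integrable M (X' t)" "Y' t \<in> borel_measurable (F t)" "integrable M (Y' t)"
    using X' Y' t by (auto simp: conditional_value_def)
  have "(\<integral>\<omega>. \<bar>X' t \<omega> - Y' t \<omega>\<bar> \<partial>M) \<le> (\<integral>\<omega>. \<bar>tail_value g \<zeta> X t \<omega> - tail_value g \<zeta> Y t \<omega>\<bar> \<partial>M)"
  proof (rule cond_abs_integral_le[OF t(1)])
    fix B assume B: "B \<in> sets (F t)"
    then have BM: "B \<in> sets M" using sets_F_M t by auto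
    have "(\<integral>\<omega>. indicator B \<omega> * X' t \<omega> \<partial>M) = (\<integral>\<omega>. indicator B \<omega> * tail_value g \<zeta> X t \<omega> \<partial>M)"
      "(\<integral>\<omega>. indicator B \<omega> * Y' t \<omega> \<partial>M) = (\<integral>\<omega>. indicator B \<omega> * tail_value g \<zeta> Y t \<omega> \<partial>M)"
      using X' Y' t B by (auto simp: conditional_value_def)
    then show "(\<integral>\<omega>. indicator B \<omega> * (X' t \<omega> - Y' t \<omega>) \<partial>M) = (\<integral>\<omega>. indicator B \<omega> * (tail_value g \<zeta> X t \<omega> - tail_value g \<zeta> Y t \<omega>) \<partial>M)"
      using X'm BM tail_value_integrable[OF X(1)] tail_value_integrable[OF Y(1)]
      by (simp add: right_diff_distrib integrable_indicator_mult)
  qed (use X'm tail_value_integrable[OF X(1)] tail_value_integrable[OF Y(1)] in auto)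
  also have "\<dots> \<le> (\<integral>\<omega>. L * J \<omega> \<partial>M)"
    using tail_value_integrable[OF X(1)] tail_value_integrable[OF Y(1)] Ji
    by (intro integral_mono) (auto simp: J_def intro!: tail_value_difference X(1) Y(1) J_int)
  also have "\<dots> = L * (LINT u:{t..T}|lborel. a u * \<delta> u)" using EJ by simp
  also have "\<dots> \<le> L * (LINT u:{t..T}|lborel. k * (a u * w u))"
  proof (intro mult_left_mono set_integral_mono i\<delta> L_nonneg)
    show "set_integrable lborel {t..T} (\<lambda>u. k * (a u * w u))" using iw by simp
    show "a u * \<delta> u \<le> k * (a u * w u)" for u using mult_left_mono[OF \<delta>k[of u] a_nonneg[of u]] by (simp add: mult_ac)
  qed
  also have "\<dots> = k * (L * (LINT u:{t..T}|lborel. a u * w u))" by simp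
  also have "L * (LINT u:{t..T}|lborel. a u * w u) = (w t - 1) / 2"
    unfolding w_def using t a_nonneg by (intro exp_weight_integral(2) a_set_integrable) auto
  also have "k * ((w t - 1) / 2) \<le> k / 2 * w t" using k by (simp add: field_simps)
  finally show ?thesis by (simp add: w_def)
qed

text \<open>The mean distances of consecutive iterates decay geometrically at each time, so they are
  summable on almost every path and the iterates converge almost surely at each fixed time.
  Dominated convergence then passes to the limit on both sides of the conditional identity.\<close>

theorem conditional_fixed_point:
  "\<exists>X. prog X \<and> (\<forall>t \<omega>. \<bar>X t \<omega>\<bar> \<le> sol_bound) \<and> conditional_value g \<zeta> X X"
proof -
  let ?c = sol_bound
  have "\<exists>X. \<forall>n. (prog (X n) \<and> (\<forall>t \<omega>. \<bar>X n t \<omega>\<bar> \<le> ?c)) \<and> conditional_value g \<zeta> (X n) (X (Suc n))"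
  proof (rule dependent_nat_choice)
    show "\<exists>X. prog X \<and> (\<forall>t \<omega>. \<bar>X t \<omega>\<bar> \<le> ?c)"
      using sol_bound_nonneg prog_comp[OF v_prog, of "\<lambda>_. 0"] by (intro exI[of _ "\<lambda>_ _. 0"]) auto
    fix X :: "real \<Rightarrow> 'a \<Rightarrow> real" and n :: nat assume "prog X \<and> (\<forall>t \<omega>. \<bar>X t \<omega>\<bar> \<le> ?c)"
    then show "\<exists>Y. (prog Y \<and> (\<forall>t \<omega>. \<bar>Y t \<omega>\<bar> \<le> ?c)) \<and> conditional_value g \<zeta> X Y" using picard_step by blast
  qed
  then obtain X where X: "\<And>n. prog (X n)" "\<And>n t \<omega>. \<bar>X n t \<omega>\<bar> \<le> ?c" "\<And>n. conditional_value g \<zeta> (X n) (X (Suc n))" by blast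
  define w where "w \<equiv> \<lambda>u. exp (2 * L * (LINT x:{u..T}|lborel. a x))"
  have Xm: "X n t \<in> borel_measurable M" if "0 \<le> t" "t < T" for n t
    using measurable_compose[OF measurable_Pair2'[of t] prog_measurable_M[OF X(1)[of n]]] that by simp
  have di: "integrable M (\<lambda>\<omega>. \<bar>X (Suc n) t \<omega> - X n t \<omega>\<bar>)" if "0 \<le> t" "t < T" for n t
  proof (rule integrable_const_bound[where B="2 * ?c"])
    show "AE \<omega> in M. norm \<bar>X (Suc n) t \<omega> - X n t \<omega>\<bar> \<le> 2 * ?c"
      using X(2)[of "Suc n" t] X(2)[of n t] by (intro AE_I2) (simp, smt (verit))
  qed (use Xm[OF that] in auto)
  have geo: "(\<integral>\<omega>. \<bar>X (Suc n) t \<omega> - X n t \<omega>\<bar> \<partial>M) \<le> (2 * ?c) * (1 / 2) ^ n * w t" if "0 \<le> t" "t < T" for n t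
    using that
  proof (induction n arbitrary: t)
    case 0
    have "0 \<le> (LINT x:{t..T}|lborel. a x)" using a_nonneg by (intro set_integral_nonneg_real) auto
    then have w1: "1 \<le> w t" using L_nonneg by (simp add: w_def)
    have "(\<integral>\<omega>. \<bar>X (Suc 0) t \<omega> - X 0 t \<omega>\<bar> \<partial>M) \<le> (\<integral>\<omega>. 2 * ?c \<partial>M)"
    proof (rule integral_mono[OF di[OF 0]])
      show "\<bar>X (Suc 0) t \<omega> - X 0 t \<omega>\<bar> \<le> 2 * ?c" for \<omega> using X(2)[of "Suc 0" t \<omega>] X(2)[of 0 t \<omega>] by linarith
    qed auto
    also have "\<dots> \<le> 2 * ?c * w t" using mult_left_mono[OF w1, of "2 * ?c"] sol_bound_nonneg by (simp add: prob_space)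
    finally show ?case by simp
  next
    case (Suc n)
    have "(\<integral>\<omega>. \<bar>X (Suc (Suc n)) t \<omega> - X (Suc n) t \<omega>\<bar> \<partial>M) \<le> (2 * ?c * (1 / 2) ^ n) / 2 * exp (2 * L * (LINT x:{t..T}|lborel. a x))"
      by (rule picard_contraction[OF X(1,2) X(1,2) X(3) X(3) _ Suc.prems])
        (use Suc.IH sol_bound_nonneg in \<open>auto simp: w_def\<close>)
    then show ?case by (simp add: w_def)
  qed
  have conv: "AE \<omega> in M. convergent (\<lambda>n. X n t \<omega>)" if t: "0 \<le> t" "t < T" for t
  proof -
    let ?d = "\<lambda>n \<omega>. \<bar>X (Suc n) t \<omega> - X n t \<omega>\<bar>"
    have "(\<integral>\<^sup>+\<omega>. (\<Sum>n. ennreal (?d n \<omega>)) \<partial>M) = (\<Sum>n. \<integral>\<^sup>+\<omega>. ennreal (?d n \<omega>) \<partial>M)"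
      by (rule nn_integral_suminf) (use Xm[OF t] in auto)
    also have "\<dots> \<le> (\<Sum>n. ennreal (2 * ?c * w t * (1 / 2) ^ n))"
    proof (rule suminf_le)
      show "(\<integral>\<^sup>+\<omega>. ennreal (?d n \<omega>) \<partial>M) \<le> ennreal (2 * ?c * w t * (1 / 2) ^ n)" for n
        using geo[OF t, of n] di[OF t, of n] by (subst nn_integral_eq_integral) (auto intro!: ennreal_leI simp: mult_ac)
    qed auto
    also have "\<dots> < \<top>"
    proof -
      have "(\<Sum>n. ennreal (2 * ?c * w t * (1 / 2) ^ n)) = ennreal (\<Sum>n. 2 * ?c * w t * (1 / 2) ^ n)"
        by (rule suminf_ennreal2) (use sol_bound_nonneg in \<open>auto simp: w_def intro!: summable_mult summable_geometric\<close>)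
      then show ?thesis by simp
    qed
    finally have "AE \<omega> in M. (\<Sum>n. ennreal (?d n \<omega>)) \<noteq> \<infinity>"
      by (intro nn_integral_PInf_AE borel_measurable_suminf_order) (use Xm[OF t] in auto)
    then show ?thesis
    proof eventually_elim
      case (elim \<omega>)
      then have "summable (\<lambda>n. ?d n \<omega>)" by (intro summable_suminf_not_top) auto
      then have "summable (\<lambda>n. X (Suc n) t \<omega> - X n t \<omega>)" by (rule summable_rabs_cancel)
      then have "(\<lambda>n. \<Sum>i<n. X (Suc i) t \<omega> - X i t \<omega>) \<longlonglongrightarrow> (\<Sum>n. X (Suc n) t \<omega> - X n t \<omega>)" by (rule summable_LIMSEQ)
      then have "(\<lambda>n. X n t \<omega> - X 0 t \<omega>) \<longlonglongrightarrow> (\<Sum>n. X (Suc n) t \<omega> - X n t \<omega>)"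
        by (simp add: sum_lessThan_telescope[of "\<lambda>n. X n t \<omega>"])
      from tendsto_add[OF this tendsto_const[of "X 0 t \<omega>"]] show ?case by (auto simp: convergent_def)
    qed
  qed
  \<comment> \<open>Clipping keeps the bound also where the iterates fail to converge and
    \<open>lim\<close> is an arbitrary number.\<close>
  define Y where "Y \<equiv> \<lambda>t \<omega>. max (- ?c) (min ?c (lim (\<lambda>n. X n t \<omega>)))"
  have progY: "prog Y" unfolding Y_def by (rule prog_comp[OF prog_lim[OF X(1)]]) measurable
  have Yc: "\<bar>Y t \<omega>\<bar> \<le> ?c" for t \<omega> using sol_bound_nonneg by (auto simp: Y_def)
  have lim: "AE \<omega> in M. (\<lambda>n. X n t \<omega>) \<longlonglongrightarrow> Y t \<omega>" if t: "0 \<le> t" "t < T" for t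
    using conv[OF t]
  proof eventually_elim
    case (elim \<omega>)
    then have l: "(\<lambda>n. X n t \<omega>) \<longlonglongrightarrow> lim (\<lambda>n. X n t \<omega>)" by (simp add: convergent_LIMSEQ_iff)
    have "\<bar>lim (\<lambda>n. X n t \<omega>)\<bar> \<le> ?c"
      by (rule LIMSEQ_le_const2[OF tendsto_rabs[OF l]]) (use X(2) in auto)
    then have "Y t \<omega> = lim (\<lambda>n. X n t \<omega>)" by (auto simp: Y_def)
    then show ?case using l by simp
  qed
  \<comment> \<open>The null set of \<open>lim\<close> depends on the time. Fubini trades this for
    convergence at almost every time of almost every path, which is enough inside the driver
    integral.\<close>
  have limAE: "AE \<omega> in M. AE u in lborel. u \<in> {0..<T} \<longrightarrow> (\<lambda>n. X n u \<omega>) \<longlonglongrightarrow> Y u \<omega>"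
    by (rule AE_AE_lborel_of_AE_LIMSEQ[OF X(1) progY lim])
  have tail_lim: "AE \<omega> in M. (\<lambda>n. tail_value g \<zeta> (X n) t \<omega>) \<longlonglongrightarrow> tail_value g \<zeta> Y t \<omega>" for t
    using limAE AE_space
  proof eventually_elim
    case (elim \<omega>)
    have gc: "(\<lambda>n. g (x n)) \<longlonglongrightarrow> g y" if "x \<longlonglongrightarrow> y" for x y
    proof (rule Lim_transform_bound[where g="\<lambda>n. L * \<bar>x n - y\<bar>", THEN LIM_zero_cancel])
      show "eventually (\<lambda>n. norm (g (x n) - g y) \<le> norm (L * \<bar>x n - y\<bar>)) sequentially"
        using g_lipschitz L_nonneg by (auto simp: abs_mult intro!: always_eventually)
      have "(\<lambda>n. L * \<bar>x n - y\<bar>) \<longlonglongrightarrow> L * \<bar>y - y\<bar>" by (intro tendsto_intros that)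
      then show "(\<lambda>n. L * \<bar>x n - y\<bar>) \<longlonglongrightarrow> 0" by simp
    qed
    have "(\<lambda>n. LINT u:{t..T}|lborel. v u \<omega> * g (X n u \<omega>)) \<longlonglongrightarrow> (LINT u:{t..T}|lborel. v u \<omega> * g (Y u \<omega>))"
      unfolding set_lebesgue_integral_def
    proof (rule integral_dominated_convergence[where w="\<lambda>u. a u * b"])
      show "(\<lambda>u. indicator {t..T} u *\<^sub>R (v u \<omega> * g (Y u \<omega>))) \<in> borel_measurable lborel"
        using driver_path_measurable[OF progY g_measurable elim(2)] by auto
      show "(\<lambda>u. indicator {t..T} u *\<^sub>R (v u \<omega> * g (X n u \<omega>))) \<in> borel_measurable lborel" for n
        using driver_path_measurable[OF X(1) g_measurable elim(2)] by auto
      show "integrable lborel (\<lambda>u. a u * b)" using a_integrable by simp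
      show "AE u in lborel. (\<lambda>n. indicator {t..T} u *\<^sub>R (v u \<omega> * g (X n u \<omega>))) \<longlonglongrightarrow> indicator {t..T} u *\<^sub>R (v u \<omega> * g (Y u \<omega>))"
        using elim(1)
      proof eventually_elim
        case (elim u)
        show ?case
        proof (cases "u \<in> {0..<T}")
          case True
          then show ?thesis using elim by (intro tendsto_intros gc) auto
        qed (simp add: v_zero)
      qed
      show "AE u in lborel. norm (indicator {t..T} u *\<^sub>R (v u \<omega> * g (X n u \<omega>))) \<le> a u * b" for n
      proof (rule AE_I2)
        fix u
        have "\<bar>v u \<omega> * g (X n u \<omega>)\<bar> \<le> a u * b" unfolding abs_mult
          using v_nonneg[of u \<omega>] v_le[of u \<omega>] g_bound a_nonneg by (intro mult_mono) auto
        then show "norm (indicator {t..T} u *\<^sub>R (v u \<omega> * g (X n u \<omega>))) \<le> a u * b"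
          using a_nonneg[of u] b_nonneg by (auto simp: indicator_def)
      qed
    qed
    then show ?case unfolding tail_value_def by (intro tendsto_intros)
  qed
  have "conditional_value g \<zeta> Y Y"
    unfolding conditional_value_def
  proof (intro allI impI conjI ballI)
    fix t assume "0 \<le> t \<and> t < T"
    then have t: "0 \<le> t" "t < T" by auto
    show Ym: "Y t \<in> borel_measurable (F t)"
      using measurable_compose[OF measurable_Pair2'[of t] progD[OF progY t]] t by simp
    have YM: "Y t \<in> borel_measurable M" by (rule measurable_F_M[OF Ym t(1)])
    show "integrable M (Y t)" by (rule integrable_const_bound[where B="?c", OF _ YM]) (use Yc in auto)
    fix B assume B: "B \<in> sets (F t)"
    then have BM: "B \<in> sets M" using sets_F_M t by auto
    have 1: "(\<lambda>n. \<integral>\<omega>. indicator B \<omega> * X (Suc n) t \<omega> \<partial>M) \<longlonglongrightarrow> (\<integral>\<omega>. indicator B \<omega> * Y t \<omega> \<partial>M)"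
    proof (rule integral_dominated_convergence[where w="\<lambda>_. ?c"])
      show "AE \<omega> in M. (\<lambda>n. indicator B \<omega> * X (Suc n) t \<omega>) \<longlonglongrightarrow> indicator B \<omega> * Y t \<omega>"
        using lim[OF t] by eventually_elim (intro tendsto_intros LIMSEQ_Suc)
      show "AE \<omega> in M. norm (indicator B \<omega> * X (Suc n) t \<omega>) \<le> ?c" for n
        using X(2)[of "Suc n" t] sol_bound_nonneg by (intro AE_I2) (auto simp: indicator_def)
    qed (use YM Xm[OF t] BM in auto)
    have 2: "(\<lambda>n. \<integral>\<omega>. indicator B \<omega> * tail_value g \<zeta> (X n) t \<omega> \<partial>M) \<longlonglongrightarrow> (\<integral>\<omega>. indicator B \<omega> * tail_value g \<zeta> Y t \<omega> \<partial>M)"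
    proof (rule integral_dominated_convergence[where w="\<lambda>_. ?c"])
      show "AE \<omega> in M. (\<lambda>n. indicator B \<omega> * tail_value g \<zeta> (X n) t \<omega>) \<longlonglongrightarrow> indicator B \<omega> * tail_value g \<zeta> Y t \<omega>"
        using tail_lim[of t] by eventually_elim (intro tendsto_intros)
      show "AE \<omega> in M. norm (indicator B \<omega> * tail_value g \<zeta> (X n) t \<omega>) \<le> ?c" for n
        using tail_value_bound[OF X(1)[of n], of _ t] sol_bound_nonneg by (intro AE_I2) (auto simp: indicator_def)
    qed (use tail_value_measurable X(1) progY BM in auto)
    have "(\<integral>\<omega>. indicator B \<omega> * X (Suc n) t \<omega> \<partial>M) = (\<integral>\<omega>. indicator B \<omega> * tail_value g \<zeta> (X n) t \<omega> \<partial>M)" for n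
      using X(3)[of n] t B by (auto simp: conditional_value_def)
    then show "(\<integral>\<omega>. indicator B \<omega> * Y t \<omega> \<partial>M) = (\<integral>\<omega>. indicator B \<omega> * tail_value g \<zeta> Y t \<omega> \<partial>M)"
      using 1 2 by (simp add: LIMSEQ_unique)
  qed
  then show ?thesis using progY Yc by blast
qed

text \<open>Right-continuous regularization of the fixed point. Its martingale part is bounded and
  closed by the tail value at 0, hence converges to it at \<open>T\<close>; adding the full driver
  integral leaves exactly \<open>\<zeta>\<close>.\<close>

theorem bounded_solution:
  assumes lc: "left_continuous_filtration_at M F T"
  shows "\<exists>Y N. adapted_before F T Y \<and> mart N \<and> cadlag_before M T N \<and>
    (\<forall>\<omega>\<in>space M. \<forall>t\<in>{0..<T}. ((\<lambda>s. Y s \<omega>) \<longlongrightarrow> Y t \<omega>) (at_right t)) \<and>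
    (AE \<omega> in M. \<forall>t\<in>{0..<T}. Y t \<omega> = N t \<omega> + (LINT u:{0..t}|lborel. v u \<omega> * g (Y u \<omega>))) \<and>
    (AE \<omega> in M. \<forall>t\<in>{0..<T}. \<bar>Y t \<omega>\<bar> \<le> sol_bound) \<and>
    conditional_value g \<zeta> Y Y \<and> (AE \<omega> in M. ((\<lambda>t. Y t \<omega>) \<longlongrightarrow> \<zeta> \<omega>) (at_left T))"
proof -
  obtain X where X: "prog X" "\<And>t \<omega>. \<bar>X t \<omega>\<bar> \<le> sol_bound" "conditional_value g \<zeta> X X"
    using conditional_fixed_point by blast
  let ?I = "\<lambda>X t \<omega>. LINT u:{0..t}|lborel. v u \<omega> * g (X u \<omega>)"
  let ?W = "tail_value g \<zeta> X 0"
  have Xm: "X t \<in> borel_measurable (F t)" "integrable M (X t)" if "0 \<le> t" "t < T" for t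
    using X(3) that by (auto simp: conditional_value_def)
  have Wi: "integrable M ?W" by (rule tail_value_integrable[OF X(1)])
  have ZW: "(\<integral>\<omega>. indicator B \<omega> * (X t \<omega> - ?I X t \<omega>) \<partial>M) = (\<integral>\<omega>. indicator B \<omega> * ?W \<omega> \<partial>M)"
    if t: "0 \<le> t" "t < T" and B: "B \<in> sets (F t)" for t B
  proof -
    have BM: "B \<in> sets M" using B sets_F_M t by auto
    have "(\<integral>\<omega>. indicator B \<omega> * X t \<omega> \<partial>M) = (\<integral>\<omega>. indicator B \<omega> * tail_value g \<zeta> X t \<omega> \<partial>M)"
      using X(3) t B by (auto simp: conditional_value_def)
    then have "(\<integral>\<omega>. indicator B \<omega> * (X t \<omega> - ?I X t \<omega>) \<partial>M) = (\<integral>\<omega>. indicator B \<omega> * (tail_value g \<zeta> X t \<omega> - ?I X t \<omega>) \<partial>M)"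
      using Xm[OF t] BM tail_value_integrable[OF X(1)] driver_integral_integrable[OF X(1)]
      by (simp add: right_diff_distrib integrable_indicator_mult)
    also have "\<dots> = (\<integral>\<omega>. indicator B \<omega> * ?W \<omega> \<partial>M)"
      by (rule Bochner_Integration.integral_cong) (auto simp: tail_value_split[OF X(1) _ t])
    finally show ?thesis .
  qed
  have Zi: "integrable M (\<lambda>\<omega>. X t \<omega> - ?I X t \<omega>)" if "0 \<le> t" "t < T" for t
    using Xm[OF that] driver_integral_integrable[OF X(1)] by auto
  have Zad: "adapted_before F T (\<lambda>t \<omega>. X t \<omega> - ?I X t \<omega>)"
    unfolding adapted_before_def
    by (intro ballI borel_measurable_diff driver_integral_measurable X(1) g_measurable Xm(1)) auto
  have Zmart: "mart (\<lambda>t \<omega>. X t \<omega> - ?I X t \<omega>)"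
  proof (rule martI[OF Zad Zi])
    fix s t B assume *: "0 \<le> s" "s \<le> t" "t < T" "B \<in> sets (F s)"
    then have "B \<in> sets (F t)" using sets_F_mono by auto
    then show "(\<integral>\<omega>. indicator B \<omega> * (X s \<omega> - ?I X s \<omega>) \<partial>M) = (\<integral>\<omega>. indicator B \<omega> * (X t \<omega> - ?I X t \<omega>) \<partial>M)"
      using ZW[of t B] ZW[of s B] * by simp
  qed auto
  have fi: "integrable (M \<Otimes>\<^sub>M lborel) (\<lambda>x. indicator {0..t} (snd x) * (v (snd x) (fst x) * g (X (snd x) (fst x))))" for t
  proof (rule integrable_pair_bounded[where b="\<lambda>u. a u * b"])
    note driver_joint_measurable[OF X(1) g_measurable, measurable]
    show "(\<lambda>x. indicator {0..t} (snd x) * (v (snd x) (fst x) * g (X (snd x) (fst x)))) \<in> borel_measurable (M \<Otimes>\<^sub>M borel)"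
      by measurable
    show "integrable lborel (\<lambda>u. a u * b)" using a_integrable by simp
    fix \<omega> u
    have "\<bar>v u \<omega> * g (X u \<omega>)\<bar> \<le> a u * b" unfolding abs_mult
      using v_nonneg[of u \<omega>] v_le[of u \<omega>] g_bound a_nonneg by (intro mult_mono) auto
    then show "\<bar>indicator {0..t} (snd (\<omega>, u)) * (v (snd (\<omega>, u)) (fst (\<omega>, u)) * g (X (snd (\<omega>, u)) (fst (\<omega>, u))))\<bar> \<le> a u * b"
      using a_nonneg[of u] b_nonneg by (auto simp: indicator_def)
  qed
  obtain Y N where Y: "adapted_before F T Y" and N: "mart N" "cadlag_before M T N"
    and rc: "\<forall>\<omega>\<in>space M. \<forall>t\<in>{0..<T}. ((\<lambda>s. Y s \<omega>) \<longlongrightarrow> Y t \<omega>) (at_right t)"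
    and YX: "\<And>t. 0 \<le> t \<Longrightarrow> t < T \<Longrightarrow> AE \<omega> in M. Y t \<omega> = X t \<omega>"
    and eq: "AE \<omega> in M. \<forall>t\<in>{0..<T}. set_integrable lborel {0..t} (\<lambda>u. v u \<omega> * g (Y u \<omega>)) \<and> Y t \<omega> = N t \<omega> + ?I Y t \<omega>"
    using regularization[OF X(1) g_measurable fi Zmart] by blast
  have progY: "prog Y" by (rule prog_right_continuous[OF Y]) (use rc in auto)
  \<comment> \<open>Regularization changed the process only on null sets at each time, so all driver
    integrals agree on one set of full probability; the identities proved for \<open>X\<close>
    thereby hold for \<open>Y\<close>.\<close>
  have same: "AE \<omega> in M. \<forall>A\<in>sets borel. (LINT u:A|lborel. v u \<omega> * g (Y u \<omega>)) = (LINT u:A|lborel. v u \<omega> * g (X u \<omega>))"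
    using AE_AE_lborel_of_AE[OF progY X(1) YX, simplified] AE_space
  proof eventually_elim
    case (elim \<omega>)
    from elim(1) have ae: "AE u in lborel. v u \<omega> * g (Y u \<omega>) = v u \<omega> * g (X u \<omega>)"
    proof eventually_elim
      case (elim u)
      then show ?case using v_zero[of u \<omega>] by (cases "u \<in> {0..<T}") auto
    qed
    show ?case
      using set_integral_cong_AE_borel(2)[OF driver_path_measurable[OF progY g_measurable elim(2)] driver_path_measurable[OF X(1) g_measurable elim(2)] ae]
      by blast
  qed
  have Ym: "Y t \<in> borel_measurable (F t)" if "0 \<le> t" "t < T" for t using adaptedD[OF Y that] .
  have YM: "Y t \<in> borel_measurable M" if "0 \<le> t" "t < T" for t by (rule measurable_F_M[OF Ym[OF that] that(1)])
  have XM: "X t \<in> borel_measurable M" if "0 \<le> t" "t < T" for t by (rule measurable_F_M[OF Xm(1)[OF that] that(1)])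
  have cv: "conditional_value g \<zeta> Y Y"
    unfolding conditional_value_def
  proof (intro allI impI conjI ballI)
    fix t assume "0 \<le> t \<and> t < T"
    then have t: "0 \<le> t" "t < T" by auto
    show "Y t \<in> borel_measurable (F t)" by (rule Ym[OF t])
    show "integrable M (Y t)" using integrable_cong_AE[OF YM[OF t] XM[OF t] YX[OF t]] Xm[OF t] by simp
    fix B assume B: "B \<in> sets (F t)"
    then have BM: "B \<in> sets M" using sets_F_M t by auto
    have "AE \<omega> in M. tail_value g \<zeta> Y t \<omega> = tail_value g \<zeta> X t \<omega>"
      using same by eventually_elim (simp add: tail_value_def)
    then have "(\<integral>\<omega>. indicator B \<omega> * tail_value g \<zeta> Y t \<omega> \<partial>M) = (\<integral>\<omega>. indicator B \<omega> * tail_value g \<zeta> X t \<omega> \<partial>M)"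
      by (intro integral_indicator_cong_AE tail_value_measurable progY X BM)
    moreover have "(\<integral>\<omega>. indicator B \<omega> * Y t \<omega> \<partial>M) = (\<integral>\<omega>. indicator B \<omega> * X t \<omega> \<partial>M)"
      by (intro integral_indicator_cong_AE YX YM XM t BM)
    ultimately show "(\<integral>\<omega>. indicator B \<omega> * Y t \<omega> \<partial>M) = (\<integral>\<omega>. indicator B \<omega> * tail_value g \<zeta> Y t \<omega> \<partial>M)"
      using X(3) t B by (auto simp: conditional_value_def)
  qed
  have bdd: "AE \<omega> in M. \<forall>t\<in>{0..<T}. \<bar>Y t \<omega>\<bar> \<le> sol_bound"
  proof -
    have "AE \<omega> in M. \<forall>t\<in>{0..<T}. Y t \<omega> \<le> sol_bound"
    proof (rule AE_all_times_of_right_continuous)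
      show "AE \<omega> in M. Y t \<omega> \<le> sol_bound" if "0 \<le> t" "t < T" for t
        using YX[OF that] by eventually_elim (use X(2)[of t] in \<open>auto simp: abs_le_iff\<close>)
      show "AE \<omega> in M. \<forall>t\<in>{0..<T}. ((\<lambda>s. Y s \<omega>) \<longlongrightarrow> Y t \<omega>) (at_right t)"
        using rc by (auto intro!: AE_I2)
    qed
    moreover have "AE \<omega> in M. \<forall>t\<in>{0..<T}. - Y t \<omega> \<le> sol_bound"
    proof (rule AE_all_times_of_right_continuous)
      show "AE \<omega> in M. - Y t \<omega> \<le> sol_bound" if "0 \<le> t" "t < T" for t
        using YX[OF that] by eventually_elim (use X(2)[of t] in \<open>auto simp: abs_le_iff\<close>)
      show "AE \<omega> in M. \<forall>t\<in>{0..<T}. ((\<lambda>s. - Y s \<omega>) \<longlongrightarrow> - Y t \<omega>) (at_right t)"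
        using rc by (auto intro!: AE_I2 tendsto_minus)
    qed
    ultimately show ?thesis by eventually_elim (auto simp: abs_le_iff)
  qed
  have NW: "AE \<omega> in M. ((\<lambda>t. N t \<omega>) \<longlongrightarrow> ?W \<omega>) (at_left T)"
  proof (rule closed_mart_left_limit[OF N(1) _ _ lc tail_value_measurable_T[OF X(1)] Wi])
    show "AE \<omega> in M. \<forall>t\<in>{0..<T}. ((\<lambda>s. N s \<omega>) \<longlongrightarrow> N t \<omega>) (at_right t)"
      using N(2) by (auto simp: cadlag_before_def intro!: AE_I2)
    show "AE \<omega> in M. \<forall>t\<in>{0..<T}. \<bar>N t \<omega>\<bar> \<le> sol_bound + b * (\<integral>u. a u \<partial>lborel)"
      using bdd eq AE_space
    proof eventually_elim
      case (elim \<omega>)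
      show ?case
      proof
        fix t assume t: "t \<in> {0..<T}"
        have "\<bar>?I Y t \<omega>\<bar> \<le> b * (\<integral>u. a u \<partial>lborel)"
          by (rule driver_integral_bound[OF progY g_measurable g_bound elim(3)]) simp
        moreover have "\<bar>Y t \<omega>\<bar> \<le> sol_bound" "Y t \<omega> = N t \<omega> + ?I Y t \<omega>" using elim t by auto
        ultimately show "\<bar>N t \<omega>\<bar> \<le> sol_bound + b * (\<integral>u. a u \<partial>lborel)" by linarith
      qed
    qed
    fix t B assume t: "0 \<le> t" "t < T" and B: "B \<in> sets (F t)"
    have BM: "B \<in> sets M" using B sets_F_M t by auto
    have "AE \<omega> in M. N t \<omega> = X t \<omega> - ?I X t \<omega>"
      using eq YX[OF t] same by eventually_elim (use t in auto)
    then have "(\<integral>\<omega>. indicator B \<omega> * N t \<omega> \<partial>M) = (\<integral>\<omega>. indicator B \<omega> * (X t \<omega> - ?I X t \<omega>) \<partial>M)"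
      using N(1) t Zi[OF t] BM by (intro integral_indicator_cong_AE) (auto simp: martingale_before_def)
    then show "(\<integral>\<omega>. indicator B \<omega> * N t \<omega> \<partial>M) = (\<integral>\<omega>. indicator B \<omega> * ?W \<omega> \<partial>M)" using ZW[OF t B] by simp
  qed
  have "AE \<omega> in M. ((\<lambda>t. Y t \<omega>) \<longlongrightarrow> \<zeta> \<omega>) (at_left T)"
    using NW eq same AE_space
  proof eventually_elim
    case (elim \<omega>)
    have "continuous_on {0..T} (\<lambda>t. ?I Y t \<omega>)"
      by (rule continuous_on_indefinite_set_integral[OF driver_set_integrable[OF progY g_measurable g_bound elim(4)]]) simp
    then have "((\<lambda>t. ?I Y t \<omega>) \<longlongrightarrow> ?I Y T \<omega>) (at_left T)"
      using T_pos by (auto simp: continuous_on_def at_within_Icc_at_left dest!: bspec[of _ _ T])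
    from tendsto_add[OF elim(1) this]
    have "((\<lambda>t. N t \<omega> + ?I Y t \<omega>) \<longlongrightarrow> \<zeta> \<omega>) (at_left T)"
      using elim(3) by (simp add: tail_value_def)
    then show ?case
    proof (rule Lim_transform_eventually)
      show "\<forall>\<^sub>F t in at_left T. N t \<omega> + ?I Y t \<omega> = Y t \<omega>"
        using eventually_at_left_real[OF T_pos] by eventually_elim (use elim(2) in auto)
    qed
  qed
  moreover have "AE \<omega> in M. \<forall>t\<in>{0..<T}. Y t \<omega> = N t \<omega> + ?I Y t \<omega>"
    using eq by eventually_elim blast
  ultimately show ?thesis using Y N rc bdd cv by blast
qed

end

text \<open>The exponent \<open>1 / (p - 1)\<close> in the last assumption is the conjugate exponent
  of \<open>p\<close> minus 1. It is the power of \<open>v\<close> that the estimate of the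
  expectations produces.\<close>

locale singular_bsde = bsde_coefficient M F T v a for M :: "'a measure" and F T v a +
  fixes p K :: real and \<xi> :: "'a \<Rightarrow> ereal"
  assumes p: "1 < p" and K: "0 < K" and smallness: "K powr (p - 1) * (\<integral>u. a u \<partial>lborel) < 1 / (p - 1)"
    and \<xi>_measurable: "\<xi> \<in> borel_measurable (F T)" and \<xi>_lower: "AE \<omega> in M. - ereal K \<le> \<xi> \<omega>"
    and left_continuous: "left_continuous_filtration_at M F T"
    and inverse_integrable: "\<exists>\<epsilon>. 0 < \<epsilon> \<and> \<epsilon> \<le> T \<and>
      (\<integral>\<^sup>+\<omega>. (\<integral>\<^sup>+s\<in>{T - \<epsilon>..T}. 1 / ennreal (v s \<omega> powr (1 / (p - 1))) \<partial>lborel) \<partial>M) < \<infinity>"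
begin

section \<open>The deterministic lower barrier\<close>

definition tail_a :: "real \<Rightarrow> real" where "tail_a t = (LINT u:{t..T}|lborel. a u)"

text \<open>Minus the solution of the ordinary differential equation \<open>y' = a |y|^p\<close> with terminal value
  \<open>- K\<close>; the smallness assumption says precisely that it does not explode on \<open>[0, T]\<close>.\<close>

definition barrier :: "real \<Rightarrow> real" where
  "barrier t = (K powr (1 - p) - (p - 1) * tail_a t) powr (- 1 / (p - 1))"

lemma tail_a_bounds: "0 \<le> tail_a t" "tail_a t \<le> (\<integral>u. a u \<partial>lborel)"
proof -
  show "0 \<le> tail_a t" unfolding tail_a_def using a_nonneg by (intro set_integral_nonneg_real) auto
  show "tail_a t \<le> (\<integral>u. a u \<partial>lborel)"
    unfolding tail_a_def set_lebesgue_integral_def using a_set_integrable[of "{t..T}"] a_nonneg a_integrable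
    by (intro integral_mono) (auto simp: set_integrable_def indicator_def)
qed

text \<open>The smallness assumption, multiplied by \<open>(p - 1) * K powr (1 - p)\<close>, says
  that the base of the power in \<open>barrier\<close> stays positive.\<close>

lemma barrier_base_pos:
  assumes "y \<le> (\<integral>u. a u \<partial>lborel)"
  shows "0 < K powr (1 - p) - (p - 1) * y"
proof -
  have "(p - 1) * y \<le> (p - 1) * (\<integral>u. a u \<partial>lborel)" using assms p by (intro mult_left_mono) auto
  also have "\<dots> = K powr (1 - p) * ((p - 1) * (K powr (p - 1) * (\<integral>u. a u \<partial>lborel)))"
    using K by (simp add: mult_ac flip: powr_add)
  also have "\<dots> < K powr (1 - p) * 1"
    using smallness p K by (intro mult_strict_left_mono) (auto simp: field_simps)
  finally show ?thesis by simp
qed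

lemma K_powr: "(K powr (1 - p)) powr (- 1 / (p - 1)) = K"
proof -
  have "(1 - p) * (- 1 / (p - 1)) = 1" using p by (simp add: field_simps)
  then show ?thesis using K by (simp only: powr_powr) simp
qed

lemma barrier_bounds:
  shows "K \<le> barrier t" and "0 \<le> t \<Longrightarrow> barrier t \<le> barrier 0"
proof -
  have "K = (K powr (1 - p)) powr (- 1 / (p - 1))" by (rule K_powr[symmetric])
  also have "\<dots> \<le> barrier t"
    unfolding barrier_def using p tail_a_bounds[of t] barrier_base_pos[OF tail_a_bounds(2)[of t]]
    by (intro powr_mono2') (auto simp: divide_nonpos_pos)
  finally show "K \<le> barrier t" .
  assume t: "0 \<le> t"
  have "tail_a t \<le> tail_a 0"
    unfolding tail_a_def set_lebesgue_integral_def
    using a_set_integrable[of "{t..T}"] a_set_integrable[of "{0..T}"] a_nonneg t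
    by (intro integral_mono) (auto simp: set_integrable_def indicator_def)
  then show "barrier t \<le> barrier 0"
    unfolding barrier_def using p barrier_base_pos[OF tail_a_bounds(2)[of 0]]
    by (intro powr_mono2') (auto simp: divide_nonpos_pos)
qed

lemma barrier_pos: "0 < barrier t" using barrier_bounds(1)[of t] K by linarith

lemma barrier_equation:
  assumes "t \<le> T"
  shows "set_integrable lborel {t..T} (\<lambda>u. a u * barrier u powr p)"
    "barrier t = K + (LINT u:{t..T}|lborel. a u * barrier u powr p)"
proof -
  \<comment> \<open>The chain rule is applied to minus the barrier as a function of the tail
    integral. Since \<open>- 1 / (p - 1) - 1 = - p / (p - 1)\<close>, its derivative is minus the
    \<open>p\<close>-th power of the barrier.\<close>
  let ?\<phi> = "\<lambda>y. - ((K powr (1 - p) - (p - 1) * y) powr (- 1 / (p - 1)))"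
  let ?\<phi>' = "\<lambda>y. - ((K powr (1 - p) - (p - 1) * y) powr (- p / (p - 1)))"
  have pos: "0 < K powr (1 - p) - (p - 1) * y" if "y \<in> {0..LINT u:{t..T}|lborel. a u}" for y
    using that tail_a_bounds(2)[of t] by (intro barrier_base_pos) (auto simp: tail_a_def)
  have e: "- 1 / (p - 1) - 1 = - p / (p - 1)" using p by (simp add: field_simps)
  have d: "(?\<phi> has_real_derivative ?\<phi>' y) (at y)" if y: "y \<in> {0..LINT u:{t..T}|lborel. a u}" for y
  proof -
    have "((\<lambda>y. K powr (1 - p) - (p - 1) * y) has_real_derivative - (p - 1)) (at y)"
      by (auto intro!: derivative_eq_intros)
    from DERIV_chain2[OF has_real_derivative_powr[OF pos[OF y], of "- 1 / (p - 1)"] this]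
    have "(?\<phi> has_real_derivative - ((- 1 / (p - 1)) * (K powr (1 - p) - (p - 1) * y) powr (- 1 / (p - 1) - 1) * (- (p - 1)))) (at y)"
      by (rule DERIV_minus)
    moreover have "- ((- 1 / (p - 1)) * r * (- (p - 1))) = - r" for r :: real using p by (simp add: field_simps)
    ultimately show ?thesis unfolding e by simp
  qed
  have c: "continuous_on {0..LINT u:{t..T}|lborel. a u} ?\<phi>'"
    using pos by (intro continuous_intros) (force dest!: pos)
  have ai: "set_integrable lborel {t..T} a" by (rule a_set_integrable) simp
  note cr = chain_rule_indefinite_integral[OF ai a_nonneg assms d c]
  have b: "(K powr (1 - p) - (p - 1) * (LINT x:{u..T}|lborel. a x)) powr (- p / (p - 1)) = barrier u powr p" for u
    unfolding barrier_def tail_a_def using p by (simp add: powr_powr)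
  have "set_integrable lborel {t..T} (\<lambda>u. - (barrier u powr p) * a u)" using cr(1) unfolding b .
  from set_integrable_mult_right[OF this, of "-1"]
  show "set_integrable lborel {t..T} (\<lambda>u. a u * barrier u powr p)" by (simp add: mult.commute)
  have "(LINT u:{t..T}|lborel. - (barrier u powr p) * a u) = - barrier t + (K powr (1 - p)) powr (- 1 / (p - 1))"
    using cr(2) unfolding b by (simp add: barrier_def tail_a_def)
  moreover note K_powr
  moreover have "(LINT u:{t..T}|lborel. - (barrier u powr p) * a u) = - (LINT u:{t..T}|lborel. a u * barrier u powr p)"
    using set_integral_mult_right[of lborel "{t..T}" "-1" "\<lambda>u. a u * barrier u powr p"] by (simp add: mult.commute)
  ultimately show "barrier t = K + (LINT u:{t..T}|lborel. a u * barrier u powr p)" by simp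
qed

lemma barrier_increment:
  assumes "0 \<le> s" "s \<le> t" "t \<le> T"
  shows "set_integrable lborel {s..t} (\<lambda>u. a u * barrier u powr p)"
    "barrier s = barrier t + (LINT u:{s..t}|lborel. a u * barrier u powr p)"
proof -
  have i: "set_integrable lborel {s..T} (\<lambda>u. a u * barrier u powr p)" using assms by (intro barrier_equation) auto
  then show "set_integrable lborel {s..t} (\<lambda>u. a u * barrier u powr p)"
    by (rule set_integrable_subset) (use assms in auto)
  show "barrier s = barrier t + (LINT u:{s..t}|lborel. a u * barrier u powr p)"
    using barrier_equation(2)[of s] barrier_equation(2)[of t] set_integral_combine[OF i assms(2,3)] assms by simp
qed

lemma barrier_tendsto: "(barrier \<longlongrightarrow> K) (at_left T)"
proof -
  have i: "set_integrable lborel {0..T} (\<lambda>u. a u * barrier u powr p)" using T_pos by (intro barrier_equation) auto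
  have "continuous_on {0..T} (\<lambda>t. K + (LINT u:{t..T}|lborel. a u * barrier u powr p))"
    by (intro continuous_intros continuous_on_indefinite_set_integral'[OF i])
  then have "continuous_on {0..T} barrier" by (rule continuous_on_eq) (use barrier_equation(2) in auto)
  then have "(barrier \<longlongrightarrow> barrier T) (at_left T)"
    using T_pos by (auto simp: continuous_on_def at_within_Icc_at_left dest!: bspec[of _ _ T])
  moreover have "barrier T = K"
    using barrier_equation(2)[of T] set_borel_integral_eq_integral(2)[OF barrier_equation(1)[of T]] by simp
  ultimately show ?thesis by simp
qed

end

section \<open>Comparison and truncated equations\<close>

lemma cadlag_before_uminus:
  assumes X: "cadlag_before M T X" shows "cadlag_before M T (\<lambda>t \<omega>. - X t \<omega>)"
  unfolding cadlag_before_def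
proof (intro ballI conjI)
  fix \<omega> t assume w: "\<omega> \<in> space M"
  show "((\<lambda>s. - X s \<omega>) \<longlongrightarrow> - X t \<omega>) (at_right t)" if "t \<in> {0..<T}"
    using X w that by (intro tendsto_minus) (auto simp: cadlag_before_def)
  assume "t \<in> {0<..<T}"
  then have "\<exists>l. ((\<lambda>s. X s \<omega>) \<longlongrightarrow> l) (at_left t)" using X w unfolding cadlag_before_def by blast
  then show "\<exists>l. ((\<lambda>s. - X s \<omega>) \<longlongrightarrow> l) (at_left t)" by (elim exE) (rule exI, erule tendsto_minus)
qed

lemma cadlag_before_diff:
  assumes X: "cadlag_before M T X" and Y: "cadlag_before M T Y"
  shows "cadlag_before M T (\<lambda>t \<omega>. X t \<omega> - Y t \<omega>)"
  unfolding cadlag_before_def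
proof (intro ballI conjI)
  fix \<omega> t assume w: "\<omega> \<in> space M"
  show "((\<lambda>s. X s \<omega> - Y s \<omega>) \<longlongrightarrow> X t \<omega> - Y t \<omega>) (at_right t)" if "t \<in> {0..<T}"
    using X Y w that by (intro tendsto_diff) (auto simp: cadlag_before_def)
  assume t: "t \<in> {0<..<T}"
  have "\<exists>l. ((\<lambda>s. X s \<omega>) \<longlongrightarrow> l) (at_left t)" "\<exists>l. ((\<lambda>s. Y s \<omega>) \<longlongrightarrow> l) (at_left t)"
    using X Y w t unfolding cadlag_before_def by blast+
  then show "\<exists>l. ((\<lambda>s. X s \<omega> - Y s \<omega>) \<longlongrightarrow> l) (at_left t)" by (elim exE) (rule exI, erule (1) tendsto_diff)
qed

context bsde_coefficient
begin

definition power_dynamics :: "real \<Rightarrow> (real \<Rightarrow> 'a \<Rightarrow> real) \<Rightarrow> (real \<Rightarrow> 'a \<Rightarrow> real) \<Rightarrow> 'a \<Rightarrow> bool" where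
  "power_dynamics p Y N \<omega> \<longleftrightarrow> (\<forall>s t. 0 \<le> s \<and> s \<le> t \<and> t < T \<longrightarrow>
     set_integrable lborel {s..t} (\<lambda>u. v u \<omega> * \<bar>Y u \<omega>\<bar> powr p) \<and>
     Y t \<omega> = Y s \<omega> + (LINT u:{s..t}|lborel. v u \<omega> * \<bar>Y u \<omega>\<bar> powr p) + (N t \<omega> - N s \<omega>))"

lemma power_dynamicsD:
  assumes "power_dynamics p Y N \<omega>" "0 \<le> s" "s \<le> t" "t < T"
  shows "set_integrable lborel {s..t} (\<lambda>u. v u \<omega> * \<bar>Y u \<omega>\<bar> powr p)"
    "Y t \<omega> = Y s \<omega> + (LINT u:{s..t}|lborel. v u \<omega> * \<bar>Y u \<omega>\<bar> powr p) + (N t \<omega> - N s \<omega>)"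
  using assms unfolding power_dynamics_def by blast+

lemma power_dynamicsI:
  assumes "\<And>t. 0 \<le> t \<Longrightarrow> t < T \<Longrightarrow> set_integrable lborel {0..t} (\<lambda>u. v u \<omega> * \<bar>Y u \<omega>\<bar> powr p) \<and>
     Y t \<omega> = N t \<omega> + (LINT u:{0..t}|lborel. v u \<omega> * \<bar>Y u \<omega>\<bar> powr p)"
  shows "power_dynamics p Y N \<omega>"
  unfolding power_dynamics_def
proof (intro allI impI)
  fix s t assume "0 \<le> s \<and> s \<le> t \<and> t < T"
  then have *: "0 \<le> s" "s \<le> t" "t < T" "0 \<le> t" "s < T" by auto
  note t = assms[OF *(4,3)] and s = assms[OF *(1,5)]
  have "set_integrable lborel {s..t} (\<lambda>u. v u \<omega> * \<bar>Y u \<omega>\<bar> powr p)"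
    by (rule set_integrable_subset[OF conjunct1[OF t]]) (use * in auto)
  moreover have "Y t \<omega> = Y s \<omega> + (LINT u:{s..t}|lborel. v u \<omega> * \<bar>Y u \<omega>\<bar> powr p) + (N t \<omega> - N s \<omega>)"
    using set_integral_combine[OF conjunct1[OF t] *(1,2)] conjunct2[OF t] conjunct2[OF s] by linarith
  ultimately show "set_integrable lborel {s..t} (\<lambda>u. v u \<omega> * \<bar>Y u \<omega>\<bar> powr p) \<and>
     Y t \<omega> = Y s \<omega> + (LINT u:{s..t}|lborel. v u \<omega> * \<bar>Y u \<omega>\<bar> powr p) + (N t \<omega> - N s \<omega>)" ..
qed

lemma power_dynamics_right_continuous:
  assumes "power_dynamics p Y N \<omega>" "cadlag_before M T N" "\<omega> \<in> space M" "t \<in> {0..<T}"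
  shows "((\<lambda>s. Y s \<omega>) \<longlongrightarrow> Y t \<omega>) (at_right t)"
proof (rule right_continuous_of_increments[where T=T])
  show "((\<lambda>s. N s \<omega>) \<longlongrightarrow> N t \<omega>) (at_right t)" using assms by (auto simp: cadlag_before_def)
  show "set_integrable lborel {t..s} (\<lambda>u. v u \<omega> * \<bar>Y u \<omega>\<bar> powr p) \<and>
      Y s \<omega> = Y t \<omega> + (LINT u:{t..s}|lborel. v u \<omega> * \<bar>Y u \<omega>\<bar> powr p) + (N s \<omega> - N t \<omega>)" if "t \<le> s" "s < T" for s
    using power_dynamicsD[OF assms(1), of t s] that assms(4) by (intro conjI) auto
qed (use assms(4) in auto)

text \<open>Only times with \<open>Y \<ge> Y'\<close> matter. There the lower bound of
  \<open>Y'\<close> and the bound of \<open>Y\<close> confine both to [- m, m], where the power is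
  Lipschitz, although \<open>Y'\<close> may be unbounded above. At \<open>T\<close> the limit of
  \<open>Y\<close> does not exceed the lower limit of \<open>Y'\<close>, so the positive part of the
  difference tends to 0.\<close>

theorem comparison:
  assumes p: "1 < p" and lc: "adapted_before F T Y" "mart N" "cadlag_before M T N" "AE \<omega> in M. power_dynamics p Y N \<omega>"
    and Yc: "AE \<omega> in M. \<forall>t\<in>{0..<T}. \<bar>Y t \<omega>\<bar> \<le> c" and lim: "AE \<omega> in M. ((\<lambda>t. Y t \<omega>) \<longlongrightarrow> \<eta> \<omega>) (at_left T)"
    and Y': "adapted_before F T Y'" "mart N'" "cadlag_before M T N'" "AE \<omega> in M. power_dynamics p Y' N' \<omega>"
    and Y'c: "AE \<omega> in M. \<forall>t\<in>{0..<T}. - c' \<le> Y' t \<omega>"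
    and lim': "AE \<omega> in M. ereal (\<eta> \<omega>) \<le> Liminf (at_left T) (\<lambda>t. ereal (Y' t \<omega>))"
  shows "AE \<omega> in M. \<forall>t\<in>{0..<T}. Y t \<omega> \<le> Y' t \<omega>"
proof -
  define m where "m = max \<bar>c\<bar> \<bar>c'\<bar>"
  have "AE \<omega> in M. \<forall>t\<in>{0..<T}. Y t \<omega> - Y' t \<omega> \<le> 0"
  proof (rule drift_nonpositive[where a=a and L="p * m powr (p - 1)" and R="\<lambda>t \<omega>. N t \<omega> - N' t \<omega>" and c="\<bar>c\<bar> + \<bar>c'\<bar>"
      and f="\<lambda>u \<omega>. v u \<omega> * \<bar>Y u \<omega>\<bar> powr p - v u \<omega> * \<bar>Y' u \<omega>\<bar> powr p"])
    show "adapted_before F T (\<lambda>t \<omega>. Y t \<omega> - Y' t \<omega>)"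
      using lc(1) Y'(1) by (auto simp: adapted_before_def intro!: borel_measurable_diff)
    show "mart (\<lambda>t \<omega>. N t \<omega> - N' t \<omega>)" by (rule mart_diff[OF lc(2) Y'(2)])
    show "cadlag_before M T (\<lambda>t \<omega>. N t \<omega> - N' t \<omega>)"
      by (rule cadlag_before_diff[OF lc(3) Y'(3)])
    show "set_integrable lborel {0..T} a" by (rule a_set_integrable) simp
    show "0 \<le> p * m powr (p - 1)" using p by simp
    show "AE \<omega> in M. \<forall>s t. 0 \<le> s \<and> s \<le> t \<and> t < T \<longrightarrow>
        set_integrable lborel {s..t} (\<lambda>u. v u \<omega> * \<bar>Y u \<omega>\<bar> powr p - v u \<omega> * \<bar>Y' u \<omega>\<bar> powr p) \<and>
        Y t \<omega> - Y' t \<omega> = Y s \<omega> - Y' s \<omega> + (LINT u:{s..t}|lborel. v u \<omega> * \<bar>Y u \<omega>\<bar> powr p - v u \<omega> * \<bar>Y' u \<omega>\<bar> powr p) +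
          (N t \<omega> - N' t \<omega> - (N s \<omega> - N' s \<omega>))"
      using lc(4) Y'(4)
    proof eventually_elim
      case (elim \<omega>)
      show ?case
      proof (intro allI impI)
        fix s t assume "0 \<le> s \<and> s \<le> t \<and> t < T"
        then have *: "0 \<le> s" "s \<le> t" "t < T" by auto
        note d = power_dynamicsD[OF elim(1) *] and d' = power_dynamicsD[OF elim(2) *]
        show "set_integrable lborel {s..t} (\<lambda>u. v u \<omega> * \<bar>Y u \<omega>\<bar> powr p - v u \<omega> * \<bar>Y' u \<omega>\<bar> powr p) \<and>
          Y t \<omega> - Y' t \<omega> = Y s \<omega> - Y' s \<omega> + (LINT u:{s..t}|lborel. v u \<omega> * \<bar>Y u \<omega>\<bar> powr p - v u \<omega> * \<bar>Y' u \<omega>\<bar> powr p) +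
            (N t \<omega> - N' t \<omega> - (N s \<omega> - N' s \<omega>))"
          using set_integral_diff[OF d(1) d'(1)] d(2) d'(2) by (intro conjI) linarith+
      qed
    qed
    show "AE \<omega> in M. \<forall>u\<in>{0..<T}. 0 \<le> Y u \<omega> - Y' u \<omega> \<longrightarrow>
        - (p * m powr (p - 1) * a u * (Y u \<omega> - Y' u \<omega>)) \<le> v u \<omega> * \<bar>Y u \<omega>\<bar> powr p - v u \<omega> * \<bar>Y' u \<omega>\<bar> powr p"
      using Yc Y'c
    proof eventually_elim
      case (elim \<omega>)
      show ?case
      proof (intro ballI impI)
        fix u assume u: "u \<in> {0..<T}" and D: "0 \<le> Y u \<omega> - Y' u \<omega>"
        have "\<bar>Y u \<omega>\<bar> \<le> c" "- c' \<le> Y' u \<omega>" using elim u by auto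
        then have "\<bar>Y u \<omega>\<bar> \<le> m" "\<bar>Y' u \<omega>\<bar> \<le> m" using D by (auto simp: m_def abs_le_iff)
        from abs_powr_lipschitz[OF p this]
        have "\<bar>Y' u \<omega>\<bar> powr p - \<bar>Y u \<omega>\<bar> powr p \<le> p * m powr (p - 1) * (Y u \<omega> - Y' u \<omega>)" using D by linarith
        then have "v u \<omega> * (\<bar>Y' u \<omega>\<bar> powr p - \<bar>Y u \<omega>\<bar> powr p) \<le> v u \<omega> * (p * m powr (p - 1) * (Y u \<omega> - Y' u \<omega>))"
          by (rule mult_left_mono[OF _ v_nonneg])
        also have "\<dots> \<le> a u * (p * m powr (p - 1) * (Y u \<omega> - Y' u \<omega>))"
          using D p by (intro mult_right_mono v_le) auto
        finally show "- (p * m powr (p - 1) * a u * (Y u \<omega> - Y' u \<omega>)) \<le> v u \<omega> * \<bar>Y u \<omega>\<bar> powr p - v u \<omega> * \<bar>Y' u \<omega>\<bar> powr p"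
          by (simp add: algebra_simps)
      qed
    qed
    show "AE \<omega> in M. \<forall>u\<in>{0..<T}. Y u \<omega> - Y' u \<omega> \<le> \<bar>c\<bar> + \<bar>c'\<bar>"
      using Yc Y'c
    proof eventually_elim
      case (elim \<omega>)
      show ?case
      proof
        fix u assume "u \<in> {0..<T}"
        then have "\<bar>Y u \<omega>\<bar> \<le> c" "- c' \<le> Y' u \<omega>" using elim by auto
        then show "Y u \<omega> - Y' u \<omega> \<le> \<bar>c\<bar> + \<bar>c'\<bar>" by linarith
      qed
    qed
    show "AE \<omega> in M. ((\<lambda>t. max 0 (Y t \<omega> - Y' t \<omega>)) \<longlongrightarrow> 0) (at_left T)"
      using lim lim'
    proof eventually_elim
      case (elim \<omega>)
      show ?case
      proof (rule tendstoI)
        fix e :: real assume e: "0 < e"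
        have 1: "\<forall>\<^sub>F t in at_left T. Y t \<omega> < \<eta> \<omega> + e / 2" using elim(1) e by (intro order_tendstoD) auto
        have "ereal (\<eta> \<omega> - e / 2) < ereal (\<eta> \<omega>)" using e by simp
        then have "ereal (\<eta> \<omega> - e / 2) < Liminf (at_left T) (\<lambda>t. ereal (Y' t \<omega>))" using elim(2) by (rule less_le_trans)
        then have 2: "\<forall>\<^sub>F t in at_left T. ereal (\<eta> \<omega> - e / 2) < ereal (Y' t \<omega>)" by (rule less_LiminfD)
        show "\<forall>\<^sub>F t in at_left T. dist (max 0 (Y t \<omega> - Y' t \<omega>)) 0 < e"
          using 1 2 by eventually_elim (use e in \<open>auto simp: dist_real_def\<close>)
      qed
    qed
  qed (auto intro: a_measurable a_nonneg)
  then show ?thesis by eventually_elim auto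
qed

end

context singular_bsde
begin

text \<open>Clipping the argument makes the power bounded and Lipschitz. The solution will turn out
  to stay inside [- barrier 0, n], so the clipping never acts on it.\<close>

definition trunc_driver :: "nat \<Rightarrow> real \<Rightarrow> real" where
  "trunc_driver n y = \<bar>max (- barrier 0) (min (real n) y)\<bar> powr p"

text \<open>The truncation is formed in the extended reals, where \<open>\<xi>\<close> may be
  infinite. The lower cut at \<open>- K\<close> makes the bound hold everywhere instead of almost
  surely.\<close>

definition trunc_terminal :: "nat \<Rightarrow> 'a \<Rightarrow> real" where
  "trunc_terminal n \<omega> = real_of_ereal (max (- ereal K) (min (ereal (real n)) (\<xi> \<omega>)))"

lemma ereal_trunc_terminal: "ereal (trunc_terminal n \<omega>) = max (- ereal K) (min (ereal (real n)) (\<xi> \<omega>))"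
  unfolding trunc_terminal_def using K by (cases "\<xi> \<omega>") (auto simp: min_def max_def)

lemma trunc_terminal_bounds: "- K \<le> trunc_terminal n \<omega>" "trunc_terminal n \<omega> \<le> real n"
proof -
  have "ereal (- K) \<le> ereal (trunc_terminal n \<omega>)" unfolding ereal_trunc_terminal by simp
  then show "- K \<le> trunc_terminal n \<omega>" by simp
  have "ereal (trunc_terminal n \<omega>) \<le> ereal (real n)" unfolding ereal_trunc_terminal using K by simp
  then show "trunc_terminal n \<omega> \<le> real n" by simp
qed

lemma trunc_bounded_bsde:
  "bounded_bsde M F T v a (trunc_driver n) (max (barrier 0) n powr p) (p * max (barrier 0) n powr (p - 1)) (max K n) (trunc_terminal n)"
proof unfold_locales
  have cont: "continuous_on UNIV (trunc_driver n)"
    unfolding trunc_driver_def using p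
    by (intro continuous_on_powr' continuous_intros) auto
  show "trunc_driver n \<in> borel_measurable borel" by (rule borel_measurable_continuous_onI[OF cont])
  have b0: "0 < barrier 0" by (rule barrier_pos)
  have cl: "\<bar>max (- barrier 0) (min (real n) y)\<bar> \<le> max (barrier 0) n" for y using b0 by (auto simp: abs_le_iff)
  show "\<bar>trunc_driver n y\<bar> \<le> max (barrier 0) n powr p" for y
    unfolding trunc_driver_def using cl p by (auto intro!: powr_mono2)
  show "\<bar>trunc_driver n x - trunc_driver n y\<bar> \<le> p * max (barrier 0) n powr (p - 1) * \<bar>x - y\<bar>" for x y
  proof -
    have "\<bar>trunc_driver n x - trunc_driver n y\<bar> \<le> p * max (barrier 0) n powr (p - 1) *
        \<bar>max (- barrier 0) (min (real n) x) - max (- barrier 0) (min (real n) y)\<bar>"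
      unfolding trunc_driver_def by (rule abs_powr_lipschitz[OF p cl cl])
    also have "\<dots> \<le> p * max (barrier 0) n powr (p - 1) * \<bar>x - y\<bar>"
      using p by (intro mult_left_mono) auto
    finally show ?thesis .
  qed
  show "trunc_terminal n \<in> borel_measurable (F T)" unfolding trunc_terminal_def using \<xi>_measurable by measurable
  show "\<bar>trunc_terminal n \<omega>\<bar> \<le> max K n" for \<omega> using trunc_terminal_bounds[of n \<omega>] by (auto simp: abs_le_iff)
qed

text \<open>Bounds and right continuity are required on every path, which avoids null sets in the
  joint estimates; the existence proof secures them by killing \<open>Y\<close> on a null
  set.\<close>

definition truncated :: "nat \<Rightarrow> (real \<Rightarrow> 'a \<Rightarrow> real) \<Rightarrow> (real \<Rightarrow> 'a \<Rightarrow> real) \<Rightarrow> bool" where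
  "truncated n Y N \<longleftrightarrow> adapted_before F T Y \<and> mart N \<and> cadlag_before M T N \<and>
    (\<forall>\<omega>\<in>space M. \<forall>t\<in>{0..<T}. ((\<lambda>s. Y s \<omega>) \<longlongrightarrow> Y t \<omega>) (at_right t)) \<and>
    (\<forall>t\<in>{0..<T}. \<forall>\<omega>. - barrier 0 \<le> Y t \<omega> \<and> Y t \<omega> \<le> real n) \<and>
    (AE \<omega> in M. power_dynamics p Y N \<omega>) \<and>
    (AE \<omega> in M. ((\<lambda>t. Y t \<omega>) \<longlongrightarrow> trunc_terminal n \<omega>) (at_left T))"

text \<open>The upper bound is immediate: the driver is nonnegative, so the tail value is at most
  \<open>n\<close> and so is its conditional expectation. The lower bound is comparison with the
  barrier, that is \<open>drift_nonpositive\<close> for \<open>- barrier - Y\<close>. Inside these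
  bounds the clipped driver is the original power.\<close>

lemma truncated_solution_exists: "\<exists>Y N. truncated n Y N"
proof -
  interpret B: bounded_bsde M F T v a "trunc_driver n" "max (barrier 0) n powr p" "p * max (barrier 0) n powr (p - 1)" "max K n" "trunc_terminal n"
    by (rule trunc_bounded_bsde)
  let ?g = "trunc_driver n" and ?\<zeta> = "trunc_terminal n"
  obtain Y N where Y: "adapted_before F T Y" and N: "mart N" "cadlag_before M T N"
    and rc: "\<forall>\<omega>\<in>space M. \<forall>t\<in>{0..<T}. ((\<lambda>s. Y s \<omega>) \<longlongrightarrow> Y t \<omega>) (at_right t)"
    and eq: "AE \<omega> in M. \<forall>t\<in>{0..<T}. Y t \<omega> = N t \<omega> + (LINT u:{0..t}|lborel. v u \<omega> * ?g (Y u \<omega>))"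
    and bd: "AE \<omega> in M. \<forall>t\<in>{0..<T}. \<bar>Y t \<omega>\<bar> \<le> B.sol_bound"
    and cv: "conditional_value ?g ?\<zeta> Y Y" and lim: "AE \<omega> in M. ((\<lambda>t. Y t \<omega>) \<longlongrightarrow> ?\<zeta> \<omega>) (at_left T)"
    using B.bounded_solution[OF left_continuous] by blast
  have b0: "0 < barrier 0" by (rule barrier_pos)
  have progY: "prog Y" by (rule prog_right_continuous[OF Y]) (use rc in auto)
  have rcAE: "AE \<omega> in M. \<forall>t\<in>{0..<T}. ((\<lambda>s. Y s \<omega>) \<longlongrightarrow> Y t \<omega>) (at_right t)" using rc by (auto intro!: AE_I2)
  have upper: "AE \<omega> in M. \<forall>t\<in>{0..<T}. Y t \<omega> \<le> real n"
  proof (rule AE_all_times_of_right_continuous[OF _ rcAE])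
    fix t assume t: "0 \<le> t" "t < T"
    show "AE \<omega> in M. Y t \<omega> \<le> real n"
    proof (rule cond_le_const[OF t(1), where w="tail_value ?g ?\<zeta> Y t"])
      show "AE \<omega> in M. tail_value ?g ?\<zeta> Y t \<omega> \<le> real n"
      proof (rule AE_I2)
        fix \<omega>
        have "0 \<le> (LINT u:{t..T}|lborel. v u \<omega> * ?g (Y u \<omega>))"
          using v_nonneg by (intro set_integral_nonneg_real) (auto simp: trunc_driver_def)
        then show "tail_value ?g ?\<zeta> Y t \<omega> \<le> real n" using trunc_terminal_bounds(2)[of n \<omega>] by (simp add: tail_value_def)
      qed
    qed (use cv t B.tail_value_integrable[OF progY] in \<open>auto simp: conditional_value_def\<close>)
  qed
  have seti: "set_integrable lborel {s..t} (\<lambda>u. v u \<omega> * ?g (Y u \<omega>))" if "\<omega> \<in> space M" for s t \<omega>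
    by (rule driver_set_integrable[OF progY B.g_measurable B.g_bound that]) simp
  have lower: "AE \<omega> in M. \<forall>t\<in>{0..<T}. - barrier t - Y t \<omega> \<le> 0"
  proof (rule drift_nonpositive[where a=a and L="p * max (barrier 0) n powr (p - 1)" and R="\<lambda>t \<omega>. - N t \<omega>" and c="B.sol_bound"
      and f="\<lambda>u \<omega>. a u * barrier u powr p - v u \<omega> * ?g (Y u \<omega>)"])
    show "adapted_before F T (\<lambda>t \<omega>. - barrier t - Y t \<omega>)"
      using Y by (auto simp: adapted_before_def intro!: borel_measurable_diff)
    show "mart (\<lambda>t \<omega>. - N t \<omega>)" by (rule mart_uminus[OF N(1)])
    show "cadlag_before M T (\<lambda>t \<omega>. - N t \<omega>)"
      by (rule cadlag_before_uminus[OF N(2)])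
    show "set_integrable lborel {0..T} a" by (rule a_set_integrable) simp
    show "AE \<omega> in M. \<forall>s t. 0 \<le> s \<and> s \<le> t \<and> t < T \<longrightarrow>
        set_integrable lborel {s..t} (\<lambda>u. a u * barrier u powr p - v u \<omega> * ?g (Y u \<omega>)) \<and>
        - barrier t - Y t \<omega> = - barrier s - Y s \<omega> + (LINT u:{s..t}|lborel. a u * barrier u powr p - v u \<omega> * ?g (Y u \<omega>)) + (- N t \<omega> - - N s \<omega>)"
      using eq AE_space
    proof eventually_elim
      case (elim \<omega>)
      show ?case
      proof (intro allI impI)
        fix s t assume "0 \<le> s \<and> s \<le> t \<and> t < T"
        then have *: "0 \<le> s" "s \<le> t" "t < T" "t \<le> T" by auto
        note bi = barrier_increment[OF *(1,2,4)] and si = seti[OF elim(2), of s t]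
        have "Y t \<omega> = N t \<omega> + (LINT u:{0..t}|lborel. v u \<omega> * ?g (Y u \<omega>))" "Y s \<omega> = N s \<omega> + (LINT u:{0..s}|lborel. v u \<omega> * ?g (Y u \<omega>))"
          using elim(1) * by auto
        then show "set_integrable lborel {s..t} (\<lambda>u. a u * barrier u powr p - v u \<omega> * ?g (Y u \<omega>)) \<and>
          - barrier t - Y t \<omega> = - barrier s - Y s \<omega> + (LINT u:{s..t}|lborel. a u * barrier u powr p - v u \<omega> * ?g (Y u \<omega>)) + (- N t \<omega> - - N s \<omega>)"
          using set_integral_diff[OF bi(1) si] bi(2) set_integral_combine[OF seti[OF elim(2), of 0 t] *(1,2)]
          by (intro conjI) linarith+
      qed
    qed
    show "AE \<omega> in M. \<forall>u\<in>{0..<T}. 0 \<le> - barrier u - Y u \<omega> \<longrightarrow>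
        - (p * max (barrier 0) n powr (p - 1) * a u * (- barrier u - Y u \<omega>)) \<le> a u * barrier u powr p - v u \<omega> * ?g (Y u \<omega>)"
    proof (intro AE_I2 ballI impI)
      fix \<omega> u assume u: "u \<in> {0..<T}" and D: "0 \<le> - barrier u - Y u \<omega>"
      have bu: "0 < barrier u" "barrier u \<le> barrier 0" using barrier_pos barrier_bounds(2)[of u] u by auto
      \<comment> \<open>The value \<open>- barrier u\<close> lies inside the clipping window, so the
        truncated driver is exact there.\<close>
      have gb: "?g (- barrier u) = barrier u powr p" using bu by (simp add: trunc_driver_def max_def min_def)
      have "?g (Y u \<omega>) - barrier u powr p \<le> p * max (barrier 0) n powr (p - 1) * (- barrier u - Y u \<omega>)"
      proof -
        have e: "\<bar>Y u \<omega> - - barrier u\<bar> = - barrier u - Y u \<omega>" using D by linarith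
        show ?thesis using B.g_lipschitz[of "Y u \<omega>" "- barrier u"] unfolding gb e by linarith
      qed
      then have "v u \<omega> * (?g (Y u \<omega>) - barrier u powr p) \<le> v u \<omega> * (p * max (barrier 0) n powr (p - 1) * (- barrier u - Y u \<omega>))"
        by (rule mult_left_mono[OF _ v_nonneg])
      also have "\<dots> \<le> a u * (p * max (barrier 0) n powr (p - 1) * (- barrier u - Y u \<omega>))"
        using D p by (intro mult_right_mono v_le) auto
      finally have 1: "v u \<omega> * ?g (Y u \<omega>) - v u \<omega> * barrier u powr p \<le> p * max (barrier 0) n powr (p - 1) * a u * (- barrier u - Y u \<omega>)"
        by (simp only: right_diff_distrib mult_ac)
      \<comment> \<open>The barrier was built with \<open>a\<close>, which dominates
        \<open>v\<close>; this gives the remaining inequality the right sign.\<close>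
      have "v u \<omega> * barrier u powr p \<le> a u * barrier u powr p" by (intro mult_right_mono v_le) simp
      then show "- (p * max (barrier 0) n powr (p - 1) * a u * (- barrier u - Y u \<omega>)) \<le> a u * barrier u powr p - v u \<omega> * ?g (Y u \<omega>)"
        using 1 by linarith
    qed
    show "AE \<omega> in M. \<forall>u\<in>{0..<T}. - barrier u - Y u \<omega> \<le> B.sol_bound"
      using bd
    proof eventually_elim
      case (elim \<omega>)
      show ?case
      proof
        fix u assume "u \<in> {0..<T}"
        then have "\<bar>Y u \<omega>\<bar> \<le> B.sol_bound" using elim by auto
        then show "- barrier u - Y u \<omega> \<le> B.sol_bound" using barrier_pos[of u] by linarith
      qed
    qed
    show "AE \<omega> in M. ((\<lambda>t. max 0 (- barrier t - Y t \<omega>)) \<longlongrightarrow> 0) (at_left T)"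
      using lim
    proof eventually_elim
      case (elim \<omega>)
      have "((\<lambda>t. max 0 (- barrier t - Y t \<omega>)) \<longlongrightarrow> max 0 (- K - ?\<zeta> \<omega>)) (at_left T)"
        by (intro tendsto_intros barrier_tendsto elim)
      moreover have "max 0 (- K - ?\<zeta> \<omega>) = 0" using trunc_terminal_bounds(1)[of n \<omega>] by simp
      ultimately show ?case by simp
    qed
  qed (use B.L_nonneg a_measurable a_nonneg in auto)
  have "AE \<omega> in M. \<forall>t\<in>{0..<T}. - barrier 0 \<le> Y t \<omega> \<and> Y t \<omega> \<le> real n"
    using upper lower
  proof eventually_elim
    case (elim \<omega>)
    show ?case
    proof
      fix t assume t: "t \<in> {0..<T}"
      then have "- barrier t - Y t \<omega> \<le> 0" "barrier t \<le> barrier 0" "Y t \<omega> \<le> real n" using elim barrier_bounds(2)[of t] by auto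
      then show "- barrier 0 \<le> Y t \<omega> \<and> Y t \<omega> \<le> real n" by linarith
    qed
  qed
  from AE_good_set[OF this] obtain A where A: "\<And>t. 0 \<le> t \<Longrightarrow> A \<in> sets (F t)" "AE \<omega> in M. \<omega> \<in> A"
    "\<And>\<omega>. \<omega> \<in> A \<Longrightarrow> \<forall>t\<in>{0..<T}. - barrier 0 \<le> Y t \<omega> \<and> Y t \<omega> \<le> real n" "A \<subseteq> space M" by blast
  define Y' where "Y' \<equiv> \<lambda>t \<omega>. indicator A \<omega> * Y t \<omega>"
  have Y'eq: "Y' t \<omega> = Y t \<omega>" if "\<omega> \<in> A" for t \<omega> using that by (simp add: Y'_def)
  have "truncated n Y' N"
    unfolding truncated_def
  proof (intro conjI ballI allI)
    show "adapted_before F T Y'"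
      unfolding adapted_before_def Y'_def using A(1) Y by (auto simp: adapted_before_def intro!: borel_measurable_times)
    show "((\<lambda>s. Y' s \<omega>) \<longlongrightarrow> Y' t \<omega>) (at_right t)" if "\<omega> \<in> space M" "t \<in> {0..<T}" for \<omega> t
      unfolding Y'_def using rc that by (intro tendsto_mult tendsto_const) auto
    show "- barrier 0 \<le> Y' t \<omega>" "Y' t \<omega> \<le> real n" if "t \<in> {0..<T}" for t \<omega>
      using A(3)[of \<omega>] that b0 by (auto simp: Y'_def indicator_def)
    show "AE \<omega> in M. power_dynamics p Y' N \<omega>"
      using A(2) eq AE_space
    proof eventually_elim
      case (elim \<omega>)
      have g: "v u \<omega> * \<bar>Y' u \<omega>\<bar> powr p = v u \<omega> * ?g (Y u \<omega>)" for u
      proof (cases "u \<in> {0..<T}")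
        case True
        then have "- barrier 0 \<le> Y u \<omega>" "Y u \<omega> \<le> real n" using A(3)[OF elim(1)] by auto
        then have "max (- barrier 0) (min (real n) (Y u \<omega>)) = Y u \<omega>" by simp
        then show ?thesis using Y'eq[OF elim(1)] by (simp add: trunc_driver_def)
      qed (simp add: v_zero)
      show ?case
        by (rule power_dynamicsI, unfold g) (use elim(2) seti[OF elim(3)] Y'eq[OF elim(1)] in auto)
    qed
    show "AE \<omega> in M. ((\<lambda>t. Y' t \<omega>) \<longlongrightarrow> ?\<zeta> \<omega>) (at_left T)"
      using A(2) lim by eventually_elim (simp add: Y'_def)
  qed (use N in auto)
  then show ?thesis by blast
qed

section \<open>Estimates for truncated solutions\<close>

abbreviation power_driver :: "(real \<Rightarrow> 'a \<Rightarrow> real) \<Rightarrow> 'a \<times> real \<Rightarrow> real" where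
  "power_driver Y x \<equiv> v (snd x) (fst x) * \<bar>Y (snd x) (fst x)\<bar> powr p"

lemma power_measurable: "(\<lambda>y :: real. \<bar>y\<bar> powr p) \<in> borel_measurable borel"
  using p by (intro borel_measurable_continuous_onI continuous_on_powr' continuous_intros) auto

lemma power_driver_measurable: "prog Y \<Longrightarrow> power_driver Y \<in> borel_measurable (M \<Otimes>\<^sub>M borel)"
  using driver_joint_measurable[OF _ power_measurable] by simp

lemma truncatedD:
  assumes "truncated n Y N"
  shows "adapted_before F T Y" "mart N" "cadlag_before M T N"
    "\<And>\<omega> t. \<omega> \<in> space M \<Longrightarrow> t \<in> {0..<T} \<Longrightarrow> ((\<lambda>s. Y s \<omega>) \<longlongrightarrow> Y t \<omega>) (at_right t)"
    "\<And>t \<omega>. 0 \<le> t \<Longrightarrow> t < T \<Longrightarrow> - barrier 0 \<le> Y t \<omega>" "\<And>t \<omega>. 0 \<le> t \<Longrightarrow> t < T \<Longrightarrow> Y t \<omega> \<le> real n"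
    "AE \<omega> in M. power_dynamics p Y N \<omega>" "AE \<omega> in M. ((\<lambda>t. Y t \<omega>) \<longlongrightarrow> trunc_terminal n \<omega>) (at_left T)"
  using assms unfolding truncated_def by auto

lemma truncated_prog: "truncated n Y N \<Longrightarrow> prog Y"
  using prog_right_continuous truncatedD(1,4) by blast

lemma truncated_abs: "truncated n Y N \<Longrightarrow> 0 \<le> t \<Longrightarrow> t < T \<Longrightarrow> \<bar>Y t \<omega>\<bar> \<le> max (barrier 0) n"
  using truncatedD(5,6)[of n Y N t \<omega>] by (auto simp: abs_le_iff)

lemma truncated_integrable:
  assumes "truncated n Y N" "0 \<le> t" "t < T"
  shows "Y t \<in> borel_measurable M" "integrable M (Y t)"
proof -
  show m: "Y t \<in> borel_measurable M"
    using measurable_F_M[OF adaptedD[OF truncatedD(1)[OF assms(1)] assms(2,3)] assms(2)] .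
  show "integrable M (Y t)"
    by (rule integrable_const_bound[where B="max (barrier 0) n", OF _ m]) (use truncated_abs[OF assms] in auto)
qed

lemma truncated_comparison:
  assumes tr: "truncated n Y N"
    and Y': "adapted_before F T Y'" "mart N'" "cadlag_before M T N'" "AE \<omega> in M. power_dynamics p Y' N' \<omega>"
    and Y'c: "AE \<omega> in M. \<forall>t\<in>{0..<T}. - c' \<le> Y' t \<omega>"
    and lim': "AE \<omega> in M. ereal (trunc_terminal n \<omega>) \<le> Liminf (at_left T) (\<lambda>t. ereal (Y' t \<omega>))"
  shows "AE \<omega> in M. \<forall>t\<in>{0..<T}. Y t \<omega> \<le> Y' t \<omega>"
  by (rule comparison[OF p truncatedD(1,2,3,7)[OF tr] _ truncatedD(8)[OF tr] Y' Y'c lim'])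
    (use truncated_abs[OF tr] in \<open>auto intro!: AE_I2\<close>)

lemma truncated_mono:
  assumes tr: "truncated n Y N" and tr': "truncated (Suc n) Y' N'"
  shows "AE \<omega> in M. \<forall>t\<in>{0..<T}. Y t \<omega> \<le> Y' t \<omega>"
proof (rule truncated_comparison[OF tr truncatedD(1,2,3,7)[OF tr']])
  show "AE \<omega> in M. \<forall>t\<in>{0..<T}. - barrier 0 \<le> Y' t \<omega>" using truncatedD(5)[OF tr'] by auto
  show "AE \<omega> in M. ereal (trunc_terminal n \<omega>) \<le> Liminf (at_left T) (\<lambda>t. ereal (Y' t \<omega>))"
    using truncatedD(8)[OF tr']
  proof eventually_elim
    case (elim \<omega>)
    have "((\<lambda>t. ereal (Y' t \<omega>)) \<longlongrightarrow> ereal (trunc_terminal (Suc n) \<omega>)) (at_left T)" using elim by (rule tendsto_ereal)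
    then have "Liminf (at_left T) (\<lambda>t. ereal (Y' t \<omega>)) = ereal (trunc_terminal (Suc n) \<omega>)"
      by (intro lim_imp_Liminf) (auto simp: trivial_limit_at_left_real)
    moreover have "ereal (trunc_terminal n \<omega>) \<le> ereal (trunc_terminal (Suc n) \<omega>)"
      unfolding ereal_trunc_terminal by (intro max.mono min.mono) auto
    ultimately show ?case by simp
  qed
qed

text \<open>Martingale increments have mean 0, and Fubini writes the mean of the drift as an
  integral over the product space. The growth of the expectation thus measures the accumulated
  driver.\<close>

lemma truncated_expectation:
  assumes tr: "truncated n Y N" and st: "0 \<le> s" "s \<le> t" "t < T"
  shows "integrable (M \<Otimes>\<^sub>M lborel) (\<lambda>x. indicator {s..t} (snd x) * power_driver Y x)"
    "(\<integral>\<omega>. Y t \<omega> \<partial>M) - (\<integral>\<omega>. Y s \<omega> \<partial>M) = (\<integral>x. indicator {s..t} (snd x) * power_driver Y x \<partial>(M \<Otimes>\<^sub>M lborel))"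
proof -
  let ?m = "max (barrier 0) n"
  show i: "integrable (M \<Otimes>\<^sub>M lborel) (\<lambda>x. indicator {s..t} (snd x) * power_driver Y x)"
  proof (rule integrable_pair_bounded[where b="\<lambda>u. a u * ?m powr p"])
    note power_driver_measurable[OF truncated_prog[OF tr], measurable]
    show "(\<lambda>x. indicator {s..t} (snd x) * power_driver Y x) \<in> borel_measurable (M \<Otimes>\<^sub>M borel)" by measurable
    show "integrable lborel (\<lambda>u. a u * ?m powr p)" using a_integrable by simp
    show "\<bar>indicator {s..t} (snd (\<omega>, u)) * power_driver Y (\<omega>, u)\<bar> \<le> a u * ?m powr p" for \<omega> u
    proof (cases "u \<in> {s..t}")
      case True
      then have "\<bar>Y u \<omega>\<bar> \<le> ?m" using st by (intro truncated_abs[OF tr]) auto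
      then have "\<bar>Y u \<omega>\<bar> powr p \<le> ?m powr p" using p by (intro powr_mono2) auto
      then have "v u \<omega> * \<bar>Y u \<omega>\<bar> powr p \<le> a u * ?m powr p"
        using v_le v_nonneg a_nonneg by (intro mult_mono) auto
      then show ?thesis using True v_nonneg[of u \<omega>] by (simp add: abs_mult)
    qed (simp add: a_nonneg)
  qed
  have sT: "0 \<le> t" "s < T" using st by auto
  have Ni: "integrable M (N u)" if "0 \<le> u" "u < T" for u using truncatedD(2)[OF tr] that by (auto simp: martingale_before_def)
  note Yi = truncated_integrable(2)[OF tr]
  have "(\<integral>x. indicator {s..t} (snd x) * power_driver Y x \<partial>(M \<Otimes>\<^sub>M lborel)) =
      (\<integral>\<omega>. (LINT u:{s..t}|lborel. v u \<omega> * \<bar>Y u \<omega>\<bar> powr p) \<partial>M)"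
    using pair.integral_fst'[OF i] by (simp add: set_lebesgue_integral_def)
  also have "\<dots> = (\<integral>\<omega>. (Y t \<omega> - Y s \<omega>) - (N t \<omega> - N s \<omega>) \<partial>M)"
  proof (rule integral_cong_AE)
    show "(\<lambda>\<omega>. LINT u:{s..t}|lborel. v u \<omega> * \<bar>Y u \<omega>\<bar> powr p) \<in> borel_measurable M"
      using driver_integral_measurable_M[OF truncated_prog[OF tr] power_measurable, of "{s..t}"] by simp
    show "AE \<omega> in M. (LINT u:{s..t}|lborel. v u \<omega> * \<bar>Y u \<omega>\<bar> powr p) = (Y t \<omega> - Y s \<omega>) - (N t \<omega> - N s \<omega>)"
      using truncatedD(7)[OF tr] by eventually_elim (use power_dynamicsD(2)[OF _ st] in fastforce)
  qed (use Yi[OF sT(1) st(3)] Yi[OF st(1) sT(2)] Ni[OF sT(1) st(3)] Ni[OF st(1) sT(2)] in auto)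
  also have "\<dots> = (\<integral>\<omega>. Y t \<omega> \<partial>M) - (\<integral>\<omega>. Y s \<omega> \<partial>M)"
    using Yi[OF sT(1) st(3)] Yi[OF st(1) sT(2)] Ni[OF sT(1) st(3)] Ni[OF st(1) sT(2)]
      mart_expectation[OF truncatedD(2)[OF tr] st] by simp
  finally show "(\<integral>\<omega>. Y t \<omega> \<partial>M) - (\<integral>\<omega>. Y s \<omega> \<partial>M) = (\<integral>x. indicator {s..t} (snd x) * power_driver Y x \<partial>(M \<Otimes>\<^sub>M lborel))" ..
qed

lemma truncated_expectation_mono:
  assumes tr: "truncated n Y N" and st: "0 \<le> s" "s \<le> t" "t < T"
  shows "(\<integral>\<omega>. Y s \<omega> \<partial>M) \<le> (\<integral>\<omega>. Y t \<omega> \<partial>M)"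
proof -
  have "0 \<le> (\<integral>x. indicator {s..t} (snd x) * power_driver Y x \<partial>(M \<Otimes>\<^sub>M lborel))"
    using v_nonneg by (intro Bochner_Integration.integral_nonneg) (auto simp: indicator_def)
  then show ?thesis using truncated_expectation(2)[OF tr st] by linarith
qed

text \<open>The elementary inequality \<open>y \<le> \<lambda> v y^p + (\<lambda> v)^(- 1 / (p - 1))\<close>, integrated over
  \<open>[s, s']\<close> with \<open>\<lambda> = s' - s\<close>, bounds the expectation at \<open>s\<close> by half of the one at \<open>s'\<close> plus a
  multiple of \<open>(s' - s)^(- 1 - 1 / (p - 1))\<close>. Letting \<open>T - s'\<close> be a fixed fraction of \<open>T - s\<close> close
  to 1, the supremum of the suitably weighted expectation absorbs itself.\<close>

lemma truncated_expectation_bound: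
  assumes t: "0 \<le> t" "t < T"
  shows "\<exists>B. \<forall>n Y N. truncated n Y N \<longrightarrow> (\<integral>\<omega>. Y t \<omega> \<partial>M) \<le> B"
proof -
  define q where "q = 1 / (p - 1)"
  have q: "0 < q" using p by (simp add: q_def)
  obtain \<epsilon> where \<epsilon>: "0 < \<epsilon>" "\<epsilon> \<le> T"
    and fin: "(\<integral>\<^sup>+\<omega>. (\<integral>\<^sup>+s\<in>{T - \<epsilon>..T}. 1 / ennreal (v s \<omega> powr q) \<partial>lborel) \<partial>M) < \<infinity>"
    using inverse_integrable by (auto simp: q_def)
  define s0 where "s0 = T - \<epsilon>"
  have s0: "0 \<le> s0" "s0 < T" using \<epsilon> by (auto simp: s0_def)
  let ?E = "\<lambda>x :: 'a \<times> real. 1 / ennreal (v (snd x) (fst x) powr q) * indicator {s0..T} (snd x)"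
  let ?k = "\<lambda>x :: 'a \<times> real. indicator {s0..T} (snd x) * v (snd x) (fst x) powr (- q)"
  have vm: "(\<lambda>x. v (snd x) (fst x)) \<in> borel_measurable (M \<Otimes>\<^sub>M lborel)"
    using driver_joint_measurable[OF v_prog, of "\<lambda>_. 1"] by (simp add: borel_measurable_pair_lborel_iff)
  note vm[measurable]
  have Em: "?E \<in> borel_measurable (M \<Otimes>\<^sub>M lborel)" by measurable
  have Efin: "(\<integral>\<^sup>+x. ?E x \<partial>(M \<Otimes>\<^sub>M lborel)) < \<infinity>"
    using lborel.nn_integral_fst[OF Em] fin by (simp add: s0_def)
  \<comment> \<open>With the convention 1 / 0 = \<infinity>, finiteness of the integral forces
    \<open>v\<close> to be positive almost everywhere near \<open>T\<close>.\<close>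
  have vpos: "AE x in M \<Otimes>\<^sub>M lborel. snd x \<in> {s0..T} \<longrightarrow> 0 < v (snd x) (fst x)"
  proof -
    have "AE x in M \<Otimes>\<^sub>M lborel. ?E x \<noteq> \<infinity>" using Efin by (intro nn_integral_PInf_AE[OF Em]) auto
    then show ?thesis
    proof eventually_elim
      case (elim x)
      show ?case
      proof (rule impI, rule ccontr)
        assume "snd x \<in> {s0..T}" "\<not> 0 < v (snd x) (fst x)"
        then have "v (snd x) (fst x) = 0" "indicator {s0..T} (snd x) = (1::ennreal)" using v_nonneg[of "snd x" "fst x"] by auto
        then show False using elim by (simp add: ennreal_divide_zero)
      qed
    qed
  qed
  have ki: "integrable (M \<Otimes>\<^sub>M lborel) ?k"
  proof (rule integrableI_bounded)
    show "?k \<in> borel_measurable (M \<Otimes>\<^sub>M lborel)" by measurable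
    have "(\<integral>\<^sup>+x. ennreal (norm (?k x)) \<partial>(M \<Otimes>\<^sub>M lborel)) \<le> (\<integral>\<^sup>+x. ?E x \<partial>(M \<Otimes>\<^sub>M lborel))"
    proof (rule nn_integral_mono)
      fix x :: "'a \<times> real"
      show "ennreal (norm (?k x)) \<le> ?E x"
      proof (cases "snd x \<in> {s0..T} \<and> v (snd x) (fst x) \<noteq> 0")
        case True
        then have "0 < v (snd x) (fst x)" using v_nonneg[of "snd x" "fst x"] by (simp add: less_le)
        then have "1 / ennreal (v (snd x) (fst x) powr q) = ennreal (1 / v (snd x) (fst x) powr q)"
          using divide_ennreal[of 1 "v (snd x) (fst x) powr q"] by simp
        then show ?thesis using True by (simp add: powr_minus inverse_eq_divide)
      qed (auto simp: indicator_def)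
    qed
    then show "(\<integral>\<^sup>+x. ennreal (norm (?k x)) \<partial>(M \<Otimes>\<^sub>M lborel)) < \<infinity>" using Efin by (rule le_less_trans)
  qed
  define I where "I = (\<integral>x. ?k x \<partial>(M \<Otimes>\<^sub>M lborel))"
  have I0: "0 \<le> I" unfolding I_def by (intro Bochner_Integration.integral_nonneg) auto
  \<comment> \<open>If \<open>l * w * y powr (p - 1)\<close> is at least 1, the first term alone
    exceeds \<open>y\<close>; otherwise \<open>y\<close> is below the second term.\<close>
  have young: "y \<le> l * (w * \<bar>y\<bar> powr p) + l powr (- q) * w powr (- q)" if lw: "0 < l" "0 < w" for y l w :: real
  proof (cases "y \<le> 0")
    case True
    have "0 \<le> l * (w * \<bar>y\<bar> powr p) + l powr (- q) * w powr (- q)" using lw by simp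
    then show ?thesis using True by linarith
  next
    case False
    then have y: "0 < y" by simp
    show ?thesis
    proof (cases "1 \<le> l * w * y powr (p - 1)")
      case True
      have "y * 1 \<le> y * (l * w * y powr (p - 1))" using True y by (intro mult_left_mono) auto
      also have "\<dots> = l * (w * \<bar>y\<bar> powr p)" using y by (simp add: powr_diff field_simps)
      finally show ?thesis using lw by (simp add: add_increasing2)
    next
      case False
      then have "y powr (p - 1) \<le> 1 / (l * w)" using lw by (simp add: field_simps)
      then have "(y powr (p - 1)) powr q \<le> (1 / (l * w)) powr q" using q by (intro powr_mono2) auto
      also have "(y powr (p - 1)) powr q = y" using y p by (simp add: powr_powr q_def)
      also have "(1 / (l * w)) powr q = l powr (- q) * w powr (- q)" using lw by (simp add: powr_divide powr_mult powr_minus field_simps)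
      finally show ?thesis using lw by (simp add: add_increasing)
    qed
  qed
  \<comment> \<open>The fraction is fixed by \<open>r powr (q + 1) = 2 / 3\<close>: passing from
    \<open>T - u\<close> to \<open>r * (T - u)\<close> then costs a factor 3/2 in the weight, which
    after halving leaves 3/4 < 1.\<close>
  define r where "r = (2 / 3) powr (1 / (q + 1))"
  have r: "0 < r" "r < 1" "r powr (q + 1) = 2 / 3"
  proof -
    have "(2 / 3) powr (1 / (q + 1)) < (2 / 3 :: real) powr 0" using q by (intro powr_less_mono') auto
    then show "r < 1" by (simp add: r_def)
    show "r powr (q + 1) = 2 / 3" using q by (simp add: r_def powr_powr)
  qed (simp add: r_def)
  \<comment> \<open>Chosen so that the estimate below reads
    \<open>\<kappa> \<le> 3 / 4 * \<kappa> + H / 4\<close>, whence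
    \<open>\<kappa> \<le> H\<close>.\<close>
  define H where "H = 2 * (1 - r) powr (- (q + 1)) * I"
  have main: "(\<integral>\<omega>. Y s \<omega> \<partial>M) \<le> (T - s) powr (- (q + 1)) * H"
    if tr: "truncated n Y N" and s: "s \<in> {s0..<T}" for n Y N s
  proof -
    define y where "y \<equiv> \<lambda>u. (\<integral>\<omega>. Y u \<omega> \<partial>M)"
    have yn: "y u \<le> real n" if "0 \<le> u" "u < T" for u
    proof -
      have "y u \<le> (\<integral>\<omega>. real n \<partial>M)" unfolding y_def
        using truncated_integrable[OF tr that] truncatedD(6)[OF tr that] by (intro integral_mono) auto
      then show ?thesis by (simp add: prob_space)
    qed
    have step: "2 * y s \<le> y s' + (s' - s) powr (- (q + 1)) * I" if ss: "s0 \<le> s" "s < s'" "s' < T" for s s'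
    proof -
      have *: "0 \<le> s" "s \<le> s'" using ss s0 by auto
      let ?l = "s' - s"
      let ?i = "\<lambda>x :: 'a \<times> real. indicator {s..s'} (snd x) :: real"
      note te = truncated_expectation[OF tr * ss(3)]
      have ind: "integrable lborel (indicator {s..s'} :: real \<Rightarrow> real)"
        by (rule integrable_real_indicator) (auto simp: emeasure_lborel_Icc_eq)
      have Yint: "integrable (M \<Otimes>\<^sub>M lborel) (\<lambda>x. ?i x * Y (snd x) (fst x))"
      proof (rule integrable_pair_bounded[where b="\<lambda>u. max (barrier 0) n * indicator {s..s'} u"])
        note prog_measurable_M[OF truncated_prog[OF tr], measurable]
        have "(\<lambda>x. ?i x * (indicator {0..<T} (snd x) * Y (snd x) (fst x))) \<in> borel_measurable (M \<Otimes>\<^sub>M borel)" by measurable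
        moreover have "?i x * (indicator {0..<T} (snd x) * Y (snd x) (fst x)) = ?i x * Y (snd x) (fst x)" for x
          using * ss by (auto simp: indicator_def)
        ultimately show "(\<lambda>x. ?i x * Y (snd x) (fst x)) \<in> borel_measurable (M \<Otimes>\<^sub>M borel)" by simp
        show "\<bar>?i (\<omega>, u) * Y (snd (\<omega>, u)) (fst (\<omega>, u))\<bar> \<le> max (barrier 0) n * indicator {s..s'} u" for \<omega> u
          using truncated_abs[OF tr, of u \<omega>] * ss by (auto simp: indicator_def)
        show "integrable lborel (\<lambda>u. max (barrier 0) n * indicator {s..s'} u)" using ind by simp
      qed
      have iki: "integrable (M \<Otimes>\<^sub>M lborel) (\<lambda>x. ?i x * v (snd x) (fst x) powr (- q))"
        by (rule Bochner_Integration.integrable_bound[OF ki]) (use ss in \<open>auto simp: indicator_def\<close>)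
      \<comment> \<open>Expectations increase in time, so \<open>?l * y s\<close> is at most the
        time integral of \<open>y\<close> over [s, s'], to which the pointwise inequality is
        applied. The driver term then integrates to \<open>y s' - y s\<close>.\<close>
      have "?l * y s = (LINT u:{s..s'}|lborel. y s)" using * by (simp add: set_lebesgue_integral_def)
      also have "\<dots> \<le> (LINT u:{s..s'}|lborel. y u)"
      proof (rule set_integral_mono)
        show "set_integrable lborel {s..s'} y"
          using pair.integrable_snd[of "\<lambda>\<omega> u. indicator {s..s'} u * Y u \<omega>"] Yint
          by (simp add: set_integrable_def y_def split_beta')
        show "y s \<le> y u" if "u \<in> {s..s'}" for u
          unfolding y_def using that * ss by (intro truncated_expectation_mono[OF tr]) auto
      qed (use ind in \<open>simp add: set_integrable_def\<close>)
      also have "\<dots> = (\<integral>x. ?i x * Y (snd x) (fst x) \<partial>(M \<Otimes>\<^sub>M lborel))"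
        using pair.integral_snd[of "\<lambda>\<omega> u. indicator {s..s'} u * Y u \<omega>"] Yint
        by (simp add: set_lebesgue_integral_def y_def split_beta')
      also have "\<dots> \<le> (\<integral>x. ?l * (?i x * power_driver Y x) + ?l powr (- q) * (?i x * v (snd x) (fst x) powr (- q)) \<partial>(M \<Otimes>\<^sub>M lborel))"
      proof (rule integral_mono_AE)
        show "AE x in M \<Otimes>\<^sub>M lborel. ?i x * Y (snd x) (fst x) \<le> ?l * (?i x * power_driver Y x) + ?l powr (- q) * (?i x * v (snd x) (fst x) powr (- q))"
          using vpos
        proof eventually_elim
          case (elim x)
          show ?case
          proof (cases "snd x \<in> {s..s'}")
            case True
            then have "0 < v (snd x) (fst x)" using elim ss by auto
            then show ?thesis using young[of ?l "v (snd x) (fst x)" "Y (snd x) (fst x)"] True ss by simp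
          qed simp
        qed
      qed (use Yint te(1) iki in auto)
      also have "\<dots> = ?l * (y s' - y s) + ?l powr (- q) * (\<integral>x. ?i x * v (snd x) (fst x) powr (- q) \<partial>(M \<Otimes>\<^sub>M lborel))"
        using te iki by (simp add: y_def)
      also have "\<dots> \<le> ?l * (y s' - y s) + ?l powr (- q) * I"
        unfolding I_def using ki iki ss
        by (intro add_left_mono mult_left_mono integral_mono) (auto simp: indicator_def)
      finally have le: "?l * y s \<le> ?l * (y s' - y s) + ?l powr (- q) * I" .
      have "2 * b \<le> c + d / x * I" if "x * b \<le> x * (c - b) + d * I" "0 < x" for x b c d :: real
        using that by (simp add: field_simps)
      from this[OF le] ss have "2 * y s \<le> y s' + (?l powr (- q) / ?l) * I" by simp
      also have "?l powr (- q) / ?l = ?l powr (- (q + 1))" using ss by (simp add: powr_diff powr_minus powr_add field_simps)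
      finally show ?thesis .
    qed
    define z where "z \<equiv> \<lambda>u. (T - u) powr (q + 1) * y u"
    define \<kappa> where "\<kappa> = (SUP u\<in>{s0..<T}. z u)"
    \<comment> \<open>This bound depends on \<open>n\<close>, but it only serves to make the
      supremum finite; the resulting bound \<open>H\<close> does not.\<close>
    have bdd: "bdd_above (z ` {s0..<T})"
    proof (rule bdd_aboveI2)
      fix u assume u: "u \<in> {s0..<T}"
      have "z u \<le> (T - u) powr (q + 1) * real n" unfolding z_def using yn[of u] u s0 by (intro mult_left_mono) auto
      also have "\<dots> \<le> T powr (q + 1) * real n" using u s0 q by (intro mult_right_mono powr_mono2) auto
      finally show "z u \<le> T powr (q + 1) * real n" .
    qed
    have zk: "z u \<le> \<kappa>" if "u \<in> {s0..<T}" for u unfolding \<kappa>_def using bdd that by (intro cSUP_upper)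
    have "z u \<le> 3 / 4 * \<kappa> + H / 4" if u: "u \<in> {s0..<T}" for u
    proof -
      define u' where "u' = T - r * (T - u)"
      have Tu: "0 < T - u" using u by simp
      have rT: "r * (T - u) < 1 * (T - u)" using r Tu by (intro mult_strict_right_mono)
      have u': "s0 \<le> u" "u < u'" "u' < T"
      proof -
        define d where "d = r * (T - u)"
        have "0 < d" "d < T - u" using rT mult_pos_pos[OF r(1) Tu] by (simp_all only: d_def mult_1)
        then show "u < u'" "u' < T" unfolding u'_def d_def[symmetric] by linarith+
      qed (use u in auto)
      have d: "u' - u = (1 - r) * (T - u)" "T - u' = r * (T - u)" by (auto simp: u'_def algebra_simps)
      let ?w = "(T - u) powr (q + 1)"
      have w0: "0 < ?w" using Tu by simp
      have zu': "z u' = 2 / 3 * (?w * y u')" unfolding z_def d(2) using r Tu by (simp add: powr_mult)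
      have "?w * (2 * y u) \<le> ?w * (y u' + (u' - u) powr (- (q + 1)) * I)"
        using step[OF u'] w0 by (intro mult_left_mono) auto
      also have "\<dots> = ?w * y u' + (1 - r) powr (- (q + 1)) * (?w * (T - u) powr (- (q + 1))) * I"
      proof -
        have e: "(u' - u) powr (- (q + 1)) = (1 - r) powr (- (q + 1)) * (T - u) powr (- (q + 1))"
          unfolding d(1) by (rule powr_mult)
        have "b * (c + (d * e) * I) = b * c + d * (b * e) * I" for b c d e :: real by (simp add: algebra_simps)
        then show ?thesis unfolding e .
      qed
      also have "?w * (T - u) powr (- (q + 1)) = 1" using Tu powr_add[of "T - u" "q + 1" "- (q + 1)"] by simp
      finally have "?w * (2 * y u) \<le> ?w * y u' + (1 - r) powr (- (q + 1)) * 1 * I" .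
      moreover have "?w * (2 * y u) = 2 * z u" by (simp add: z_def)
      moreover have "?w * y u' = 3 / 2 * z u'" using zu' by simp
      moreover have "(1 - r) powr (- (q + 1)) * 1 * I = H / 2" by (simp add: H_def)
      ultimately have "2 * z u \<le> 3 / 2 * z u' + H / 2" by linarith
      moreover have "z u' \<le> \<kappa>" using u' by (intro zk) auto
      ultimately show ?thesis by linarith
    qed
    then have "\<kappa> \<le> 3 / 4 * \<kappa> + H / 4" unfolding \<kappa>_def[symmetric] using s0 by (subst (1) \<kappa>_def, intro cSUP_least) auto
    then have "z s \<le> H" using zk[OF s] by linarith
    have Ts: "0 < T - s" using s by simp
    have "(T - s) powr (- (q + 1)) * (T - s) powr (q + 1) = 1"
      using Ts powr_add[of "T - s" "- (q + 1)" "q + 1"] by simp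
    then have "y s = (T - s) powr (- (q + 1)) * z s" unfolding z_def by (simp only: mult.assoc[symmetric] mult_1)
    also have "\<dots> \<le> (T - s) powr (- (q + 1)) * H" using \<open>z s \<le> H\<close> by (intro mult_left_mono) auto
    finally show ?thesis by (simp add: y_def)
  qed
  show ?thesis
  proof (intro exI allI impI)
    fix n Y N assume tr: "truncated n Y N"
    \<comment> \<open>The estimate is available only near \<open>T\<close>; earlier expectations are
      smaller by monotonicity.\<close>
    have "(\<integral>\<omega>. Y t \<omega> \<partial>M) \<le> (\<integral>\<omega>. Y (max t s0) \<omega> \<partial>M)"
      using t s0 by (intro truncated_expectation_mono[OF tr]) auto
    also have "\<dots> \<le> (T - max t s0) powr (- (q + 1)) * H" using t s0 by (intro main[OF tr]) auto
    finally show "(\<integral>\<omega>. Y t \<omega> \<partial>M) \<le> (T - max t s0) powr (- (q + 1)) * H" .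
  qed
qed

end

section \<open>The limit of the truncated solutions\<close>

context singular_bsde
begin

context
  fixes Yn Nn :: "nat \<Rightarrow> real \<Rightarrow> 'a \<Rightarrow> real"
  assumes tr: "\<And>n. truncated n (Yn n) (Nn n)"
begin

lemma Yn_incseq: "AE \<omega> in M. \<forall>t\<in>{0..<T}. incseq (\<lambda>n. Yn n t \<omega>)"
proof -
  have "AE \<omega> in M. \<forall>n. \<forall>t\<in>{0..<T}. Yn n t \<omega> \<le> Yn (Suc n) t \<omega>"
    unfolding AE_all_countable using truncated_mono[OF tr tr] by blast
  then show ?thesis by eventually_elim (auto intro!: incseq_SucI)
qed

text \<open>The uniform bound on the expectations and Fatou's lemma, applied after shifting by the
  lower bound, give an integrable lower limit. Its finiteness bounds the increasing sequence, which
  therefore converges.\<close>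

lemma limit_at_time:
  assumes t: "0 \<le> t" "t < T"
  shows "AE \<omega> in M. convergent (\<lambda>n. Yn n t \<omega>)" "integrable M (\<lambda>\<omega>. lim (\<lambda>n. Yn n t \<omega>))"
proof -
  let ?C = "barrier 0"
  obtain B where B: "\<And>n. (\<integral>\<omega>. Yn n t \<omega> \<partial>M) \<le> B" using truncated_expectation_bound[OF t] tr by blast
  note m = truncated_integrable(1)[OF tr t] and i = truncated_integrable(2)[OF tr t]
  have low: "0 \<le> Yn n t \<omega> + ?C" for n \<omega> using truncatedD(5)[OF tr[of n] t, of \<omega>] by simp
  note m[measurable]
  have "(\<integral>\<^sup>+\<omega>. liminf (\<lambda>n. ennreal (Yn n t \<omega> + ?C)) \<partial>M) \<le> liminf (\<lambda>n. \<integral>\<^sup>+\<omega>. ennreal (Yn n t \<omega> + ?C) \<partial>M)"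
    by (rule nn_integral_liminf) simp
  also have "\<dots> \<le> ennreal (B + ?C)"
  proof (rule Liminf_le)
    have "(\<integral>\<^sup>+\<omega>. ennreal (Yn n t \<omega> + ?C) \<partial>M) \<le> ennreal (B + ?C)" for n
      using i[of n] low B[of n] by (subst nn_integral_eq_integral) (auto intro!: ennreal_leI simp: prob_space)
    then show "\<forall>\<^sub>F n in sequentially. (\<integral>\<^sup>+\<omega>. ennreal (Yn n t \<omega> + ?C) \<partial>M) \<le> ennreal (B + ?C)" by simp
  qed simp
  finally have fin: "(\<integral>\<^sup>+\<omega>. liminf (\<lambda>n. ennreal (Yn n t \<omega> + ?C)) \<partial>M) \<le> ennreal (B + ?C)" .
  have "AE \<omega> in M. liminf (\<lambda>n. ennreal (Yn n t \<omega> + ?C)) \<noteq> \<infinity>"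
  proof (rule nn_integral_PInf_AE)
    show "(\<integral>\<^sup>+\<omega>. liminf (\<lambda>n. ennreal (Yn n t \<omega> + ?C)) \<partial>M) \<noteq> \<infinity>" using fin by (auto simp: top_unique)
  qed measurable
  then show conv: "AE \<omega> in M. convergent (\<lambda>n. Yn n t \<omega>)"
    using Yn_incseq
  proof eventually_elim
    case (elim \<omega>)
    then have inc: "incseq (\<lambda>n. Yn n t \<omega>)" using t by auto
    obtain b :: nat where b: "liminf (\<lambda>n. ennreal (Yn n t \<omega> + ?C)) < of_nat b"
      using ennreal_Ex_less_of_nat[of "liminf (\<lambda>n. ennreal (Yn n t \<omega> + ?C))"] elim(1) by (auto simp: less_top)
    have "Yn n t \<omega> \<le> real b - ?C" for n
    proof -
      have "ennreal (Yn n t \<omega> + ?C) \<le> liminf (\<lambda>n. ennreal (Yn n t \<omega> + ?C))"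
      proof (rule Liminf_bounded)
        show "\<forall>\<^sub>F k in sequentially. ennreal (Yn n t \<omega> + ?C) \<le> ennreal (Yn k t \<omega> + ?C)"
          using eventually_ge_at_top[of n] by eventually_elim (auto intro!: ennreal_leI incseqD[OF inc])
      qed
      also have "\<dots> \<le> ennreal (real b)" using b by (simp add: ennreal_of_nat_eq_real_of_nat)
      finally have "Yn n t \<omega> + ?C \<le> real b" by (subst (asm) ennreal_le_iff) auto
      then show ?thesis by simp
    qed
    then obtain l where "(\<lambda>n. Yn n t \<omega>) \<longlonglongrightarrow> l" using incseq_convergent[OF inc] by blast
    then show ?case by (auto simp: convergent_def)
  qed
  show "integrable M (\<lambda>\<omega>. lim (\<lambda>n. Yn n t \<omega>))"
  proof -
    have [measurable]: "(\<lambda>\<omega>. lim (\<lambda>n. Yn n t \<omega>)) \<in> borel_measurable M" by (rule borel_measurable_lim_metric) simp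
    have eq: "AE \<omega> in M. ennreal (norm (lim (\<lambda>n. Yn n t \<omega>) + ?C)) = liminf (\<lambda>n. ennreal (Yn n t \<omega> + ?C))"
      using conv
    proof eventually_elim
      case (elim \<omega>)
      then have l: "(\<lambda>n. Yn n t \<omega> + ?C) \<longlonglongrightarrow> lim (\<lambda>n. Yn n t \<omega>) + ?C"
        by (intro tendsto_intros) (simp add: convergent_LIMSEQ_iff)
      have "0 \<le> lim (\<lambda>n. Yn n t \<omega>) + ?C" by (rule LIMSEQ_le_const[OF l]) (use low in auto)
      moreover have "liminf (\<lambda>n. ennreal (Yn n t \<omega> + ?C)) = ennreal (lim (\<lambda>n. Yn n t \<omega>) + ?C)"
        by (rule lim_imp_Liminf[OF sequentially_bot]) (rule tendsto_ennrealI[OF l])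
      ultimately show ?case by simp
    qed
    have "integrable M (\<lambda>\<omega>. lim (\<lambda>n. Yn n t \<omega>) + ?C)"
    proof (rule integrableI_bounded)
      have "(\<integral>\<^sup>+\<omega>. ennreal (norm (lim (\<lambda>n. Yn n t \<omega>) + ?C)) \<partial>M) \<le> ennreal (B + ?C)"
        using fin nn_integral_cong_AE[OF eq] by simp
      then show "(\<integral>\<^sup>+\<omega>. ennreal (norm (lim (\<lambda>n. Yn n t \<omega>) + ?C)) \<partial>M) < \<infinity>"
        by (rule le_less_trans) simp
    qed measurable
    from Bochner_Integration.integrable_diff[OF this integrable_const[of ?C]] show ?thesis by simp
  qed
qed

text \<open>The mean accumulated driver of \<open>Yn n\<close> is the growth of its expectation,
  hence bounded uniformly in \<open>n\<close>, and Fatou gives integrability for the limit. From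
  \<open>- barrier 0 \<le> Yn n \<le> X\<close> comes the majorant
  \<open>\<bar>X\<bar> powr p + barrier 0 powr p\<close>, up to the coefficient, which permits
  dominated convergence.\<close>

lemma limit_driver_integrable:
  assumes t: "0 \<le> t" "t < T"
  defines "X \<equiv> \<lambda>t \<omega>. lim (\<lambda>n. Yn n t \<omega>)"
  shows "integrable (M \<Otimes>\<^sub>M lborel) (\<lambda>x. indicator {0..t} (snd x) * power_driver X x)"
    "\<And>B. B \<in> sets M \<Longrightarrow> (\<lambda>n. \<integral>\<omega>. indicator B \<omega> * (LINT u:{0..t}|lborel. v u \<omega> * \<bar>Yn n u \<omega>\<bar> powr p) \<partial>M) \<longlonglongrightarrow>
      (\<integral>\<omega>. indicator B \<omega> * (LINT u:{0..t}|lborel. v u \<omega> * \<bar>X u \<omega>\<bar> powr p) \<partial>M)"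
proof -
  let ?C = "barrier 0" and ?i = "\<lambda>x :: 'a \<times> real. indicator {0..t} (snd x) :: real"
  have progn: "prog (Yn n)" for n by (rule truncated_prog[OF tr])
  have progX: "prog X" unfolding X_def by (rule prog_lim[OF progn])
  have limX: "AE \<omega> in M. (\<lambda>n. Yn n u \<omega>) \<longlonglongrightarrow> X u \<omega>" if "0 \<le> u" "u < T" for u
    using limit_at_time(1)[OF that] by eventually_elim (simp add: X_def convergent_LIMSEQ_iff)
  have AEp: "AE x in M \<Otimes>\<^sub>M lborel. (\<forall>n. indicator {0..<T} (snd x) * Yn n (snd x) (fst x) \<le> indicator {0..<T} (snd x) * Yn (Suc n) (snd x) (fst x)) \<and>
      (\<lambda>n. indicator {0..<T} (snd x) * Yn n (snd x) (fst x)) \<longlonglongrightarrow> indicator {0..<T} (snd x) * X (snd x) (fst x)"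
    (is "AE x in M \<Otimes>\<^sub>M lborel. ?P x")
  proof (rule pair.AE_pair_measure)
    have [measurable]: "(\<lambda>x. indicator {0..<T} (snd x) * Yn n (snd x) (fst x)) \<in> borel_measurable (M \<Otimes>\<^sub>M lborel)"
      "(\<lambda>x. indicator {0..<T} (snd x) * X (snd x) (fst x)) \<in> borel_measurable (M \<Otimes>\<^sub>M lborel)" for n
      using prog_measurable_M progn progX by (auto simp: borel_measurable_pair_lborel_iff)
    show "{x \<in> space (M \<Otimes>\<^sub>M lborel). ?P x} \<in> sets (M \<Otimes>\<^sub>M lborel)" by measurable
    show "AE \<omega> in M. AE u in lborel. ?P (\<omega>, u)"
      using Yn_incseq AE_AE_lborel_of_AE_LIMSEQ[OF progn progX limX, simplified]
    proof eventually_elim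
      case (elim \<omega>)
      from elim(2) show ?case
      proof eventually_elim
        case (elim u)
        then show ?case using \<open>\<forall>t\<in>{0..<T}. incseq (\<lambda>n. Yn n t \<omega>)\<close>
          by (cases "u \<in> {0..<T}") (auto intro: incseq_SucD)
      qed
    qed
  qed
  have pc: "(\<lambda>n. \<bar>y n\<bar> powr p) \<longlonglongrightarrow> \<bar>z\<bar> powr p" if "y \<longlonglongrightarrow> z" for y and z :: real
    using p by (intro tendsto_powr' tendsto_rabs that tendsto_const) auto
  have AEl: "AE x in M \<Otimes>\<^sub>M lborel. (\<lambda>n. ?i x * power_driver (Yn n) x) \<longlonglongrightarrow> ?i x * power_driver X x"
    using AEp
  proof eventually_elim
    case (elim x)
    show ?case
    proof (cases "snd x \<in> {0..t}")
      case True
      then have "(\<lambda>n. Yn n (snd x) (fst x)) \<longlonglongrightarrow> X (snd x) (fst x)" using elim t by simp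
      then show ?thesis by (intro tendsto_intros pc)
    qed simp
  qed
  have AEd: "AE x in M \<Otimes>\<^sub>M lborel. norm (?i x * power_driver (Yn n) x) \<le> ?i x * power_driver X x + ?C powr p * a (snd x)" for n
    using AEp
  proof eventually_elim
    case (elim x)
    show ?case
    proof (cases "snd x \<in> {0..t}")
      case True
      then have u: "0 \<le> snd x" "snd x < T" using t by auto
      have "incseq (\<lambda>n. Yn n (snd x) (fst x))" using elim u by (intro incseq_SucI) auto
      from incseq_le[OF this, of "X (snd x) (fst x)" n] have "Yn n (snd x) (fst x) \<le> X (snd x) (fst x)" using elim u by simp
      moreover have "- ?C \<le> Yn n (snd x) (fst x)" by (rule truncatedD(5)[OF tr u])
      ultimately have "\<bar>Yn n (snd x) (fst x)\<bar> \<le> max ?C \<bar>X (snd x) (fst x)\<bar>" by linarith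
      then have "\<bar>Yn n (snd x) (fst x)\<bar> powr p \<le> max ?C \<bar>X (snd x) (fst x)\<bar> powr p" using p by (intro powr_mono2) auto
      also have "\<dots> \<le> ?C powr p + \<bar>X (snd x) (fst x)\<bar> powr p" by (auto simp: max_def)
      finally have "power_driver (Yn n) x \<le> v (snd x) (fst x) * (?C powr p + \<bar>X (snd x) (fst x)\<bar> powr p)"
        by (rule mult_left_mono[OF _ v_nonneg])
      also have "\<dots> \<le> power_driver X x + ?C powr p * a (snd x)"
        using mult_right_mono[OF v_le, of "?C powr p" "snd x" "fst x"] by (simp add: distrib_left mult.commute)
      finally show ?thesis using True v_nonneg[of "snd x" "fst x"] by (simp add: abs_mult)
    next
      case False
      then show ?thesis using a_nonneg[of "snd x"] by simp
    qed
  qed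
  have pm: "(\<lambda>x. ?i x * power_driver Z x) \<in> borel_measurable (M \<Otimes>\<^sub>M lborel)" if "prog Z" for Z
  proof -
    note power_driver_measurable[OF that, measurable]
    have "(\<lambda>x. ?i x * power_driver Z x) \<in> borel_measurable (M \<Otimes>\<^sub>M borel)" by measurable
    then show ?thesis by (simp add: borel_measurable_pair_lborel_iff)
  qed
  obtain B where B: "\<And>n. (\<integral>\<omega>. Yn n t \<omega> \<partial>M) \<le> B" using truncated_expectation_bound[OF t] tr by blast
  show iX: "integrable (M \<Otimes>\<^sub>M lborel) (\<lambda>x. ?i x * power_driver X x)"
  proof (rule integrableI_bounded[OF pm[OF progX]])
    have "(\<integral>\<^sup>+x. ennreal (norm (?i x * power_driver X x)) \<partial>(M \<Otimes>\<^sub>M lborel)) = (\<integral>\<^sup>+x. liminf (\<lambda>n. ennreal (?i x * power_driver (Yn n) x)) \<partial>(M \<Otimes>\<^sub>M lborel))"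
    proof (rule nn_integral_cong_AE)
      show "AE x in M \<Otimes>\<^sub>M lborel. ennreal (norm (?i x * power_driver X x)) = liminf (\<lambda>n. ennreal (?i x * power_driver (Yn n) x))"
        using AEl
      proof eventually_elim
        case (elim x)
        have "liminf (\<lambda>n. ennreal (?i x * power_driver (Yn n) x)) = ennreal (?i x * power_driver X x)"
          by (rule lim_imp_Liminf[OF sequentially_bot]) (rule tendsto_ennrealI[OF elim])
        then show ?case using v_nonneg[of "snd x" "fst x"] by (simp add: abs_mult)
      qed
    qed
    also have "\<dots> \<le> liminf (\<lambda>n. \<integral>\<^sup>+x. ennreal (?i x * power_driver (Yn n) x) \<partial>(M \<Otimes>\<^sub>M lborel))"
      by (rule nn_integral_liminf) (use pm[OF progn] in measurable)
    also have "\<dots> \<le> ennreal (B + ?C)"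
    proof (rule Liminf_le)
      have "(\<integral>\<^sup>+x. ennreal (?i x * power_driver (Yn n) x) \<partial>(M \<Otimes>\<^sub>M lborel)) \<le> ennreal (B + ?C)" for n
      proof -
        note te = truncated_expectation[OF tr[of n] order_refl t]
        have "(\<integral>\<omega>. - ?C \<partial>M) \<le> (\<integral>\<omega>. Yn n 0 \<omega> \<partial>M)"
          using truncated_integrable(2)[OF tr order_refl T_pos] truncatedD(5)[OF tr order_refl T_pos] by (intro integral_mono) auto
        then have "(\<integral>x. ?i x * power_driver (Yn n) x \<partial>(M \<Otimes>\<^sub>M lborel)) \<le> B + ?C"
          using te(2) B[of n] by (simp add: prob_space)
        then show ?thesis using te(1) v_nonneg
          by (subst nn_integral_eq_integral) (auto intro!: ennreal_leI AE_I2 mult_nonneg_nonneg)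
      qed
      then show "\<forall>\<^sub>F n in sequentially. (\<integral>\<^sup>+x. ennreal (?i x * power_driver (Yn n) x) \<partial>(M \<Otimes>\<^sub>M lborel)) \<le> ennreal (B + ?C)" by simp
    qed simp
    finally show "(\<integral>\<^sup>+x. ennreal (norm (?i x * power_driver X x)) \<partial>(M \<Otimes>\<^sub>M lborel)) < \<infinity>"
      by (rule le_less_trans) simp
  qed
  fix A assume A: "A \<in> sets M"
  have ia: "integrable (M \<Otimes>\<^sub>M lborel) (\<lambda>x. a (snd x))"
    by (rule integrable_pair_bounded[OF _ a_integrable]) (use a_measurable a_nonneg in auto)
  have iA: "(\<lambda>x. indicator A (fst x) * (?i x * power_driver Z x)) \<in> borel_measurable (M \<Otimes>\<^sub>M lborel)" if "prog Z" for Z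
    using pm[OF that] A by measurable
  have d: "(\<lambda>n. \<integral>x. indicator A (fst x) * (?i x * power_driver (Yn n) x) \<partial>(M \<Otimes>\<^sub>M lborel)) \<longlonglongrightarrow>
      (\<integral>x. indicator A (fst x) * (?i x * power_driver X x) \<partial>(M \<Otimes>\<^sub>M lborel))"
  proof (rule integral_dominated_convergence[where w="\<lambda>x. ?i x * power_driver X x + ?C powr p * a (snd x)"])
    show "integrable (M \<Otimes>\<^sub>M lborel) (\<lambda>x. ?i x * power_driver X x + ?C powr p * a (snd x))" using iX ia by simp
    show "AE x in M \<Otimes>\<^sub>M lborel. (\<lambda>n. indicator A (fst x) * (?i x * power_driver (Yn n) x)) \<longlonglongrightarrow> indicator A (fst x) * (?i x * power_driver X x)"
      using AEl by eventually_elim (rule tendsto_mult[OF tendsto_const])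
    show "AE x in M \<Otimes>\<^sub>M lborel. norm (indicator A (fst x) * (?i x * power_driver (Yn n) x)) \<le> ?i x * power_driver X x + ?C powr p * a (snd x)" for n
      using AEd[of n] by eventually_elim (auto simp: indicator_def)
  qed (use iA progn progX in auto)
  have fub: "(\<integral>x. indicator A (fst x) * (?i x * power_driver Z x) \<partial>(M \<Otimes>\<^sub>M lborel)) =
      (\<integral>\<omega>. indicator A \<omega> * (LINT u:{0..t}|lborel. v u \<omega> * \<bar>Z u \<omega>\<bar> powr p) \<partial>M)"
    if Z: "prog Z" and iZ: "integrable (M \<Otimes>\<^sub>M lborel) (\<lambda>x. ?i x * power_driver Z x)" for Z
  proof -
    have "integrable (M \<Otimes>\<^sub>M lborel) (\<lambda>x. indicator A (fst x) * (?i x * power_driver Z x))"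
      by (rule Bochner_Integration.integrable_bound[OF iZ iA[OF Z]]) (auto simp: indicator_def)
    from pair.integral_fst'[OF this] show ?thesis by (simp add: set_lebesgue_integral_def)
  qed
  show "(\<lambda>n. \<integral>\<omega>. indicator A \<omega> * (LINT u:{0..t}|lborel. v u \<omega> * \<bar>Yn n u \<omega>\<bar> powr p) \<partial>M) \<longlonglongrightarrow>
      (\<integral>\<omega>. indicator A \<omega> * (LINT u:{0..t}|lborel. v u \<omega> * \<bar>X u \<omega>\<bar> powr p) \<partial>M)"
    using d unfolding fub[OF progX iX] fub[OF progn truncated_expectation(1)[OF tr order_refl t]] .
qed

text \<open>Value and accumulated driver converge separately when tested on events, so the
  martingale property of their difference survives in the limit. The pointwise limit need not be
  right-continuous, so \<open>regularization\<close> supplies the actual solution.\<close>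

theorem limit_solution:
  "\<exists>Y N. adapted_before F T Y \<and> mart N \<and> cadlag_before M T N \<and> (AE \<omega> in M. power_dynamics p Y N \<omega>) \<and>
    (\<forall>t. 0 \<le> t \<and> t < T \<longrightarrow> integrable M (Y t) \<and> (AE \<omega> in M. (\<lambda>n. Yn n t \<omega>) \<longlonglongrightarrow> Y t \<omega>))"
proof -
  let ?C = "barrier 0"
  define X where "X \<equiv> \<lambda>t \<omega>. lim (\<lambda>n. Yn n t \<omega>)"
  let ?I = "\<lambda>Z t \<omega>. LINT u:{0..t}|lborel. v u \<omega> * \<bar>Z u \<omega>\<bar> powr p"
  have progn: "prog (Yn n)" for n by (rule truncated_prog[OF tr])
  have progX: "prog X" unfolding X_def by (rule prog_lim[OF progn])
  have limX: "AE \<omega> in M. (\<lambda>n. Yn n u \<omega>) \<longlonglongrightarrow> X u \<omega>" if "0 \<le> u" "u < T" for u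
    using limit_at_time(1)[OF that] by eventually_elim (simp add: X_def convergent_LIMSEQ_iff)
  have Xi: "integrable M (X t)" if "0 \<le> t" "t < T" for t using limit_at_time(2)[OF that] by (simp add: X_def)
  have di: "integrable (M \<Otimes>\<^sub>M lborel) (\<lambda>x. indicator {0..t} (snd x) * power_driver X x)"
    "\<And>B. B \<in> sets M \<Longrightarrow> (\<lambda>n. \<integral>\<omega>. indicator B \<omega> * ?I (Yn n) t \<omega> \<partial>M) \<longlonglongrightarrow> (\<integral>\<omega>. indicator B \<omega> * ?I X t \<omega> \<partial>M)"
    if "0 \<le> t" "t < T" for t
    unfolding X_def by (rule limit_driver_integrable[OF that]; assumption?)+
  have Ii: "integrable M (?I X t)" if "0 \<le> t" "t < T" for t
    using pair.integrable_fst'[OF di(1)[OF that]] by (simp add: set_lebesgue_integral_def)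
  have Iin: "integrable M (?I (Yn n) t)" if "0 \<le> t" "t < T" for n t
    using pair.integrable_fst'[OF truncated_expectation(1)[OF tr order_refl that]] by (simp add: set_lebesgue_integral_def)
  have ad: "adapted_before F T (\<lambda>t \<omega>. X t \<omega> - ?I X t \<omega>)"
    unfolding adapted_before_def
  proof
    fix t assume t: "t \<in> {0..<T}"
    have "X t \<in> borel_measurable (F t)" unfolding X_def
      using t by (intro borel_measurable_lim_metric adaptedD[OF truncatedD(1)[OF tr]]) auto
    moreover have "?I X t \<in> borel_measurable (F t)" using driver_integral_measurable[OF progX power_measurable] t by auto
    ultimately show "(\<lambda>\<omega>. X t \<omega> - ?I X t \<omega>) \<in> borel_measurable (F t)" by (rule borel_measurable_diff)
  qed
  have Xb: "AE \<omega> in M. \<forall>n. norm (Yn n t \<omega>) \<le> \<bar>X t \<omega>\<bar> + ?C" if t: "0 \<le> t" "t < T" for t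
    using Yn_incseq limX[OF t]
  proof eventually_elim
    case (elim \<omega>)
    show ?case
    proof
      fix n
      have "Yn n t \<omega> \<le> X t \<omega>" using incseq_le[OF _ elim(2)] elim(1) t by auto
      moreover have "- ?C \<le> Yn n t \<omega>" by (rule truncatedD(5)[OF tr t])
      ultimately show "norm (Yn n t \<omega>) \<le> \<bar>X t \<omega>\<bar> + ?C" using barrier_pos[of 0] unfolding real_norm_def by linarith
    qed
  qed
  have mart: "mart (\<lambda>t \<omega>. X t \<omega> - ?I X t \<omega>)"
  proof (rule martI[OF ad])
    show "integrable M (\<lambda>\<omega>. X t \<omega> - ?I X t \<omega>)" if "0 \<le> t" "t < T" for t using Xi[OF that] Ii[OF that] by simp
    fix s t B assume *: "0 \<le> s" "s \<le> t" "t < T" and B: "B \<in> sets (F s)"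
    have BM: "B \<in> sets M" using B sets_F_M * by auto
    have lim: "(\<lambda>n. (\<integral>\<omega>. indicator B \<omega> * (Yn n u \<omega> - ?I (Yn n) u \<omega>) \<partial>M)) \<longlonglongrightarrow> (\<integral>\<omega>. indicator B \<omega> * (X u \<omega> - ?I X u \<omega>) \<partial>M)"
      if u: "0 \<le> u" "u < T" for u
    proof -
      have "(\<lambda>n. \<integral>\<omega>. indicator B \<omega> * Yn n u \<omega> \<partial>M) \<longlonglongrightarrow> (\<integral>\<omega>. indicator B \<omega> * X u \<omega> \<partial>M)"
      proof (rule integral_dominated_convergence[where w="\<lambda>\<omega>. \<bar>X u \<omega>\<bar> + ?C"])
        show "AE \<omega> in M. (\<lambda>n. indicator B \<omega> * Yn n u \<omega>) \<longlonglongrightarrow> indicator B \<omega> * X u \<omega>"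
          using limX[OF u] by eventually_elim (intro tendsto_intros)
        show "AE \<omega> in M. norm (indicator B \<omega> * Yn n u \<omega>) \<le> \<bar>X u \<omega>\<bar> + ?C" for n
          using Xb[OF u] by eventually_elim (use barrier_pos[of 0] in \<open>auto simp: indicator_def\<close>)
      qed (use Xi[OF u] truncated_integrable(1)[OF tr u] BM in auto)
      from tendsto_diff[OF this di(2)[OF u BM]] show ?thesis
        using Xi[OF u] Ii[OF u] Iin[OF u] truncated_integrable(2)[OF tr u] BM
        by (simp add: right_diff_distrib integrable_indicator_mult)
    qed
    have "(\<integral>\<omega>. indicator B \<omega> * (Yn n s \<omega> - ?I (Yn n) s \<omega>) \<partial>M) = (\<integral>\<omega>. indicator B \<omega> * (Yn n t \<omega> - ?I (Yn n) t \<omega>) \<partial>M)" for n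
    proof -
      \<comment> \<open>On almost every path \<open>Yn n - ?I (Yn n)\<close> is \<open>Nn n\<close>
        plus the time-independent variable \<open>Yn n 0 - Nn n 0\<close>, so it inherits the
        identity tested on \<open>B\<close>.\<close>
      have e: "(\<integral>\<omega>. indicator B \<omega> * (Yn n u \<omega> - ?I (Yn n) u \<omega>) \<partial>M) =
          (\<integral>\<omega>. indicator B \<omega> * (Yn n 0 \<omega> - Nn n 0 \<omega>) \<partial>M) + (\<integral>\<omega>. indicator B \<omega> * Nn n u \<omega> \<partial>M)" if u: "0 \<le> u" "u < T" for u
      proof -
        have N: "integrable M (Nn n u)" "integrable M (Nn n 0)" using truncatedD(2)[OF tr] u T_pos by (auto simp: martingale_before_def)
        note Y0 = truncated_integrable(2)[OF tr order_refl T_pos, of n]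
        have "(\<integral>\<omega>. indicator B \<omega> * (Yn n u \<omega> - ?I (Yn n) u \<omega>) \<partial>M) = (\<integral>\<omega>. indicator B \<omega> * ((Yn n 0 \<omega> - Nn n 0 \<omega>) + Nn n u \<omega>) \<partial>M)"
        proof (rule integral_indicator_cong_AE[OF _ _ _ BM])
          show "AE \<omega> in M. Yn n u \<omega> - ?I (Yn n) u \<omega> = (Yn n 0 \<omega> - Nn n 0 \<omega>) + Nn n u \<omega>"
            using truncatedD(7)[OF tr[of n]] by eventually_elim (use power_dynamicsD(2)[OF _ order_refl u] in fastforce)
        qed (use N Y0 Iin[OF u] truncated_integrable[OF tr u] in auto)
        also have "\<dots> = (\<integral>\<omega>. indicator B \<omega> * (Yn n 0 \<omega> - Nn n 0 \<omega>) \<partial>M) + (\<integral>\<omega>. indicator B \<omega> * Nn n u \<omega> \<partial>M)"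
          unfolding distrib_left using N Y0 BM by (intro Bochner_Integration.integral_add integrable_indicator_mult) auto
        finally show ?thesis .
      qed
      show ?thesis using e[of s] e[of t] mart_indicator_integral[OF truncatedD(2)[OF tr] * B, of n] * by simp
    qed
    then have "(\<lambda>n. (\<integral>\<omega>. indicator B \<omega> * (Yn n s \<omega> - ?I (Yn n) s \<omega>) \<partial>M)) \<longlonglongrightarrow> (\<integral>\<omega>. indicator B \<omega> * (X t \<omega> - ?I X t \<omega>) \<partial>M)"
      using lim[of t] * by simp
    then show "(\<integral>\<omega>. indicator B \<omega> * (X s \<omega> - ?I X s \<omega>) \<partial>M) = (\<integral>\<omega>. indicator B \<omega> * (X t \<omega> - ?I X t \<omega>) \<partial>M)"
      using lim[of s] * by (intro LIMSEQ_unique) auto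
  qed
  obtain Y N where Y: "adapted_before F T Y" and N: "mart N" "cadlag_before M T N"
    and YX: "\<And>t. 0 \<le> t \<Longrightarrow> t < T \<Longrightarrow> AE \<omega> in M. Y t \<omega> = X t \<omega>"
    and eq: "AE \<omega> in M. \<forall>t\<in>{0..<T}. set_integrable lborel {0..t} (\<lambda>u. v u \<omega> * \<bar>Y u \<omega>\<bar> powr p) \<and> Y t \<omega> = N t \<omega> + ?I Y t \<omega>"
    using regularization[OF progX power_measurable di(1) mart] by blast
  have "AE \<omega> in M. power_dynamics p Y N \<omega>"
    using eq by eventually_elim (rule power_dynamicsI, auto)
  moreover have "integrable M (Y t) \<and> (AE \<omega> in M. (\<lambda>n. Yn n t \<omega>) \<longlonglongrightarrow> Y t \<omega>)" if t: "0 \<le> t" "t < T" for t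
  proof
    show "integrable M (Y t)"
      using integrable_cong_AE[OF measurable_F_M[OF adaptedD[OF Y t] t(1)] _ YX[OF t]] Xi[OF t] by auto
    show "AE \<omega> in M. (\<lambda>n. Yn n t \<omega>) \<longlonglongrightarrow> Y t \<omega>" using YX[OF t] limX[OF t] by eventually_elim simp
  qed
  ultimately show ?thesis using Y N by blast
qed

end

end

section \<open>The left limit at the terminal time\<close>

context filtered_prob_space
begin

lemma mart_bounded_integral:
  assumes N: "mart N" and st: "0 \<le> s" "s \<le> t" "t < T"
    and H: "H \<in> borel_measurable (F s)" "AE \<omega> in M. \<bar>H \<omega>\<bar> \<le> b"
  shows "integrable M (\<lambda>\<omega>. H \<omega> * N t \<omega>)" "(\<integral>\<omega>. H \<omega> * N t \<omega> \<partial>M) = (\<integral>\<omega>. H \<omega> * N s \<omega> \<partial>M)"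
proof -
  interpret S: sigma_finite_subalgebra M "F s" by (rule cond_subalgebra[OF st(1)])
  have Hm: "H \<in> borel_measurable M" by (rule measurable_F_M[OF H(1) st(1)])
  have Nt: "integrable M (N t)" "N s \<in> borel_measurable M" and ce: "AE \<omega> in M. real_cond_exp M (F s) (N t) \<omega> = N s \<omega>"
    using N st by (auto simp: martingale_before_def intro!: measurable_F_M[OF adaptedD])
  show i: "integrable M (\<lambda>\<omega>. H \<omega> * N t \<omega>)"
  proof (rule Bochner_Integration.integrable_bound[where f="\<lambda>\<omega>. b * N t \<omega>"])
    show "AE \<omega> in M. norm (H \<omega> * N t \<omega>) \<le> norm (b * N t \<omega>)"
      using H(2)
    proof eventually_elim
      case (elim \<omega>)
      then have "\<bar>H \<omega>\<bar> \<le> \<bar>b\<bar>" by linarith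
      then show ?case by (simp add: abs_mult mult_right_mono)
    qed
  qed (use Nt Hm in auto)
  have "(\<integral>\<omega>. H \<omega> * N t \<omega> \<partial>M) = (\<integral>\<omega>. H \<omega> * real_cond_exp M (F s) (N t) \<omega> \<partial>M)"
    using S.real_cond_exp_intg(2)[OF i H(1)] Nt by simp
  also have "\<dots> = (\<integral>\<omega>. H \<omega> * N s \<omega> \<partial>M)"
  proof (rule integral_cong_AE)
    show "AE \<omega> in M. H \<omega> * real_cond_exp M (F s) (N t) \<omega> = H \<omega> * N s \<omega>" using ce by eventually_elim simp
  qed (use Hm Nt in auto)
  finally show "(\<integral>\<omega>. H \<omega> * N t \<omega> \<partial>M) = (\<integral>\<omega>. H \<omega> * N s \<omega> \<partial>M)" .
qed

end

text \<open>The sums are integrals of \<open>h\<close> against the step function that freezes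
  \<open>x\<close> at the left end of each grid cell. That step function is bounded and converges
  wherever \<open>x\<close> is left-continuous, so dominated convergence applies.\<close>

lemma riemann_stieltjes_left_tendsto:
  fixes x h :: "real \<Rightarrow> real"
  assumes st: "s < t" and h: "set_integrable lborel {s..t} h" "h \<in> borel_measurable borel"
    and x: "AE u in lborel. u \<in> {s<..<t} \<longrightarrow> (x \<longlongrightarrow> x u) (at_left u)" "\<And>u. u \<in> {s..t} \<Longrightarrow> \<bar>x u\<bar> \<le> b"
    and xm: "(\<lambda>u. indicator {s<..<t} u * x u) \<in> borel_measurable borel"
  defines "g \<equiv> \<lambda>k i. s + (t - s) * real i / 2 ^ k"
  shows "(\<lambda>k. \<Sum>i<2 ^ k. x (g k i) * (LINT u:{g k i..g k (Suc i)}|lborel. h u)) \<longlonglongrightarrow> (LINT u:{s<..<t}|lborel. x u * h u)"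
proof -
  \<comment> \<open>The index of the grid cell containing \<open>u\<close>.\<close>
  define j where "j \<equiv> \<lambda>(k::nat) u. nat \<lfloor>(u - s) / (t - s) * 2 ^ k\<rfloor>"
  let ?w = "\<lambda>k u. x (g k (j k u))"
  have jm: "j k \<in> borel \<rightarrow>\<^sub>M count_space UNIV" for k unfolding j_def by measurable
  have wm: "?w k \<in> borel_measurable borel" for k
    by (rule measurable_compose[OF jm]) simp
  have gs: "g k 0 = s" "g k (2 ^ k) = t" for k by (auto simp: g_def)
  have gmono: "g k i \<le> g k l" if "i \<le> l" for k i l
    using st that by (simp add: g_def divide_right_mono mult_left_mono)
  have jg: "j k u = i" if u: "u \<in> {g k i..<g k (Suc i)}" for k u i
  proof -
    have "real i \<le> (u - s) / (t - s) * 2 ^ k" "(u - s) / (t - s) * 2 ^ k < real i + 1"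
      using u st by (auto simp: g_def field_simps)
    then have "\<lfloor>(u - s) / (t - s) * 2 ^ k\<rfloor> = int i" by (simp add: floor_unique)
    then show ?thesis by (simp add: j_def)
  qed
  have near: "g k (j k u) \<le> u" "u - (t - s) / 2 ^ k < g k (j k u)" if u: "s \<le> u" for k u
  proof -
    have "0 \<le> (u - s) / (t - s) * 2 ^ k" using u st by simp
    then have "real (j k u) = of_int \<lfloor>(u - s) / (t - s) * 2 ^ k\<rfloor>" by (simp add: j_def)
    then have 1: "real (j k u) \<le> (u - s) / (t - s) * 2 ^ k" "(u - s) / (t - s) * 2 ^ k < real (j k u) + 1" by linarith+
    then have "(t - s) * (real (j k u) / 2 ^ k) \<le> u - s" "u - s < (t - s) * ((real (j k u) + 1) / 2 ^ k)"
      using st by (simp_all add: field_simps)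
    then show "g k (j k u) \<le> u" "u - (t - s) / 2 ^ k < g k (j k u)" by (simp_all add: g_def distrib_left add_divide_distrib)
  qed
  have wb: "\<bar>?w k u\<bar> \<le> b" if "u \<in> {s..t}" for k u
  proof (rule x(2))
    show "g k (j k u) \<in> {s..t}" using near(1)[of u k] gmono[of 0 "j k u" k] gs(1)[of k] that by auto
  qed
  have wh: "set_integrable lborel {s..t} (\<lambda>u. ?w k u * h u)" for k
    by (rule set_integrable_mult_bounded[OF h(1) wm _ wb]) auto
  have sum: "(\<Sum>i<m. x (g k i) * (LINT u:{g k i..g k (Suc i)}|lborel. h u)) = (LINT u:{s..g k m}|lborel. ?w k u * h u)"
    if "m \<le> 2 ^ k" for k m
    using that
  proof (induction m)
    case 0
    show ?case using set_borel_integral_eq_integral(2)[OF set_integrable_subset[OF wh, of "{s..s}"]] st by (simp add: gs)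
  next
    case (Suc m)
    have b: "s \<le> g k m" "g k m \<le> g k (Suc m)" "g k (Suc m) \<le> t"
      using gmono[of 0 m k] gmono[of m "Suc m" k] gmono[OF Suc.prems, of k] gs[of k] by auto
    have i1: "set_integrable lborel {g k m..g k (Suc m)} h" by (rule set_integrable_subset[OF h(1)]) (use b in auto)
    have i2: "set_integrable lborel {g k m..g k (Suc m)} (\<lambda>u. ?w k u * h u)" by (rule set_integrable_subset[OF wh]) (use b in auto)
    have i3: "set_integrable lborel {g k m..g k (Suc m)} (\<lambda>u. x (g k m) * h u)" using i1 by simp
    have "(LINT u:{g k m..g k (Suc m)}|lborel. ?w k u * h u) = (LINT u:{g k m..g k (Suc m)}|lborel. x (g k m) * h u)"
      by (rule antisym; rule set_integral_mono_except_point) (auto simp: jg i2 i3)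
    moreover have "(LINT u:{s..g k (Suc m)}|lborel. ?w k u * h u) = (LINT u:{s..g k m}|lborel. ?w k u * h u) + (LINT u:{g k m..g k (Suc m)}|lborel. ?w k u * h u)"
      by (rule set_integral_combine[OF set_integrable_subset[OF wh]]) (use b in auto)
    ultimately show ?case using Suc by simp
  qed
  have eq: "(LINT u:{s..t}|lborel. ?w k u * h u) = (LINT u:{s<..<t}|lborel. ?w k u * h u)" for k
    unfolding set_lebesgue_integral_def
  proof (rule integral_cong_AE)
    show "AE u in lborel. indicator {s..t} u *\<^sub>R (?w k u * h u) = indicator {s<..<t} u *\<^sub>R (?w k u * h u)"
      using AE_lborel_singleton[of s] AE_lborel_singleton[of t] by eventually_elim (auto simp: indicator_def)
  qed (use wm[of k] h(2) in measurable)
  have "(\<lambda>k. LINT u:{s<..<t}|lborel. ?w k u * h u) \<longlonglongrightarrow> (LINT u:{s<..<t}|lborel. x u * h u)"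
    unfolding set_lebesgue_integral_def
  proof (rule integral_dominated_convergence[where w="\<lambda>u. b * (indicator {s..t} u * \<bar>h u\<bar>)"])
    have "(\<lambda>u. indicator {s<..<t} u * x u * h u) \<in> borel_measurable borel" using xm h(2) by measurable
    then show "(\<lambda>u. indicator {s<..<t} u *\<^sub>R (x u * h u)) \<in> borel_measurable lborel" by (simp add: mult.assoc)
    show "(\<lambda>u. indicator {s<..<t} u *\<^sub>R (?w k u * h u)) \<in> borel_measurable lborel" for k
      using wm[of k] h(2) by measurable
    show "integrable lborel (\<lambda>u. b * (indicator {s..t} u * \<bar>h u\<bar>))"
      using set_integrable_abs[OF h(1)] by (simp add: set_integrable_def)
    show "AE u in lborel. (\<lambda>k. indicator {s<..<t} u *\<^sub>R (?w k u * h u)) \<longlonglongrightarrow> indicator {s<..<t} u *\<^sub>R (x u * h u)"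
      using x(1)
    proof eventually_elim
      case (elim u)
      show ?case
      proof (cases "u \<in> {s<..<t}")
        case True
        have inv: "(\<lambda>k. (t - s) / 2 ^ k) \<longlonglongrightarrow> 0"
          using tendsto_mult[OF tendsto_const[of "t - s"] LIMSEQ_inverse_realpow_zero[of 2]] by (simp add: divide_inverse)
        have "(\<lambda>k. g k (j k u)) \<longlonglongrightarrow> u"
        proof (rule tendsto_sandwich)
          show "(\<lambda>k. u - (t - s) / 2 ^ k) \<longlonglongrightarrow> u" using tendsto_diff[OF tendsto_const[of u] inv] by simp
          show "(\<lambda>k. u) \<longlonglongrightarrow> u" by (rule tendsto_const)
        qed (use near[of u] True in \<open>auto intro!: always_eventually less_imp_le\<close>)
        then have m: "(\<lambda>k. - g k (j k u)) \<longlonglongrightarrow> - u" by (rule tendsto_minus)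
        \<comment> \<open>Time is reversed in order to reuse the sequential criterion for right
          continuity; the grid points may coincide with \<open>u\<close>.\<close>
        have "((\<lambda>y. x (- y)) \<longlongrightarrow> x u) (at_right (- u))"
          using elim True by (simp add: filterlim_at_left_to_right[of x _ u])
        then have "(\<lambda>k. ?w k u) \<longlonglongrightarrow> x u"
          using right_continuous_sequentially[of "\<lambda>y. x (- y)" "- u", OF _ m] near(1)[of u] True by simp
        then show ?thesis by (intro tendsto_scaleR tendsto_const tendsto_mult)
      qed simp
    qed
    show "AE u in lborel. norm (indicator {s<..<t} u *\<^sub>R (?w k u * h u)) \<le> b * (indicator {s..t} u * \<bar>h u\<bar>)" for k
    proof (rule AE_I2)
      fix u
      have "\<bar>?w k u\<bar> * \<bar>h u\<bar> \<le> b * \<bar>h u\<bar>" if "u \<in> {s..t}" using wb[OF that, of k] by (intro mult_right_mono) auto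
      then show "norm (indicator {s<..<t} u *\<^sub>R (?w k u * h u)) \<le> b * (indicator {s..t} u * \<bar>h u\<bar>)"
        using wb[of s k] st by (auto simp: indicator_def abs_mult)
    qed
  qed
  then show ?thesis using sum[OF order_refl] eq by (simp add: gs)
qed

context filtered_prob_space
begin

lemma AE_path_measurable:
  assumes ad: "adapted_before F T X" and rc: "AE \<omega> in M. \<forall>t\<in>{0..<T}. ((\<lambda>s. X s \<omega>) \<longlongrightarrow> X t \<omega>) (at_right t)"
  shows "AE \<omega> in M. (\<lambda>u. indicator {0..<T} u * X u \<omega>) \<in> borel_measurable borel"
proof -
  from AE_good_set[OF rc] obtain A where A: "\<And>t. 0 \<le> t \<Longrightarrow> A \<in> sets (F t)" "AE \<omega> in M. \<omega> \<in> A"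
    "\<And>\<omega>. \<omega> \<in> A \<Longrightarrow> \<forall>t\<in>{0..<T}. ((\<lambda>s. X s \<omega>) \<longlongrightarrow> X t \<omega>) (at_right t)" "A \<subseteq> space M" by blast
  have "prog (\<lambda>t \<omega>. indicator A \<omega> * X t \<omega>)"
  proof (rule prog_right_continuous)
    show "adapted_before F T (\<lambda>t \<omega>. indicator A \<omega> * X t \<omega>)"
      unfolding adapted_before_def using A(1) ad by (auto simp: adapted_before_def intro!: borel_measurable_times)
    show "((\<lambda>s. indicator A \<omega> * X s \<omega>) \<longlongrightarrow> indicator A \<omega> * X t \<omega>) (at_right t)" if "t \<in> {0..<T}" for \<omega> t
    proof (cases "\<omega> \<in> A")
      case True
      then show ?thesis using A(3)[OF True] that by simp
    qed simp
  qed
  note m = prog_path_measurable[OF this]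
  show ?thesis using A(2)
  proof eventually_elim
    case (elim \<omega>)
    then have "\<omega> \<in> space M" using A(4) by auto
    from m[OF this] elim show ?case by simp
  qed
qed

end

context bsde_coefficient
begin

text \<open>The convexity bound \<open>exp (- y') \<ge> exp (- y) - exp (- y) (y' - y)\<close> summed along a fine grid
  replaces Ito's formula for \<open>exp (- Y)\<close>.\<close>

lemma exp_submart:
  assumes Y: "adapted_before F T Y" "AE \<omega> in M. power_dynamics p Y N \<omega>" "AE \<omega> in M. \<forall>t\<in>{0..<T}. - C \<le> Y t \<omega>"
    and N: "mart N" "cadlag_before M T N" and Yi: "\<And>t. 0 \<le> t \<Longrightarrow> t < T \<Longrightarrow> integrable M (Y t)"
    and c: "\<And>y. - C \<le> y \<Longrightarrow> exp (- y) * \<bar>y\<bar> powr p \<le> c"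
  shows "submart (\<lambda>t \<omega>. exp (- Y t \<omega>) + c * (LINT u:{0..t}|lborel. a u))"
  unfolding submart_def
proof (intro conjI allI ballI impI)
  let ?e = "\<lambda>t \<omega>. exp (- Y t \<omega>)"
  have em: "?e t \<in> borel_measurable (F t)" if "0 \<le> t" "t < T" for t
    using adaptedD[OF Y(1) that] by measurable
  have eb: "AE \<omega> in M. \<bar>?e t \<omega>\<bar> \<le> exp C" if "0 \<le> t" "t < T" for t
    using Y(3) by eventually_elim (use that in \<open>auto dest!: bspec[of _ _ t]\<close>)
  have ei: "integrable M (?e t)" if "0 \<le> t" "t < T" for t
    by (rule integrable_const_bound[where B="exp C"]) (use eb[OF that] measurable_F_M[OF em[OF that] that(1)] in auto)
  show "adapted_before F T (\<lambda>t \<omega>. ?e t \<omega> + c * (LINT u:{0..t}|lborel. a u))"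
    unfolding adapted_before_def using em by (auto intro!: borel_measurable_add)
  show "integrable M (\<lambda>\<omega>. ?e t \<omega> + c * (LINT u:{0..t}|lborel. a u))" if "t \<in> {0..<T}" for t
    using ei[of t] that by simp
  fix s t B assume *: "0 \<le> s \<and> s \<le> t \<and> t < T \<and> B \<in> sets (F s)"
  let ?A = "LINT u:{s..t}|lborel. a u"
  have BM: "B \<in> sets M" using sets_F_M * by auto
  have "(\<integral>\<omega>. indicator B \<omega> * (?e s \<omega> - ?e t \<omega>) \<partial>M) \<le> c * ?A * measure M B"
  proof (cases "s = t")
    case True
    have "0 \<le> exp C * \<bar>- C\<bar> powr p" by simp
    also have "\<dots> \<le> c" using c[of "- C"] by simp
    finally have "0 \<le> c" .
    moreover have "0 \<le> ?A" by (rule set_integral_nonneg_real) (rule a_nonneg)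
    ultimately have "0 \<le> c * ?A * measure M B" by simp
    then show ?thesis using True by simp
  next
    case False
    then have st: "s < t" "0 \<le> s" "t < T" using * by auto
    define g where "g \<equiv> \<lambda>k i. s + (t - s) * real i / 2 ^ k"
    have g0: "g k 0 = s" "g k (2 ^ k) = t" for k by (auto simp: g_def)
    have gmono: "g k i \<le> g k l" if "i \<le> l" for k i l
      using st that by (simp add: g_def divide_right_mono mult_left_mono)
    have gI: "s \<le> g k i" "i \<le> 2 ^ k \<Longrightarrow> g k i \<le> t" for k i using gmono[of 0 i k] gmono[of i "2 ^ k" k] g0[of k] by auto
    have gT: "0 \<le> g k i" "i \<le> 2 ^ k \<Longrightarrow> g k i < T" for k i using gI[of k i] gI(2)[of i k] st by auto
    let ?h = "\<lambda>u \<omega>. v u \<omega> * \<bar>Y u \<omega>\<bar> powr p"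
    let ?dN = "\<lambda>k i \<omega>. N (g k (Suc i)) \<omega> - N (g k i) \<omega>"
    let ?dY = "\<lambda>k i \<omega>. Y (g k (Suc i)) \<omega> - Y (g k i) \<omega>"
    \<comment> \<open>Left-point sums of \<open>exp (- Y)\<close> against the drift increments,
      written as increments of \<open>Y - N\<close> so that they are meaningful and measurable off
      the null set as well.\<close>
    define Z where "Z \<equiv> \<lambda>k \<omega>. \<Sum>i<2 ^ k. ?e (g k i) \<omega> * (?dY k i \<omega> - ?dN k i \<omega>)"
    define D where "D \<equiv> \<lambda>\<omega>. Y t \<omega> - Y s \<omega> - (N t \<omega> - N s \<omega>)"
    have Ni: "integrable M (N r)" if "0 \<le> r" "r < T" for r using N(1) that by (auto simp: martingale_before_def)
    have Di: "integrable M D" unfolding D_def using Yi[of s] Yi[of t] Ni[of s] Ni[of t] st by simp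
    have Zm: "Z k \<in> borel_measurable M" for k
      unfolding Z_def using gT Yi Ni ei
      by (intro borel_measurable_sum borel_measurable_times borel_measurable_diff) (auto intro!: borel_measurable_integrable)
    have path: "AE \<omega> in M. (\<forall>k. 0 \<le> Z k \<omega> \<and> Z k \<omega> \<le> exp C * D \<omega>) \<and> (\<lambda>k. max 0 (Z k \<omega> - c * ?A)) \<longlonglongrightarrow> 0"
    proof -
      have rc: "AE \<omega> in M. \<forall>t\<in>{0..<T}. ((\<lambda>s. Y s \<omega>) \<longlongrightarrow> Y t \<omega>) (at_right t)"
        using Y(2) AE_space by eventually_elim (use power_dynamics_right_continuous[OF _ N(2)] in blast)
      show ?thesis using Y(2,3) AE_space AE_path_measurable[OF Y(1) rc]
      proof eventually_elim
        case (elim \<omega>)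
        note dyn = power_dynamicsD[OF elim(1)] and low = elim(2) and m = elim(4)[measurable]
        have hi: "set_integrable lborel {s..t} (\<lambda>u. ?h u \<omega>)" using dyn(1) st by auto
        have eC: "?e u \<omega> \<le> exp C" if "u \<in> {0..<T}" for u using bspec[OF low that] by simp
        have vm: "(\<lambda>u. v u \<omega>) \<in> borel_measurable borel"
          using driver_path_measurable[OF v_prog, of "\<lambda>_. 1" \<omega>] elim(3) by simp
        have hm: "(\<lambda>u. ?h u \<omega>) \<in> borel_measurable borel"
        proof -
          have "(\<lambda>u. v u \<omega> * \<bar>indicator {0..<T} u * Y u \<omega>\<bar> powr p) \<in> borel_measurable borel" using vm by measurable
          moreover have "v u \<omega> * \<bar>indicator {0..<T} u * Y u \<omega>\<bar> powr p = ?h u \<omega>" for u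
            by (cases "u \<in> {0..<T}") (auto simp: v_zero)
          ultimately show ?thesis by simp
        qed
        have inc: "?dY k i \<omega> - ?dN k i \<omega> = (LINT u:{g k i..g k (Suc i)}|lborel. ?h u \<omega>)" if "i < 2 ^ k" for k i
          using dyn(2)[of "g k i" "g k (Suc i)"] gT(1)[of k i] gT(2)[of "Suc i" k] gmono[of i "Suc i" k] that by auto
        have inc0: "0 \<le> (LINT u:{q..r}|lborel. ?h u \<omega>)" for q r
          by (rule set_integral_nonneg_real) (simp add: v_nonneg)
        have Zeq: "Z k \<omega> = (\<Sum>i<2 ^ k. ?e (g k i) \<omega> * (LINT u:{g k i..g k (Suc i)}|lborel. ?h u \<omega>))" for k
          unfolding Z_def by (rule sum.cong) (auto simp: inc)
        have Z0: "0 \<le> Z k \<omega>" for k unfolding Zeq by (intro sum_nonneg mult_nonneg_nonneg inc0) simp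
        have ZD: "Z k \<omega> \<le> exp C * D \<omega>" for k
        proof -
          have "Z k \<omega> \<le> (\<Sum>i<2 ^ k. exp C * (?dY k i \<omega> - ?dN k i \<omega>))"
            unfolding Z_def
          proof (rule sum_mono)
            fix i :: nat assume i: "i \<in> {..<2 ^ k}"
            show "?e (g k i) \<omega> * (?dY k i \<omega> - ?dN k i \<omega>) \<le> exp C * (?dY k i \<omega> - ?dN k i \<omega>)"
              using inc[of i k] inc0 i gT(1)[of k i] gT(2)[of i k] by (intro mult_right_mono eC) auto
          qed
          also have "\<dots> = exp C * D \<omega>"
          proof -
            have "(\<Sum>i<2 ^ k. ?dY k i \<omega> - ?dN k i \<omega>) = (\<Sum>i<2 ^ k. (Y (g k (Suc i)) \<omega> - N (g k (Suc i)) \<omega>) - (Y (g k i) \<omega> - N (g k i) \<omega>))"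
              by (rule sum.cong) auto
            also have "\<dots> = D \<omega>"
              using sum_lessThan_telescope[of "\<lambda>i. Y (g k i) \<omega> - N (g k i) \<omega>" "2 ^ k"] by (simp add: D_def g0)
            finally show ?thesis by (simp flip: sum_distrib_left)
          qed
          finally show ?thesis .
        qed
        \<comment> \<open>The drift integral is continuous, so \<open>Y\<close> is left-continuous
          wherever \<open>N\<close> is, which is at almost every time.\<close>
        have lc: "AE u in lborel. u \<in> {s<..<t} \<longrightarrow> ((\<lambda>r. ?e r \<omega>) \<longlongrightarrow> ?e u \<omega>) (at_left u)"
        proof -
          have "AE u in lborel. u \<in> {0<..<T} \<longrightarrow> ((\<lambda>r. N r \<omega>) \<longlongrightarrow> N u \<omega>) (at_left u)"
            by (rule AE_left_continuous) (use N(2) elim(3) in \<open>auto simp: cadlag_before_def\<close>)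
          then show ?thesis
          proof eventually_elim
            case (elim u)
            show ?case
            proof
              assume u: "u \<in> {s<..<t}"
              have "continuous_on {s..u} (\<lambda>r. LINT x:{s..r}|lborel. ?h x \<omega>)"
                by (rule continuous_on_indefinite_set_integral[OF set_integrable_subset[OF hi]]) (use u in auto)
              then have "((\<lambda>r. LINT x:{s..r}|lborel. ?h x \<omega>) \<longlongrightarrow> (LINT x:{s..u}|lborel. ?h x \<omega>)) (at_left u)"
                using u by (auto simp: continuous_on_def at_within_Icc_at_left dest!: bspec[of _ _ u])
              moreover have "((\<lambda>r. N r \<omega>) \<longlongrightarrow> N u \<omega>) (at_left u)" using elim u st by auto
              ultimately have "((\<lambda>r. exp (- (Y s \<omega> + (LINT x:{s..r}|lborel. ?h x \<omega>) + (N r \<omega> - N s \<omega>)))) \<longlongrightarrow>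
                  exp (- (Y s \<omega> + (LINT x:{s..u}|lborel. ?h x \<omega>) + (N u \<omega> - N s \<omega>)))) (at_left u)"
                by (intro tendsto_intros)
              also have "Y s \<omega> + (LINT x:{s..u}|lborel. ?h x \<omega>) + (N u \<omega> - N s \<omega>) = Y u \<omega>" using dyn(2)[of s u] u st by auto
              finally show "((\<lambda>r. ?e r \<omega>) \<longlongrightarrow> ?e u \<omega>) (at_left u)"
              proof (rule Lim_transform_eventually)
                show "\<forall>\<^sub>F r in at_left u. exp (- (Y s \<omega> + (LINT x:{s..r}|lborel. ?h x \<omega>) + (N r \<omega> - N s \<omega>))) = ?e r \<omega>"
                  using eventually_at_left_real[of s u] u
                proof (auto elim!: eventually_mono, goal_cases)
                  case (1 r)
                  then show ?case using dyn(2)[of s r] u st by auto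
                qed
              qed
            qed
          qed
        qed
        have xm: "(\<lambda>u. indicator {s<..<t} u * ?e u \<omega>) \<in> borel_measurable borel"
        proof -
          have "(\<lambda>u. indicator {s<..<t} u * exp (- (indicator {0..<T} u * Y u \<omega>))) \<in> borel_measurable borel" by measurable
          moreover have "indicator {s<..<t} u * exp (- (indicator {0..<T} u * Y u \<omega>)) = indicator {s<..<t} u * ?e u \<omega>" for u
            using st by (auto simp: indicator_def)
          ultimately show ?thesis by simp
        qed
        have lim: "(\<lambda>k. Z k \<omega>) \<longlonglongrightarrow> (LINT u:{s<..<t}|lborel. ?e u \<omega> * ?h u \<omega>)"
          unfolding Zeq g_def
          by (rule riemann_stieltjes_left_tendsto[OF st(1) hi hm lc _ xm, of "exp C"]) (use eC st in auto)
        have le: "(LINT u:{s<..<t}|lborel. ?e u \<omega> * ?h u \<omega>) \<le> c * ?A"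
        proof -
          have pt: "?e u \<omega> * ?h u \<omega> \<le> c * a u" if "u \<in> {s<..<t}" for u
          proof -
            have "(?e u \<omega> * \<bar>Y u \<omega>\<bar> powr p) * v u \<omega> \<le> c * v u \<omega>"
              using c[of "Y u \<omega>"] low that st v_nonneg by (intro mult_right_mono) auto
            also have "\<dots> \<le> c * a u"
            proof (rule mult_left_mono[OF v_le])
              have "0 \<le> exp C * \<bar>- C\<bar> powr p" by simp
              also have "\<dots> \<le> c" using c[of "- C"] by simp
              finally show "0 \<le> c" .
            qed
            finally show ?thesis by (simp add: mult_ac)
          qed
          have "(LINT u:{s<..<t}|lborel. ?e u \<omega> * ?h u \<omega>) \<le> (LINT u:{s<..<t}|lborel. c * a u)"
          proof (rule set_integral_mono)
            have i: "set_integrable lborel {s<..<t} (\<lambda>u. ?h u \<omega>)" by (rule set_integrable_subset[OF hi]) auto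
            have "set_integrable lborel {s<..<t} (\<lambda>u. (indicator {s<..<t} u * ?e u \<omega>) * ?h u \<omega>)"
              by (rule set_integrable_mult_bounded[OF i xm, of "exp C"]) (use eC st in auto)
            moreover have "(\<lambda>u. indicator {s<..<t} u *\<^sub>R ((indicator {s<..<t} u * ?e u \<omega>) * ?h u \<omega>)) =
                (\<lambda>u. indicator {s<..<t} u *\<^sub>R (?e u \<omega> * ?h u \<omega>))"
              by (auto simp: indicator_def)
            ultimately show "set_integrable lborel {s<..<t} (\<lambda>u. ?e u \<omega> * ?h u \<omega>)"
              by (simp only: set_integrable_def)
          qed (use pt a_set_integrable in auto)
          also have "\<dots> = c * ?A"
          proof -
            have "(LINT u:{s<..<t}|lborel. a u) = ?A"
              unfolding set_lebesgue_integral_def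
            proof (rule integral_cong_AE)
              show "AE u in lborel. indicator {s<..<t} u *\<^sub>R a u = indicator {s..t} u *\<^sub>R a u"
                using AE_lborel_singleton[of s] AE_lborel_singleton[of t] by eventually_elim (auto simp: indicator_def)
            qed (use a_measurable in measurable)
            then show ?thesis by simp
          qed
          finally show ?thesis .
        qed
        have "(\<lambda>k. max 0 (Z k \<omega> - c * ?A)) \<longlonglongrightarrow> max 0 ((LINT u:{s<..<t}|lborel. ?e u \<omega> * ?h u \<omega>) - c * ?A)"
          by (intro tendsto_max tendsto_diff tendsto_const lim)
        also have "max 0 ((LINT u:{s<..<t}|lborel. ?e u \<omega> * ?h u \<omega>) - c * ?A) = 0" using le by simp
        finally show ?case using Z0 ZD by blast
      qed
    qed
    have Zi: "integrable M (Z k)" for k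
      by (rule Bochner_Integration.integrable_bound[OF integrable_mult_right[OF Di, of "exp C"] Zm])
        (use path in \<open>eventually_elim, auto intro: order_trans[OF _ abs_ge_self]\<close>)
    have step: "(\<integral>\<omega>. indicator B \<omega> * (?e s \<omega> - ?e t \<omega>) \<partial>M) \<le> (\<integral>\<omega>. indicator B \<omega> * Z k \<omega> \<partial>M)" for k
    proof -
      let ?H = "\<lambda>i \<omega>. indicator B \<omega> * ?e (g k i) \<omega>"
      have one: "integrable M (\<lambda>\<omega>. ?H i \<omega> * (?dY k i \<omega> - ?dN k i \<omega>))"
        "(\<integral>\<omega>. indicator B \<omega> * (?e (g k i) \<omega> - ?e (g k (Suc i)) \<omega>) \<partial>M) \<le> (\<integral>\<omega>. ?H i \<omega> * (?dY k i \<omega> - ?dN k i \<omega>) \<partial>M)"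
        if i: "i < 2 ^ k" for i
      proof -
        have i': "0 \<le> g k i" "g k i \<le> g k (Suc i)" "g k (Suc i) < T" "g k i < T" "0 \<le> g k (Suc i)"
          using i gT(1)[of k i] gT(2)[of i k] gT(1)[of k "Suc i"] gT(2)[of "Suc i" k] gmono[of i "Suc i" k] by auto
        have Hm: "?H i \<in> borel_measurable (F (g k i))"
        proof -
          have "B \<in> sets (F (g k i))" using sets_F_mono[OF st(2) gI(1)[of k i]] * by auto
          then show ?thesis using em[OF i'(1,4)] by measurable
        qed
        have Hb: "AE \<omega> in M. \<bar>?H i \<omega>\<bar> \<le> exp C"
          using eb[OF i'(1,4)] by eventually_elim (auto simp: indicator_def)
        have HmM: "?H i \<in> borel_measurable M" by (rule measurable_F_M[OF Hm i'(1)])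
        have bi: "integrable M (\<lambda>\<omega>. ?H i \<omega> * W \<omega>)" if "integrable M W" for W
        proof (rule Bochner_Integration.integrable_bound[where f="\<lambda>\<omega>. exp C * W \<omega>"])
          show "AE \<omega> in M. norm (?H i \<omega> * W \<omega>) \<le> norm (exp C * W \<omega>)"
            using Hb by eventually_elim (simp add: abs_mult mult_right_mono)
        qed (use that HmM in auto)
        note int = bi[OF Yi[OF i'(1,4)]] bi[OF Yi[OF i'(5,3)]] bi[OF Ni[OF i'(1,4)]] bi[OF Ni[OF i'(5,3)]]
        have dYi: "integrable M (\<lambda>\<omega>. ?H i \<omega> * ?dY k i \<omega>)" and dNi: "integrable M (\<lambda>\<omega>. ?H i \<omega> * ?dN k i \<omega>)"
          unfolding right_diff_distrib using int by auto
        have N0: "(\<integral>\<omega>. ?H i \<omega> * ?dN k i \<omega> \<partial>M) = 0"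
          unfolding right_diff_distrib using int mart_bounded_integral(2)[OF N(1) i'(1-3) Hm Hb] by simp
        show "integrable M (\<lambda>\<omega>. ?H i \<omega> * (?dY k i \<omega> - ?dN k i \<omega>))"
          unfolding right_diff_distrib[of _ "?dY k i _" "?dN k i _"] by (rule Bochner_Integration.integrable_diff[OF dYi dNi])
        have "(\<integral>\<omega>. indicator B \<omega> * (?e (g k i) \<omega> - ?e (g k (Suc i)) \<omega>) \<partial>M) \<le> (\<integral>\<omega>. ?H i \<omega> * ?dY k i \<omega> \<partial>M)"
        proof (rule integral_mono[OF _ dYi])
          show "integrable M (\<lambda>\<omega>. indicator B \<omega> * (?e (g k i) \<omega> - ?e (g k (Suc i)) \<omega>))"
            using ei[OF i'(1,4)] ei[OF i'(5,3)] BM by (intro integrable_indicator_mult) auto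
          fix \<omega>
          \<comment> \<open>Convexity of the exponential, from \<open>1 + x \<le> exp x\<close> at
            \<open>x\<close> equal to minus the increment of \<open>Y\<close>.\<close>
          have "?e (g k i) \<omega> * (1 - ?dY k i \<omega>) \<le> ?e (g k i) \<omega> * exp (- ?dY k i \<omega>)"
            using exp_ge_add_one_self[of "- ?dY k i \<omega>"] by (intro mult_left_mono) (linarith, simp)
          also have "\<dots> = ?e (g k (Suc i)) \<omega>" by (simp flip: exp_add)
          finally have "?e (g k i) \<omega> - ?e (g k (Suc i)) \<omega> \<le> ?e (g k i) \<omega> * ?dY k i \<omega>" by (simp add: algebra_simps)
          then show "indicator B \<omega> * (?e (g k i) \<omega> - ?e (g k (Suc i)) \<omega>) \<le> ?H i \<omega> * ?dY k i \<omega>"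
            by (simp add: mult.assoc mult_left_mono)
        qed
        also have "\<dots> = (\<integral>\<omega>. ?H i \<omega> * (?dY k i \<omega> - ?dN k i \<omega>) \<partial>M)"
          unfolding right_diff_distrib[of _ "?dY k i _" "?dN k i _"] using dYi dNi N0 by simp
        finally show "(\<integral>\<omega>. indicator B \<omega> * (?e (g k i) \<omega> - ?e (g k (Suc i)) \<omega>) \<partial>M) \<le> (\<integral>\<omega>. ?H i \<omega> * (?dY k i \<omega> - ?dN k i \<omega>) \<partial>M)" .
      qed
      have "(\<integral>\<omega>. indicator B \<omega> * (?e s \<omega> - ?e t \<omega>) \<partial>M) = (\<integral>\<omega>. (\<Sum>i<2 ^ k. indicator B \<omega> * (?e (g k i) \<omega> - ?e (g k (Suc i)) \<omega>)) \<partial>M)"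
        using sum_lessThan_telescope'[of "\<lambda>i. ?e (g k i) _" "2 ^ k"] by (simp add: g0 flip: sum_distrib_left)
      also have "\<dots> = (\<Sum>i<2 ^ k. \<integral>\<omega>. indicator B \<omega> * (?e (g k i) \<omega> - ?e (g k (Suc i)) \<omega>) \<partial>M)"
        using ei gT BM by (intro Bochner_Integration.integral_sum integrable_indicator_mult Bochner_Integration.integrable_diff) auto
      also have "\<dots> \<le> (\<Sum>i<2 ^ k. \<integral>\<omega>. ?H i \<omega> * (?dY k i \<omega> - ?dN k i \<omega>) \<partial>M)"
        by (rule sum_mono) (use one in auto)
      also have "\<dots> = (\<integral>\<omega>. (\<Sum>i<2 ^ k. ?H i \<omega> * (?dY k i \<omega> - ?dN k i \<omega>)) \<partial>M)"
        by (rule Bochner_Integration.integral_sum[symmetric]) (use one in auto)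
      finally show ?thesis by (simp add: Z_def sum_distrib_left mult.assoc)
    qed
    \<comment> \<open>Only the excess of \<open>Z k\<close> over \<open>c * ?A\<close> can hurt. It
      tends to 0 pathwise and is dominated through \<open>exp C * \<bar>D \<omega>\<bar>\<close>,
      which is integrable.\<close>
    let ?R = "\<lambda>k. \<integral>\<omega>. max 0 (Z k \<omega> - c * ?A) \<partial>M"
    have lim0: "?R \<longlonglongrightarrow> (\<integral>\<omega>. 0 \<partial>M)"
    proof (rule integral_dominated_convergence[where w="\<lambda>\<omega>. exp C * \<bar>D \<omega>\<bar> + \<bar>c * ?A\<bar>"])
      show "AE \<omega> in M. norm (max 0 (Z k \<omega> - c * ?A)) \<le> exp C * \<bar>D \<omega>\<bar> + \<bar>c * ?A\<bar>" for k
        using path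
      proof eventually_elim
        case (elim \<omega>)
        have "exp C * D \<omega> \<le> exp C * \<bar>D \<omega>\<bar>" by (rule mult_left_mono) auto
        moreover have "Z k \<omega> \<le> exp C * D \<omega>" "0 \<le> exp C * \<bar>D \<omega>\<bar>" using elim by auto
        ultimately show ?case unfolding real_norm_def by linarith
      qed
      show "AE \<omega> in M. (\<lambda>k. max 0 (Z k \<omega> - c * ?A)) \<longlonglongrightarrow> 0" using path by eventually_elim blast
    qed (use Di Zm in auto)
    have "(\<integral>\<omega>. indicator B \<omega> * (?e s \<omega> - ?e t \<omega>) \<partial>M) \<le> c * ?A * measure M B + ?R k" for k
    proof -
      have i1: "integrable M (\<lambda>\<omega>. c * ?A * indicator B \<omega>)" and i2: "integrable M (\<lambda>\<omega>. max 0 (Z k \<omega> - c * ?A))"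
        using Zi[of k] BM by (auto intro!: integrable_max simp: less_top[symmetric])
      have "(\<integral>\<omega>. indicator B \<omega> * Z k \<omega> \<partial>M) \<le> (\<integral>\<omega>. c * ?A * indicator B \<omega> + max 0 (Z k \<omega> - c * ?A) \<partial>M)"
        using BM by (intro integral_mono integrable_indicator_mult Zi Bochner_Integration.integrable_add i1 i2) (auto simp: indicator_def)
      also have "\<dots> = c * ?A * measure M B + ?R k"
        using BM by (simp add: Bochner_Integration.integral_add[OF i1 i2])
      finally show ?thesis using step[of k] by linarith
    qed
    then show ?thesis
      using tendsto_add[OF tendsto_const[of "c * ?A * measure M B"] lim0] by (intro LIMSEQ_le_const) auto
  qed
  moreover have "(LINT u:{0..t}|lborel. a u) = (LINT u:{0..s}|lborel. a u) + ?A"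
    by (rule set_integral_combine[OF a_set_integrable]) (use * in auto)
  moreover have e: "(\<integral>\<omega>. indicator B \<omega> * (?e u \<omega> + d) \<partial>M) = (\<integral>\<omega>. indicator B \<omega> * ?e u \<omega> \<partial>M) + d * measure M B"
    if "0 \<le> u" "u < T" for u d
  proof -
    have "(\<integral>\<omega>. indicator B \<omega> * (?e u \<omega> + d) \<partial>M) = (\<integral>\<omega>. indicator B \<omega> * ?e u \<omega> + d * indicator B \<omega> \<partial>M)"
      by (simp add: distrib_left mult.commute)
    also have "\<dots> = (\<integral>\<omega>. indicator B \<omega> * ?e u \<omega> \<partial>M) + d * measure M B"
      using integrable_indicator_mult[OF ei[OF that] BM] BM
      by (subst Bochner_Integration.integral_add) (auto simp: less_top[symmetric])
    finally show ?thesis .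
  qed
  moreover have "(\<integral>\<omega>. indicator B \<omega> * (?e s \<omega> - ?e t \<omega>) \<partial>M) = (\<integral>\<omega>. indicator B \<omega> * ?e s \<omega> \<partial>M) - (\<integral>\<omega>. indicator B \<omega> * ?e t \<omega> \<partial>M)"
    using * ei[of s] ei[of t] BM by (simp add: right_diff_distrib integrable_indicator_mult)
  ultimately show "(\<integral>\<omega>. indicator B \<omega> * (?e s \<omega> + c * (LINT u:{0..s}|lborel. a u)) \<partial>M) \<le>
      (\<integral>\<omega>. indicator B \<omega> * (?e t \<omega> + c * (LINT u:{0..t}|lborel. a u)) \<partial>M)"
    using * by (subst (1 2) e) (auto simp: distrib_left distrib_right)
qed

end

text \<open>For positive \<open>y\<close> the maximum is at \<open>y = p\<close>, which follows from
  \<open>ln z \<le> z - 1\<close> at \<open>z = y / p\<close>. For nonpositive \<open>y\<close> both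
  factors are bounded because \<open>\<bar>y\<bar> \<le> \<bar>C\<bar>\<close>.\<close>

lemma exp_uminus_powr_bounded:
  fixes C p :: real
  assumes p: "0 < p"
  shows "\<exists>c. \<forall>y. - C \<le> y \<longrightarrow> exp (- y) * \<bar>y\<bar> powr p \<le> c"
proof -
  have "exp (- y) * \<bar>y\<bar> powr p \<le> max (exp (p * ln p - p)) (exp \<bar>C\<bar> * \<bar>C\<bar> powr p)" if y: "- C \<le> y" for y
  proof (cases "0 < y")
    case True
    have "ln (y / p) \<le> y / p - 1" using True p by (intro ln_le_minus_one) simp
    then have "p * (ln y - ln p) \<le> p * (y / p - 1)" using True p by (intro mult_left_mono) (auto simp: ln_div)
    then have "- y + p * ln y \<le> p * ln p - p" using p by (simp add: algebra_simps)
    then have "exp (- y) * \<bar>y\<bar> powr p \<le> exp (p * ln p - p)" using True by (simp add: powr_def flip: exp_add)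
    then show ?thesis by simp
  next
    case False
    then have "exp (- y) * \<bar>y\<bar> powr p \<le> exp \<bar>C\<bar> * \<bar>C\<bar> powr p" using y p by (intro mult_mono powr_mono2) auto
    then show ?thesis by simp
  qed
  then show ?thesis by blast
qed

lemma tendsto_of_exp_uminus:
  fixes f :: "'b \<Rightarrow> real"
  assumes ne: "G \<noteq> bot" and lim: "((\<lambda>x. exp (- f x)) \<longlongrightarrow> l) G"
  shows "\<exists>l'. l' \<noteq> - \<infinity> \<and> ((\<lambda>x. ereal (f x)) \<longlongrightarrow> l') G"
proof -
  have l0: "0 \<le> l" by (rule tendsto_lowerbound[OF lim _ ne]) simp
  show ?thesis
  proof (cases "l = 0")
    case False
    then have "((\<lambda>x. - ln (exp (- f x))) \<longlongrightarrow> - ln l) G" using lim l0 by (intro tendsto_minus tendsto_ln) auto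
    then have "((\<lambda>x. ereal (f x)) \<longlongrightarrow> ereal (- ln l)) G" by (intro tendsto_ereal) simp
    then show ?thesis by (intro exI[of _ "ereal (- ln l)"]) simp
  next
    case True
    have "((\<lambda>x. ereal (f x)) \<longlongrightarrow> \<infinity>) G"
      unfolding tendsto_PInfty
    proof
      fix r :: real
      have "\<forall>\<^sub>F x in G. exp (- f x) < exp (- r)" using order_tendstoD(2)[OF lim, of "exp (- r)"] True by simp
      then show "\<forall>\<^sub>F x in G. ereal r < ereal (f x)" by eventually_elim simp
    qed
    then show ?thesis by (intro exI[of _ "\<infinity>"]) simp
  qed
qed

context bsde_coefficient
begin

lemma solution_left_limit:
  assumes p: "1 < p" and Y: "adapted_before F T Y" "AE \<omega> in M. power_dynamics p Y N \<omega>" "AE \<omega> in M. \<forall>t\<in>{0..<T}. - C \<le> Y t \<omega>"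
    and N: "mart N" "cadlag_before M T N" and Yi: "\<And>t. 0 \<le> t \<Longrightarrow> t < T \<Longrightarrow> integrable M (Y t)"
  shows "AE \<omega> in M. \<exists>l. l \<noteq> - \<infinity> \<and> ((\<lambda>t. ereal (Y t \<omega>)) \<longlongrightarrow> l) (at_left T)"
proof -
  obtain c where c: "\<And>y. - C \<le> y \<Longrightarrow> exp (- y) * \<bar>y\<bar> powr p \<le> c"
    using exp_uminus_powr_bounded[of p C] p by auto
  let ?A = "\<lambda>t. LINT u:{0..t}|lborel. a u"
  have ai: "set_integrable lborel {0..T} a" by (rule a_set_integrable) simp
  have Acont: "continuous_on {0..T} ?A" by (rule continuous_on_indefinite_set_integral[OF ai])
  have Aright: "(?A \<longlongrightarrow> ?A t) (at_right t)" if "t \<in> {0..<T}" for t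
  proof -
    have "continuous_on {t..T} ?A" by (rule continuous_on_subset[OF Acont]) (use that in auto)
    then show ?thesis using that by (auto simp: continuous_on_def at_within_Icc_at_right dest!: bspec[of _ _ t])
  qed
  have Aleft: "(?A \<longlongrightarrow> ?A T) (at_left T)"
    using Acont T_pos by (auto simp: continuous_on_def at_within_Icc_at_left dest!: bspec[of _ _ T])
  let ?S = "\<lambda>t \<omega>. exp (- Y t \<omega>) + c * ?A t"
  have "AE \<omega> in M. \<exists>l. ((\<lambda>t. ?S t \<omega>) \<longlongrightarrow> l) (at_left T)"
  proof (rule submart_left_limit[OF exp_submart[OF Y N Yi c]])
    show "AE \<omega> in M. \<forall>t\<in>{0..<T}. ((\<lambda>s. ?S s \<omega>) \<longlongrightarrow> ?S t \<omega>) (at_right t)"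
      using Y(2) AE_space
      by eventually_elim (intro ballI tendsto_add tendsto_exp tendsto_minus tendsto_mult tendsto_const Aright power_dynamics_right_continuous[OF _ N(2)])
    show "AE \<omega> in M. \<forall>t\<in>{0..<T}. \<bar>?S t \<omega>\<bar> \<le> exp C + \<bar>c\<bar> * ?A T"
      using Y(3)
    proof eventually_elim
      case (elim \<omega>)
      show ?case
      proof
        fix t assume t: "t \<in> {0..<T}"
        have 0: "0 \<le> ?A t" "0 \<le> (LINT u:{t..T}|lborel. a u)" by (auto intro!: set_integral_nonneg_real a_nonneg)
        moreover have "?A T = ?A t + (LINT u:{t..T}|lborel. a u)" by (rule set_integral_combine[OF ai]) (use t in auto)
        ultimately have "\<bar>c\<bar> * ?A t \<le> \<bar>c\<bar> * ?A T" by (intro mult_left_mono) auto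
        moreover have "\<bar>c * ?A t\<bar> = \<bar>c\<bar> * ?A t" using 0 by (simp add: abs_mult)
        moreover have "\<bar>exp (- Y t \<omega>)\<bar> \<le> exp C" using bspec[OF elim t] by simp
        ultimately show "\<bar>?S t \<omega>\<bar> \<le> exp C + \<bar>c\<bar> * ?A T" by linarith
      qed
    qed
  qed
  then show ?thesis
  proof eventually_elim
    case (elim \<omega>)
    then obtain l where "((\<lambda>t. ?S t \<omega>) \<longlongrightarrow> l) (at_left T)" by blast
    \<comment> \<open>The primitive of \<open>a\<close> is continuous up to \<open>T\<close> and can
      be subtracted from the submartingale limit.\<close>
    from tendsto_diff[OF this tendsto_mult[OF tendsto_const[of c] Aleft]]
    have "((\<lambda>t. exp (- Y t \<omega>)) \<longlongrightarrow> l - c * ?A T) (at_left T)" by simp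
    then show ?case by (intro tendsto_of_exp_uminus) (auto simp: trivial_limit_at_left_real)
  qed
qed

end

context singular_bsde
begin

section \<open>Terminal condition and minimality\<close>

lemma trunc_terminal_le: "AE \<omega> in M. ereal (trunc_terminal n \<omega>) \<le> \<xi> \<omega>"
  using \<xi>_lower by eventually_elim (auto simp: ereal_trunc_terminal min_def)

lemma trunc_terminal_exhausts:
  assumes "\<And>n. ereal (trunc_terminal n \<omega>) \<le> L"
  shows "\<xi> \<omega> \<le> L"
proof (cases "\<xi> \<omega>")
  case (real r)
  obtain n :: nat where "r \<le> real n" using real_arch_simple by blast
  then have "\<xi> \<omega> \<le> ereal (trunc_terminal n \<omega>)" using real by (simp add: ereal_trunc_terminal min_def)
  then show ?thesis using assms order_trans by blast
next
  case PInf
  have "ereal (real n) \<le> L" for n using assms[of n] by (rule order_trans[rotated]) (simp add: ereal_trunc_terminal PInf min_def)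
  then have "ereal r \<le> L" for r using real_arch_simple[of r] by (meson ereal_less_eq(3) order_trans)
  then have "L = \<infinity>" by (rule ereal_top)
  then show ?thesis by simp
qed simp

theorem minimal_solution:
  "\<exists>Y N C. adapted_before F T Y \<and> mart N \<and> cadlag_before M T N \<and> (AE \<omega> in M. power_dynamics p Y N \<omega>) \<and>
    (AE \<omega> in M. \<forall>t\<in>{0..<T}. - C \<le> Y t \<omega>) \<and>
    (AE \<omega> in M. \<xi> \<omega> \<le> Liminf (at_left T) (\<lambda>t. ereal (Y t \<omega>))) \<and>
    (AE \<omega> in M. \<exists>l. l \<noteq> - \<infinity> \<and> ((\<lambda>t. ereal (Y t \<omega>)) \<longlongrightarrow> l) (at_left T)) \<and>
    (\<forall>Y' N' C'. adapted_before F T Y' \<longrightarrow> mart N' \<longrightarrow> cadlag_before M T N' \<longrightarrow> (AE \<omega> in M. power_dynamics p Y' N' \<omega>) \<longrightarrow>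
      (AE \<omega> in M. \<forall>t\<in>{0..<T}. - C' \<le> Y' t \<omega>) \<longrightarrow> (AE \<omega> in M. \<xi> \<omega> \<le> Liminf (at_left T) (\<lambda>t. ereal (Y' t \<omega>))) \<longrightarrow>
      (AE \<omega> in M. \<forall>t\<in>{0..<T}. Y t \<omega> \<le> Y' t \<omega>))"
proof -
  have "\<forall>n. \<exists>Y N. truncated n Y N" using truncated_solution_exists by blast
  then obtain Yn Nn where tr: "\<And>n. truncated n (Yn n) (Nn n)" by metis
  obtain Y N where Y: "adapted_before F T Y" and N: "mart N" "cadlag_before M T N" and dyn: "AE \<omega> in M. power_dynamics p Y N \<omega>"
    and lim: "\<And>t. 0 \<le> t \<Longrightarrow> t < T \<Longrightarrow> integrable M (Y t) \<and> (AE \<omega> in M. (\<lambda>n. Yn n t \<omega>) \<longlonglongrightarrow> Y t \<omega>)"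
    using limit_solution[OF tr] by auto
  have rcY: "AE \<omega> in M. \<forall>t\<in>{0..<T}. ((\<lambda>s. Y s \<omega>) \<longlongrightarrow> Y t \<omega>) (at_right t)"
    using dyn AE_space by eventually_elim (intro ballI power_dynamics_right_continuous[OF _ N(2)])
  have le: "AE \<omega> in M. \<forall>n. \<forall>t\<in>{0..<T}. Yn n t \<omega> - Y t \<omega> \<le> 0"
    unfolding AE_all_countable
  proof
    fix n
    show "AE \<omega> in M. \<forall>t\<in>{0..<T}. Yn n t \<omega> - Y t \<omega> \<le> 0"
    proof (rule AE_all_times_of_right_continuous)
      show "AE \<omega> in M. Yn n t \<omega> - Y t \<omega> \<le> 0" if t: "0 \<le> t" "t < T" for t
        using Yn_incseq[OF tr] conjunct2[OF lim[OF t]]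
      proof eventually_elim
        case (elim \<omega>)
        have "Yn n t \<omega> \<le> Y t \<omega>" by (rule incseq_le[OF _ elim(2)]) (use elim(1) t in auto)
        then show ?case by simp
      qed
      show "AE \<omega> in M. \<forall>t\<in>{0..<T}. ((\<lambda>s. Yn n s \<omega> - Y s \<omega>) \<longlongrightarrow> Yn n t \<omega> - Y t \<omega>) (at_right t)"
        using rcY AE_space
      proof eventually_elim
        case (elim \<omega>)
        then show ?case using truncatedD(4)[OF tr[of n]] by (auto intro!: tendsto_diff)
      qed
    qed
  qed
  have low: "AE \<omega> in M. \<forall>t\<in>{0..<T}. - barrier 0 \<le> Y t \<omega>"
    using le
  proof eventually_elim
    case (elim \<omega>)
    show ?case
    proof
      fix t assume t: "t \<in> {0..<T}"
      then have "Yn 0 t \<omega> \<le> Y t \<omega>" using elim by (simp add: le_diff_eq)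
      then show "- barrier 0 \<le> Y t \<omega>" using truncatedD(5)[OF tr[of 0], of t \<omega>] t by simp
    qed
  qed
  have terminal: "AE \<omega> in M. \<xi> \<omega> \<le> Liminf (at_left T) (\<lambda>t. ereal (Y t \<omega>))"
  proof -
    have "AE \<omega> in M. \<forall>n. ((\<lambda>t. Yn n t \<omega>) \<longlongrightarrow> trunc_terminal n \<omega>) (at_left T)"
      unfolding AE_all_countable using truncatedD(8)[OF tr] by blast
    then show ?thesis using le
    proof eventually_elim
      case (elim \<omega>)
      show ?case
      proof (rule trunc_terminal_exhausts)
        fix n
        have "ereal (trunc_terminal n \<omega>) = Liminf (at_left T) (\<lambda>t. ereal (Yn n t \<omega>))"
          using elim(1) by (intro lim_imp_Liminf[symmetric] tendsto_ereal) (auto simp: trivial_limit_at_left_real)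
        also have "\<dots> \<le> Liminf (at_left T) (\<lambda>t. ereal (Y t \<omega>))"
        proof (rule Liminf_mono)
          show "\<forall>\<^sub>F t in at_left T. ereal (Yn n t \<omega>) \<le> ereal (Y t \<omega>)"
            using eventually_at_left_real[OF T_pos] by eventually_elim (use elim(2) in auto)
        qed
        finally show "ereal (trunc_terminal n \<omega>) \<le> Liminf (at_left T) (\<lambda>t. ereal (Y t \<omega>))" .
      qed
    qed
  qed
  \<comment> \<open>Every truncated solution lies below the competitor; the limit inherits this at
    each fixed time, and right continuity of both processes yields one null set for all
    times.\<close>
  have minimal: "AE \<omega> in M. \<forall>t\<in>{0..<T}. Y t \<omega> \<le> Y' t \<omega>"
    if Y': "adapted_before F T Y'" "mart N'" "cadlag_before M T N'" "AE \<omega> in M. power_dynamics p Y' N' \<omega>"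
      and Y'c: "AE \<omega> in M. \<forall>t\<in>{0..<T}. - C' \<le> Y' t \<omega>"
      and Y'T: "AE \<omega> in M. \<xi> \<omega> \<le> Liminf (at_left T) (\<lambda>t. ereal (Y' t \<omega>))" for Y' N' C'
  proof -
    have n: "AE \<omega> in M. \<forall>n. \<forall>t\<in>{0..<T}. Yn n t \<omega> \<le> Y' t \<omega>"
      unfolding AE_all_countable
    proof
      fix n
      show "AE \<omega> in M. \<forall>t\<in>{0..<T}. Yn n t \<omega> \<le> Y' t \<omega>"
        by (rule truncated_comparison[OF tr Y' Y'c])
          (use trunc_terminal_le[of n] Y'T in \<open>eventually_elim, auto\<close>)
    qed
    have "AE \<omega> in M. \<forall>t\<in>{0..<T}. Y t \<omega> - Y' t \<omega> \<le> 0"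
    proof (rule AE_all_times_of_right_continuous)
      show "AE \<omega> in M. Y t \<omega> - Y' t \<omega> \<le> 0" if t: "0 \<le> t" "t < T" for t
        using n conjunct2[OF lim[OF t]]
      proof eventually_elim
        case (elim \<omega>)
        have "Y t \<omega> \<le> Y' t \<omega>" by (rule LIMSEQ_le_const2[OF elim(2)]) (use elim(1) t in auto)
        then show ?case by simp
      qed
      show "AE \<omega> in M. \<forall>t\<in>{0..<T}. ((\<lambda>s. Y s \<omega> - Y' s \<omega>) \<longlongrightarrow> Y t \<omega> - Y' t \<omega>) (at_right t)"
        using rcY Y'(4) AE_space
        by eventually_elim (intro ballI tendsto_diff power_dynamics_right_continuous[of p Y' N', OF _ Y'(3)], auto)
    qed
    then show ?thesis by eventually_elim auto
  qed
  show ?thesis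
    using Y N dyn low terminal solution_left_limit[OF p Y dyn low N] lim minimal by blast
qed

end

section \<open>Existence of the minimal supersolution\<close>

text \<open>Both alternatives of (A1) are put into one form: the majorant is the deterministic
  coefficient itself, or the constant bound, cut off to [0, T).\<close>

lemma A1_dominating_function:
  fixes M :: "'a measure"
  assumes M: "prob_space M" and F: "space (F T) = space M" and p: "1 < p" and T: "0 < T" and K: "0 < K"
    and nonneg: "\<forall>t\<in>{0..T}. \<forall>\<omega>\<in>space M. 0 \<le> vol t \<omega>"
    and prog: "progressively_measurable F T vol" and A1: "assumption_A1 M T K p vol"
  shows "\<exists>a. a \<in> borel_measurable borel \<and> integrable lborel a \<and> (\<forall>u. 0 \<le> a u) \<and> (\<forall>u. u \<notin> {0..<T} \<longrightarrow> a u = 0) \<and>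
    (AE \<omega> in M. \<forall>t\<in>{0..<T}. vol t \<omega> \<le> a t) \<and> K powr (p - 1) * (\<integral>u. a u \<partial>lborel) < 1 / (p - 1)"
  using A1 unfolding assumption_A1_def
proof (elim disjE exE conjE)
  fix w :: "real \<Rightarrow> real"
  assume w: "\<forall>t\<in>{0..T}. \<forall>\<omega>\<in>space M. vol t \<omega> = w t"
    and small: "ennreal (K powr (p - 1)) * (\<integral>\<^sup>+t\<in>{0..T}. ennreal (w t) \<partial>lborel) < ennreal (1 / (p - 1))"
  \<comment> \<open>The deterministic function is not assumed measurable; it is measurable on [0, T]
    as the section of \<open>vol\<close> at a single outcome.\<close>
  obtain \<omega> where \<omega>: "\<omega> \<in> space M" using prob_space.not_empty[OF M] by blast
  define a where "a u = indicator {0..<T} u * w u" for u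
  have am: "a \<in> borel_measurable borel"
  proof -
    have "(\<lambda>(s, \<omega>). vol s \<omega>) \<in> borel_measurable (restrict_space borel {0..T} \<Otimes>\<^sub>M F T)"
      using prog T by (simp add: progressively_measurable_def)
    from measurable_compose[OF measurable_Pair2'[of \<omega>] this] have "(\<lambda>s. vol s \<omega>) \<in> borel_measurable (restrict_space borel {0..T})"
      using \<omega> F by simp
    then have "(\<lambda>s. indicator {0..T} s *\<^sub>R vol s \<omega>) \<in> borel_measurable borel"
      by (subst (asm) borel_measurable_restrict_space_iff) auto
    then have "(\<lambda>s. indicator {0..<T} s * (indicator {0..T} s *\<^sub>R vol s \<omega>)) \<in> borel_measurable borel" by measurable
    moreover have "indicator {0..<T} s * (indicator {0..T} s *\<^sub>R vol s \<omega>) = a s" for s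
      using w \<omega> by (auto simp: a_def indicator_def)
    ultimately show ?thesis by simp
  qed
  have a0: "0 \<le> a u" for u using w nonneg \<omega> by (auto simp: a_def indicator_def)
  have eq: "(\<integral>\<^sup>+u. ennreal (a u) \<partial>lborel) = (\<integral>\<^sup>+t\<in>{0..T}. ennreal (w t) \<partial>lborel)"
  proof (rule nn_integral_cong_AE)
    show "AE u in lborel. ennreal (a u) = ennreal (w u) * indicator {0..T} u"
      using AE_lborel_singleton[of T] by eventually_elim (auto simp: a_def indicator_def)
  qed
  have ai: "integrable lborel a"
  proof (rule integrableI_bounded)
    have "(\<integral>\<^sup>+u. ennreal (a u) \<partial>lborel) \<noteq> \<infinity>"
    proof
      assume "(\<integral>\<^sup>+u. ennreal (a u) \<partial>lborel) = \<infinity>"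
      then have "ennreal (K powr (p - 1)) * (\<integral>\<^sup>+t\<in>{0..T}. ennreal (w t) \<partial>lborel) = \<infinity>"
        using K unfolding eq by (simp add: ennreal_mult_top)
      then show False using small by simp
    qed
    then show "(\<integral>\<^sup>+u. ennreal (norm (a u)) \<partial>lborel) < \<infinity>" using a0 by (simp add: less_top)
  qed (use am in simp)
  have "ennreal (K powr (p - 1) * (\<integral>u. a u \<partial>lborel)) < ennreal (1 / (p - 1))"
    using small nn_integral_eq_integral[OF ai] a0 by (simp add: eq ennreal_mult'')
  then have "K powr (p - 1) * (\<integral>u. a u \<partial>lborel) < 1 / (p - 1)"
    using a0 by (subst (asm) ennreal_less_iff) (auto intro!: mult_nonneg_nonneg Bochner_Integration.integral_nonneg)
  moreover have "AE \<omega> in M. \<forall>t\<in>{0..<T}. vol t \<omega> \<le> a t" using w by (auto simp: a_def intro!: AE_I2)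
  moreover have "\<forall>u. u \<notin> {0..<T} \<longrightarrow> a u = 0" by (simp add: a_def)
  ultimately show ?thesis using am ai a0 by blast
next
  fix b assume b: "0 < b" "AE \<omega> in M. \<forall>t\<in>{0..T}. vol t \<omega> \<le> b" "K powr (p - 1) * T * b < 1 / (p - 1)"
  let ?a = "\<lambda>u. b * indicator {0..<T} u :: real"
  have "integrable lborel ?a" "(\<integral>u. ?a u \<partial>lborel) = T * b" using T by auto
  moreover have "AE \<omega> in M. \<forall>t\<in>{0..<T}. vol t \<omega> \<le> ?a t" using b(2) by eventually_elim auto
  moreover have "?a \<in> borel_measurable borel" by measurable
  ultimately show ?thesis using b(1,3) by (intro exI[of _ ?a]) (auto simp: mult_ac)
qed

text \<open>Lowers the exponent of (A2) to the one used for the expectations: for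
  \<open>x < 1\<close> the larger exponent gives the larger inverse, for \<open>x \<ge> 1\<close>
  the inverse is at most 1, and at 0 both sides are infinite.\<close>

lemma inverse_powr_le:
  fixes x q \<sigma> :: real
  assumes "0 \<le> x" "0 < q" "1 < \<sigma>"
  shows "1 / ennreal (x powr q) \<le> 1 + 1 / ennreal (x powr (q * \<sigma>))"
proof (cases "x = 0")
  case True
  then show ?thesis by (simp add: ennreal_divide_zero)
next
  case False
  then have x: "0 < x" using assms by simp
  then have e: "1 / ennreal (x powr r) = ennreal (1 / x powr r)" for r
    using divide_ennreal[of 1 "x powr r"] by simp
  have "1 / x powr q \<le> 1 + 1 / x powr (q * \<sigma>)"
  proof (cases "x < 1")
    case True
    then have "x powr (q * \<sigma>) \<le> x powr q" using x assms by (intro powr_mono') auto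
    then have "1 / x powr q \<le> 1 / x powr (q * \<sigma>)" using x by (intro divide_left_mono) auto
    then show ?thesis by simp
  next
    case False
    then have "1 / x powr q \<le> 1" using x assms ge_one_powr_ge_zero[of x q] by simp
    then show ?thesis by (simp add: add_increasing2)
  qed
  then have "ennreal (1 / x powr q) \<le> ennreal (1 + 1 / x powr (q * \<sigma>))" by (rule ennreal_leI)
  then show ?thesis unfolding e by simp
qed

text \<open>Clamping the time argument to [0, t] extends the process to all real times, which
  replaces the restricted space by the plain product with \<open>borel\<close>.\<close>

lemma progressively_measurable_clamp:
  assumes "progressively_measurable F T vol" "0 \<le> t" "t \<le> T"
  shows "(\<lambda>x. vol (max 0 (min t (snd x))) (fst x)) \<in> borel_measurable (F t \<Otimes>\<^sub>M borel)"
proof -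
  have v: "(\<lambda>(s, \<omega>). vol s \<omega>) \<in> borel_measurable (restrict_space borel {0..t} \<Otimes>\<^sub>M F t)"
    using assms by (simp add: progressively_measurable_def)
  have "(\<lambda>x. max 0 (min t (snd x))) \<in> F t \<Otimes>\<^sub>M borel \<rightarrow>\<^sub>M restrict_space borel {0..t}"
    using assms(2) by (intro measurable_restrict_space2) auto
  then have "(\<lambda>x. (max 0 (min t (snd x)), fst x)) \<in> F t \<Otimes>\<^sub>M borel \<rightarrow>\<^sub>M restrict_space borel {0..t} \<Otimes>\<^sub>M F t"
    by (intro measurable_Pair measurable_fst)
  from measurable_compose[OF this v] show ?thesis by simp
qed

theorem proposition3p2:
  fixes M :: "'a measure" and F :: "real \<Rightarrow> 'a measure"
    and p p_hat T K :: real
    and vol :: "real \<Rightarrow> 'a \<Rightarrow> real" and \<xi> :: "'a \<Rightarrow> ereal"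
  assumes "prob_space M"
    and "is_filtration M F" and "complete_filtration M F" and "right_continuous_filtration F"
    and "p > 1" and "1 / p + 1 / p_hat = 1" and "T > 0" and "K > 0"
    and "\<forall>t\<in>{0..T}. \<forall>\<omega>\<in>space M. 0 \<le> vol t \<omega>"
    and "progressively_measurable F T vol"
    and "assumption_A1 M T K p vol"
    and "assumption_A2 M T p_hat vol"
    and "\<xi> \<in> borel_measurable (F T)"
    and "\<forall>\<omega>\<in>space M. \<xi> \<omega> \<noteq> -\<infinity>"
    and "AE \<omega> in M. max (- \<xi> \<omega>) 0 \<le> ereal K"
    and "left_continuous_filtration_at M F T"
  shows "\<exists>Y N.
    minimal_supersolution_in {(Y', N'). bounded_negative_part M T Y'} M F T p vol \<xi> Y N \<and>
    (AE \<omega> in M. \<exists>l::ereal. l \<noteq> -\<infinity> \<and> ((\<lambda>t. ereal (Y t \<omega>)) \<longlongrightarrow> l) (at_left T)) \<and>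
    bounded_negative_part M T Y"
proof -
  interpret filtered_prob_space M F T
    using assms by (simp add: filtered_prob_space_def filtered_prob_space_axioms_def)
  obtain a where am: "a \<in> borel_measurable borel" and ai: "integrable lborel a" and a0: "\<And>u. 0 \<le> a u"
    and az: "\<And>u. u \<notin> {0..<T} \<Longrightarrow> a u = 0" and va: "AE \<omega> in M. \<forall>t\<in>{0..<T}. vol t \<omega> \<le> a t"
    and small: "K powr (p - 1) * (\<integral>u. a u \<partial>lborel) < 1 / (p - 1)"
    using A1_dominating_function[OF assms(1) space_F assms(5,7,8,9,10,11)] T_pos by auto
  \<comment> \<open>Almost surely this is \<open>vol\<close> on [0, T); the minimum and the cut-off
    make the inequalities with \<open>a\<close> hold everywhere.\<close>
  define v where "v u \<omega> = (if u \<in> {0..<T} \<and> \<omega> \<in> space M then min (vol u \<omega>) (a u) else 0)" for u \<omega>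
  have eqv: "AE \<omega> in M. \<forall>u\<in>{0..<T}. v u \<omega> = vol u \<omega>"
    using va AE_space by eventually_elim (auto simp: v_def)
  have vol0: "0 \<le> vol u \<omega>" if "u \<in> {0..T}" "\<omega> \<in> space M" for u \<omega> using assms(9) that by blast
  have vprog: "prog v"
    unfolding prog_def
  proof (intro allI impI)
    fix t assume t: "0 \<le> t \<and> t < T"
    then have [measurable]: "(\<lambda>x. vol (max 0 (min t (snd x))) (fst x)) \<in> borel_measurable (F t \<Otimes>\<^sub>M borel)"
      by (intro progressively_measurable_clamp[OF assms(10)]) auto
    note am[measurable]
    have "(\<lambda>x. indicator {0..t} (snd x) * min (vol (max 0 (min t (snd x))) (fst x)) (a (snd x))) \<in> borel_measurable (F t \<Otimes>\<^sub>M borel)"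
      by measurable
    then show "(\<lambda>x. indicator {0..t} (snd x) * v (snd x) (fst x)) \<in> borel_measurable (F t \<Otimes>\<^sub>M borel)"
    proof (rule measurable_cong[THEN iffD1, rotated])
      fix x :: "'a \<times> real" assume "x \<in> space (F t \<Otimes>\<^sub>M borel)"
      then have "fst x \<in> space M" using t by (auto simp: space_pair_measure)
      then show "indicator {0..t} (snd x) * min (vol (max 0 (min t (snd x))) (fst x)) (a (snd x)) = indicator {0..t} (snd x) * v (snd x) (fst x)"
        using t by (auto simp: v_def indicator_def)
    qed
  qed
  have inverse: "\<exists>\<epsilon>. 0 < \<epsilon> \<and> \<epsilon> \<le> T \<and> (\<integral>\<^sup>+\<omega>. (\<integral>\<^sup>+s\<in>{T - \<epsilon>..T}. 1 / ennreal (v s \<omega> powr (1 / (p - 1))) \<partial>lborel) \<partial>M) < \<infinity>"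
  proof -
    obtain \<sigma> \<epsilon> where \<epsilon>: "1 < \<sigma>" "0 < \<epsilon>" "\<epsilon> \<le> T"
      and fin: "(\<integral>\<^sup>+\<omega>. (\<integral>\<^sup>+s\<in>{T - \<epsilon>..T}. 1 / ennreal (vol s \<omega> powr ((p_hat - 1) * \<sigma>)) \<partial>lborel) \<partial>M) < \<infinity>"
      using assms(12) by (auto simp: assumption_A2_def)
    define q where "q = 1 / (p - 1)"
    have q: "0 < q" using assms(5) by (simp add: q_def)
    have "p_hat \<noteq> 0" using assms(5,6) by auto
    \<comment> \<open>Conjugacy of the exponents: the power in (A2) is the one in
      \<open>inverse_integrable\<close>, multiplied by \<open>\<sigma>\<close>.\<close>
    then have "p_hat - 1 = q" using assms(5,6) by (simp add: q_def field_simps)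
    then have fin: "(\<integral>\<^sup>+\<omega>. (\<integral>\<^sup>+s\<in>{T - \<epsilon>..T}. 1 / ennreal (vol s \<omega> powr (q * \<sigma>)) \<partial>lborel) \<partial>M) < \<infinity>" using fin by simp
    let ?i = "\<lambda>s. indicator {T - \<epsilon>..T} s :: ennreal"
    let ?E = "\<lambda>x. 1 / ennreal (vol (max 0 (min T (snd x))) (fst x) powr (q * \<sigma>)) * ?i (snd x)"
    have W: "(\<lambda>x. vol (max 0 (min T (snd x))) (fst x)) \<in> borel_measurable (M \<Otimes>\<^sub>M lborel)"
      using measurable_pair_subalgebra[OF progressively_measurable_clamp[OF assms(10), of T] subalgebra_F] T_pos
      by (simp add: borel_measurable_pair_lborel_iff)
    note W[measurable]
    have Em: "?E \<in> borel_measurable (M \<Otimes>\<^sub>M lborel)" by measurable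
    have E: "?E (\<omega>, s) = 1 / ennreal (vol s \<omega> powr (q * \<sigma>)) * ?i s" for \<omega> s
      using \<epsilon> by (cases "s \<in> {T - \<epsilon>..T}") (auto simp: max_def min_def)
    have "(\<integral>\<^sup>+\<omega>. (\<integral>\<^sup>+s\<in>{T - \<epsilon>..T}. 1 / ennreal (v s \<omega> powr q) \<partial>lborel) \<partial>M) \<le> (\<integral>\<^sup>+\<omega>. (ennreal \<epsilon> + (\<integral>\<^sup>+s. ?E (\<omega>, s) \<partial>lborel)) \<partial>M)"
    proof (rule nn_integral_mono_AE)
      show "AE \<omega> in M. (\<integral>\<^sup>+s\<in>{T - \<epsilon>..T}. 1 / ennreal (v s \<omega> powr q) \<partial>lborel) \<le> ennreal \<epsilon> + (\<integral>\<^sup>+s. ?E (\<omega>, s) \<partial>lborel)"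
        using eqv AE_space
      proof eventually_elim
        case (elim \<omega>)
        have "(\<integral>\<^sup>+s\<in>{T - \<epsilon>..T}. 1 / ennreal (v s \<omega> powr q) \<partial>lborel) \<le> (\<integral>\<^sup>+s. ?i s + ?E (\<omega>, s) \<partial>lborel)"
        proof (rule nn_integral_mono_AE)
          show "AE s in lborel. 1 / ennreal (v s \<omega> powr q) * ?i s \<le> ?i s + ?E (\<omega>, s)"
            \<comment> \<open>At \<open>s = T\<close> the cut-off coefficient is 0 and its inverse
              infinite, whatever \<open>vol\<close> is; this single time is discarded.\<close>
            using AE_lborel_singleton[of T]
          proof eventually_elim
            case (elim s)
            show ?case
            proof (cases "s \<in> {T - \<epsilon>..T}")
              case True
              then have "s \<in> {0..<T}" using elim \<epsilon> by auto
              then have "v s \<omega> = vol s \<omega>" "0 \<le> vol s \<omega>"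
                using \<open>\<forall>u\<in>{0..<T}. v u \<omega> = vol u \<omega>\<close> vol0[of s \<omega>] \<open>\<omega> \<in> space M\<close> by auto
              then show ?thesis unfolding E using inverse_powr_le[OF _ q \<epsilon>(1), of "vol s \<omega>"] True by simp
            qed simp
          qed
        qed
        also have "\<dots> = (\<integral>\<^sup>+s. ?i s \<partial>lborel) + (\<integral>\<^sup>+s. ?E (\<omega>, s) \<partial>lborel)"
          by (rule nn_integral_add) (use measurable_compose[OF measurable_Pair1'[OF elim(2)] Em] in auto)
        also have "(\<integral>\<^sup>+s. ?i s \<partial>lborel) = ennreal \<epsilon>" using \<epsilon> by simp
        finally show ?case .
      qed
    qed
    also have "\<dots> = (\<integral>\<^sup>+\<omega>. ennreal \<epsilon> \<partial>M) + (\<integral>\<^sup>+\<omega>. (\<integral>\<^sup>+s. ?E (\<omega>, s) \<partial>lborel) \<partial>M)"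
      by (rule nn_integral_add) (use lborel.borel_measurable_nn_integral_fst[OF Em] in auto)
    also have "\<dots> < \<infinity>" using fin unfolding E by (simp add: emeasure_space_1)
    finally show ?thesis using \<epsilon> by (auto simp: q_def)
  qed
  interpret singular_bsde M F T v a p K \<xi>
  proof
    show "0 \<le> v u \<omega>" for u \<omega> using vol0[of u \<omega>] a0[of u] by (auto simp: v_def)
    show "v u \<omega> \<le> a u" for u \<omega> using a0[of u] by (auto simp: v_def)
    show "AE \<omega> in M. - ereal K \<le> \<xi> \<omega>"
      using assms(15) by eventually_elim (metis ereal_uminus_le_reorder max.boundedE)
  qed (use assms vprog am ai az small inverse in auto)
  have bnp: "bounded_negative_part M T Y \<longleftrightarrow> (\<exists>C. AE \<omega> in M. \<forall>t\<in>{0..<T}. - C \<le> Y t \<omega>)" for Y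
  proof
    assume "bounded_negative_part M T Y"
    then obtain C where "AE \<omega> in M. \<forall>t\<in>{0..<T}. max (- Y t \<omega>) 0 \<le> C" by (auto simp: bounded_negative_part_def)
    then have "AE \<omega> in M. \<forall>t\<in>{0..<T}. - C \<le> Y t \<omega>" by eventually_elim force
    then show "\<exists>C. AE \<omega> in M. \<forall>t\<in>{0..<T}. - C \<le> Y t \<omega>" ..
  next
    assume "\<exists>C. AE \<omega> in M. \<forall>t\<in>{0..<T}. - C \<le> Y t \<omega>"
    then obtain C where C: "AE \<omega> in M. \<forall>t\<in>{0..<T}. - C \<le> Y t \<omega>" ..
    have "AE \<omega> in M. \<forall>t\<in>{0..<T}. max (- Y t \<omega>) 0 \<le> \<bar>C\<bar>"
      using C by eventually_elim force
    then show "bounded_negative_part M T Y" unfolding bounded_negative_part_def by blast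
  qed
  have super: "supersolution M F T p vol \<xi> Y N \<longleftrightarrow> adapted_before F T Y \<and> mart N \<and> cadlag_before M T N \<and>
      (AE \<omega> in M. power_dynamics p Y N \<omega>) \<and> (AE \<omega> in M. \<xi> \<omega> \<le> Liminf (at_left T) (\<lambda>t. ereal (Y t \<omega>)))" for Y N
  proof -
    let ?P = "\<lambda>\<omega>. \<forall>s t. 0 \<le> s \<and> s < t \<and> t < T \<longrightarrow>
        set_integrable lborel {s..t} (\<lambda>u. vol u \<omega> * \<bar>Y u \<omega>\<bar> powr p) \<and>
        Y s \<omega> = Y t \<omega> - (LINT u:{s..t}|lborel. vol u \<omega> * \<bar>Y u \<omega>\<bar> powr p) - (N t \<omega> - N s \<omega>)"
    have iff: "AE \<omega> in M. ?P \<omega> \<longleftrightarrow> power_dynamics p Y N \<omega>"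
      using eqv
    proof eventually_elim
      case (elim \<omega>)
      have c: "set_integrable lborel {s..t} (\<lambda>u. v u \<omega> * \<bar>Y u \<omega>\<bar> powr p) \<longleftrightarrow> set_integrable lborel {s..t} (\<lambda>u. vol u \<omega> * \<bar>Y u \<omega>\<bar> powr p)"
        "(LINT u:{s..t}|lborel. v u \<omega> * \<bar>Y u \<omega>\<bar> powr p) = (LINT u:{s..t}|lborel. vol u \<omega> * \<bar>Y u \<omega>\<bar> powr p)"
        if "0 \<le> s" "t < T" for s t
      proof -
        have "indicator {s..t} u *\<^sub>R (v u \<omega> * \<bar>Y u \<omega>\<bar> powr p) = indicator {s..t} u *\<^sub>R (vol u \<omega> * \<bar>Y u \<omega>\<bar> powr p)" for u
          using that elim by (cases "u \<in> {s..t}") auto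
        then show "set_integrable lborel {s..t} (\<lambda>u. v u \<omega> * \<bar>Y u \<omega>\<bar> powr p) \<longleftrightarrow> set_integrable lborel {s..t} (\<lambda>u. vol u \<omega> * \<bar>Y u \<omega>\<bar> powr p)"
          "(LINT u:{s..t}|lborel. v u \<omega> * \<bar>Y u \<omega>\<bar> powr p) = (LINT u:{s..t}|lborel. vol u \<omega> * \<bar>Y u \<omega>\<bar> powr p)"
          by (simp_all only: set_integrable_def set_lebesgue_integral_def)
      qed
      show ?case
      proof
        assume P: "?P \<omega>"
        show "power_dynamics p Y N \<omega>"
          unfolding power_dynamics_def
        proof (intro allI impI)
          fix s t assume st: "0 \<le> s \<and> s \<le> t \<and> t < T"
          show "set_integrable lborel {s..t} (\<lambda>u. v u \<omega> * \<bar>Y u \<omega>\<bar> powr p) \<and>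
            Y t \<omega> = Y s \<omega> + (LINT u:{s..t}|lborel. v u \<omega> * \<bar>Y u \<omega>\<bar> powr p) + (N t \<omega> - N s \<omega>)"
          proof (cases "s = t")
            case True
            \<comment> \<open>The supersolution condition concerns \<open>s < t\<close> only,
              whereas \<open>power_dynamics\<close> includes \<open>s = t\<close>; integrability on
              the one-point interval is inherited from a longer one.\<close>
            obtain r where r: "s < r" "r < T" using st dense[of s T] by auto
            have "set_integrable lborel {s..r} (\<lambda>u. v u \<omega> * \<bar>Y u \<omega>\<bar> powr p)" using c(1)[of s r] P r st by auto
            then have i: "set_integrable lborel {s..s} (\<lambda>u. v u \<omega> * \<bar>Y u \<omega>\<bar> powr p)"
              by (rule set_integrable_subset) (use r in auto)
            show ?thesis using i set_borel_integral_eq_integral(2)[OF i] True by simp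
          next
            case False
            then have "Y s \<omega> = Y t \<omega> - (LINT u:{s..t}|lborel. vol u \<omega> * \<bar>Y u \<omega>\<bar> powr p) - (N t \<omega> - N s \<omega>)"
              "set_integrable lborel {s..t} (\<lambda>u. vol u \<omega> * \<bar>Y u \<omega>\<bar> powr p)" using P st by auto
            then show ?thesis using c[of s t] st by simp
          qed
        qed
      next
        assume D: "power_dynamics p Y N \<omega>"
        show "?P \<omega>"
        proof (intro allI impI)
          fix s t assume st: "0 \<le> s \<and> s < t \<and> t < T"
          have "set_integrable lborel {s..t} (\<lambda>u. vol u \<omega> * \<bar>Y u \<omega>\<bar> powr p)"
            "Y t \<omega> = Y s \<omega> + (LINT u:{s..t}|lborel. vol u \<omega> * \<bar>Y u \<omega>\<bar> powr p) + (N t \<omega> - N s \<omega>)"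
            using power_dynamicsD[OF D, of s t] c[of s t] st by auto
          then show "set_integrable lborel {s..t} (\<lambda>u. vol u \<omega> * \<bar>Y u \<omega>\<bar> powr p) \<and>
            Y s \<omega> = Y t \<omega> - (LINT u:{s..t}|lborel. vol u \<omega> * \<bar>Y u \<omega>\<bar> powr p) - (N t \<omega> - N s \<omega>)"
            by (intro conjI) linarith+
        qed
      qed
    qed
    have "(AE \<omega> in M. ?P \<omega>) \<longleftrightarrow> (AE \<omega> in M. power_dynamics p Y N \<omega>)"
      by (rule eventually_subst[OF iff])
    then show ?thesis unfolding supersolution_def by blast
  qed
  show ?thesis
    using minimal_solution unfolding minimal_supersolution_in_def super bnp by (auto simp: bnp) blast
qed

end
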